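(* Let $H\in(0,\tfrac12)$ and let $W=\{W(t,x):(t,x)\in\mathbb{R}_+\times\mathbb{R}^d\}$ be a centered Gaussian random field with covariance $\mathbb{E}[W(t,x)W(s,y)]=\tfrac12\big(t^{2H}+s^{2H}-|t-s|^{2H}\big)Q(x,y)$ for all $s,t\in\mathbb{R}_+$, $x,y\in\mathbb{R}^d$. Suppose that there exist constants $\alpha\in(1-2H,1]$ and $C_1>0$ such that $$Q(x,x)+Q(y,y)-2Q(x,y)\le C_1|x-y|^{2\alpha}\qquad\text{for all }x,y\in\mathbb{R}^d.$$ Let $u_0:\mathbb{R}^d\to\mathbb{R}$ be bounded and measurable, and let $u$ be the (mild, Skorohod) solution with initial condition $u_0$ of $$\frac{\partial}{\partial t}u(t,x)=\frac12\Delta u(t,x)+u(t,x)\diamond\frac{\partial}{\partial t}W(t,x),$$ where $\diamond$ is the Wick product. Then for all positive integers $n$, all $t\ge 1$ and all $x\in\mathbb{R}^d$, $$\mathbb{E}\big[u(t,x)^n\big]\le C_x\exp\Big(C\,n^{\frac{2-\alpha}{1-\alpha}}\,t^{\frac{2H+\alpha}{1-\alpha}}\Big),$$ where $C>0$ depends on $d,H,\alpha,\|u_0\|_\infty$ and $C_x>0$ depends on $d,H,\alpha,\|u_0\|_\infty$ and $x$.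
   Context: Hilbert space and noise. $\mathfrak{H}$ is the completion of the linear span of the indicator functions of rectangles of $\mathbb{R}_+\times\mathbb{R}^d$ with respect to the inner product $\langle \mathbf 1_{[0,t]\times[0,x]},\mathbf 1_{[0,s]\times[0,y]}\rangle_{\mathfrak{H}}=\tfrac12(t^{2H}+s^{2H}-|t-s|^{2H})Q(x,y)$. Here $\mathbf 1_{[0,x]}=\prod_{i=1}^d\mathbf 1_{[0,x_i]}$, with $\mathbf 1_{[0,x_i]}=-\mathbf 1_{[x_i,0]}$ if $x_i<0$. The map $\mathbf 1_{[0,t]\times[0,x]}\mapsto W(t,x)$ extends to an isonormal Gaussian process $\{W(h):h\in\mathfrak{H}\}$, that is, a centered Gaussian family with $\mathbb{E}[W(h)W(\hat h)]=\langle h,\hat h\rangle_{\mathfrak{H}}$. $I_n$ denotes the multiple Wiener integral of order $n$ with respect to $W$, so that $\mathbb{E}[I_n(f)^2]=n!\|f\|^2_{\mathfrak{H}^{\otimes n}}$ for symmetric $f\in\mathfrak{H}^{\otimes n}$. Skorohod integral. A square integrable, $W$-measurable random field $v$ with chaos expansion $v(t,x)=\mathbb{E}(v(t,x))+\sum_{n\ge1}I_n(h_n(\cdot,t,x))$ belongs to $Dom(\delta)$ if $\mathbb{E}(v)\in\mathfrak{H}$, $h_n\in\mathfrak{H}^{\otimes(n+1)}$ for all $n\ge1$, and the series $\delta(v)=\int_0^\infty\int_{\mathbb{R}^d}v(t,x)\,\delta W(t,x):=W(\mathbb{E}(v))+\sum_{n\ge1}I_{n+1}(\widetilde h_n)$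 converges in $L^2(\Omega)$, where $\widetilde h_n$ is the symmetrization of $h_n$ in $\mathfrak{H}^{\otimes(n+1)}$. Mild solution. With $p_t(x)=(2\pi t)^{-d/2}e^{-|x|^2/(2t)}$, a random field $u$ is a (mild) solution with initial condition $u_0$ (bounded measurable) if for every $(t,x)\in\mathbb{R}_+\times\mathbb{R}^d$ the random field $(s,y)\mapsto\mathbf 1_{[0,t]}(s)\int_{\mathbb{R}^d}p_{t-s}(x-z)u(s,z)\mathbf 1_{[0,z]}(y)\,dz$ is in $Dom(\delta)$ and almost surely $$u(t,x)=\int_{\mathbb{R}^d}p_t(x-y)u_0(y)\,dy+\int_0^\infty\int_{\mathbb{R}^d}\Big(\mathbf 1_{[0,t]}(s)\int_{\mathbb{R}^d}p_{t-s}(x-z)u(s,z)\mathbf 1_{[0,z]}(y)\,dz\Big)\delta W(s,y).$$ The solution. Under the stated condition on $Q$ and for bounded measurable $u_0$, the equation has a unique mild solution, which is the $u$ of the claim. It is given by $$u(t,x)=\mathbb{E}^B\Big[u_0(B^x_t)\exp\Big(W(g^B_{t,x})-\tfrac12\|g^B_{t,x}\|_{\mathfrak{H}}^2\Big)\Big],$$ where $B$ is a standard $d$-dimensional Brownian motion independent of $W$, $B^x_t=x+B_t$, $\mathbb{E}^B$ is expectation with respect to $B$ only, and $g^B_{t,x}(r,z)=\mathbf 1_{[0,t]}(r)\mathbf 1_{[0,B^x_{t-r}]}(z)$, which belongs to $\mathfrak{H}$.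
   Formalization: Proved for α < 1 (at α = 1 the exponents are undefined); C may also depend on C_1, and C_x also on C_1 and Q, since with only the listed dependences the bound fails (constant Q = c with c large, or W rescaled). *)

theory Defs
  imports "HOL-Probability.Probability" "HOL-Library.Multiset"
begin

section \<open>Gaussian families\<close>

definition centered_gaussian :: "'w measure \<Rightarrow> ('w \<Rightarrow> real) \<Rightarrow> bool" where
  "centered_gaussian M Y \<longleftrightarrow> Y \<in> borel_measurable M \<and>
     ((AE \<omega> in M. Y \<omega> = 0) \<or>
      (\<exists>\<sigma>>0. distributed M lborel Y (\<lambda>y. ennreal (normal_density 0 \<sigma> y))))"

definition centered_gaussian_family ::
    "'w measure \<Rightarrow> 'i set \<Rightarrow> ('i \<Rightarrow> 'w \<Rightarrow> real) \<Rightarrow> bool" where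
  "centered_gaussian_family M I Y \<longleftrightarrow>
     (\<forall>F c. finite F \<and> F \<subseteq> I \<longrightarrow> centered_gaussian M (\<lambda>\<omega>. \<Sum>i\<in>F. c i * Y i \<omega>))"

definition fbm_cov :: "real \<Rightarrow> real \<Rightarrow> real \<Rightarrow> real" where
  "fbm_cov H t s = (t powr (2 * H) + s powr (2 * H) - \<bar>t - s\<bar> powr (2 * H)) / 2"

definition gaussian_noise ::
    "'w measure \<Rightarrow> real \<Rightarrow> (real ^ 'd \<Rightarrow> real ^ 'd \<Rightarrow> real) \<Rightarrow> (real \<Rightarrow> real ^ 'd \<Rightarrow> 'w \<Rightarrow> real) \<Rightarrow> bool"
  where
  "gaussian_noise M H Q W \<longleftrightarrow>
     centered_gaussian_family M ({0..} \<times> UNIV) (\<lambda>(t, x). W t x) \<and>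
     (\<forall>t\<ge>0. \<forall>s\<ge>0. \<forall>x y. (\<integral>\<omega>. W t x \<omega> * W s y \<omega> \<partial>M) = fbm_cov H t s * Q x y)"

section \<open>The Hilbert space of the noise and its tensor powers\<close>

text \<open>A completion is determined up to isometry, so the space is given as a complete inner product
  space \<^typ>\<open>'h\<close> together with the images \<^term>\<open>ind t x\<close> of the indicators of
  \<open>[0,t] \<times> [0,x]\<close>.  The signed indicators of closed rectangles are linearly
  independent as functions, so the prescribed inner products, up to null vectors, are the only
  relations between the \<^term>\<open>ind t x\<close>.\<close>

definition rectangle_completion ::
    "real \<Rightarrow> (real ^ 'd \<Rightarrow> real ^ 'd \<Rightarrow> real) \<Rightarrow>
     (real \<Rightarrow> real ^ 'd \<Rightarrow> 'h :: {real_inner, complete_space}) \<Rightarrow> bool" where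
  "rectangle_completion H Q ind \<longleftrightarrow>
     (\<forall>t\<ge>0. \<forall>s\<ge>0. \<forall>x y. inner (ind t x) (ind s y) = fbm_cov H t s * Q x y) \<and>
     closure (span {ind t x | t x. t \<ge> 0}) = UNIV"

text \<open>All tensor powers live in the Fock space \<^typ>\<open>'f\<close>; \<open>tens [h\<^sub>1, \<dots>, h\<^sub>n]\<close> is the
  elementary tensor, and tensors of different orders are orthogonal.  Multilinearity of
  \<^term>\<open>tens\<close> follows from the inner products.\<close>

definition hilbert_tensors ::
    "('h :: {real_inner, complete_space} list \<Rightarrow> 'f :: {real_inner, complete_space}) \<Rightarrow> bool" where
  "hilbert_tensors tens \<longleftrightarrow>
     (\<forall>hs ks. inner (tens hs) (tens ks) =
        (if length hs = length ks then (\<Prod>i<length hs. inner (hs ! i) (ks ! i)) else 0)) \<and>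
     closure (span (range tens)) = UNIV"

definition tensor_power ::
    "('h list \<Rightarrow> 'f :: {real_inner, complete_space}) \<Rightarrow> nat \<Rightarrow> 'f set" where
  "tensor_power tens n = closure (span (tens ` {hs. length hs = n}))"

definition sym_tensor_power ::
    "('h list \<Rightarrow> 'f :: {real_inner, complete_space}) \<Rightarrow> nat \<Rightarrow> 'f set" where
  "sym_tensor_power tens n = {f \<in> tensor_power tens n.
     \<forall>hs ks. length hs = n \<and> mset hs = mset ks \<longrightarrow> inner f (tens hs) = inner f (tens ks)}"

definition isonormal ::
    "'w measure \<Rightarrow> ('h :: {real_inner, complete_space} \<Rightarrow> 'w \<Rightarrow> real) \<Rightarrow> bool" where
  "isonormal M X \<longleftrightarrow> centered_gaussian_family M UNIV X \<and>
     (\<forall>h k. (\<integral>\<omega>. X h \<omega> * X k \<omega> \<partial>M) = inner h k)"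

section \<open>Multiple Wiener integrals and chaos expansions\<close>

definition sq_integrable :: "'w measure \<Rightarrow> ('w \<Rightarrow> real) \<Rightarrow> bool" where
  "sq_integrable M Y \<longleftrightarrow> Y \<in> borel_measurable M \<and> integrable M (\<lambda>\<omega>. (Y \<omega>)\<^sup>2)"

definition L2_tendsto :: "'w measure \<Rightarrow> (nat \<Rightarrow> 'w \<Rightarrow> real) \<Rightarrow> ('w \<Rightarrow> real) \<Rightarrow> bool" where
  "L2_tendsto M Y Z \<longleftrightarrow> (\<forall>k. sq_integrable M (Y k)) \<and> sq_integrable M Z \<and>
     (\<lambda>k. \<integral>\<omega>. (Y k \<omega> - Z \<omega>)\<^sup>2 \<partial>M) \<longlonglongrightarrow> 0"

text \<open>\<^term>\<open>hermite n v y\<close> is the monic Hermite polynomial of variance \<^term>\<open>v\<close>, that is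
  \<open>\<sigma>\<^sup>n He\<^sub>n(y / \<sigma>)\<close> for \<open>v = \<sigma>\<^sup>2\<close>.\<close>

fun hermite :: "nat \<Rightarrow> real \<Rightarrow> real \<Rightarrow> real" where
  "hermite 0 v y = 1"
| "hermite (Suc 0) v y = y"
| "hermite (Suc (Suc n)) v y = y * hermite (Suc n) v y - real (Suc n) * v * hermite n v y"

text \<open>\<^term>\<open>Y\<close> is a version of the integral of order \<^term>\<open>n\<close> of the symmetric tensor
  \<^term>\<open>f\<close>: the continuous linear extension of
  \<open>h \<otimes> \<dots> \<otimes> h \<mapsto> hermite n \<parallel>h\<parallel>\<^sup>2 (X h)\<close> from the linear span of these powers, which
  is dense in the symmetric tensors.  A list of pairs \<open>(c, h)\<close> stands for the combination
  \<open>\<Sum> c h \<otimes> \<dots> \<otimes> h\<close>.\<close>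

definition wiener_integral ::
    "'w measure \<Rightarrow> ('h :: {real_inner, complete_space} \<Rightarrow> 'w \<Rightarrow> real) \<Rightarrow>
     ('h list \<Rightarrow> 'f :: {real_inner, complete_space}) \<Rightarrow> nat \<Rightarrow> 'f \<Rightarrow> ('w \<Rightarrow> real) \<Rightarrow> bool" where
  "wiener_integral M X tens n f Y \<longleftrightarrow> f \<in> sym_tensor_power tens n \<and>
     (\<exists>S :: nat \<Rightarrow> (real \<times> 'h) list.
        (\<lambda>k. \<Sum>(c, h)\<leftarrow>S k. c *\<^sub>R tens (replicate n h)) \<longlonglongrightarrow> f \<and>
        L2_tendsto M (\<lambda>k \<omega>. \<Sum>(c, h)\<leftarrow>S k. c * hermite n ((norm h)\<^sup>2) (X h \<omega>)) Y)"

text \<open>Having a chaos expansion entails measurability with respect to the (completed)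
  sigma-algebra generated by the noise.  The value of \<^term>\<open>f\<close> at \<open>0\<close> is irrelevant.\<close>

definition chaos_expansion ::
    "'w measure \<Rightarrow> ('h :: {real_inner, complete_space} \<Rightarrow> 'w \<Rightarrow> real) \<Rightarrow>
     ('h list \<Rightarrow> 'f :: {real_inner, complete_space}) \<Rightarrow> ('w \<Rightarrow> real) \<Rightarrow> (nat \<Rightarrow> 'f) \<Rightarrow> bool" where
  "chaos_expansion M X tens V f \<longleftrightarrow>
     (\<exists>Y. (\<forall>n\<ge>1. wiener_integral M X tens n (f n) (Y n)) \<and>
          L2_tendsto M (\<lambda>N \<omega>. (\<integral>\<omega>'. V \<omega>' \<partial>M) + (\<Sum>n=1..N. Y n \<omega>)) V)"

section \<open>Functions as elements of the Hilbert space\<close>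

definition rect_ind :: "real ^ 'd \<Rightarrow> real ^ 'd \<Rightarrow> real" where
  "rect_ind z y = (\<Prod>i\<in>UNIV.
     if 0 \<le> z $ i then indicator {0..z $ i} (y $ i) else - indicator {z $ i..0} (y $ i))"

text \<open>Derivative of \<^term>\<open>fbm_cov H s r\<close> in \<^term>\<open>s\<close>.\<close>

definition fbm_cov_deriv :: "real \<Rightarrow> real \<Rightarrow> real \<Rightarrow> real" where
  "fbm_cov_deriv H s r = H * (s powr (2 * H - 1) - sgn (s - r) * \<bar>s - r\<bar> powr (2 * H - 1))"

definition finite_kernel :: "(real \<Rightarrow> (real ^ 'd) measure) \<Rightarrow> bool" where
  "finite_kernel \<mu> \<longleftrightarrow> (\<forall>s. finite_measure (\<mu> s) \<and> sets (\<mu> s) = sets borel) \<and>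
     (\<forall>A\<in>sets borel. (\<lambda>s. measure (\<mu> s) A) \<in> borel_measurable borel)"

text \<open>\<^term>\<open>fun_inner H Q \<phi> r x c\<close>: the inner product of the function \<^term>\<open>\<phi>\<close> on
  \<open>[0,\<infinity>) \<times> \<real>\<^sup>d\<close> with the indicator of \<open>[0,r] \<times> [0,x]\<close> exists and equals \<^term>\<open>c\<close>.

  It is defined for \<open>\<phi>(s,y) = \<integral> 1\<^bsub>[0,z]\<^esub>(y) \<mu>\<^sub>s(dz)\<close> with finite signed measures
  \<open>\<mu>\<^sub>s\<close> (here \<open>\<mu>\<^sub>s = \<mu>1\<^sub>s - \<mu>2\<^sub>s\<close>), as
  \<open>\<integral> \<partial>\<^sub>s R(s,r) \<integral> Q(z,x) \<mu>\<^sub>s(dz) ds\<close> with \<open>R = fbm_cov H\<close>, provided that this integral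
  converges absolutely.  The signed measure \<open>\<mu>\<^sub>s\<close> is determined by \<open>\<phi>(s,\<cdot>)\<close>, hence
  \<^term>\<open>c\<close> by \<^term>\<open>\<phi>\<close>.  For \<open>\<phi>\<close> the indicator of \<open>[0,t] \<times> [0,z]\<close> the value is
  \<open>R(t,r) Q(z,x)\<close>, as it must be.  No regularity of \<^term>\<open>Q\<close> beyond continuity is
  available, which is why \<open>\<phi>(s,\<cdot>)\<close> is paired through \<open>\<mu>\<^sub>s\<close> and not through
  derivatives of \<^term>\<open>Q\<close>.\<close>

definition fun_inner ::
    "real \<Rightarrow> (real ^ 'd \<Rightarrow> real ^ 'd \<Rightarrow> real) \<Rightarrow> (real \<Rightarrow> real ^ 'd \<Rightarrow> real) \<Rightarrow>
     real \<Rightarrow> real ^ 'd \<Rightarrow> real \<Rightarrow> bool" where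
  "fun_inner H Q \<phi> r x c \<longleftrightarrow>
     (\<exists>\<mu>1 \<mu>2. finite_kernel \<mu>1 \<and> finite_kernel \<mu>2 \<and>
        (\<forall>s\<ge>0. \<forall>y. \<phi> s y = (\<integral>z. rect_ind z y \<partial>\<mu>1 s) - (\<integral>z. rect_ind z y \<partial>\<mu>2 s)) \<and>
        (\<forall>s\<ge>0. integrable (\<mu>1 s) (\<lambda>z. Q z x) \<and> integrable (\<mu>2 s) (\<lambda>z. Q z x)) \<and>
        set_integrable lborel {0..}
          (\<lambda>s. fbm_cov_deriv H s r * ((\<integral>z. \<bar>Q z x\<bar> \<partial>\<mu>1 s) + (\<integral>z. \<bar>Q z x\<bar> \<partial>\<mu>2 s))) \<and>
        c = (LINT s:{0..}|lborel.
               fbm_cov_deriv H s r * ((\<integral>z. Q z x \<partial>\<mu>1 s) - (\<integral>z. Q z x \<partial>\<mu>2 s))))"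

text \<open>The function \<^term>\<open>\<phi>\<close> belongs to the Hilbert space and is its element \<^term>\<open>k\<close>.\<close>

definition represents ::
    "real \<Rightarrow> (real ^ 'd \<Rightarrow> real ^ 'd \<Rightarrow> real) \<Rightarrow>
     (real \<Rightarrow> real ^ 'd \<Rightarrow> 'h :: {real_inner, complete_space}) \<Rightarrow>
     (real \<Rightarrow> real ^ 'd \<Rightarrow> real) \<Rightarrow> 'h \<Rightarrow> bool" where
  "represents H Q ind \<phi> k \<longleftrightarrow> (\<forall>r\<ge>0. \<forall>x. fun_inner H Q \<phi> r x (inner k (ind r x)))"

text \<open>\<^term>\<open>k\<close> is the symmetrization, an element of the tensor power of order \<open>n + 1\<close>, of
  the kernel \<open>(s,y) \<mapsto> g s y\<close> whose values are symmetric tensors of order \<open>n\<close>: its inner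
  product with the tensor of the indicators \<open>p\<^sub>0, \<dots>, p\<^sub>n\<close> is the average over \<open>i\<close>
  of the kernel tested with \<open>p\<^sub>i\<close> in the variable \<open>(s,y)\<close> and with the others in the
  remaining variables.

  Membership is required of the symmetrization only, on which alone the Skorohod integral
  depends.  If the kernel itself is an element of the tensor power of order \<open>n + 1\<close>, its
  symmetrization satisfies this condition.  For \<open>H \<le> 1/4\<close> the larger domain is essential:
  already for constant \<open>Q\<close> and \<open>u\<^sub>0 = 1\<close> the kernel of order 1 of the solution is the indicator of a
  triangle in the time variables, which does not lie in the tensor square, while its
  symmetrization, half the indicator of a square, does.\<close>

definition symmetrization ::
    "real \<Rightarrow> (real ^ 'd \<Rightarrow> real ^ 'd \<Rightarrow> real) \<Rightarrow>
     (real \<Rightarrow> real ^ 'd \<Rightarrow> 'h :: {real_inner, complete_space}) \<Rightarrow>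
     ('h list \<Rightarrow> 'f :: {real_inner, complete_space}) \<Rightarrow>
     nat \<Rightarrow> (real \<Rightarrow> real ^ 'd \<Rightarrow> 'f) \<Rightarrow> 'f \<Rightarrow> bool" where
  "symmetrization H Q ind tens n g k \<longleftrightarrow> k \<in> sym_tensor_power tens (Suc n) \<and>
     (\<forall>ps :: (real \<times> (real ^ 'd)) list. length ps = Suc n \<and> (\<forall>(r, x)\<in>set ps. 0 \<le> r) \<longrightarrow>
        (\<exists>c. (\<forall>i\<le>n. fun_inner H Q
                 (\<lambda>s y. inner (g s y)
                    (tens (map (\<lambda>(r, x). ind r x) (take i ps @ drop (Suc i) ps))))
                 (fst (ps ! i)) (snd (ps ! i)) (c i)) \<and>
             inner k (tens (map (\<lambda>(r, x). ind r x) ps)) = (\<Sum>i\<le>n. c i) / real (Suc n)))"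

section \<open>Skorohod integral and mild solutions\<close>

text \<open>\<^term>\<open>v\<close> belongs to the domain of the Skorohod integral and \<^term>\<open>Z\<close> is a version of
  its integral.\<close>

definition skorohod_integral ::
    "'w measure \<Rightarrow> real \<Rightarrow> (real ^ 'd \<Rightarrow> real ^ 'd \<Rightarrow> real) \<Rightarrow>
     (real \<Rightarrow> real ^ 'd \<Rightarrow> 'h :: {real_inner, complete_space}) \<Rightarrow>
     ('h list \<Rightarrow> 'f :: {real_inner, complete_space}) \<Rightarrow> ('h \<Rightarrow> 'w \<Rightarrow> real) \<Rightarrow>
     (real \<Rightarrow> real ^ 'd \<Rightarrow> 'w \<Rightarrow> real) \<Rightarrow> ('w \<Rightarrow> real) \<Rightarrow> bool" where
  "skorohod_integral M H Q ind tens X v Z \<longleftrightarrow>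
     (\<exists>h k0 k Y.
        (\<forall>s\<ge>0. \<forall>y. chaos_expansion M X tens (v s y) (\<lambda>n. h n s y)) \<and>
        represents H Q ind (\<lambda>s y. \<integral>\<omega>. v s y \<omega> \<partial>M) k0 \<and>
        (\<forall>n\<ge>1. symmetrization H Q ind tens n (h n) (k n)) \<and>
        (\<forall>n\<ge>1. wiener_integral M X tens (Suc n) (k n) (Y n)) \<and>
        L2_tendsto M (\<lambda>N \<omega>. X k0 \<omega> + (\<Sum>n=1..N. Y n \<omega>)) Z)"

text \<open>Because \<^term>\<open>0 powr a = 0\<close>, the kernel is \<open>0\<close> at \<open>t = 0\<close>.\<close>

definition heat_kernel :: "real \<Rightarrow> real ^ 'd \<Rightarrow> real" where
  "heat_kernel t x =
     (2 * pi * t) powr (- real CARD('d) / 2) * exp (- (norm x)\<^sup>2 / (2 * t))"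

definition heat_semigroup :: "real \<Rightarrow> (real ^ 'd \<Rightarrow> real) \<Rightarrow> real ^ 'd \<Rightarrow> real" where
  "heat_semigroup t f x =
     (if t = 0 then f x else \<integral>y. heat_kernel t (x - y) * f y \<partial>lborel)"

definition duhamel_field ::
    "(real \<Rightarrow> real ^ 'd \<Rightarrow> 'w \<Rightarrow> real) \<Rightarrow> real \<Rightarrow> real ^ 'd \<Rightarrow> real \<Rightarrow> real ^ 'd \<Rightarrow> 'w \<Rightarrow> real" where
  "duhamel_field u t x s y \<omega> =
     indicator {0..t} s * (\<integral>z. heat_kernel (t - s) (x - z) * u s z \<omega> * rect_ind z y \<partial>lborel)"

text \<open>The spatial integral in \<^const>\<open>duhamel_field\<close> is meaningful as an absolutely convergent
  integral with values in \<open>L\<^sup>2(\<Omega>)\<close>; this is the second condition.  The value at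
  \<open>s = t\<close> does not matter for the Skorohod integral.\<close>

definition mild_solution ::
    "'w measure \<Rightarrow> real \<Rightarrow> (real ^ 'd \<Rightarrow> real ^ 'd \<Rightarrow> real) \<Rightarrow>
     (real \<Rightarrow> real ^ 'd \<Rightarrow> 'h :: {real_inner, complete_space}) \<Rightarrow>
     ('h list \<Rightarrow> 'f :: {real_inner, complete_space}) \<Rightarrow> ('h \<Rightarrow> 'w \<Rightarrow> real) \<Rightarrow>
     (real ^ 'd \<Rightarrow> real) \<Rightarrow> (real \<Rightarrow> real ^ 'd \<Rightarrow> 'w \<Rightarrow> real) \<Rightarrow> bool" where
  "mild_solution M H Q ind tens X u0 u \<longleftrightarrow>
     (\<lambda>((s, z), \<omega>). u s z \<omega>)
       \<in> borel_measurable ((restrict_space borel {0..} \<Otimes>\<^sub>M borel) \<Otimes>\<^sub>M M) \<and>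
     (\<forall>t\<ge>0. \<forall>x.
        (\<forall>s\<in>{0..<t}. integrable lborel
           (\<lambda>z. heat_kernel (t - s) (x - z) * sqrt (\<integral>\<omega>. (u s z \<omega>)\<^sup>2 \<partial>M))) \<and>
        (\<exists>Z. skorohod_integral M H Q ind tens X (duhamel_field u t x) Z \<and>
             (AE \<omega> in M. u t x \<omega> = heat_semigroup t u0 x + Z \<omega>)))"

end

(*
  Testing the mild equation against products of rectangles gives a recursion in the order for the
  chaos kernels of u(t,x).  Discretizing time with mesh h = t/N turns its solution into
  E[u_0(x + S_N) prod_p <G_N, 1_p>], where S is a Gaussian random walk and G_N the indicator of the
  region below the piecewise constant path of the walk; the error is O(h^{2H} + h^{alpha/2}).  By
  linearity and density,
      E[u(t,x) psi] = lim_N E^S[u_0(x + S_N) E[psi exp(W(G_N) - |G_N|^2/2)]]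
  for psi in finite sums of chaoses, which is the Feynman-Kac formula without constructing Brownian
  motion or the limit of G_N.

  Hoelder's inequality in psi = sgn(u) min(|u|,A)^{n-1} bounds the n-th moment by
  (|u_0|_oo sup_N E^S exp((n-1)|G_N|^2/2))^n.  For H < 1/2 the increments of fractional Brownian motion
  are negatively correlated, so |G_N|^2 is at most t^{2H} Q(x,x) plus a weighted sum of
  |S_j - S_l|^{2 alpha} of total order t^{2H+alpha}.  Jensen's and Young's inequalities (2 alpha < 2)
  reduce its exponential moment to the Gaussian integral E exp(|S_j - S_l|^2 / (4 |j-l| h)), which gives
  exp(C (n t^{2H+alpha})^{1/(1-alpha)}), and the n-th power is the claim.
*)
theory Submission
  imports Defs
begin

section \<open>Hermite polynomials and Wick exponentials\<close>

text \<open>The error bounds of the scheme deteriorate with the chaos order, so its limit cannot be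
  taken inside an exponential. Duality separates two tasks: the limit is used only against
  polynomials in the noise, and uniformity in the order rests on one pointwise bound,
  \<open>|E[psi exp(W(g) - |g|^2/2)]| <= c exp((n-1) |g|^2/2)\<close>. The bound survives the
  replacement of \<open>psi\<close> by a polynomial: project \<open>psi\<close> approximately onto
  the chaos; the rest is nearly orthogonal to \<open>u\<close> and to every Wick exponential, whose
  \<open>L^2\<close> norm \<open>exp(|g|^2/2)\<close> is again of the admissible size once
  \<open>n >= 2\<close>.

  A solution is accessible only through inner products with tensors of rectangles, since the
  Skorohod integrand is known to lie in the tensor power only after symmetrization. Kernels are
  therefore scalar functions of \<open>(s, z)\<close>, recovered by polarization from pairings with
  Hermite polynomials. In \<open>z\<close> the covariance \<open>Q(z, y)\<close> grows at most like
  \<open>|z|^alpha\<close>; a kernel of order \<open>m\<close> is controlled by the weight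
  \<open>exp(m |z|)\<close>, which the heat flow preserves up to a constant.\<close>

lemma sums_zero_coeffs_zero:
  fixes a :: "nat \<Rightarrow> real"
  assumes "\<And>x. (\<lambda>n. a n * x ^ n) sums 0"
  shows "a m = 0"
  using assms
proof (induction m arbitrary: a)
  case 0
  then show ?case using sums_unique2[OF powser_sums_zero[of a] 0[of 0]] by simp
next
  case (Suc m)
  have a0: "a 0 = 0" using sums_unique2[OF powser_sums_zero[of a] Suc.prems[of 0]] by simp
  have nz: "(\<lambda>n. a (Suc n) * x ^ n) sums 0" if "x \<noteq> 0" for x
  proof -
    have "(\<lambda>n. a (Suc n) * x ^ Suc n) sums 0"
      using Suc.prems[of x] a0 by (subst sums_Suc_iff) simp
    then have "(\<lambda>n. a (Suc n) * x ^ Suc n / x) sums (0 / x)" by (rule sums_divide)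
    then show ?thesis using that by simp
  qed
  \<comment> \<open>The sum of the series divided by \<open>x\<close>. The division is legitimate
    off \<open>0\<close> only; continuity of a power series at \<open>0\<close> then forces
    \<open>a 1 = 0\<close>, so the shifted coefficients satisfy the hypothesis of the
    induction.\<close>
  let ?f = "\<lambda>x::real. if x = 0 then a 1 else 0"
  have "(?f \<longlongrightarrow> a (Suc 0)) (at 0)"
  proof (rule powser_limit_0[of 1])
    fix x :: real
    show "(\<lambda>n. a (Suc n) * x ^ n) sums ?f x"
      using nz[of x] powser_sums_zero[of "\<lambda>n. a (Suc n)"] by auto
  qed auto
  moreover have "(?f \<longlongrightarrow> 0) (at 0)"
    by (rule tendsto_eventually) (auto simp: eventually_at_filter)
  ultimately have "a (Suc 0) = 0"
    using tendsto_unique[of "at (0::real)"] by auto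
  then have "(\<lambda>n. a (Suc n) * x ^ n) sums 0" for x
    using nz[of x] powser_sums_zero[of "\<lambda>n. a (Suc n)"] by (cases "x = 0") auto
  then show ?case by (rule Suc.IH)
qed

lemma sums_coeffs_unique:
  fixes a b :: "nat \<Rightarrow> real"
  assumes "\<And>x. (\<lambda>n. a n * x ^ n) sums f x" "\<And>x. (\<lambda>n. b n * x ^ n) sums f x"
  shows "a m = b m"
proof -
  have "(\<lambda>n. (a n - b n) * x ^ n) sums 0" for x
    using sums_diff[OF assms[of x]] by (simp add: left_diff_distrib)
  from sums_zero_coeffs_zero[OF this, of m] show ?thesis by simp
qed

text \<open>Taylor coefficients in \<open>x\<close> of \<open>exp (- x^2 v / 2)\<close>, the
  variance factor of the Hermite generating function.\<close>

definition half_exp_coeff :: "real \<Rightarrow> nat \<Rightarrow> real" where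
  "half_exp_coeff v n = (if even n then (- v / 2) ^ (n div 2) / fact (n div 2) else 0)"

lemma half_exp_coeff_rec: "real (Suc (Suc k)) * half_exp_coeff v (Suc (Suc k)) = - v * half_exp_coeff v k"
proof (cases "even k")
  case True
  then obtain j where k: "k = 2 * j" by blast
  have "Suc (Suc k) div 2 = Suc j" "k div 2 = j" using k by auto
  then have "real (Suc (Suc k)) * half_exp_coeff v (Suc (Suc k))
      = 2 * real (Suc j) * ((- v / 2) * (- v / 2) ^ j / (real (Suc j) * fact j))"
    using k by (simp add: half_exp_coeff_def)
  also have "\<dots> = - v * ((- v / 2) ^ j / fact j)"
    by (simp add: divide_simps del: of_nat_Suc)
  finally show ?thesis using True \<open>k div 2 = j\<close> by (simp add: half_exp_coeff_def)
next
  case False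
  then show ?thesis by (simp add: half_exp_coeff_def)
qed

text \<open>Multiplying the \<open>n\<close>-th coefficient by \<open>n\<close> amounts to
  differentiating the generating function \<open>exp (x y) * exp (- x^2 v / 2)\<close>. Leibniz
  turns the derivative into \<open>y - x v\<close> times the function, and this is the three-term
  recursion of \<open>hermite\<close>.\<close>

lemma hermite_eq_convolution:
  "hermite n v y / fact n = (\<Sum>i\<le>n. y ^ i / fact i * half_exp_coeff v (n - i))"
proof (induction n v y rule: hermite.induct)
  case (3 n v y)
  let ?p = "\<lambda>i. y ^ i / fact i" and ?e = "half_exp_coeff v"
  let ?c = "\<lambda>n. (\<Sum>i\<le>n. ?p i * ?e (n - i))"
  let ?N = "Suc (Suc n)"
  have p: "real (Suc i) * ?p (Suc i) = y * ?p i" for i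
    by (simp add: field_simps del: of_nat_Suc)
  have "real ?N * ?c ?N = (\<Sum>i\<le>?N. real i * ?p i * ?e (?N - i) + ?p i * (real (?N - i) * ?e (?N - i)))"
    unfolding sum_distrib_left by (intro sum.cong refl) (auto simp: of_nat_diff algebra_simps add_divide_distrib)
  also have "\<dots> = (\<Sum>i\<le>?N. real i * ?p i * ?e (?N - i)) + (\<Sum>i\<le>?N. ?p i * (real (?N - i) * ?e (?N - i)))"
    by (rule sum.distrib)
  also have "(\<Sum>i\<le>?N. real i * ?p i * ?e (?N - i)) = (\<Sum>i\<le>Suc n. real (Suc i) * ?p (Suc i) * ?e (Suc n - i))"
    by (subst sum.atMost_Suc_shift) simp
  also have "\<dots> = y * ?c (Suc n)"
    unfolding sum_distrib_left by (intro sum.cong refl) (simp only: p mult_ac)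
  also have "(\<Sum>i\<le>?N. ?p i * (real (?N - i) * ?e (?N - i))) = (\<Sum>i\<le>n. ?p i * (real (?N - i) * ?e (?N - i)))"
    by (simp add: half_exp_coeff_def)
  also have "\<dots> = (\<Sum>i\<le>n. ?p i * (- v * ?e (n - i)))"
  proof (intro sum.cong refl)
    fix i assume "i \<in> {..n}"
    then have "?N - i = Suc (Suc (n - i))" by auto
    then show "?p i * (real (?N - i) * ?e (?N - i)) = ?p i * (- v * ?e (n - i))"
      by (simp only: half_exp_coeff_rec)
  qed
  also have "\<dots> = - v * ?c n"
    unfolding sum_distrib_left by (intro sum.cong refl) (simp only: mult_ac)
  finally have "real ?N * ?c ?N = y * ?c (Suc n) + - v * ?c n" .
  also have "\<dots> = y * (hermite (Suc n) v y / fact (Suc n)) - v * (hermite n v y / fact n)"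
    using 3 by simp
  also have "\<dots> = real ?N * (hermite ?N v y / fact ?N)"
    by (simp add: field_simps del: of_nat_Suc)
  finally show ?case by (metis mult_left_cancel of_nat_eq_0_iff nat.distinct(1))
qed (simp_all add: half_exp_coeff_def)

lemma half_exp_coeff_sums:
  "(\<lambda>n. half_exp_coeff v n * x ^ n) sums exp (- (x\<^sup>2 * v) / 2)"
proof -
  have "(\<lambda>k. half_exp_coeff v (2 * k) * x ^ (2 * k)) sums exp (- (x\<^sup>2 * v) / 2)"
  proof -
    have "(\<lambda>k. (- (x\<^sup>2 * v) / 2) ^ k /\<^sub>R fact k) sums exp (- (x\<^sup>2 * v) / 2)"
      by (rule exp_converges)
    moreover have "(- (x\<^sup>2 * v) / 2) ^ k /\<^sub>R fact k = half_exp_coeff v (2 * k) * x ^ (2 * k)" for k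
    proof -
      have "(- (x\<^sup>2 * v) / 2) = x\<^sup>2 * (- v / 2)" by simp
      then have "(- (x\<^sup>2 * v) / 2) ^ k = x ^ (2 * k) * (- v / 2) ^ k"
        by (simp only: power_mult_distrib power_mult)
      then show ?thesis by (simp add: half_exp_coeff_def field_simps)
    qed
    ultimately show ?thesis by simp
  qed
  moreover have "half_exp_coeff v n * x ^ n = 0" if "n \<notin> range (\<lambda>k. 2 * k)" for n
    using that by (cases "even n") (auto simp: half_exp_coeff_def elim!: evenE)
  ultimately show ?thesis
    by (subst (asm) sums_mono_reindex[of "\<lambda>k. 2 * k"])
       (auto simp: strict_mono_def)
qed

lemma half_exp_coeff_abs: "\<bar>half_exp_coeff v n\<bar> = half_exp_coeff (- \<bar>v\<bar>) n"
  by (simp add: half_exp_coeff_def power_abs)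

lemma half_exp_coeff_abs_sums:
  "(\<lambda>n. \<bar>half_exp_coeff v n * x ^ n\<bar>) sums exp (x\<^sup>2 * \<bar>v\<bar> / 2)"
  using half_exp_coeff_sums[of "- \<bar>v\<bar>" "\<bar>x\<bar>"] by (simp add: abs_mult half_exp_coeff_abs power_abs)

lemma hermite_conv_power:
  "hermite n v y * x ^ n / fact n = (\<Sum>i\<le>n. (x * y) ^ i / fact i * (half_exp_coeff v (n - i) * x ^ (n - i)))"
proof -
  have "hermite n v y * x ^ n / fact n = (hermite n v y / fact n) * x ^ n" by simp
  also have "\<dots> = (\<Sum>i\<le>n. (x * y) ^ i / fact i * (half_exp_coeff v (n - i) * x ^ (n - i)))"
    unfolding hermite_eq_convolution sum_distrib_right
  proof (intro sum.cong refl)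
    fix i assume "i \<in> {..n}"
    then have "x ^ n = x ^ i * x ^ (n - i)" by (simp flip: power_add)
    then show "y ^ i / fact i * half_exp_coeff v (n - i) * x ^ n =
      (x * y) ^ i / fact i * (half_exp_coeff v (n - i) * x ^ (n - i))" by (simp add: power_mult_distrib)
  qed
  finally show ?thesis .
qed

lemma hermite_generating:
  "(\<lambda>n. hermite n v y * x ^ n / fact n) sums exp (x * y - x\<^sup>2 * v / 2)"
proof -
  have e: "(\<lambda>i. (x * y) ^ i / fact i) sums exp (x * y)"
    using exp_converges[of "x * y"] by (simp add: divide_inverse mult.commute)
  have "(\<lambda>n. \<Sum>i\<le>n. (x * y) ^ i / fact i * (half_exp_coeff v (n - i) * x ^ (n - i)))
    sums ((\<Sum>i. (x * y) ^ i / fact i) * (\<Sum>i. half_exp_coeff v i * x ^ i))"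
  proof (rule Cauchy_product_sums)
    show "summable (\<lambda>k. norm ((x * y) ^ k / fact k))"
      using summable_norm_exp[of "x*y"] by (simp add: divide_inverse mult.commute)
    show "summable (\<lambda>k. norm (half_exp_coeff v k * x ^ k))"
      using half_exp_coeff_abs_sums by (auto simp: sums_iff)
  qed
  moreover have "exp (x * y) * exp (- (x\<^sup>2 * v) / 2) = exp (x * y - x\<^sup>2 * v / 2)"
    by (simp flip: exp_add)
  ultimately show ?thesis
    using sums_unique[OF e] sums_unique[OF half_exp_coeff_sums[of v x]]
    by (simp add: hermite_conv_power)
qed

text \<open>The majorant is the generating series itself at \<open>\<bar>x\<bar>\<close>,
  \<open>\<bar>y\<bar>\<close> and \<open>- \<bar>v\<bar>\<close>: with a negative variance all its
  coefficients are nonnegative. The bound does not depend on \<open>N\<close>, as dominated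
  convergence in \<open>wick_series\<close> requires.\<close>

lemma hermite_abs_sum_le:
  "(\<Sum>n<N. \<bar>hermite n v y * x ^ n / fact n\<bar>) \<le> exp (\<bar>x\<bar> * \<bar>y\<bar> + x\<^sup>2 * \<bar>v\<bar> / 2)"
proof -
  have s: "(\<lambda>n. hermite n (- \<bar>v\<bar>) \<bar>y\<bar> * \<bar>x\<bar> ^ n / fact n) sums exp (\<bar>x\<bar> * \<bar>y\<bar> + x\<^sup>2 * \<bar>v\<bar> / 2)"
    using hermite_generating[of "- \<bar>v\<bar>" "\<bar>y\<bar>" "\<bar>x\<bar>"] by simp
  have le: "\<bar>hermite n v y * x ^ n / fact n\<bar> \<le> hermite n (- \<bar>v\<bar>) \<bar>y\<bar> * \<bar>x\<bar> ^ n / fact n" for n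
    unfolding hermite_conv_power
    by (rule order_trans[OF sum_abs], intro sum_mono)
       (simp add: abs_mult power_abs half_exp_coeff_abs)
  have "(\<Sum>n<N. \<bar>hermite n v y * x ^ n / fact n\<bar>) \<le> (\<Sum>n<N. hermite n (- \<bar>v\<bar>) \<bar>y\<bar> * \<bar>x\<bar> ^ n / fact n)"
    by (intro sum_mono le)
  also have "\<dots> \<le> exp (\<bar>x\<bar> * \<bar>y\<bar> + x\<^sup>2 * \<bar>v\<bar> / 2)"
    using s le by (subst sums_unique[OF s], intro sum_le_suminf) (auto simp: sums_iff intro: order_trans[OF abs_ge_zero le])
  finally show ?thesis .
qed

lemma hermite_abs_le: "\<bar>hermite n v y\<bar> \<le> fact n * exp (\<bar>y\<bar> + \<bar>v\<bar> / 2)"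
proof -
  have "\<bar>hermite n v y * 1 ^ n / fact n\<bar> \<le> (\<Sum>n<Suc n. \<bar>hermite n v y * 1 ^ n / fact n\<bar>)"
    by (rule member_le_sum) auto
  also have "\<dots> \<le> exp (\<bar>y\<bar> + \<bar>v\<bar> / 2)" using hermite_abs_sum_le[of v y 1 "Suc n"] by simp
  finally show ?thesis by (simp add: field_simps)
qed

lemma hermite_measurable [measurable]: "hermite n v \<in> borel_measurable borel"
proof (induction n rule: less_induct)
  case (less n)
  consider "n = 0" | "n = Suc 0" | m where "n = Suc (Suc m)"
    by (cases n; cases "n - 1") auto
  then show ?case
  proof cases
    case (3 m)
    have [measurable]: "hermite m v \<in> borel_measurable borel" "hermite (Suc m) v \<in> borel_measurable borel"
      using less 3 by auto
    have "hermite n v = (\<lambda>y. y * hermite (Suc m) v y - real (Suc m) * v * hermite m v y)"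
      using 3 by (simp add: fun_eq_iff)
    then show ?thesis by simp
  next
    case 1
    then have "hermite n v = (\<lambda>y. 1)" by (simp add: fun_eq_iff)
    then show ?thesis by simp
  next
    case 2
    then have "hermite n v = (\<lambda>y. y)" by (simp add: fun_eq_iff)
    then show ?thesis by simp
  qed
qed

section \<open>Wick exponentials and Hermite polynomials of an isonormal process\<close>

locale isonormal_process = prob_space M
  for M :: "'w measure" and X :: "'h::{real_inner,complete_space} \<Rightarrow> 'w \<Rightarrow> real" +
  assumes isonormal: "isonormal M X"
begin

lemma gaussian_combination:
  "finite F \<Longrightarrow> centered_gaussian M (\<lambda>\<omega>. \<Sum>i\<in>F. c i * X i \<omega>)"
  using isonormal unfolding isonormal_def centered_gaussian_family_def by blast

lemma gaussian_X: "centered_gaussian M (X h)"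
  using gaussian_combination[of "{h}" "\<lambda>_. 1"] by simp

lemma X_measurable [measurable]: "X h \<in> borel_measurable M"
  using gaussian_X by (simp add: centered_gaussian_def)

lemma covariance: "(\<integral>\<omega>. X h \<omega> * X k \<omega> \<partial>M) = inner h k"
  using isonormal by (simp add: isonormal_def)

text \<open>With the exponent written through the second moment, the law concentrated at
  \<open>0\<close> and the nondegenerate laws obey one formula.\<close>

lemma centered_gaussian_exp:
  assumes "centered_gaussian M Y"
  shows "integrable M (\<lambda>\<omega>. exp (a * Y \<omega>))" "integrable M (\<lambda>\<omega>. (Y \<omega>)\<^sup>2)"
    "(\<integral>\<omega>. exp (a * Y \<omega>) \<partial>M) = exp (a\<^sup>2 * (\<integral>\<omega>. (Y \<omega>)\<^sup>2 \<partial>M) / 2)"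
proof -
  have [measurable]: "Y \<in> borel_measurable M" using assms by (simp add: centered_gaussian_def)
  have "integrable M (\<lambda>\<omega>. exp (a * Y \<omega>)) \<and> integrable M (\<lambda>\<omega>. (Y \<omega>)\<^sup>2) \<and>
    (\<integral>\<omega>. exp (a * Y \<omega>) \<partial>M) = exp (a\<^sup>2 * (\<integral>\<omega>. (Y \<omega>)\<^sup>2 \<partial>M) / 2)"
  proof (cases "AE \<omega> in M. Y \<omega> = 0")
    case True
    have "integrable M (\<lambda>\<omega>. exp (a * Y \<omega>)) = integrable M (\<lambda>\<omega>. 1::real)"
      using True by (intro integrable_cong_AE) auto
    moreover have "integrable M (\<lambda>\<omega>. (Y \<omega>)\<^sup>2) = integrable M (\<lambda>\<omega>. 0::real)"
      using True by (intro integrable_cong_AE) auto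
    moreover have "(\<integral>\<omega>. exp (a * Y \<omega>) \<partial>M) = (\<integral>\<omega>. 1 \<partial>M)"
      using True by (intro integral_cong_AE) auto
    moreover have "(\<integral>\<omega>. (Y \<omega>)\<^sup>2 \<partial>M) = (\<integral>\<omega>. 0 \<partial>M)"
      using True by (intro integral_cong_AE) auto
    ultimately show ?thesis by (simp add: prob_space)
  next
    case False
    with assms obtain \<sigma> where \<sigma>: "\<sigma> > 0" and D: "distributed M lborel Y (\<lambda>y. ennreal (normal_density 0 \<sigma> y))"
      by (auto simp: centered_gaussian_def)
    have dens: "normal_density 0 \<sigma> y * exp (a * y) = exp (a\<^sup>2 * \<sigma>\<^sup>2 / 2) * normal_density (a * \<sigma>\<^sup>2) \<sigma> y" for y
    proof -
      have "- (y - 0)\<^sup>2 / (2 * \<sigma>\<^sup>2) + a * y = a\<^sup>2 * \<sigma>\<^sup>2 / 2 + - (y - a * \<sigma>\<^sup>2)\<^sup>2 / (2 * \<sigma>\<^sup>2)"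
        using \<sigma> by (simp add: field_simps power2_eq_square)
      then show ?thesis unfolding normal_density_def
        by (simp add: exp_add[symmetric] mult.assoc mult.left_commute)
    qed
    have "integrable lborel (\<lambda>y. normal_density 0 \<sigma> y * exp (a * y))"
      unfolding dens using \<sigma> by simp
    then have 1: "integrable M (\<lambda>\<omega>. exp (a * Y \<omega>))"
      using distributed_integrable[OF D, of "\<lambda>y. exp (a * y)"] by simp
    have "(\<integral>\<omega>. exp (a * Y \<omega>) \<partial>M) = (\<integral>y. normal_density 0 \<sigma> y * exp (a * y) \<partial>lborel)"
      using distributed_integral[OF D, of "\<lambda>y. exp (a * y)"] by simp
    also have "\<dots> = exp (a\<^sup>2 * \<sigma>\<^sup>2 / 2)" unfolding dens using \<sigma> by simp
    finally have 2: "(\<integral>\<omega>. exp (a * Y \<omega>) \<partial>M) = exp (a\<^sup>2 * \<sigma>\<^sup>2 / 2)" .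
    have "integrable lborel (\<lambda>y. normal_density 0 \<sigma> y * y\<^sup>2)"
      using integrable_normal_moment[OF \<sigma>, of 0 2] by simp
    then have 3: "integrable M (\<lambda>\<omega>. (Y \<omega>)\<^sup>2)"
      using distributed_integrable[OF D, of "\<lambda>y. y\<^sup>2"] by simp
    have "expectation Y = 0" using normal_distributed_expectation[OF \<sigma> D] .
    then have "(\<integral>\<omega>. (Y \<omega>)\<^sup>2 \<partial>M) = \<sigma>\<^sup>2" using normal_distributed_variance[OF \<sigma> D] by simp
    with 1 2 3 show ?thesis by simp
  qed
  then show "integrable M (\<lambda>\<omega>. exp (a * Y \<omega>))" "integrable M (\<lambda>\<omega>. (Y \<omega>)\<^sup>2)"
    "(\<integral>\<omega>. exp (a * Y \<omega>) \<partial>M) = exp (a\<^sup>2 * (\<integral>\<omega>. (Y \<omega>)\<^sup>2 \<partial>M) / 2)" by auto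
qed

lemma exp_X:
  "integrable M (\<lambda>\<omega>. exp (a * X h \<omega>))"
  "(\<integral>\<omega>. exp (a * X h \<omega>) \<partial>M) = exp (a\<^sup>2 * (norm h)\<^sup>2 / 2)"
  using centered_gaussian_exp(1,3)[OF gaussian_X[of h], of a] covariance[of h h]
  by (auto simp: power2_eq_square[of "X h _"] power2_norm_eq_inner)

lemma X_mult_integrable [simp]: "integrable M (\<lambda>\<omega>. X h \<omega> * X k \<omega>)"
proof (rule Bochner_Integration.integrable_bound)
  show "integrable M (\<lambda>\<omega>. (X h \<omega>)\<^sup>2 + (X k \<omega>)\<^sup>2)"
    by (intro Bochner_Integration.integrable_add centered_gaussian_exp(2) gaussian_X)
  show "AE \<omega> in M. norm (X h \<omega> * X k \<omega>) \<le> norm ((X h \<omega>)\<^sup>2 + (X k \<omega>)\<^sup>2)"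
  proof (rule AE_I2)
    fix \<omega>
    have "2 * (\<bar>X h \<omega>\<bar> * \<bar>X k \<omega>\<bar>) \<le> (X h \<omega>)\<^sup>2 + (X k \<omega>)\<^sup>2"
      using sum_squares_bound[of "\<bar>X h \<omega>\<bar>" "\<bar>X k \<omega>\<bar>"] by simp
    moreover have "0 \<le> \<bar>X h \<omega>\<bar> * \<bar>X k \<omega>\<bar>" by simp
    ultimately show "norm (X h \<omega> * X k \<omega>) \<le> norm ((X h \<omega>)\<^sup>2 + (X k \<omega>)\<^sup>2)"
      unfolding real_norm_def abs_mult by linarith
  qed
qed measurable

text \<open>The isometry forces linearity: the difference of the two sides has second moment
  \<open>0\<close>. The exceptional set depends on the vectors, because \<open>X\<close> is only a
  family of versions.\<close>

lemma X_AE_linear: "AE \<omega> in M. X (a *\<^sub>R h + b *\<^sub>R k) \<omega> = a * X h \<omega> + b * X k \<omega>"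
proof -
  let ?g = "a *\<^sub>R h + b *\<^sub>R k"
  have "(X ?g \<omega> - (a * X h \<omega> + b * X k \<omega>))\<^sup>2 = X ?g \<omega> * X ?g \<omega> - 2 * a * (X ?g \<omega> * X h \<omega>)
    - 2 * b * (X ?g \<omega> * X k \<omega>) + a\<^sup>2 * (X h \<omega> * X h \<omega>) + 2 * a * b * (X h \<omega> * X k \<omega>) + b\<^sup>2 * (X k \<omega> * X k \<omega>)" for \<omega>
    by (simp add: power2_eq_square algebra_simps)
  then have eq: "(\<lambda>\<omega>. (X ?g \<omega> - (a * X h \<omega> + b * X k \<omega>))\<^sup>2) = (\<lambda>\<omega>. X ?g \<omega> * X ?g \<omega> - 2 * a * (X ?g \<omega> * X h \<omega>)
    - 2 * b * (X ?g \<omega> * X k \<omega>) + a\<^sup>2 * (X h \<omega> * X h \<omega>) + 2 * a * b * (X h \<omega> * X k \<omega>) + b\<^sup>2 * (X k \<omega> * X k \<omega>))" by simp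
  have int: "integrable M (\<lambda>\<omega>. (X ?g \<omega> - (a * X h \<omega> + b * X k \<omega>))\<^sup>2)"
    unfolding eq by simp
  have "(\<integral>\<omega>. (X ?g \<omega> - (a * X h \<omega> + b * X k \<omega>))\<^sup>2 \<partial>M) = 0"
    unfolding eq by (simp add: covariance inner_add_left inner_add_right inner_commute[of k h] power2_eq_square algebra_simps)
  then have "AE \<omega> in M. (X ?g \<omega> - (a * X h \<omega> + b * X k \<omega>))\<^sup>2 = 0"
    using integral_nonneg_eq_0_iff_AE[OF int] by simp
  then show ?thesis by simp
qed

lemma exp_abs_X_integrable: "integrable M (\<lambda>\<omega>. exp (a * \<bar>X h \<omega>\<bar>))"
proof (rule Bochner_Integration.integrable_bound)
  show "integrable M (\<lambda>\<omega>. exp (a * X h \<omega>) + exp ((-a) * X h \<omega>))"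
    by (intro Bochner_Integration.integrable_add exp_X)
  show "AE \<omega> in M. norm (exp (a * \<bar>X h \<omega>\<bar>)) \<le> norm (exp (a * X h \<omega>) + exp ((-a) * X h \<omega>))"
  proof (rule AE_I2)
    fix \<omega>
    have "\<bar>exp (a * X h \<omega>) + exp ((-a) * X h \<omega>)\<bar> = exp (a * X h \<omega>) + exp ((-a) * X h \<omega>)"
      by (intro abs_of_nonneg add_nonneg_nonneg) auto
    then show "norm (exp (a * \<bar>X h \<omega>\<bar>)) \<le> norm (exp (a * X h \<omega>) + exp ((-a) * X h \<omega>))"
      by (simp add: abs_if)
  qed
qed measurable

lemma exp_abs_X2_integrable: "integrable M (\<lambda>\<omega>. exp (a * \<bar>X h \<omega>\<bar>) * exp (b * \<bar>X k \<omega>\<bar>))"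
proof (rule Bochner_Integration.integrable_bound)
  show "integrable M (\<lambda>\<omega>. exp ((2 * a) * \<bar>X h \<omega>\<bar>) + exp ((2 * b) * \<bar>X k \<omega>\<bar>))"
    by (intro Bochner_Integration.integrable_add exp_abs_X_integrable)
  show "AE \<omega> in M. norm (exp (a * \<bar>X h \<omega>\<bar>) * exp (b * \<bar>X k \<omega>\<bar>)) \<le> norm (exp ((2 * a) * \<bar>X h \<omega>\<bar>) + exp ((2 * b) * \<bar>X k \<omega>\<bar>))"
  proof (rule AE_I2)
    fix \<omega>
    have "2 * (exp (a * \<bar>X h \<omega>\<bar>) * exp (b * \<bar>X k \<omega>\<bar>)) \<le> (exp (a * \<bar>X h \<omega>\<bar>))\<^sup>2 + (exp (b * \<bar>X k \<omega>\<bar>))\<^sup>2"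
      using sum_squares_bound[of "exp (a * \<bar>X h \<omega>\<bar>)" "exp (b * \<bar>X k \<omega>\<bar>)"] by simp
    also have "\<dots> = exp ((2 * a) * \<bar>X h \<omega>\<bar>) + exp ((2 * b) * \<bar>X k \<omega>\<bar>)"
      by (simp add: exp_double[symmetric] mult.assoc)
    finally show "norm (exp (a * \<bar>X h \<omega>\<bar>) * exp (b * \<bar>X k \<omega>\<bar>)) \<le> norm (exp ((2 * a) * \<bar>X h \<omega>\<bar>) + exp ((2 * b) * \<bar>X k \<omega>\<bar>))"
      using mult_pos_pos[OF exp_gt_zero exp_gt_zero, of "a * \<bar>X h \<omega>\<bar>" "b * \<bar>X k \<omega>\<bar>"]
      unfolding real_norm_def by linarith
  qed
qed measurable

definition wick_exp :: "'h \<Rightarrow> 'w \<Rightarrow> real" where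
  "wick_exp h \<omega> = exp (X h \<omega> - (norm h)\<^sup>2 / 2)"

definition herm :: "nat \<Rightarrow> 'h \<Rightarrow> 'w \<Rightarrow> real" where
  "herm n h \<omega> = hermite n ((norm h)\<^sup>2) (X h \<omega>)"

lemma wick_exp_measurable [measurable]: "wick_exp h \<in> borel_measurable M"
  unfolding wick_exp_def[abs_def] by measurable

lemma herm_measurable [measurable]: "herm n h \<in> borel_measurable M"
  unfolding herm_def[abs_def] by measurable

lemma herm_le: "\<bar>herm n h \<omega>\<bar> \<le> fact n * exp ((norm h)\<^sup>2 / 2) * exp (1 * \<bar>X h \<omega>\<bar>)"
  using hermite_abs_le[of n "(norm h)\<^sup>2" "X h \<omega>"] unfolding herm_def
  by (simp add: exp_add mult_ac)

lemma wick_exp_le: "\<bar>wick_exp h \<omega>\<bar> \<le> 1 * exp (1 * \<bar>X h \<omega>\<bar>)"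
  unfolding wick_exp_def by simp (smt (verit) zero_le_power2 divide_nonneg_pos)

text \<open>Hermite polynomials and Wick exponentials are both dominated by a multiple of
  \<open>exp \<bar>X h\<bar>\<close>, so one criterion settles the integrability of all their
  pairings.\<close>

lemma exp_growth_mult_integrable:
  assumes [measurable]: "f \<in> borel_measurable M" "g \<in> borel_measurable M"
    and "\<And>\<omega>. \<bar>f \<omega>\<bar> \<le> A * exp (a * \<bar>X h \<omega>\<bar>)" "\<And>\<omega>. \<bar>g \<omega>\<bar> \<le> B * exp (b * \<bar>X k \<omega>\<bar>)"
  shows "integrable M (\<lambda>\<omega>. f \<omega> * g \<omega>)"
proof (rule Bochner_Integration.integrable_bound)
  show "integrable M (\<lambda>\<omega>. (A * B) * (exp (a * \<bar>X h \<omega>\<bar>) * exp (b * \<bar>X k \<omega>\<bar>)))"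
    by (intro integrable_mult_right exp_abs_X2_integrable)
  show "AE \<omega> in M. norm (f \<omega> * g \<omega>) \<le> norm ((A * B) * (exp (a * \<bar>X h \<omega>\<bar>) * exp (b * \<bar>X k \<omega>\<bar>)))"
  proof (rule AE_I2)
    fix \<omega>
    have "\<bar>f \<omega>\<bar> * \<bar>g \<omega>\<bar> \<le> (A * exp (a * \<bar>X h \<omega>\<bar>)) * (B * exp (b * \<bar>X k \<omega>\<bar>))"
      using assms(3,4)[of \<omega>] by (intro mult_mono) (auto intro: order_trans[OF abs_ge_zero])
    also have "\<dots> \<le> \<bar>(A * exp (a * \<bar>X h \<omega>\<bar>)) * (B * exp (b * \<bar>X k \<omega>\<bar>))\<bar>"
      by (rule abs_ge_self)
    finally show "norm (f \<omega> * g \<omega>) \<le> norm ((A * B) * (exp (a * \<bar>X h \<omega>\<bar>) * exp (b * \<bar>X k \<omega>\<bar>)))"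
      by (simp only: real_norm_def abs_mult mult_ac)
  qed
qed measurable

lemma wick_herm_integrable [simp]:
  "integrable M (\<lambda>\<omega>. wick_exp h \<omega> * wick_exp k \<omega>)"
  "integrable M (\<lambda>\<omega>. herm n h \<omega> * wick_exp k \<omega>)"
  "integrable M (\<lambda>\<omega>. wick_exp k \<omega> * herm n h \<omega>)"
  "integrable M (\<lambda>\<omega>. herm n h \<omega> * herm m k \<omega>)"
  by (rule exp_growth_mult_integrable[OF _ _ wick_exp_le wick_exp_le]
        exp_growth_mult_integrable[OF _ _ herm_le wick_exp_le]
        exp_growth_mult_integrable[OF _ _ wick_exp_le herm_le]
        exp_growth_mult_integrable[OF _ _ herm_le herm_le], measurable)+

lemma wick_exp_mult: "(\<integral>\<omega>. wick_exp h \<omega> * wick_exp k \<omega> \<partial>M) = exp (inner h k)"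
proof -
  have "(\<integral>\<omega>. wick_exp h \<omega> * wick_exp k \<omega> \<partial>M)
    = (\<integral>\<omega>. exp (- ((norm h)\<^sup>2 + (norm k)\<^sup>2) / 2) * exp (1 * X (h + k) \<omega>) \<partial>M)"
  proof (rule integral_cong_AE)
    show "AE \<omega> in M. wick_exp h \<omega> * wick_exp k \<omega> = exp (- ((norm h)\<^sup>2 + (norm k)\<^sup>2) / 2) * exp (1 * X (h + k) \<omega>)"
      using X_AE_linear[of 1 h 1 k]
    proof eventually_elim
      case (elim \<omega>)
      then have "X (h + k) \<omega> = X h \<omega> + X k \<omega>" by simp
      then show ?case by (simp add: wick_exp_def exp_add[symmetric] field_simps)
    qed
  qed measurable
  also have "\<dots> = exp (- ((norm h)\<^sup>2 + (norm k)\<^sup>2) / 2) * exp (1\<^sup>2 * (norm (h + k))\<^sup>2 / 2)"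
    by (subst integral_mult_right_zero) (simp only: exp_X)
  also have "\<dots> = exp (inner h k)"
    by (simp add: exp_add[symmetric] power2_norm_eq_inner inner_add_left inner_add_right inner_commute[of k h])
       (simp add: field_simps)
  finally show ?thesis .
qed

lemma wick_exp_power:
  "integrable M (\<lambda>\<omega>. wick_exp h \<omega> ^ n)"
  "(\<integral>\<omega>. wick_exp h \<omega> ^ n \<partial>M) = exp (real n * (real n - 1) / 2 * (norm h)\<^sup>2)"
proof -
  have eq: "wick_exp h \<omega> ^ n = exp (- real n * (norm h)\<^sup>2 / 2) * exp (real n * X h \<omega>)" for \<omega>
    by (simp add: wick_exp_def exp_of_nat_mult[symmetric] exp_add[symmetric] algebra_simps)
  show "integrable M (\<lambda>\<omega>. wick_exp h \<omega> ^ n)" unfolding eq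
    by (intro integrable_mult_right exp_X)
  show "(\<integral>\<omega>. wick_exp h \<omega> ^ n \<partial>M) = exp (real n * (real n - 1) / 2 * (norm h)\<^sup>2)"
    unfolding eq by (subst integral_mult_right_zero) (simp add: exp_X exp_add[symmetric] power2_eq_square field_simps)
qed

text \<open>The pairing of \<open>F\<close> with the Wick exponential of
  \<open>x *\<^sub>R k\<close> is a power series in \<open>x\<close> whose coefficients are the
  pairings with Hermite polynomials. Where the sum is known explicitly, comparison of coefficients
  yields every single pairing.\<close>

lemma wick_series:
  assumes [measurable]: "F \<in> borel_measurable M"
    and int: "\<And>r. integrable M (\<lambda>\<omega>. F \<omega> * exp (r * \<bar>X k \<omega>\<bar>))"
  shows "(\<lambda>m. (\<integral>\<omega>. F \<omega> * herm m k \<omega> \<partial>M) / fact m * x ^ m) sums (\<integral>\<omega>. F \<omega> * wick_exp (x *\<^sub>R k) \<omega> \<partial>M)"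
proof -
  let ?v = "(norm k)\<^sup>2"
  let ?E = "\<lambda>\<omega>. exp (x * X k \<omega> - x\<^sup>2 * ?v / 2)"
  let ?w = "\<lambda>\<omega>. exp (x\<^sup>2 * ?v / 2) * \<bar>F \<omega> * exp (\<bar>x\<bar> * \<bar>X k \<omega>\<bar>)\<bar>"
  have intw: "integrable M ?w" by (intro integrable_mult_right integrable_abs int)
  have le: "norm (\<Sum>m<N. F \<omega> * herm m k \<omega> / fact m * x ^ m) \<le> ?w \<omega>" for N \<omega>
  proof -
    have "norm (\<Sum>m<N. F \<omega> * herm m k \<omega> / fact m * x ^ m) \<le> (\<Sum>m<N. \<bar>F \<omega>\<bar> * \<bar>hermite m ?v (X k \<omega>) * x ^ m / fact m\<bar>)"
      unfolding real_norm_def by (rule order_trans[OF sum_abs]) (simp add: abs_mult herm_def mult_ac)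
    also have "\<dots> \<le> \<bar>F \<omega>\<bar> * exp (\<bar>x\<bar> * \<bar>X k \<omega>\<bar> + x\<^sup>2 * \<bar>?v\<bar> / 2)"
      unfolding sum_distrib_left[symmetric] by (intro mult_left_mono hermite_abs_sum_le) auto
    also have "\<dots> = ?w \<omega>" by (simp add: exp_add abs_mult)
    finally show ?thesis .
  qed
  have intm: "integrable M (\<lambda>\<omega>. F \<omega> * herm m k \<omega>)" for m
  proof (rule Bochner_Integration.integrable_bound)
    show "integrable M (\<lambda>\<omega>. fact m * exp ((norm k)\<^sup>2 / 2) * (F \<omega> * exp (1 * \<bar>X k \<omega>\<bar>)))"
      by (intro integrable_mult_right int)
    show "AE \<omega> in M. norm (F \<omega> * herm m k \<omega>) \<le> norm (fact m * exp ((norm k)\<^sup>2 / 2) * (F \<omega> * exp (1 * \<bar>X k \<omega>\<bar>)))"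
      using mult_left_mono[OF herm_le[of m k] abs_ge_zero] by (intro AE_I2) (simp add: abs_mult mult_ac)
  qed measurable
  have "(\<lambda>N. \<integral>\<omega>. (\<Sum>m<N. F \<omega> * herm m k \<omega> / fact m * x ^ m) \<partial>M) \<longlonglongrightarrow> (\<integral>\<omega>. F \<omega> * ?E \<omega> \<partial>M)"
  proof (rule integral_dominated_convergence[OF _ _ intw])
    show "AE \<omega> in M. (\<lambda>N. \<Sum>m<N. F \<omega> * herm m k \<omega> / fact m * x ^ m) \<longlonglongrightarrow> F \<omega> * ?E \<omega>"
    proof (rule AE_I2)
      fix \<omega>
      from sums_mult[OF hermite_generating[of ?v "X k \<omega>" x], of "F \<omega>"]
      show "(\<lambda>N. \<Sum>m<N. F \<omega> * herm m k \<omega> / fact m * x ^ m) \<longlonglongrightarrow> F \<omega> * ?E \<omega>"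
        unfolding sums_def herm_def by (simp add: mult_ac)
    qed
  qed (use le in \<open>auto intro!: AE_I2\<close>)
  moreover have "(\<integral>\<omega>. (\<Sum>m<N. F \<omega> * herm m k \<omega> / fact m * x ^ m) \<partial>M)
      = (\<Sum>m<N. (\<integral>\<omega>. F \<omega> * herm m k \<omega> \<partial>M) / fact m * x ^ m)" for N
    by (subst Bochner_Integration.integral_sum) (auto intro!: integrable_divide integrable_mult_left intm)
  moreover have "(\<integral>\<omega>. F \<omega> * ?E \<omega> \<partial>M) = (\<integral>\<omega>. F \<omega> * wick_exp (x *\<^sub>R k) \<omega> \<partial>M)"
  proof (rule integral_cong_AE)
    show "AE \<omega> in M. F \<omega> * ?E \<omega> = F \<omega> * wick_exp (x *\<^sub>R k) \<omega>"
      using X_AE_linear[of x k 0 0] by eventually_elim (simp add: wick_exp_def power_mult_distrib)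
  qed measurable
  ultimately show ?thesis unfolding sums_def by simp
qed

text \<open>Coefficients in \<open>x\<close> of the pairing of \<open>wick_exp k\<close> with
  \<open>wick_exp (x *\<^sub>R h)\<close>, which is \<open>exp (x * inner h k)\<close>.\<close>

lemma herm_wick_exp: "(\<integral>\<omega>. herm n h \<omega> * wick_exp k \<omega> \<partial>M) = inner h k ^ n"
proof -
  have "(\<lambda>m. (\<integral>\<omega>. wick_exp k \<omega> * herm m h \<omega> \<partial>M) / fact m * x ^ m) sums exp (x * inner h k)" for x
    using wick_series[of "wick_exp k" h x]
      exp_growth_mult_integrable[OF _ _ wick_exp_le[of k], of "\<lambda>\<omega>. exp (r * \<bar>X h \<omega>\<bar>)" 1 r h for r]
    by (simp add: wick_exp_mult inner_commute)
  moreover have "(\<lambda>m. inner h k ^ m / fact m * x ^ m) sums exp (x * inner h k)" for x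
    using exp_converges[of "x * inner h k"] by (simp add: power_mult_distrib divide_inverse mult_ac)
  ultimately have "(\<integral>\<omega>. wick_exp k \<omega> * herm n h \<omega> \<partial>M) / fact n = inner h k ^ n / fact n"
    by (rule sums_coeffs_unique)
  then show ?thesis by (simp add: mult.commute)
qed

text \<open>The same comparison one level up: by \<open>herm_wick_exp\<close> the pairing of
  \<open>herm n h\<close> with \<open>wick_exp (x *\<^sub>R k)\<close> is a monomial of degree
  \<open>n\<close> in \<open>x\<close>, so all other coefficients vanish.\<close>

lemma herm_orthogonal:
  "(\<integral>\<omega>. herm n h \<omega> * herm m k \<omega> \<partial>M) = (if n = m then fact n * inner h k ^ n else 0)"
proof -
  have "(\<lambda>m. (\<integral>\<omega>. herm n h \<omega> * herm m k \<omega> \<partial>M) / fact m * x ^ m) sums (x * inner h k) ^ n" for x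
    using wick_series[of "herm n h" k x]
      exp_growth_mult_integrable[OF _ _ herm_le[of n h], of "\<lambda>\<omega>. exp (r * \<bar>X k \<omega>\<bar>)" 1 r k for r]
    by (simp add: herm_wick_exp)
  moreover have "(\<lambda>m. (if m = n then inner h k ^ n else 0) * x ^ m) sums (x * inner h k) ^ n" for x
  proof -
    have "(\<lambda>m. (if m = n then inner h k ^ n else 0) * x ^ m) = (\<lambda>m. if m = n then inner h k ^ m * x ^ m else 0)"
      by auto
    then show ?thesis
      using sums_single[of n "\<lambda>m. inner h k ^ m * x ^ m"] by (simp add: power_mult_distrib mult.commute)
  qed
  ultimately have "(\<integral>\<omega>. herm n h \<omega> * herm m k \<omega> \<partial>M) / fact m = (if m = n then inner h k ^ n else 0)"
    by (rule sums_coeffs_unique)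
  then show ?thesis by (auto simp: field_simps split: if_splits)
qed

end

section \<open>Elementary tensors and polarization\<close>

lemma tens_inner:
  assumes "hilbert_tensors tens"
  shows "inner (tens hs) (tens ks) = (if length hs = length ks then (\<Prod>i<length hs. inner (hs ! i) (ks ! i)) else 0)"
  using assms by (simp add: hilbert_tensors_def)

lemma tens_inner_replicate:
  assumes "hilbert_tensors tens"
  shows "inner (tens (replicate n h)) (tens (replicate n k)) = inner h k ^ n"
  by (simp add: tens_inner[OF assms])

lemma tens_total:
  assumes T: "hilbert_tensors tens" and "\<And>hs. inner v (tens hs) = 0"
  shows "v = 0"
proof -
  have "subspace {w. inner v w = 0}" by (auto simp: subspace_def inner_add_right)
  then have "span (range tens) \<subseteq> {w. inner v w = 0}"
    using assms(2) by (intro span_minimal) auto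
  moreover have "closed {w. inner v w = 0}"
    by (intro closed_Collect_eq continuous_intros)
  ultimately have "closure (span (range tens)) \<subseteq> {w. inner v w = 0}"
    by (rule closure_minimal)
  moreover have "closure (span (range tens)) = UNIV" using T by (simp add: hilbert_tensors_def)
  ultimately have "v \<in> {w. inner v w = 0}" by blast
  then show ?thesis by simp
qed

text \<open>Only the inner products of elementary tensors are known, so the difference of both sides
  is tested against all of them; they are total, and each test is linear in the factor that the slot
  contributes.\<close>

lemma tens_linear:
  assumes T: "hilbert_tensors tens"
  shows "tens (as @ (x *\<^sub>R a + y *\<^sub>R b) # bs) = x *\<^sub>R tens (as @ a # bs) + y *\<^sub>R tens (as @ b # bs)"
proof -
  let ?v = "tens (as @ (x *\<^sub>R a + y *\<^sub>R b) # bs) - (x *\<^sub>R tens (as @ a # bs) + y *\<^sub>R tens (as @ b # bs))"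
  have "inner ?v (tens ks) = 0" for ks
  proof (cases "length ks = Suc (length as + length bs)")
    case True
    let ?n = "Suc (length as + length bs)" and ?p = "length as"
    define R where "R = (\<Prod>i\<in>{..<?n} - {?p}. inner ((as @ a # bs) ! i) (ks ! i))"
    have split: "inner (tens (as @ c # bs)) (tens ks) = inner c (ks ! ?p) * R" for c
    proof -
      have "inner (tens (as @ c # bs)) (tens ks) = (\<Prod>i<?n. inner ((as @ c # bs) ! i) (ks ! i))"
        using True by (simp add: tens_inner[OF T])
      also have "\<dots> = inner ((as @ c # bs) ! ?p) (ks ! ?p) * (\<Prod>i\<in>{..<?n} - {?p}. inner ((as @ c # bs) ! i) (ks ! i))"
        by (intro prod.remove) auto
      also have "(\<Prod>i\<in>{..<?n} - {?p}. inner ((as @ c # bs) ! i) (ks ! i)) = R"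
        unfolding R_def by (intro prod.cong refl) (auto simp: nth_append nth_Cons split: nat.splits)
      finally show ?thesis by simp
    qed
    show ?thesis unfolding inner_diff_left inner_add_left inner_scaleR_left split
      by (simp add: inner_add_left algebra_simps)
  qed (auto simp: inner_diff_left inner_add_left tens_inner[OF T])
  then have "?v = 0" by (rule tens_total[OF T])
  then show ?thesis by simp
qed

lemma tens_add: "hilbert_tensors tens \<Longrightarrow> tens (as @ (a + b) # bs) = tens (as @ a # bs) + tens (as @ b # bs)"
  using tens_linear[of tens as 1 a 1 b bs] by simp

text \<open>The list \<open>as\<close> holds the slots already expanded into elements of
  \<open>B\<close>; the induction moves the slots of \<open>bs\<close> over one at a time, each by
  linearity in that slot alone.\<close>

lemma tens_span:
  assumes T: "hilbert_tensors tens"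
  shows "set as \<subseteq> B \<Longrightarrow> set bs \<subseteq> span B \<Longrightarrow>
    tens (as @ bs) \<in> span (tens ` {ks. set ks \<subseteq> B \<and> length ks = length as + length bs})"
proof (induction bs arbitrary: as)
  case Nil
  then show ?case by (auto intro!: span_base)
next
  case (Cons b bs)
  let ?S = "span (tens ` {ks. set ks \<subseteq> B \<and> length ks = length as + length (b # bs)})"
  have "subspace {b. tens (as @ b # bs) \<in> ?S}"
  proof (rule subspaceI)
    show "0 \<in> {b. tens (as @ b # bs) \<in> ?S}"
      using tens_linear[OF T, of as 0 0 0 0 bs] by (simp add: span_zero)
    show "a + b \<in> {b. tens (as @ b # bs) \<in> ?S}"
      if "a \<in> {b. tens (as @ b # bs) \<in> ?S}" "b \<in> {b. tens (as @ b # bs) \<in> ?S}" for a b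
      using that by (simp add: tens_add[OF T] span_add)
    show "c *\<^sub>R a \<in> {b. tens (as @ b # bs) \<in> ?S}" if "a \<in> {b. tens (as @ b # bs) \<in> ?S}" for a c
      using that tens_linear[OF T, of as c a 0 a bs] by (simp add: span_mul)
  qed
  moreover have "B \<subseteq> {b. tens (as @ b # bs) \<in> ?S}"
  proof
    fix c assume "c \<in> B"
    then have "tens ((as @ [c]) @ bs) \<in> span (tens ` {ks. set ks \<subseteq> B \<and> length ks = length (as @ [c]) + length bs})"
      using Cons by (intro Cons.IH) auto
    then show "c \<in> {b. tens (as @ b # bs) \<in> ?S}" by simp
  qed
  ultimately have "span B \<subseteq> {b. tens (as @ b # bs) \<in> ?S}" by (intro span_minimal)
  then show ?case using Cons.prems by auto
qed

section \<open>Finite differences and polarization of symmetric multilinear forms\<close>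

primrec fdiff :: "'a::ab_group_add list \<Rightarrow> ('a \<Rightarrow> real) \<Rightarrow> 'a \<Rightarrow> real" where
  "fdiff [] q = q"
| "fdiff (h # hs) q = fdiff hs (\<lambda>g. q (g + h) - q g)"

lemma fdiff_zero [simp]: "fdiff hs (\<lambda>g. 0) = (\<lambda>g. 0)"
  by (induction hs) auto

lemma fdiff_add: "fdiff hs (\<lambda>g. p g + q g) g = fdiff hs p g + fdiff hs q g"
proof (induction hs arbitrary: p q)
  case (Cons h hs)
  have "(\<lambda>g. p (g + h) + q (g + h) - (p g + q g)) = (\<lambda>g. (p (g + h) - p g) + (q (g + h) - q g))" by (simp add: fun_eq_iff)
  then show ?case using Cons by simp
qed simp

lemma fdiff_cmult: "fdiff hs (\<lambda>g. c * q g) g = c * fdiff hs q g"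
proof (induction hs arbitrary: q)
  case (Cons h hs)
  have "(\<lambda>g. c * q (g + h) - c * q g) = (\<lambda>g. c * (q (g + h) - q g))" by (simp add: fun_eq_iff right_diff_distrib)
  then show ?case using Cons by simp
qed simp

lemma fdiff_sum: "finite A \<Longrightarrow> fdiff hs (\<lambda>g. \<Sum>i\<in>A. q i g) g = (\<Sum>i\<in>A. fdiff hs (q i) g)"
  by (induction A rule: finite_induct) (auto simp: fdiff_add)

lemma fdiff_integral:
  assumes "\<And>g. integrable N (q g)"
  shows "fdiff hs (\<lambda>g. \<integral>z. q g z \<partial>N) g = (\<integral>z. fdiff hs (\<lambda>g. q g z) g \<partial>N)"
    and "integrable N (\<lambda>z. fdiff hs (\<lambda>g. q g z) g)"
  using assms
proof (induction hs arbitrary: q)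
  case (Cons h hs)
  { case 1 with Cons.IH(1)[of "\<lambda>g z. q (g + h) z - q g z"] show ?case by simp }
  { case 2 with Cons.IH(2)[of "\<lambda>g z. q (g + h) z - q g z"] show ?case by simp }
qed auto

lemma fdiff_measurable:
  assumes "\<And>g. q g \<in> borel_measurable N"
  shows "(\<lambda>z. fdiff hs (\<lambda>g. q g z) g) \<in> borel_measurable N"
  using assms
proof (induction hs arbitrary: q)
  case (Cons h hs)
  from Cons.IH[of "\<lambda>g z. q (g + h) z - q g z"] Cons.prems show ?case by simp
qed auto

context
  fixes T :: "'a::ab_group_add list \<Rightarrow> real" and n :: nat
  assumes add: "\<And>as a b bs. T (as @ (a + b) # bs) = T (as @ a # bs) + T (as @ b # bs)"
    and sym: "\<And>hs ks. length hs = n \<Longrightarrow> mset hs = mset ks \<Longrightarrow> T hs = T ks"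
begin

text \<open>\<open>rest\<close> parks the slots that no longer contain the variable; symmetry
  permits every slot to be moved there.\<close>

lemma multilinear_binomial:
  "k + length rest = n \<Longrightarrow> T (replicate k (g + h) @ rest)
    = (\<Sum>i\<le>k. real (k choose i) * T (replicate i g @ replicate (k - i) h @ rest))"
proof (induction k arbitrary: rest)
  case (Suc k)
  let ?a = "\<lambda>i. T (replicate i g @ replicate (Suc k - i) h @ rest)"
  have "T (replicate (Suc k) (g + h) @ rest) = T (g # replicate k (g + h) @ rest) + T (h # replicate k (g + h) @ rest)"
    using add[of "[]" g h "replicate k (g + h) @ rest"] by simp
  also have "T (g # replicate k (g + h) @ rest) = T (replicate k (g + h) @ g # rest)"
    using Suc.prems by (intro sym) auto
  also have "T (h # replicate k (g + h) @ rest) = T (replicate k (g + h) @ h # rest)"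
    using Suc.prems by (intro sym) auto
  also have "T (replicate k (g + h) @ g # rest) = (\<Sum>i\<le>k. real (k choose i) * ?a (Suc i))"
    using Suc.prems by (subst Suc.IH) (auto intro!: sum.cong sym)
  also have "T (replicate k (g + h) @ h # rest) = (\<Sum>i\<le>k. real (k choose i) * ?a i)"
    using Suc.prems by (subst Suc.IH) (auto intro!: sum.cong sym simp: Suc_diff_le)
  also have "(\<Sum>i\<le>k. real (k choose i) * ?a (Suc i)) + (\<Sum>i\<le>k. real (k choose i) * ?a i)
     = (\<Sum>i\<le>Suc k. real (Suc k choose i) * ?a i)"
  proof -
    have "(\<Sum>i\<le>Suc k. real (Suc k choose i) * ?a i) = ?a 0 + (\<Sum>i\<le>k. real (Suc k choose Suc i) * ?a (Suc i))"
      by (subst sum.atMost_Suc_shift) simp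
    also have "(\<Sum>i\<le>k. real (Suc k choose Suc i) * ?a (Suc i)) = (\<Sum>i\<le>k. real (k choose i) * ?a (Suc i)) + (\<Sum>i\<le>k. real (k choose Suc i) * ?a (Suc i))"
      by (simp add: sum.distrib distrib_right)
    also have "?a 0 + ((\<Sum>i\<le>k. real (k choose i) * ?a (Suc i)) + (\<Sum>i\<le>k. real (k choose Suc i) * ?a (Suc i)))
      = (\<Sum>i\<le>k. real (k choose i) * ?a (Suc i)) + (\<Sum>i\<le>Suc k. real (k choose i) * ?a i)"
      unfolding sum.atMost_Suc_shift[of "\<lambda>i. real (k choose i) * ?a i"] by simp
    finally show ?thesis by simp
  qed
  finally show ?case .
qed simp

text \<open>A difference cancels the top term \<open>i = k\<close> of the binomial expansion and so
  lowers the degree in \<open>g\<close> by at least one. When exactly \<open>k\<close> differences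
  are available, only the term \<open>i = k - 1\<close> outlives the others; it carries the factor
  \<open>k\<close>, and these factors multiply to \<open>fact k\<close>.\<close>

lemma fdiff_multilinear:
  "k + length rest = n \<Longrightarrow> k \<le> length hs \<Longrightarrow> fdiff hs (\<lambda>g. T (replicate k g @ rest)) g
    = (if length hs = k then fact k * T (hs @ rest) else 0)"
proof (induction hs arbitrary: k rest)
  case (Cons h hs)
  let ?t = "\<lambda>i g. T (replicate i g @ (replicate (k - i) h @ rest))"
  have "(\<lambda>g. T (replicate k (g + h) @ rest) - T (replicate k g @ rest)) = (\<lambda>g. \<Sum>i<k. real (k choose i) * ?t i g)"
    using Cons.prems by (simp add: multilinear_binomial fun_eq_iff lessThan_Suc_atMost[symmetric])
  then have "fdiff (h # hs) (\<lambda>g. T (replicate k g @ rest)) g = fdiff hs (\<lambda>g. \<Sum>i<k. real (k choose i) * ?t i g) g"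
    by simp
  also have "\<dots> = (\<Sum>i<k. real (k choose i) * fdiff hs (?t i) g)"
    by (simp add: fdiff_sum fdiff_cmult)
  also have "\<dots> = (\<Sum>i<k. real (k choose i) * (if length hs = i then fact i * T (hs @ replicate (k - i) h @ rest) else 0))"
    using Cons.prems by (intro sum.cong refl arg_cong2[where f="(*)"] Cons.IH) auto
  also have "\<dots> = (if length (h # hs) = k then fact k * T ((h # hs) @ rest) else 0)"
  proof (cases "length (h # hs) = k")
    case True
    then have k: "k = Suc (length hs)" by simp
    have "(\<Sum>i<k. real (k choose i) * (if length hs = i then fact i * T (hs @ replicate (k - i) h @ rest) else 0))
      = (\<Sum>i<k. if i = length hs then real (k choose i) * (fact i * T (hs @ replicate (k - i) h @ rest)) else 0)"
      by (intro sum.cong) auto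
    also have "\<dots> = real k * (fact (length hs) * T (hs @ [h] @ rest))"
      by (simp add: k)
    also have "T (hs @ [h] @ rest) = T ((h # hs) @ rest)"
      using Cons.prems k by (intro sym) auto
    finally show ?thesis using True k by simp
  next
    case False
    then have "length hs \<noteq> i" if "i < k" for i using that Cons.prems by auto
    then show ?thesis using False by (auto intro!: sum.neutral)
  qed
  finally show ?case .
qed simp

end

text \<open>Pairings with Hermite polynomials reveal only the diagonal values of the form. Since the
  difference combines finitely many of them, integrals and measurability in further parameters pass
  from the diagonal to the whole form.\<close>

lemma polarization:
  assumes T: "hilbert_tensors tens" and f: "f \<in> sym_tensor_power tens n" and n: "length hs = n"
  shows "fdiff hs (\<lambda>g. inner f (tens (replicate n g))) 0 = fact n * inner f (tens hs)"
proof -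
  have "fdiff hs (\<lambda>g. inner f (tens (replicate n g @ []))) 0
      = (if length hs = n then fact n * inner f (tens (hs @ [])) else 0)"
    by (rule fdiff_multilinear[where T="\<lambda>hs. inner f (tens hs)" and n=n])
       (use f n in \<open>auto simp: sym_tensor_power_def tens_add[OF T] inner_add_right\<close>)
  then show ?thesis using n by simp
qed

section \<open>The heat kernel\<close>

lemma lborel_integral_shift_reflect:
  fixes f :: "'a::euclidean_space \<Rightarrow> real"
  assumes c: "\<bar>c\<bar> = 1" and [measurable]: "f \<in> borel_measurable borel"
  shows "(\<integral>x. f (t + c *\<^sub>R x) \<partial>lborel) = (\<integral>x. f x \<partial>lborel)"
    "integrable lborel (\<lambda>x. f (t + c *\<^sub>R x)) \<longleftrightarrow> integrable lborel f"
proof -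
  have "lborel = density (distr lborel borel (\<lambda>x. t + c *\<^sub>R x)) (\<lambda>_. \<bar>c\<bar> ^ DIM('a))"
    using c by (intro lborel_affine) auto
  then have eq: "lborel = distr lborel borel (\<lambda>x. t + c *\<^sub>R x)" using c by (simp add: density_1)
  show "(\<integral>x. f (t + c *\<^sub>R x) \<partial>lborel) = (\<integral>x. f x \<partial>lborel)"
    by (subst (2) eq, subst integral_distr) auto
  show "integrable lborel (\<lambda>x. f (t + c *\<^sub>R x)) \<longleftrightarrow> integrable lborel f"
    by (subst (2) eq, subst integrable_distr_eq) auto
qed

lemma heat_kernel_nonneg [simp]: "0 \<le> heat_kernel t x"
  by (simp add: heat_kernel_def)

lemma heat_kernel_minus [simp]: "heat_kernel t (- x) = heat_kernel t x"
  by (simp add: heat_kernel_def)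

lemma heat_kernel_measurable [measurable]:
  "(\<lambda>(t, x :: real ^ 'd). heat_kernel t x) \<in> borel_measurable (borel \<Otimes>\<^sub>M borel)"
  unfolding heat_kernel_def case_prod_beta by measurable

lemma heat_kernel_prod:
  assumes "t > 0"
  shows "heat_kernel t (x :: real ^ 'd) = (\<Prod>b\<in>Basis. normal_density 0 (sqrt t) (x \<bullet> b))"
proof -
  have "(\<Prod>b\<in>Basis. normal_density 0 (sqrt t) (x \<bullet> b))
      = (\<Prod>b\<in>(Basis::(real^'d) set). (2 * pi * t) powr (-1/2) * exp (- (x \<bullet> b)\<^sup>2 / (2 * t)))"
  proof (intro prod.cong refl)
    fix b :: "real ^ 'd" assume "b \<in> Basis"
    have "1 / sqrt (2 * pi * t) = (2 * pi * t) powr (-1/2)"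
      using assms by (simp add: powr_minus_divide powr_half_sqrt)
    then show "normal_density 0 (sqrt t) (x \<bullet> b) = (2 * pi * t) powr (-1/2) * exp (- (x \<bullet> b)\<^sup>2 / (2 * t))"
      using assms by (simp add: normal_density_def)
  qed
  also have "\<dots> = ((2 * pi * t) powr (-1/2)) ^ CARD('d) * exp (\<Sum>b\<in>(Basis::(real^'d) set). - (x \<bullet> b)\<^sup>2 / (2 * t))"
    by (simp add: prod.distrib exp_sum)
  also have "((2 * pi * t) powr (-1/2)) ^ CARD('d) = (2 * pi * t) powr (- real CARD('d) / 2)"
    using assms by (subst powr_realpow[symmetric]) (auto simp: powr_powr)
  also have "(\<Sum>b\<in>(Basis::(real^'d) set). - (x \<bullet> b)\<^sup>2 / (2 * t)) = - (norm x)\<^sup>2 / (2 * t)"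
    unfolding power2_norm_eq_inner euclidean_inner[of x x]
    by (simp add: sum_divide_distrib sum_negf power2_eq_square)
  finally show ?thesis by (simp add: heat_kernel_def)
qed

lemma heat_kernel_integral0:
  assumes "t > 0"
  shows "integrable lborel (heat_kernel t :: real ^ 'd \<Rightarrow> real)"
    "(\<integral>x. heat_kernel t (x :: real ^ 'd) \<partial>lborel) = 1"
proof -
  have "(\<integral>\<^sup>+x. ennreal (heat_kernel t (x :: real ^ 'd)) \<partial>lborel)
    = (\<integral>\<^sup>+x. (\<Prod>b\<in>(Basis::(real^'d) set). ennreal (normal_density 0 (sqrt t) (x \<bullet> b))) \<partial>lborel)"
    by (intro nn_integral_cong) (simp add: heat_kernel_prod[OF assms] prod_ennreal)
  also have "\<dots> = (\<Prod>b\<in>(Basis::(real^'d) set). (\<integral>\<^sup>+x. ennreal (normal_density 0 (sqrt t) x) \<partial>lborel))"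
    by (rule nn_integral_lborel_prod) auto
  also have "\<dots> = 1"
    using assms by (simp add: nn_integral_eq_integral)
  finally have *: "(\<integral>\<^sup>+x. ennreal (heat_kernel t (x :: real ^ 'd)) \<partial>lborel) = ennreal 1" by simp
  have "(\<lambda>x::real^'d. heat_kernel t x) \<in> borel_measurable lborel" by measurable
  then have "has_bochner_integral lborel (heat_kernel t :: real ^ 'd \<Rightarrow> real) 1"
    using * by (intro has_bochner_integral_nn_integral) auto
  then show "integrable lborel (heat_kernel t :: real ^ 'd \<Rightarrow> real)"
    "(\<integral>x. heat_kernel t (x :: real ^ 'd) \<partial>lborel) = 1"
    by (auto simp: has_bochner_integral_iff)
qed

lemma heat_kernel_integral:
  assumes "t > 0"
  shows "integrable lborel (\<lambda>z :: real ^ 'd. heat_kernel t (x - z))"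
    "(\<integral>z. heat_kernel t (x - z :: real ^ 'd) \<partial>lborel) = 1"
  using heat_kernel_integral0[OF assms, where 'd='d]
    lborel_integral_shift_reflect[of "-1" "heat_kernel t :: real ^ 'd \<Rightarrow> real" x] by simp_all

text \<open>Completion of the square in \<open>z\<close>: given its end points, the intermediate
  point of a Gaussian bridge is Gaussian around the interpolated point with variance
  \<open>s * t / (s + t)\<close>. Chapman-Kolmogorov is then the normalization of that
  kernel.\<close>

lemma heat_kernel_convolution_pointwise:
  fixes x y z :: "real ^ 'd"
  assumes "s > 0" "t > 0"
  shows "heat_kernel s (x - z) * heat_kernel t (z - y) =
    heat_kernel (s + t) (x - y) * heat_kernel (s * t / (s + t)) ((y + (t / (s + t)) *\<^sub>R (x - y)) - z)"
proof -
  let ?c = "- real CARD('d) / 2" and ?q = "s * t / (s + t)"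
  define w v where "w = x - y" and "v = z - y"
  have xz: "x - z = w - v" and yz: "(y + (t / (s + t)) *\<^sub>R (x - y)) - z = (t / (s + t)) *\<^sub>R w - v"
    by (simp_all add: w_def v_def)
  have "(2 * pi * s) powr ?c * (2 * pi * t) powr ?c = ((2 * pi * s) * (2 * pi * t)) powr ?c"
    using assms by (subst powr_mult) auto
  also have "(2 * pi * s) * (2 * pi * t) = (2 * pi * (s + t)) * (2 * pi * ?q)"
    using assms by (simp add: field_simps)
  also have "\<dots> powr ?c = (2 * pi * (s + t)) powr ?c * (2 * pi * ?q) powr ?c"
    using assms by (subst powr_mult) auto
  finally have c: "(2 * pi * s) powr ?c * (2 * pi * t) powr ?c = (2 * pi * (s + t)) powr ?c * (2 * pi * ?q) powr ?c" .
  have "(norm ((t / (s + t)) *\<^sub>R w - v))\<^sup>2 = (t / (s + t))\<^sup>2 * (w \<bullet> w) - 2 * (t / (s + t)) * (w \<bullet> v) + v \<bullet> v"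
  proof -
    have "(norm (c *\<^sub>R w - v))\<^sup>2 = c\<^sup>2 * (w \<bullet> w) - 2 * c * (w \<bullet> v) + v \<bullet> v" for c
      by (simp add: power2_norm_eq_inner inner_diff_left inner_diff_right inner_commute[of v w] power2_eq_square[of c] algebra_simps)
    then show ?thesis .
  qed
  moreover have "(norm (w - v))\<^sup>2 = w \<bullet> w - 2 * (w \<bullet> v) + v \<bullet> v"
    by (simp add: power2_norm_eq_inner inner_diff_left inner_diff_right inner_commute[of v w])
  \<comment> \<open>With \<open>A\<close>, \<open>B\<close>, \<open>C\<close> for
    \<open>w \<bullet> w\<close>, \<open>w \<bullet> v\<close>, \<open>v \<bullet> v\<close>, both
    exponents are linear forms; the facts 1 to 4 compare their coefficients.\<close>
  moreover have "A / (2 * s) - 2 * B / (2 * s) + C / (2 * s) + C / (2 * t) =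
     A / (2 * (s + t)) + ((t / (s + t))\<^sup>2 * A - 2 * (t / (s + t)) * B + C) / (2 * ?q)" for A B C :: real
  proof -
    have p: "s + t \<noteq> 0" "s \<noteq> 0" "t \<noteq> 0" using assms by auto
    have 1: "(t / (s + t))\<^sup>2 / (2 * ?q) = t / (2 * s * (s + t))"
    proof -
      have "(t / u)\<^sup>2 / (2 * (s * t / u)) = t / (2 * s * u)" if "u \<noteq> 0" for u
        using that p by (simp add: power2_eq_square field_simps)
      then show ?thesis using p by blast
    qed
    have 2: "(t / (s + t)) / (2 * ?q) = 1 / (2 * s)"
    proof -
      have "(t / u) / (2 * (s * t / u)) = 1 / (2 * s)" if "u \<noteq> 0" for u
        using that p by (simp add: field_simps)
      then show ?thesis using p by blast
    qed
    have 3: "1 / (2 * ?q) = 1 / (2 * s) + 1 / (2 * t)"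
    proof -
      have "1 / (2 * (s * t / u)) = u / (2 * s * t)" if "u \<noteq> 0" for u
        using that p by (simp add: field_simps)
      then have "1 / (2 * ?q) = (s + t) / (2 * s * t)" using p by blast
      also have "\<dots> = 1 / (2 * s) + 1 / (2 * t)" using p by (simp add: add_divide_distrib)
      finally show ?thesis .
    qed
    have 4: "1 / (2 * s) = 1 / (2 * (s + t)) + t / (2 * s * (s + t))"
    proof -
      have "1 / (2 * u) = s / (2 * s * u)" "u / (2 * s * u) = 1 / (2 * s)" if "u \<noteq> 0" for u
        using that p by (simp_all add: field_simps)
      then have "1 / (2 * (s + t)) = s / (2 * s * (s + t))" "(s + t) / (2 * s * (s + t)) = 1 / (2 * s)" using p by blast+
      then show ?thesis by (simp add: add_divide_distrib)
    qed
    have "((t / (s + t))\<^sup>2 * A - 2 * (t / (s + t)) * B + C) / (2 * ?q)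
      = A * ((t / (s + t))\<^sup>2 / (2 * ?q)) - 2 * B * ((t / (s + t)) / (2 * ?q)) + C * (1 / (2 * ?q))"
    proof -
      have "(a * A - 2 * b * B + C) / D = A * (a / D) - 2 * B * (b / D) + C * (1 / D)" for a b D :: real
        by (simp add: add_divide_distrib diff_divide_distrib mult_ac)
      then show ?thesis .
    qed
    also have "\<dots> = A * (t / (2 * s * (s + t))) - 2 * B * (1 / (2 * s)) + C * (1 / (2 * s) + 1 / (2 * t))"
      unfolding 1 2 3 ..
    finally have "((t / (s + t))\<^sup>2 * A - 2 * (t / (s + t)) * B + C) / (2 * ?q)
      = A * (t / (2 * s * (s + t))) - 2 * B * (1 / (2 * s)) + C * (1 / (2 * s) + 1 / (2 * t))" .
    moreover have "A / (2 * s) = A * (1 / (2 * (s + t)) + t / (2 * s * (s + t)))"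
      using arg_cong[OF 4, of "\<lambda>u. A * u"] by simp
    ultimately show ?thesis by (simp add: distrib_left)
  qed
  ultimately have n1: "(norm (w - v))\<^sup>2 = w \<bullet> w - 2 * (w \<bullet> v) + v \<bullet> v"
    and n2: "(norm ((t / (s + t)) *\<^sub>R w - v))\<^sup>2 = (t / (s + t))\<^sup>2 * (w \<bullet> w) - 2 * (t / (s + t)) * (w \<bullet> v) + v \<bullet> v"
    and id: "\<And>A B C. A / (2 * s) - 2 * B / (2 * s) + C / (2 * s) + C / (2 * t) =
     A / (2 * (s + t)) + ((t / (s + t))\<^sup>2 * A - 2 * (t / (s + t)) * B + C) / (2 * ?q)"
    by blast+
  have e: "- (norm (w - v))\<^sup>2 / (2 * s) + - (norm v)\<^sup>2 / (2 * t)
     = - (norm w)\<^sup>2 / (2 * (s + t)) + - (norm ((t / (s + t)) *\<^sub>R w - v))\<^sup>2 / (2 * ?q)"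
  proof -
    have "- (norm (w - v))\<^sup>2 / (2 * s) + - (norm v)\<^sup>2 / (2 * t)
      = - ((w \<bullet> w) / (2 * s) - 2 * (w \<bullet> v) / (2 * s) + (v \<bullet> v) / (2 * s) + (v \<bullet> v) / (2 * t))"
      unfolding n1 power2_norm_eq_inner[of v] by (simp add: add_divide_distrib diff_divide_distrib)
    also have "\<dots> = - ((norm w)\<^sup>2 / (2 * (s + t)) + (norm ((t / (s + t)) *\<^sub>R w - v))\<^sup>2 / (2 * ?q))"
      unfolding id n2 power2_norm_eq_inner[of w] ..
    finally show ?thesis by simp
  qed
  have "heat_kernel s (x - z) * heat_kernel t (z - y) = ((2 * pi * s) powr ?c * (2 * pi * t) powr ?c) *
     exp (- (norm (w - v))\<^sup>2 / (2 * s) + - (norm v)\<^sup>2 / (2 * t))"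
    unfolding heat_kernel_def xz v_def[symmetric] exp_add by (simp add: mult_ac)
  also have "\<dots> = heat_kernel (s + t) (x - y) * heat_kernel ?q ((y + (t / (s + t)) *\<^sub>R (x - y)) - z)"
    unfolding c e yz unfolding heat_kernel_def w_def[symmetric] exp_add by (simp add: mult_ac)
  finally show ?thesis .
qed

lemma heat_kernel_convolution:
  fixes x y :: "real ^ 'd"
  assumes "s > 0" "t > 0"
  shows "integrable lborel (\<lambda>z. heat_kernel s (x - z) * heat_kernel t (z - y))"
    "(\<integral>z. heat_kernel s (x - z) * heat_kernel t (z - y) \<partial>lborel) = heat_kernel (s + t) (x - y)"
  using heat_kernel_integral[of "s * t / (s + t)", where 'd='d] assms
  by (simp_all add: heat_kernel_convolution_pointwise[OF assms])

text \<open>Half of the Gaussian exponent is set free at the price of a doubled variance, and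
  \<open>2^(d/2)\<close> is the ratio of the normalizations. The released factor absorbs every
  weight put on the kernel: \<open>exp (|y|^2 / (4 t))\<close> exactly, and
  \<open>exp (a |y|)\<close> after completing a square.\<close>

lemma heat_kernel_halve:
  assumes "t > 0"
  shows "heat_kernel t (y :: real ^ 'd) = 2 powr (real CARD('d) / 2) * heat_kernel (2 * t) y * exp (- (norm y)\<^sup>2 / (4 * t))"
proof -
  have "(2 * pi * t) powr (- real CARD('d) / 2) = (1 / 2 * (2 * pi * (2 * t))) powr (- real CARD('d) / 2)"
    by (simp add: mult_ac)
  also have "\<dots> = (1 / 2) powr (- real CARD('d) / 2) * (2 * pi * (2 * t)) powr (- real CARD('d) / 2)"
    using assms by (subst powr_mult) auto
  also have "(1 / 2 :: real) powr (- real CARD('d) / 2) = 2 powr (real CARD('d) / 2)"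
    by (simp add: powr_divide powr_minus_divide)
  finally show ?thesis
    by (simp add: heat_kernel_def exp_add[symmetric] mult.assoc)
qed

lemma heat_kernel_exp_square:
  assumes "t > 0"
  shows "integrable lborel (\<lambda>y :: real ^ 'd. heat_kernel t y * exp ((norm y)\<^sup>2 / (4 * t)))"
    "(\<integral>y. heat_kernel t (y :: real ^ 'd) * exp ((norm y)\<^sup>2 / (4 * t)) \<partial>lborel) = 2 powr (real CARD('d) / 2)"
proof -
  have eq: "heat_kernel t y * exp ((norm y)\<^sup>2 / (4 * t)) = 2 powr (real CARD('d) / 2) * heat_kernel (2 * t) y" for y :: "real ^ 'd"
    by (subst heat_kernel_halve[OF assms]) (simp add: mult.assoc flip: exp_add)
  show "integrable lborel (\<lambda>y :: real ^ 'd. heat_kernel t y * exp ((norm y)\<^sup>2 / (4 * t)))"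
    "(\<integral>y. heat_kernel t (y :: real ^ 'd) * exp ((norm y)\<^sup>2 / (4 * t)) \<partial>lborel) = 2 powr (real CARD('d) / 2)"
    unfolding eq using heat_kernel_integral0[of "2 * t", where 'd='d] assms by auto
qed

lemma heat_kernel_exp_le:
  assumes "t > 0"
  shows "heat_kernel t (y :: real ^ 'd) * exp (a * norm y) \<le> 2 powr (real CARD('d) / 2) * exp (a\<^sup>2 * t) * heat_kernel (2 * t) y"
proof -
  have "0 \<le> (norm y - 2 * a * t)\<^sup>2 / (4 * t)" using assms by simp
  also have "\<dots> = (norm y)\<^sup>2 / (4 * t) - a * norm y + a\<^sup>2 * t"
    using assms by (simp add: power2_eq_square field_simps)
  finally have "exp (- (norm y)\<^sup>2 / (4 * t) + a * norm y) \<le> exp (a\<^sup>2 * t)" by simp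
  then have "(2 powr (real CARD('d) / 2) * heat_kernel (2 * t) y) * exp (- (norm y)\<^sup>2 / (4 * t) + a * norm y)
     \<le> (2 powr (real CARD('d) / 2) * heat_kernel (2 * t) y) * exp (a\<^sup>2 * t)"
    by (intro mult_left_mono) auto
  then show ?thesis
    by (subst heat_kernel_halve[OF assms]) (simp only: exp_add mult_ac)
qed

lemma heat_kernel_weight:
  fixes x :: "real ^ 'd"
  assumes "t > 0" "a \<ge> 0"
  shows "integrable lborel (\<lambda>z. heat_kernel t (x - z) * exp (a * norm z))"
    "(\<integral>z. heat_kernel t (x - z) * exp (a * norm z) \<partial>lborel) \<le> 2 powr (real CARD('d) / 2) * exp (a\<^sup>2 * t) * exp (a * norm x)"
proof -
  let ?C = "2 powr (real CARD('d) / 2) * exp (a\<^sup>2 * t) * exp (a * norm x)"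
  have le: "heat_kernel t (x - z) * exp (a * norm z) \<le> ?C * heat_kernel (2 * t) (x - z)" for z
  proof -
    have "norm z \<le> norm x + norm (x - z)" by (metis norm_triangle_sub norm_minus_commute)
    then have "exp (a * norm z) \<le> exp (a * norm (x - z)) * exp (a * norm x)"
      using assms by (simp add: exp_add[symmetric] distrib_left[symmetric] mult_left_mono)
    then have "heat_kernel t (x - z) * exp (a * norm z) \<le> (heat_kernel t (x - z) * exp (a * norm (x - z))) * exp (a * norm x)"
      by (simp add: mult.assoc mult_left_mono)
    also have "\<dots> \<le> (2 powr (real CARD('d) / 2) * exp (a\<^sup>2 * t) * heat_kernel (2 * t) (x - z)) * exp (a * norm x)"
      by (intro mult_right_mono heat_kernel_exp_le assms) auto
    finally show ?thesis by (simp add: mult_ac)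
  qed
  have int: "integrable lborel (\<lambda>z. ?C * heat_kernel (2 * t) (x - z))"
    using assms by (intro integrable_mult_right heat_kernel_integral) auto
  show *: "integrable lborel (\<lambda>z. heat_kernel t (x - z) * exp (a * norm z))"
    by (rule Bochner_Integration.integrable_bound[OF int]) (use le in \<open>auto simp: abs_mult\<close>)
  show "(\<integral>z. heat_kernel t (x - z) * exp (a * norm z) \<partial>lborel) \<le> ?C"
    using integral_mono[OF * int le] heat_kernel_integral(2)[of "2 * t" x] assms by simp
qed

text \<open>\<open>t powr (\<alpha> / 2)\<close> is the size of the modulus at the diffusive scale.
  In units of \<open>sqrt t\<close>, the inequality \<open>r powr \<alpha> \<le> exp r\<close> makes
  the modulus one more exponential weight, of rate \<open>1 / sqrt t\<close>; this is the summand
  \<open>1\<close> in the exponent of the constant.\<close>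

lemma heat_kernel_weight_modulus:
  fixes x :: "real ^ 'd"
  assumes "t > 0" "a \<ge> 0" "0 < \<alpha>" "\<alpha> \<le> 1"
  shows "integrable lborel (\<lambda>z. heat_kernel t (x - z) * (norm (x - z) powr \<alpha> * exp (a * norm z)))"
    "(\<integral>z. heat_kernel t (x - z) * (norm (x - z) powr \<alpha> * exp (a * norm z)) \<partial>lborel)
      \<le> t powr (\<alpha> / 2) * (2 powr (real CARD('d) / 2) * exp ((a * sqrt t + 1)\<^sup>2)) * exp (a * norm x)"
proof -
  let ?C = "t powr (\<alpha> / 2) * (2 powr (real CARD('d) / 2) * exp ((a * sqrt t + 1)\<^sup>2)) * exp (a * norm x)"
  have le: "heat_kernel t (x - z) * (norm (x - z) powr \<alpha> * exp (a * norm z)) \<le> ?C * heat_kernel (2 * t) (x - z)" for z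
  proof -
    let ?y = "x - z"
    define r where "r = norm ?y / sqrt t"
    have r: "norm ?y = sqrt t * r" "r \<ge> 0" using assms by (auto simp: r_def)
    have "r powr \<alpha> \<le> exp r"
    proof (cases "r \<le> 1")
      case True
      then have "r powr \<alpha> \<le> 1" using r assms by (simp add: powr_le1)
      then show ?thesis using r by (smt (verit) one_le_exp_iff)
    next
      case False
      then have "r powr \<alpha> \<le> r powr 1" using assms by (intro powr_mono) auto
      also have "\<dots> = r" using r by simp
      also have "\<dots> \<le> exp r" using exp_ge_add_one_self[of r] by linarith
      finally show ?thesis .
    qed
    then have "norm ?y powr \<alpha> \<le> t powr (\<alpha> / 2) * exp (norm ?y / sqrt t)"
    proof -
      have "sqrt t powr \<alpha> = t powr (\<alpha> / 2)" using assms by (simp add: powr_half_sqrt[symmetric] powr_powr)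
      then have "norm ?y powr \<alpha> = t powr (\<alpha> / 2) * r powr \<alpha>"
        using assms r by (simp add: powr_mult)
      also have "\<dots> \<le> t powr (\<alpha> / 2) * exp r" using \<open>r powr \<alpha> \<le> exp r\<close> by (intro mult_left_mono) auto
      finally show ?thesis by (simp add: r_def)
    qed
    moreover have "exp (a * norm z) \<le> exp (a * norm ?y) * exp (a * norm x)"
    proof -
      have "norm z \<le> norm x + norm (x - z)" by (metis norm_triangle_sub norm_minus_commute)
      then show ?thesis using assms by (simp add: exp_add[symmetric] distrib_left[symmetric] mult_left_mono)
    qed
    ultimately have "norm ?y powr \<alpha> * exp (a * norm z) \<le> (t powr (\<alpha> / 2) * exp (norm ?y / sqrt t)) * (exp (a * norm ?y) * exp (a * norm x))"
      by (intro mult_mono) auto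
    also have "\<dots> = (t powr (\<alpha> / 2) * exp (a * norm x)) * exp ((a + 1 / sqrt t) * norm ?y)"
      by (simp add: algebra_simps flip: exp_add)
    finally have "heat_kernel t ?y * (norm ?y powr \<alpha> * exp (a * norm z))
      \<le> heat_kernel t ?y * ((t powr (\<alpha> / 2) * exp (a * norm x)) * exp ((a + 1 / sqrt t) * norm ?y))"
      by (intro mult_left_mono) auto
    also have "\<dots> = (t powr (\<alpha> / 2) * exp (a * norm x)) * (heat_kernel t ?y * exp ((a + 1 / sqrt t) * norm ?y))"
      by (simp add: mult_ac)
    also have "\<dots> \<le> (t powr (\<alpha> / 2) * exp (a * norm x)) * (2 powr (real CARD('d) / 2) * exp ((a + 1 / sqrt t)\<^sup>2 * t) * heat_kernel (2 * t) ?y)"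
      by (intro mult_left_mono heat_kernel_exp_le assms) auto
    also have "(a + 1 / sqrt t)\<^sup>2 * t = ((a + 1 / sqrt t) * sqrt t)\<^sup>2" using assms by (simp add: power_mult_distrib)
    also have "(a + 1 / sqrt t) * sqrt t = a * sqrt t + 1" using assms by (simp add: field_simps)
    finally show ?thesis by (simp add: mult_ac)
  qed
  have int: "integrable lborel (\<lambda>z. ?C * heat_kernel (2 * t) (x - z))"
    using assms by (intro integrable_mult_right heat_kernel_integral) auto
  show *: "integrable lborel (\<lambda>z. heat_kernel t (x - z) * (norm (x - z) powr \<alpha> * exp (a * norm z)))"
    by (rule Bochner_Integration.integrable_bound[OF int]) (use le in \<open>auto simp: abs_mult\<close>)
  show "(\<integral>z. heat_kernel t (x - z) * (norm (x - z) powr \<alpha> * exp (a * norm z)) \<partial>lborel) \<le> ?C"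
    using integral_mono[OF * int le] heat_kernel_integral(2)[of "2 * t" x] assms by simp
qed

section \<open>Signed measures determined by rectangle indicators\<close>

definition side_ind :: "real \<Rightarrow> real \<Rightarrow> real" where
  "side_ind a y = (if 0 \<le> a then indicator {0..a} y else - indicator {a..0} y)"

lemma rect_ind_prod: "rect_ind z y = (\<Prod>i\<in>UNIV. side_ind (z $ i) (y $ i))"
  by (simp add: rect_ind_def side_ind_def)

lemma side_ind_bound: "\<bar>side_ind a y\<bar> \<le> 1"
  by (auto simp: side_ind_def indicator_def)

lemma side_ind_measurable [measurable (raw)]:
  assumes [measurable]: "f \<in> borel_measurable M" "g \<in> borel_measurable M"
  shows "(\<lambda>w. side_ind (f w) (g w)) \<in> borel_measurable M"
proof -
  have "(\<lambda>w. side_ind (f w) (g w)) = (\<lambda>w. if 0 \<le> f w then (if 0 \<le> g w \<and> g w \<le> f w then 1 else 0)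
      else - (if f w \<le> g w \<and> g w \<le> 0 then 1 else 0))"
    by (auto simp: fun_eq_iff side_ind_def)
  then show ?thesis by simp
qed

lemma rect_ind_bound: "\<bar>rect_ind z y\<bar> \<le> 1"
  unfolding rect_ind_prod abs_prod by (rule prod_le_1) (simp add: side_ind_bound)

lemma rect_ind_measurable [measurable (raw)]:
  assumes [measurable]: "f \<in> borel_measurable M" "g \<in> borel_measurable M"
  shows "(\<lambda>w. rect_ind (f w) (g w)) \<in> borel_measurable M"
proof -
  have [measurable]: "(\<lambda>w. f w $ i) \<in> borel_measurable M" "(\<lambda>w. g w $ i) \<in> borel_measurable M" for i
    by (rule measurable_compose[OF _ borel_measurable_nth]; fact)+
  show ?thesis unfolding rect_ind_prod by measurable
qed

text \<open>The indicator of \<open>{..c}\<close> is a bounded limit of combinations of the functions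
  \<open>a \<mapsto> side_ind a y\<close>; the constant \<open>1\<close> is obtained from \<open>y = 0\<close> and \<open>y \<up> 0\<close>.\<close>

definition side_approx :: "real \<Rightarrow> nat \<Rightarrow> real \<Rightarrow> real" where
  "side_approx c k a = (if c < 0 then - side_ind a c else
     side_ind a 0 - 2 * side_ind a (- 1 / real (Suc k)) - side_ind a (c + 1 / real (Suc k)))"

lemma side_approx_limit: "(\<lambda>k. side_approx c k a) \<longlonglongrightarrow> indicator {..c} a"
proof (cases "c < 0")
  case True
  then show ?thesis by (auto simp: side_approx_def side_ind_def indicator_def)
next
  case False
  have l: "(\<lambda>k. 1 / real (Suc k)) \<longlonglongrightarrow> 0" using LIMSEQ_inverse_real_of_nat by (simp add: inverse_eq_divide)
  have ev: "\<forall>\<^sub>F k in sequentially. e > 0 \<longrightarrow> 1 / real (Suc k) < e" for e :: real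
    using order_tendstoD(2)[OF l, of e] by (cases "e > 0") auto
  show ?thesis
  proof (rule tendsto_eventually)
    show "\<forall>\<^sub>F k in sequentially. side_approx c k a = indicator {..c} a"
      using ev[of "- a"] ev[of "a - c"]
    proof eventually_elim
      case (elim k)
      define e where "e = 1 / real (Suc k)"
      have p: "e > 0" by (simp add: e_def)
      have approx: "side_approx c k a = side_ind a 0 - 2 * side_ind a (- e) - side_ind a (c + e)"
        using False by (simp add: side_approx_def e_def)
      note elim = elim[folded e_def]
      \<comment> \<open>For \<open>a < 0\<close> the first two terms give \<open>-1 + 2\<close> once
        \<open>e < - a\<close>, for \<open>a \<ge> 0\<close> they give \<open>1 - 0\<close>. The
        third removes the mass beyond \<open>c\<close>, and it sees no \<open>a < 0\<close> because
        \<open>c + e > 0\<close>.\<close>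
      show ?case
      proof (cases "a < 0")
        case True
        then have "e < - a" using elim by simp
        then show ?thesis using True False p unfolding approx side_ind_def indicator_def by auto
      next
        case a: False
        then show ?thesis using False p elim unfolding approx side_ind_def indicator_def by auto
      qed
    qed
  qed
qed

lemma side_approx_bound: "\<bar>side_approx c k a\<bar> \<le> 4"
  using side_ind_bound[of a c] side_ind_bound[of a 0] side_ind_bound[of a "- 1 / real (Suc k)"]
    side_ind_bound[of a "c + 1 / real (Suc k)"]
  unfolding side_approx_def by (auto split: if_splits)

text \<open>The coordinates are converted one by one: in \<open>R S c y\<close> those in
  \<open>S\<close> already carry half-lines, the others still the sides of a rectangle. After the
  last coordinate both measures agree on the orthants \<open>{..c}\<close>, which generate the Borel
  sets and are stable under intersection.\<close>

lemma rect_transform_unique: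
  fixes \<mu> \<nu> :: "(real ^ 'd) measure"
  assumes fin: "finite_measure \<mu>" "finite_measure \<nu>"
    and sets [measurable_cong]: "sets \<mu> = sets borel" "sets \<nu> = sets borel"
    and eq: "\<And>y. (\<integral>z. rect_ind z y \<partial>\<mu>) = (\<integral>z. rect_ind z y \<partial>\<nu>)"
  shows "\<mu> = \<nu>"
proof -
  interpret \<mu>: finite_measure \<mu> by fact
  interpret \<nu>: finite_measure \<nu> by fact
  have [measurable]: "side_approx c k \<in> borel_measurable borel" for c k
    unfolding side_approx_def[abs_def] by measurable
  define R where "R S c y z = (\<Prod>i\<in>S. indicator {..c $ i} (z $ i)) * (\<Prod>i\<in>-S. side_ind (z $ i) (y $ i))"
    for S and c y z :: "real ^ 'd"
  have Rm [measurable]: "R S c y \<in> borel_measurable borel" for S c y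
    unfolding R_def[abs_def] by measurable
  have ind1: "\<bar>(\<Prod>i\<in>S. indicator {..c $ i} (z $ i) :: real)\<bar> \<le> 1" for S and c z :: "real ^ 'd"
    unfolding abs_prod by (rule prod_le_1) (simp add: indicator_def)
  have side1: "\<bar>(\<Prod>i\<in>S. side_ind (z $ i) (y $ i))\<bar> \<le> 1" for S and y z :: "real ^ 'd"
    unfolding abs_prod by (rule prod_le_1) (simp add: side_ind_bound)
  have Rb: "\<bar>R S c y z\<bar> \<le> 1" for S c y z
    unfolding R_def abs_mult using mult_mono[OF ind1 side1] by simp
  have intR: "integrable \<mu> (R S c y)" "integrable \<nu> (R S c y)" for S c y
    by (rule \<mu>.integrable_const_bound[where B=1] \<nu>.integrable_const_bound[where B=1]; simp add: Rb)+
  have main: "(\<integral>z. R S c y z \<partial>\<mu>) = (\<integral>z. R S c y z \<partial>\<nu>)" for S c y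
  proof (induction S arbitrary: y rule: finite_induct[OF finite, case_names empty insert])
    case empty
    show ?case using eq[of y] by (simp add: R_def rect_ind_prod)
  next
    case (insert i S)
    define r where "r k z = (\<Prod>i\<in>S. indicator {..c $ i} (z $ i)) * (side_approx (c $ i) k (z $ i) *
        (\<Prod>j\<in>-insert i S. side_ind (z $ j) (y $ j)))" for k and z :: "real ^ 'd"
    have up: "R S c (\<chi> j. if j = i then a else y $ j) z = (\<Prod>i\<in>S. indicator {..c $ i} (z $ i)) *
        (side_ind (z $ i) a * (\<Prod>j\<in>-insert i S. side_ind (z $ j) (y $ j)))" for a z
    proof -
      have "-S = insert i (-insert i S)" using insert by auto
      then have "(\<Prod>j\<in>-S. side_ind (z $ j) ((\<chi> j. if j = i then a else y $ j) $ j))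
         = side_ind (z $ i) a * (\<Prod>j\<in>-insert i S. side_ind (z $ j) ((\<chi> j. if j = i then a else y $ j) $ j))"
        by (subst \<open>-S = _\<close>, subst prod.insert) auto
      also have "(\<Prod>j\<in>-insert i S. side_ind (z $ j) ((\<chi> j. if j = i then a else y $ j) $ j)) = (\<Prod>j\<in>-insert i S. side_ind (z $ j) (y $ j))"
        by (intro prod.cong) auto
      finally show ?thesis by (simp add: R_def)
    qed
    \<comment> \<open>Changing the \<open>i\<close>-th coordinate of \<open>y\<close> stays within
      the family for \<open>S\<close>. The approximant \<open>r k\<close> is thus a combination of
      functions for which the induction hypothesis, stated for all \<open>y\<close>, already gives
      equal integrals.\<close>
    let ?y = "\<lambda>a. \<chi> j. if j = i then a else y $ j"
    have r: "r k z = (if c $ i < 0 then - R S c (?y (c $ i)) z else R S c (?y 0) z - 2 * R S c (?y (- 1 / real (Suc k))) z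
        - R S c (?y (c $ i + 1 / real (Suc k))) z)" for k z
      unfolding up r_def side_approx_def by (auto simp: algebra_simps)
    have rint: "(\<integral>z. r k z \<partial>\<mu>) = (\<integral>z. r k z \<partial>\<nu>)" for k
      unfolding r by (cases "c $ i < 0") (simp_all add: intR insert.IH)
    have rm: "r k \<in> borel_measurable borel" for k unfolding r_def[abs_def] by measurable
    have rb: "\<bar>r k z\<bar> \<le> 4" for k z
    proof -
      have "\<bar>r k z\<bar> \<le> 1 * (4 * 1)"
        unfolding r_def abs_mult by (intro mult_mono ind1 side1 side_approx_bound) auto
      then show ?thesis by simp
    qed
    have rl: "(\<lambda>k. r k z) \<longlonglongrightarrow> R (insert i S) c y z" for z
    proof -
      have "(\<lambda>k. r k z) \<longlonglongrightarrow> (\<Prod>i\<in>S. indicator {..c $ i} (z $ i)) * (indicator {..c $ i} (z $ i) *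
        (\<Prod>j\<in>-insert i S. side_ind (z $ j) (y $ j)))"
        unfolding r_def by (intro tendsto_intros side_approx_limit)
      then show ?thesis using insert by (simp add: R_def mult_ac)
    qed
    have "(\<lambda>k. \<integral>z. r k z \<partial>\<mu>) \<longlonglongrightarrow> (\<integral>z. R (insert i S) c y z \<partial>\<mu>)"
      by (rule integral_dominated_convergence[where w="\<lambda>_. 4"]) (use rm rb rl in \<open>auto simp: sets cong: measurable_cong_sets\<close>)
    moreover have "(\<lambda>k. \<integral>z. r k z \<partial>\<nu>) \<longlonglongrightarrow> (\<integral>z. R (insert i S) c y z \<partial>\<nu>)"
      by (rule integral_dominated_convergence[where w="\<lambda>_. 4"]) (use rm rb rl in \<open>auto simp: sets cong: measurable_cong_sets\<close>)
    ultimately show ?case using rint LIMSEQ_unique by simp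
  qed
  have R: "R UNIV c 0 z = indicator {..c} z" for c z
    by (auto simp: R_def indicator_def less_eq_vec_def prod_zero_iff)
  have emu: "emeasure \<mu> {..c} = emeasure \<nu> {..c}" for c
    using main[of UNIV c 0] by (simp add: R \<mu>.emeasure_eq_measure \<nu>.emeasure_eq_measure sets)
  let ?E = "range (\<lambda>a::real ^ 'd. {..a})"
  show ?thesis
  proof (rule measure_eqI_generator_eq[where E="?E" and \<Omega>=UNIV and A="\<lambda>k. {..(\<chi> i. real k)}"])
    show "Int_stable ?E"
    proof (clarsimp simp: Int_stable_def)
      fix a b :: "real ^ 'd"
      have "{..a} \<inter> {..b} = {..inf a b}" by auto
      then show "{..a} \<inter> {..b} \<in> range atMost" by auto
    qed
    show "sets \<mu> = sigma_sets UNIV ?E" "sets \<nu> = sigma_sets UNIV ?E"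
      unfolding sets by (subst borel_eq_atMost; simp)+
    show "(\<Union>k. {..(\<chi> i. real k) :: real ^ 'd}) = UNIV"
    proof (safe, simp_all add: less_eq_vec_def)
      fix z :: "real ^ 'd"
      obtain k :: nat where "norm z \<le> real k" using real_arch_simple by blast
      then have "z $ i \<le> real k" for i using component_le_norm_cart[of z i] by linarith
      then show "\<exists>k. \<forall>i. z $ i \<le> real k" by blast
    qed
  qed (use emu in auto)
qed

text \<open>An equality between differences of measures becomes one between measures once the
  subtracted parts are moved to the other side.\<close>

definition add_measure :: "'a measure \<Rightarrow> 'a measure \<Rightarrow> 'a measure" where
  "add_measure \<mu> \<nu> = measure_of (space \<mu>) (sets \<mu>) (\<lambda>A. emeasure \<mu> A + emeasure \<nu> A)"

lemma sets_add_measure [simp, measurable_cong]: "sets (add_measure \<mu> \<nu>) = sets \<mu>"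
  and space_add_measure [simp]: "space (add_measure \<mu> \<nu>) = space \<mu>"
  by (simp_all add: add_measure_def)

lemma emeasure_add_measure:
  assumes "sets \<nu> = sets \<mu>" "A \<in> sets \<mu>"
  shows "emeasure (add_measure \<mu> \<nu>) A = emeasure \<mu> A + emeasure \<nu> A"
proof (rule emeasure_measure_of[OF add_measure_def])
  show "positive (sets (add_measure \<mu> \<nu>)) (\<lambda>A. emeasure \<mu> A + emeasure \<nu> A)"
    by (simp add: positive_def)
  show "countably_additive (sets (add_measure \<mu> \<nu>)) (\<lambda>A. emeasure \<mu> A + emeasure \<nu> A)"
  proof (rule countably_additiveI)
    fix A :: "nat \<Rightarrow> 'a set"
    assume "range A \<subseteq> sets (add_measure \<mu> \<nu>)" "disjoint_family A"
    then show "(\<Sum>i. emeasure \<mu> (A i) + emeasure \<nu> (A i)) = emeasure \<mu> (\<Union> (range A)) + emeasure \<nu> (\<Union> (range A))"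
      using assms by (subst suminf_add[symmetric]) (auto simp: suminf_emeasure)
  qed
qed (use assms sets.space_closed in auto)

lemma nn_integral_add_measure:
  assumes s: "sets \<nu> = sets \<mu>" and "f \<in> borel_measurable \<mu>"
  shows "(\<integral>\<^sup>+z. f z \<partial>add_measure \<mu> \<nu>) = (\<integral>\<^sup>+z. f z \<partial>\<mu>) + (\<integral>\<^sup>+z. f z \<partial>\<nu>)"
  using assms(2)
proof (induction rule: borel_measurable_induct)
  case (cong f g)
  then show ?case using sets_eq_imp_space_eq[OF s] by (simp cong: nn_integral_cong_simp)
next
  case (set A)
  then show ?case using s by (simp add: emeasure_add_measure)
next
  case (mult u c)
  then have "u \<in> borel_measurable \<nu>" "u \<in> borel_measurable (add_measure \<mu> \<nu>)"
    using s by (simp_all cong: measurable_cong_sets)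
  with mult show ?case by (simp add: nn_integral_cmult distrib_left)
next
  case (add u v)
  then have "u \<in> borel_measurable \<nu>" "u \<in> borel_measurable (add_measure \<mu> \<nu>)"
    "v \<in> borel_measurable \<nu>" "v \<in> borel_measurable (add_measure \<mu> \<nu>)"
    using s by (simp_all cong: measurable_cong_sets)
  with add show ?case by (simp add: nn_integral_add add_ac)
next
  case (seq U)
  have m: "U i \<in> borel_measurable \<nu>" "U i \<in> borel_measurable (add_measure \<mu> \<nu>)" for i
    using s seq(1)[of i] by (simp_all cong: measurable_cong_sets)
  have sup: "(\<lambda>z. (SUP i. U i) z) = (\<lambda>z. SUP i. U i z)" by (simp add: fun_eq_iff image_comp)
  have inc: "incseq (\<lambda>i. \<integral>\<^sup>+z. U i z \<partial>N)" for N
    using seq(3) by (auto simp: incseq_def le_fun_def intro!: nn_integral_mono)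
  have "(\<integral>\<^sup>+z. (SUP i. U i z) \<partial>add_measure \<mu> \<nu>) = (SUP i. (\<integral>\<^sup>+z. U i z \<partial>\<mu>) + (\<integral>\<^sup>+z. U i z \<partial>\<nu>))"
    using seq m by (subst nn_integral_monotone_convergence_SUP) auto
  also have "\<dots> = (SUP i. \<integral>\<^sup>+z. U i z \<partial>\<mu>) + (SUP i. \<integral>\<^sup>+z. U i z \<partial>\<nu>)"
    by (intro ennreal_SUP_add inc)
  also have "\<dots> = (\<integral>\<^sup>+z. (SUP i. U i z) \<partial>\<mu>) + (\<integral>\<^sup>+z. (SUP i. U i z) \<partial>\<nu>)"
    using seq m by (subst (1 2) nn_integral_monotone_convergence_SUP) auto
  finally show ?case by (simp add: image_comp)
qed

lemma integral_add_measure: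
  fixes f :: "'a \<Rightarrow> real"
  assumes s: "sets \<nu> = sets \<mu>" and i: "integrable \<mu> f" "integrable \<nu> f"
  shows "integrable (add_measure \<mu> \<nu>) f" "(\<integral>z. f z \<partial>add_measure \<mu> \<nu>) = (\<integral>z. f z \<partial>\<mu>) + (\<integral>z. f z \<partial>\<nu>)"
proof -
  have pos: "integrable (add_measure \<mu> \<nu>) g \<and> (\<integral>z. g z \<partial>add_measure \<mu> \<nu>) = (\<integral>z. g z \<partial>\<mu>) + (\<integral>z. g z \<partial>\<nu>)"
    if g: "integrable \<mu> g" "integrable \<nu> g" "\<And>z. 0 \<le> g z" for g :: "'a \<Rightarrow> real"
  proof -
    have [measurable]: "g \<in> borel_measurable \<mu>" using g by simp
    have gm: "g \<in> borel_measurable (add_measure \<mu> \<nu>)" by measurable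
    have "(\<integral>\<^sup>+z. ennreal (g z) \<partial>add_measure \<mu> \<nu>) = ennreal ((\<integral>z. g z \<partial>\<mu>) + (\<integral>z. g z \<partial>\<nu>))"
      using g by (subst nn_integral_add_measure[OF s]) (auto simp: nn_integral_eq_integral ennreal_plus integral_nonneg)
    then have "has_bochner_integral (add_measure \<mu> \<nu>) g ((\<integral>z. g z \<partial>\<mu>) + (\<integral>z. g z \<partial>\<nu>))"
      using g gm by (intro has_bochner_integral_nn_integral) (auto intro!: add_nonneg_nonneg integral_nonneg)
    then show ?thesis by (simp add: has_bochner_integral_iff)
  qed
  have p: "integrable N (\<lambda>z. max 0 (f z))" "integrable N (\<lambda>z. max 0 (- f z))" if "integrable N f" for N
    using that by auto
  have eq: "f = (\<lambda>z. max 0 (f z) - max 0 (- f z))" by (auto simp: fun_eq_iff max_def)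
  have 1: "integrable (add_measure \<mu> \<nu>) (\<lambda>z. max 0 (f z))" "integrable (add_measure \<mu> \<nu>) (\<lambda>z. max 0 (- f z))"
    using pos[OF p(1)[OF i(1)] p(1)[OF i(2)]] pos[OF p(2)[OF i(1)] p(2)[OF i(2)]] by auto
  have "integrable (add_measure \<mu> \<nu>) (\<lambda>z. max 0 (f z) - max 0 (- f z))"
    by (intro Bochner_Integration.integrable_diff 1)
  then show fi: "integrable (add_measure \<mu> \<nu>) f" unfolding eq[symmetric] .
  have d: "(\<integral>z. f z \<partial>N) = (\<integral>z. max 0 (f z) \<partial>N) - (\<integral>z. max 0 (- f z) \<partial>N)" if "integrable N f" for N
  proof -
    have "(\<integral>z. max 0 (f z) \<partial>N) - (\<integral>z. max 0 (- f z) \<partial>N) = (\<integral>z. max 0 (f z) - max 0 (- f z) \<partial>N)"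
      by (intro Bochner_Integration.integral_diff[symmetric] p that)
    then show ?thesis by (simp only: eq[symmetric])
  qed
  show "(\<integral>z. f z \<partial>add_measure \<mu> \<nu>) = (\<integral>z. f z \<partial>\<mu>) + (\<integral>z. f z \<partial>\<nu>)"
    unfolding d[OF fi] d[OF i(1)] d[OF i(2)]
    using pos[OF p(1)[OF i(1)] p(1)[OF i(2)]] pos[OF p(2)[OF i(1)] p(2)[OF i(2)]] by simp
qed

text \<open>\<^const>\<open>fun_inner\<close> sees a function of \<open>y\<close> only through some signed measure representing it; this
  identifies that measure with the heat kernel density of the Duhamel field.\<close>

lemma rect_transform_signed_unique:
  fixes \<mu>1 \<mu>2 :: "(real ^ 'd) measure" and \<beta> f :: "real ^ 'd \<Rightarrow> real"
  assumes fin: "finite_measure \<mu>1" "finite_measure \<mu>2"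
    and sets: "sets \<mu>1 = sets borel" "sets \<mu>2 = sets borel"
    and \<beta>: "integrable lborel \<beta>"
    and eq: "\<And>y. (\<integral>z. rect_ind z y \<partial>\<mu>1) - (\<integral>z. rect_ind z y \<partial>\<mu>2) = (\<integral>z. \<beta> z * rect_ind z y \<partial>lborel)"
    and f: "integrable \<mu>1 f" "integrable \<mu>2 f" "integrable lborel (\<lambda>z. \<beta> z * f z)"
  shows "(\<integral>z. f z \<partial>\<mu>1) - (\<integral>z. f z \<partial>\<mu>2) = (\<integral>z. \<beta> z * f z \<partial>lborel)"
proof -
  note [measurable_cong] = sets
  have [measurable]: "\<beta> \<in> borel_measurable borel" using \<beta> by simp
  have [measurable]: "f \<in> borel_measurable borel" using f(1) sets by (simp cong: measurable_cong_sets)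
  \<comment> \<open>\<open>N 1\<close> and \<open>N (-1)\<close> are the positive and the negative
    part of the signed measure with density \<open>\<beta>\<close>.\<close>
  define N where "N c = density lborel (\<lambda>z. ennreal (max 0 (c * \<beta> z)))" for c
  have N_sets [simp, measurable_cong]: "sets (N c) = sets borel" for c by (simp add: N_def)
  have N_fin: "finite_measure (N c)" for c
  proof
    have "emeasure (N c) (space (N c)) = (\<integral>\<^sup>+z. ennreal (max 0 (c * \<beta> z)) \<partial>lborel)"
      by (simp add: N_def emeasure_density cong: nn_integral_cong)
    also have "\<dots> = ennreal (\<integral>z. max 0 (c * \<beta> z) \<partial>lborel)"
      using \<beta> by (intro nn_integral_eq_integral) auto
    finally show "emeasure (N c) (space (N c)) \<noteq> \<infinity>" by simp
  qed
  have N_int: "(\<integral>z. g z \<partial>N c) = (\<integral>z. max 0 (c * \<beta> z) * g z \<partial>lborel)"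
    "integrable (N c) g = integrable lborel (\<lambda>z. max 0 (c * \<beta> z) * g z)"
    if [measurable]: "g \<in> borel_measurable borel" for g c
    unfolding N_def by (subst integral_density integrable_density; simp)+
  have N_integrable: "integrable (N c) g"
    if [measurable]: "g \<in> borel_measurable borel" and g: "integrable lborel (\<lambda>z. \<beta> z * g z)" for g c
    unfolding N_int(2)[OF that(1)]
  proof (rule Bochner_Integration.integrable_bound)
    show "integrable lborel (\<lambda>z. c * (\<beta> z * g z))" using g by simp
    show "AE z in lborel. norm (max 0 (c * \<beta> z) * g z) \<le> norm (c * (\<beta> z * g z))"
    proof (rule AE_I2)
      fix z
      have "\<bar>max 0 (c * \<beta> z)\<bar> * \<bar>g z\<bar> \<le> \<bar>c * \<beta> z\<bar> * \<bar>g z\<bar>" by (intro mult_right_mono) auto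
      then show "norm (max 0 (c * \<beta> z) * g z) \<le> norm (c * (\<beta> z * g z))"
        by (simp add: abs_mult mult.assoc)
    qed
  qed measurable
  have N_diff: "(\<integral>z. g z \<partial>N 1) - (\<integral>z. g z \<partial>N (-1)) = (\<integral>z. \<beta> z * g z \<partial>lborel)"
    if [measurable]: "g \<in> borel_measurable borel" and g: "integrable lborel (\<lambda>z. \<beta> z * g z)" for g
  proof -
    have "(\<integral>z. g z \<partial>N 1) - (\<integral>z. g z \<partial>N (-1)) = (\<integral>z. max 0 (1 * \<beta> z) * g z - max 0 (-1 * \<beta> z) * g z \<partial>lborel)"
      unfolding N_int(1)[OF that(1)]
      using N_integrable[OF that, of 1] N_integrable[OF that, of "-1"]
      by (subst Bochner_Integration.integral_diff) (simp_all add: N_int(2))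
    also have "\<dots> = (\<integral>z. \<beta> z * g z \<partial>lborel)"
      by (intro Bochner_Integration.integral_cong) (auto simp: max_def)
    finally show ?thesis .
  qed
  have rm [measurable]: "(\<lambda>z. rect_ind z y) \<in> borel_measurable borel" for y :: "real ^ 'd" by measurable
  have r_fin: "integrable \<mu> (\<lambda>z. rect_ind z y)" if "finite_measure \<mu>" "sets \<mu> = sets borel" for \<mu> and y :: "real ^ 'd"
    using that rm by (intro finite_measure.integrable_const_bound[where B=1])
      (auto simp: rect_ind_bound cong: measurable_cong_sets)
  have r_\<beta>: "integrable lborel (\<lambda>z. \<beta> z * rect_ind z y)" for y
    by (rule Bochner_Integration.integrable_bound[OF \<beta>])
       (auto simp: abs_mult intro!: mult_left_le AE_I2 rect_ind_bound)
  \<comment> \<open>This is \<open>\<mu>1 - \<mu>2 = N 1 - N (-1)\<close> with the negative parts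
    exchanged between the sides.\<close>
  have "add_measure \<mu>1 (N (-1)) = add_measure \<mu>2 (N 1)"
  proof (rule rect_transform_unique)
    show "finite_measure (add_measure \<mu>1 (N (-1)))" "finite_measure (add_measure \<mu>2 (N 1))"
      using fin N_fin sets
      by (auto intro!: finite_measureI simp: emeasure_add_measure finite_measure.emeasure_finite sets_eq_imp_space_eq[OF sets(1)] sets_eq_imp_space_eq[OF sets(2)])
    show "(\<integral>z. rect_ind z y \<partial>add_measure \<mu>1 (N (-1))) = (\<integral>z. rect_ind z y \<partial>add_measure \<mu>2 (N 1))" for y
      using eq[of y] N_diff[OF rm r_\<beta>, of y] r_fin[OF fin(1) sets(1), of y] r_fin[OF fin(2) sets(2), of y] r_fin[OF N_fin N_sets] sets
      by (simp add: integral_add_measure)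
  qed (use sets in auto)
  then have "(\<integral>z. f z \<partial>\<mu>1) + (\<integral>z. f z \<partial>N (-1)) = (\<integral>z. f z \<partial>\<mu>2) + (\<integral>z. f z \<partial>N 1)"
    using sets f N_integrable[of f] integral_add_measure(2)[of "N (-1)" \<mu>1 f] integral_add_measure(2)[of "N 1" \<mu>2 f]
    by simp
  then show ?thesis using N_diff[of f] f(3) by simp
qed

section \<open>The covariance of fractional Brownian motion\<close>

lemma powr_subadditive:
  fixes x y p :: real
  assumes "0 \<le> x" "0 \<le> y" "0 < p" "p \<le> 1"
  shows "(x + y) powr p \<le> x powr p + y powr p"
proof (cases "x + y = 0")
  case True
  then show ?thesis using assms by simp
next
  case False
  then have s: "x + y > 0" using assms by simp
  have *: "u / (x + y) \<le> (u / (x + y)) powr p" if "0 \<le> u" "u \<le> x + y" for u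
  proof (cases "u = 0")
    case False
    then have "(u / (x + y)) powr 1 \<le> (u / (x + y)) powr p"
      using that s assms by (intro powr_mono') auto
    then show ?thesis using that s by simp
  qed (use assms in simp)
  have "1 = x / (x + y) + y / (x + y)" using s by (simp flip: add_divide_distrib)
  also have "\<dots> \<le> (x / (x + y)) powr p + (y / (x + y)) powr p" using assms by (intro add_mono *) auto
  also have "\<dots> = (x powr p + y powr p) / (x + y) powr p" using assms s by (simp add: powr_divide add_divide_distrib)
  finally show ?thesis using s by (simp add: field_simps)
qed

text \<open>Majorant of the covariance derivative. It is singular at \<open>0\<close> and at
  \<open>r\<close>, but for \<open>0 < H < 1/2\<close> it has the continuous primitive
  \<open>(s^(2H) + sgn (s - r) |s - r|^(2H)) / 2\<close>, which is why the two singular terms are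
  added and not compared separately.\<close>

definition fbm_rate :: "real \<Rightarrow> real \<Rightarrow> real \<Rightarrow> real" where
  "fbm_rate H s r = H * (s powr (2 * H - 1) + \<bar>s - r\<bar> powr (2 * H - 1))"

lemma fbm_rate_measurable [measurable]: "(\<lambda>s. fbm_rate H s r) \<in> borel_measurable borel"
  unfolding fbm_rate_def by measurable

lemma fbm_cov_deriv_measurable [measurable]: "(\<lambda>s. fbm_cov_deriv H s r) \<in> borel_measurable borel"
  unfolding fbm_cov_deriv_def by measurable

lemma fbm_cov_deriv_le_rate:
  assumes "0 < H"
  shows "\<bar>fbm_cov_deriv H s r\<bar> \<le> fbm_rate H s r"
proof -
  have "\<bar>s powr (2 * H - 1) - sgn (s - r) * \<bar>s - r\<bar> powr (2 * H - 1)\<bar> \<le> s powr (2 * H - 1) + \<bar>s - r\<bar> powr (2 * H - 1)"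
    by (auto simp: sgn_real_def abs_if)
  then show ?thesis unfolding fbm_cov_deriv_def fbm_rate_def using assms by (simp add: abs_mult)
qed

lemma fbm_rate_nonneg: "0 < H \<Longrightarrow> 0 \<le> fbm_rate H s r"
  by (simp add: fbm_rate_def)

lemma has_derivative_abs_powr:
  fixes s r p :: real
  assumes "s \<noteq> r"
  shows "((\<lambda>s. \<bar>s - r\<bar> powr p) has_real_derivative p * sgn (s - r) * \<bar>s - r\<bar> powr (p - 1)) (at s)"
    "((\<lambda>s. sgn (s - r) * \<bar>s - r\<bar> powr p) has_real_derivative p * \<bar>s - r\<bar> powr (p - 1)) (at s)"
proof -
  consider "s > r" | "s < r" using assms by linarith
  then have "((\<lambda>s. \<bar>s - r\<bar> powr p) has_real_derivative p * sgn (s - r) * \<bar>s - r\<bar> powr (p - 1)) (at s) \<and>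
    ((\<lambda>s. sgn (s - r) * \<bar>s - r\<bar> powr p) has_real_derivative p * \<bar>s - r\<bar> powr (p - 1)) (at s)"
  proof cases
    case 1
    have ev: "\<forall>\<^sub>F x in nhds s. x > r" using 1 by (rule eventually_nhds_in_open[OF open_greaterThan, unfolded greaterThan_iff])
    have "((\<lambda>s. (s - r) powr p) has_real_derivative p * (s - r) powr (p - 1)) (at s)"
      using 1 by (auto intro!: derivative_eq_intros)
    then have d: "((\<lambda>s. (s - r) powr p) has_real_derivative p * (s - r) powr (p - 1)) (at s)" .
    have e1: "\<forall>\<^sub>F x in nhds s. \<bar>x - r\<bar> powr p = (x - r) powr p"
      "\<forall>\<^sub>F x in nhds s. sgn (x - r) * \<bar>x - r\<bar> powr p = (x - r) powr p"
      using ev by (eventually_elim; simp)+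
    show ?thesis using d 1 by (simp add: DERIV_cong_ev[OF refl e1(1) refl] DERIV_cong_ev[OF refl e1(2) refl])
  next
    case 2
    have ev: "\<forall>\<^sub>F x in nhds s. x < r" using 2 by (rule eventually_nhds_in_open[OF open_lessThan, unfolded lessThan_iff])
    have d1: "((\<lambda>s. (r - s) powr p) has_real_derivative - p * (r - s) powr (p - 1)) (at s)"
      using 2 by (auto intro!: derivative_eq_intros)
    have d2: "((\<lambda>s. - ((r - s) powr p)) has_real_derivative p * (r - s) powr (p - 1)) (at s)"
      using 2 by (auto intro!: derivative_eq_intros)
    have e1: "\<forall>\<^sub>F x in nhds s. \<bar>x - r\<bar> powr p = (r - x) powr p"
      "\<forall>\<^sub>F x in nhds s. sgn (x - r) * \<bar>x - r\<bar> powr p = - ((r - x) powr p)"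
      using ev by (eventually_elim; simp)+
    show ?thesis using d1 d2 2 by (simp add: DERIV_cong_ev[OF refl e1(1) refl] DERIV_cong_ev[OF refl e1(2) refl])
  qed
  then show "((\<lambda>s. \<bar>s - r\<bar> powr p) has_real_derivative p * sgn (s - r) * \<bar>s - r\<bar> powr (p - 1)) (at s)"
    "((\<lambda>s. sgn (s - r) * \<bar>s - r\<bar> powr p) has_real_derivative p * \<bar>s - r\<bar> powr (p - 1)) (at s)" by auto
qed

lemma continuous_abs_powr:
  fixes r p :: real
  assumes "0 < p"
  shows "continuous_on A (\<lambda>s. \<bar>s - r\<bar> powr p)" "continuous_on A (\<lambda>s. sgn (s - r) * \<bar>s - r\<bar> powr p)"
proof -
  show c: "continuous_on A (\<lambda>s. \<bar>s - r\<bar> powr p)" for A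
    using assms by (intro continuous_on_powr' continuous_intros) auto
  have "continuous_on UNIV (\<lambda>s. sgn (s - r) * \<bar>s - r\<bar> powr p)"
  proof -
    have "(\<lambda>s. sgn (s - r) * \<bar>s - r\<bar> powr p) = (\<lambda>s. (max 0 (s - r)) powr p - (max 0 (r - s)) powr p)"
      using assms by (auto simp: fun_eq_iff sgn_real_def max_def)
    then show ?thesis
      by (simp only:) (intro continuous_on_diff continuous_on_powr' continuous_on_max continuous_on_const continuous_on_id ballI; use assms in auto)
  qed
  then show "continuous_on A (\<lambda>s. sgn (s - r) * \<bar>s - r\<bar> powr p)"
    by (rule continuous_on_subset) simp
qed

context
  fixes H r a b :: real
  assumes H: "0 < H" "H < 1/2" and r: "0 \<le> r" and ab: "0 \<le> a" "a \<le> b"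
begin

lemma fbm_rate_has_integral:
  "((\<lambda>s. fbm_rate H s r) has_integral
     (b powr (2 * H) + sgn (b - r) * \<bar>b - r\<bar> powr (2 * H)) / 2 - (a powr (2 * H) + sgn (a - r) * \<bar>a - r\<bar> powr (2 * H)) / 2) {a..b}"
proof (rule fundamental_theorem_of_calculus_interior_strong[of "{r}"])
  fix s assume s: "s \<in> {a<..<b} - {r}"
  have "((\<lambda>s. s powr (2 * H)) has_real_derivative (2 * H) * s powr (2 * H - 1)) (at s)"
    using s ab by (intro has_real_derivative_powr) auto
  then have "((\<lambda>s. (s powr (2 * H) + sgn (s - r) * \<bar>s - r\<bar> powr (2 * H)) / 2) has_real_derivative
     ((2 * H) * s powr (2 * H - 1) + (2 * H) * \<bar>s - r\<bar> powr (2 * H - 1)) / 2) (at s)"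
    using s by (intro DERIV_cdivide DERIV_add has_derivative_abs_powr) auto
  then show "((\<lambda>s. (s powr (2 * H) + sgn (s - r) * \<bar>s - r\<bar> powr (2 * H)) / 2) has_vector_derivative fbm_rate H s r) (at s)"
    by (simp add: fbm_rate_def has_real_derivative_iff_has_vector_derivative[symmetric] distrib_left add_divide_distrib)
next
  have "continuous_on {a..b} (\<lambda>s. s powr (2 * H))"
    using ab H by (intro continuous_on_powr' continuous_intros) auto
  then show "continuous_on {a..b} (\<lambda>s. (s powr (2 * H) + sgn (s - r) * \<bar>s - r\<bar> powr (2 * H)) / 2)"
    by (rule continuous_on_divide[OF continuous_on_add[OF _ continuous_abs_powr(2)] continuous_on_const])
      (use H in auto)
qed (use ab in auto)

lemma fbm_cov_deriv_has_integral:
  "((\<lambda>s. fbm_cov_deriv H s r) has_integral fbm_cov H b r - fbm_cov H a r) {a..b}"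
proof (rule fundamental_theorem_of_calculus_interior_strong[of "{r}"])
  fix s assume s: "s \<in> {a<..<b} - {r}"
  have "((\<lambda>s. s powr (2 * H)) has_real_derivative (2 * H) * s powr (2 * H - 1)) (at s)"
    using s ab by (intro has_real_derivative_powr) auto
  then have "((\<lambda>s. (s powr (2 * H) + r powr (2 * H) - \<bar>s - r\<bar> powr (2 * H)) / 2) has_real_derivative
     ((2 * H) * s powr (2 * H - 1) + 0 - (2 * H) * sgn (s - r) * \<bar>s - r\<bar> powr (2 * H - 1)) / 2) (at s)"
    using s by (intro DERIV_cdivide DERIV_add DERIV_diff has_derivative_abs_powr DERIV_const) auto
  then show "((\<lambda>s. fbm_cov H s r) has_vector_derivative fbm_cov_deriv H s r) (at s)"
    by (simp add: fbm_cov_deriv_def fbm_cov_def has_real_derivative_iff_has_vector_derivative[symmetric] right_diff_distrib diff_divide_distrib mult.assoc)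
next
  have "continuous_on {a..b} (\<lambda>s. s powr (2 * H))"
    using ab H by (intro continuous_on_powr' continuous_intros) auto
  then show "continuous_on {a..b} (\<lambda>s. fbm_cov H s r)"
    unfolding fbm_cov_def
    by (rule continuous_on_divide[OF continuous_on_diff[OF continuous_on_add[OF _ continuous_on_const] continuous_abs_powr(1)] continuous_on_const])
      (use H in auto)
qed (use ab in auto)

text \<open>The gauge integral passes over the singularities because the primitive is continuous;
  nonnegativity turns it into a Lebesgue integral. The signed derivative is integrable afterwards,
  by domination.\<close>

lemma fbm_rate_integrable: "set_integrable lborel {a..b} (\<lambda>s. fbm_rate H s r)"
  and fbm_rate_integral: "(LINT s:{a..b}|lborel. fbm_rate H s r) =
     (b powr (2 * H) + sgn (b - r) * \<bar>b - r\<bar> powr (2 * H)) / 2 - (a powr (2 * H) + sgn (a - r) * \<bar>a - r\<bar> powr (2 * H)) / 2"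
proof -
  let ?I = "(b powr (2 * H) + sgn (b - r) * \<bar>b - r\<bar> powr (2 * H)) / 2 - (a powr (2 * H) + sgn (a - r) * \<bar>a - r\<bar> powr (2 * H)) / 2"
  have "((\<lambda>s. indicator {a..b} s * fbm_rate H s r) has_integral ?I) UNIV"
  proof -
    have "(\<lambda>s. indicator {a..b} s * fbm_rate H s r) = (\<lambda>s. if s \<in> {a..b} then fbm_rate H s r else 0)"
      by (auto simp: indicator_def)
    then show ?thesis using fbm_rate_has_integral by (simp only: has_integral_restrict_UNIV)
  qed
  then have "(\<integral>\<^sup>+s. ennreal (indicator {a..b} s * fbm_rate H s r) \<partial>lborel) = ennreal ?I"
    by (intro nn_integral_has_integral_lborel) (use H in \<open>auto simp: fbm_rate_nonneg\<close>)
  moreover have "0 \<le> ?I"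
    using has_integral_nonneg[OF fbm_rate_has_integral] fbm_rate_nonneg H by simp
  ultimately have "has_bochner_integral lborel (\<lambda>s. indicator {a..b} s * fbm_rate H s r) ?I"
    using H by (intro has_bochner_integral_nn_integral) (auto simp: fbm_rate_nonneg)
  then show "set_integrable lborel {a..b} (\<lambda>s. fbm_rate H s r)"
    "(LINT s:{a..b}|lborel. fbm_rate H s r) = ?I"
    by (auto simp: set_integrable_def set_lebesgue_integral_def has_bochner_integral_iff)
qed

text \<open>Subadditivity of the power \<open>2 * H < 1\<close> makes the bound independent of
  \<open>r\<close> and of the position of the interval. The factor \<open>2\<close> covers the worst
  case of \<open>r\<close> inside, where both halves contribute up to the full length.\<close>

lemma fbm_rate_integral_le: "(LINT s:{a..b}|lborel. fbm_rate H s r) \<le> 2 * (b - a) powr (2 * H)"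
proof -
  have sub: "(x + y) powr (2 * H) \<le> x powr (2 * H) + y powr (2 * H)" if "0 \<le> x" "0 \<le> y" for x y
    using powr_subadditive[OF that, of "2 * H"] H by simp
  have mono: "x powr (2 * H) \<le> y powr (2 * H)" if "0 \<le> x" "x \<le> y" for x y
    using that H by (intro powr_mono2) auto
  have 1: "b powr (2 * H) - a powr (2 * H) \<le> (b - a) powr (2 * H)" using sub[of a "b - a"] ab by simp
  have 2: "sgn (b - r) * \<bar>b - r\<bar> powr (2 * H) - sgn (a - r) * \<bar>a - r\<bar> powr (2 * H) \<le> 2 * (b - a) powr (2 * H)"
  proof -
    consider "r \<le> a" | "b \<le> r" | "a < r" "r < b" by linarith
    then show ?thesis
    proof cases
      case 1
      have "(b - r) powr (2 * H) \<le> (a - r) powr (2 * H) + (b - a) powr (2 * H)"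
        using sub[of "a - r" "b - a"] 1 ab by simp
      moreover have "0 \<le> (b - a) powr (2 * H)" by simp
      moreover have "sgn (b - r) * \<bar>b - r\<bar> powr (2 * H) = (b - r) powr (2 * H)"
        "sgn (a - r) * \<bar>a - r\<bar> powr (2 * H) = (a - r) powr (2 * H)"
        using 1 ab H by (auto simp: sgn_real_def)
      ultimately show ?thesis by linarith
    next
      case 2
      have "(r - a) powr (2 * H) \<le> (r - b) powr (2 * H) + (b - a) powr (2 * H)"
        using sub[of "r - b" "b - a"] 2 ab by simp
      moreover have "0 \<le> (b - a) powr (2 * H)" by simp
      moreover have "sgn (b - r) * \<bar>b - r\<bar> powr (2 * H) = - ((r - b) powr (2 * H))"
        "sgn (a - r) * \<bar>a - r\<bar> powr (2 * H) = - ((r - a) powr (2 * H))"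
        using 2 ab H by (auto simp: sgn_real_def)
      ultimately show ?thesis by linarith
    next
      case 3
      have "(b - r) powr (2 * H) \<le> (b - a) powr (2 * H)" "(r - a) powr (2 * H) \<le> (b - a) powr (2 * H)"
        using 3 by (auto intro!: mono)
      then show ?thesis using 3 by (simp add: sgn_real_def)
    qed
  qed
  have aux: "(B + S) / 2 - (A + S') / 2 \<le> 2 * P" if "0 \<le> P" "B - A \<le> P" "S - S' \<le> 2 * P" for A B S S' P :: real
    using that by (simp add: field_simps)
  have "0 \<le> (b - a) powr (2 * H)" by simp
  then show ?thesis unfolding fbm_rate_integral
    using 1 2 aux by blast
qed

lemma fbm_cov_deriv_integrable: "set_integrable lborel {a..b} (\<lambda>s. fbm_cov_deriv H s r)"
  unfolding set_integrable_def
  by (rule Bochner_Integration.integrable_bound[OF fbm_rate_integrable[unfolded set_integrable_def]])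
     (use H fbm_cov_deriv_le_rate[of H _ r] in \<open>auto simp: indicator_def fbm_rate_nonneg\<close>)

lemma fbm_cov_deriv_integral: "(LINT s:{a..b}|lborel. fbm_cov_deriv H s r) = fbm_cov H b r - fbm_cov H a r"
  using set_borel_integral_eq_integral(2)[OF fbm_cov_deriv_integrable] fbm_cov_deriv_has_integral
  by (simp add: integral_unique)

end

section \<open>Finite chaos approximation\<close>

lemma sq_integrable_mult:
  assumes "sq_integrable M f" "sq_integrable M g"
  shows "integrable M (\<lambda>x. f x * g x)"
proof (rule Bochner_Integration.integrable_bound)
  show "integrable M (\<lambda>x. (f x)\<^sup>2 + (g x)\<^sup>2)" using assms by (simp add: sq_integrable_def)
  show "AE x in M. norm (f x * g x) \<le> norm ((f x)\<^sup>2 + (g x)\<^sup>2)"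
  proof (rule AE_I2)
    fix x
    have "2 * (\<bar>f x\<bar> * \<bar>g x\<bar>) \<le> (f x)\<^sup>2 + (g x)\<^sup>2"
      using sum_squares_bound[of "\<bar>f x\<bar>" "\<bar>g x\<bar>"] by simp
    moreover have "0 \<le> \<bar>f x\<bar> * \<bar>g x\<bar>" by simp
    ultimately show "norm (f x * g x) \<le> norm ((f x)\<^sup>2 + (g x)\<^sup>2)"
      unfolding real_norm_def abs_mult by linarith
  qed
qed (use assms in \<open>auto simp: sq_integrable_def\<close>)

lemma sq_integrable_lincomb:
  assumes f: "sq_integrable M f" and g: "sq_integrable M g"
  shows "sq_integrable M (\<lambda>x. a * f x + b * g x)"
proof -
  have "(\<lambda>x. (a * f x + b * g x)\<^sup>2) = (\<lambda>x. a\<^sup>2 * (f x)\<^sup>2 + 2 * a * b * (f x * g x) + b\<^sup>2 * (g x)\<^sup>2)"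
    by (auto simp: fun_eq_iff power2_eq_square algebra_simps)
  moreover have "integrable M (\<lambda>x. a\<^sup>2 * (f x)\<^sup>2 + 2 * a * b * (f x * g x) + b\<^sup>2 * (g x)\<^sup>2)"
    using sq_integrable_mult[OF f g] f g
    by (intro Bochner_Integration.integrable_add integrable_mult_right) (auto simp: sq_integrable_def)
  ultimately show ?thesis using f g by (auto simp: sq_integrable_def)
qed

lemma sq_integrable_add: "sq_integrable M f \<Longrightarrow> sq_integrable M g \<Longrightarrow> sq_integrable M (\<lambda>x. f x + g x)"
  using sq_integrable_lincomb[of M f g 1 1] by simp

lemma sq_integrable_diff: "sq_integrable M f \<Longrightarrow> sq_integrable M g \<Longrightarrow> sq_integrable M (\<lambda>x. f x - g x)"
  using sq_integrable_lincomb[of M f g 1 "-1"] by simp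

lemma sq_integrable_zero [simp]: "sq_integrable M (\<lambda>x. 0)"
  by (simp add: sq_integrable_def)

lemma sq_integrable_cmult: "sq_integrable M f \<Longrightarrow> sq_integrable M (\<lambda>x. c * f x)"
  using sq_integrable_lincomb[of M f f c 0] by simp

lemma sq_integrable_sum: "finite A \<Longrightarrow> (\<And>i. i \<in> A \<Longrightarrow> sq_integrable M (f i)) \<Longrightarrow> sq_integrable M (\<lambda>x. \<Sum>i\<in>A. f i x)"
  by (induction A rule: finite_induct) (auto intro: sq_integrable_add)

lemma Cauchy_Schwarz_L2:
  assumes f: "sq_integrable M f" and g: "sq_integrable M g"
  shows "(\<integral>x. f x * g x \<partial>M)\<^sup>2 \<le> (\<integral>x. (f x)\<^sup>2 \<partial>M) * (\<integral>x. (g x)\<^sup>2 \<partial>M)"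
proof -
  let ?A = "\<integral>x. (f x)\<^sup>2 \<partial>M" and ?B = "\<integral>x. (g x)\<^sup>2 \<partial>M" and ?C = "\<integral>x. f x * g x \<partial>M"
  have fg: "integrable M (\<lambda>x. f x * g x)" by (rule sq_integrable_mult[OF f g])
  have q: "0 \<le> ?A - 2 * l * ?C + l\<^sup>2 * ?B" for l
  proof -
    have "0 \<le> (\<integral>x. (f x - l * g x)\<^sup>2 \<partial>M)" by simp
    also have "(\<lambda>x. (f x - l * g x)\<^sup>2) = (\<lambda>x. (f x)\<^sup>2 - 2 * l * (f x * g x) + l\<^sup>2 * (g x)\<^sup>2)"
      by (auto simp: fun_eq_iff power2_eq_square algebra_simps)
    also have "(\<integral>x. (f x)\<^sup>2 - 2 * l * (f x * g x) + l\<^sup>2 * (g x)\<^sup>2 \<partial>M) = ?A - 2 * l * ?C + l\<^sup>2 * ?B"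
      using f g fg by (simp add: sq_integrable_def)
    finally show ?thesis .
  qed
  show ?thesis
  proof (cases "?B = 0")
    case True
    then have "AE x in M. (g x)\<^sup>2 = 0"
      using integral_nonneg_eq_0_iff_AE[of M "\<lambda>x. (g x)\<^sup>2"] g by (simp add: sq_integrable_def)
    then have "?C = (\<integral>x. 0 \<partial>M)" using f g by (intro integral_cong_AE) (auto simp: sq_integrable_def)
    then show ?thesis using True by simp
  next
    case False
    then have B: "?B > 0" by (simp add: order_less_le)
    have "0 \<le> ?A - 2 * (?C / ?B) * ?C + (?C / ?B)\<^sup>2 * ?B" by (rule q)
    also have "\<dots> = ?A - ?C\<^sup>2 / ?B" using B by (simp add: power2_eq_square field_simps)
    finally show ?thesis using B by (simp add: field_simps)
  qed
qed

lemma Cauchy_Schwarz_L2_sqrt: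
  assumes f: "sq_integrable M f" and g: "sq_integrable M g"
  shows "\<bar>\<integral>x. f x * g x \<partial>M\<bar> \<le> sqrt (\<integral>x. (f x)\<^sup>2 \<partial>M) * sqrt (\<integral>x. (g x)\<^sup>2 \<partial>M)"
    "(\<integral>x. \<bar>f x * g x\<bar> \<partial>M) \<le> sqrt (\<integral>x. (f x)\<^sup>2 \<partial>M) * sqrt (\<integral>x. (g x)\<^sup>2 \<partial>M)"
proof -
  show "\<bar>\<integral>x. f x * g x \<partial>M\<bar> \<le> sqrt (\<integral>x. (f x)\<^sup>2 \<partial>M) * sqrt (\<integral>x. (g x)\<^sup>2 \<partial>M)"
    using real_sqrt_le_mono[OF Cauchy_Schwarz_L2[OF f g]] by (simp add: real_sqrt_mult)
  have "sq_integrable M (\<lambda>x. \<bar>f x\<bar>)" "sq_integrable M (\<lambda>x. \<bar>g x\<bar>)" using f g by (auto simp: sq_integrable_def)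
  from real_sqrt_le_mono[OF Cauchy_Schwarz_L2[OF this]]
  show "(\<integral>x. \<bar>f x * g x\<bar> \<partial>M) \<le> sqrt (\<integral>x. (f x)\<^sup>2 \<partial>M) * sqrt (\<integral>x. (g x)\<^sup>2 \<partial>M)"
    by (simp add: real_sqrt_mult abs_mult[symmetric])
qed

lemma L2_tendsto_mult:
  assumes "L2_tendsto M Y Z" and G: "sq_integrable M G"
  shows "(\<lambda>k. \<integral>x. Y k x * G x \<partial>M) \<longlonglongrightarrow> (\<integral>x. Z x * G x \<partial>M)"
proof -
  have Y: "sq_integrable M (Y k)" and Z: "sq_integrable M Z"
    and l: "(\<lambda>k. \<integral>x. (Y k x - Z x)\<^sup>2 \<partial>M) \<longlonglongrightarrow> 0" for k
    using assms(1) by (auto simp: L2_tendsto_def)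
  have "(\<lambda>k. (\<integral>x. Y k x * G x \<partial>M) - (\<integral>x. Z x * G x \<partial>M)) \<longlonglongrightarrow> 0"
  proof (rule Lim_null_comparison)
    show "\<forall>\<^sub>F k in sequentially. norm ((\<integral>x. Y k x * G x \<partial>M) - (\<integral>x. Z x * G x \<partial>M))
      \<le> sqrt (\<integral>x. (Y k x - Z x)\<^sup>2 \<partial>M) * sqrt (\<integral>x. (G x)\<^sup>2 \<partial>M)"
    proof (intro always_eventually allI)
      fix k
      have "(\<integral>x. Y k x * G x \<partial>M) - (\<integral>x. Z x * G x \<partial>M) = (\<integral>x. (Y k x - Z x) * G x \<partial>M)"
        using sq_integrable_mult[OF Y G, of k] sq_integrable_mult[OF Z G] by (simp add: left_diff_distrib)
      then show "norm ((\<integral>x. Y k x * G x \<partial>M) - (\<integral>x. Z x * G x \<partial>M))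
          \<le> sqrt (\<integral>x. (Y k x - Z x)\<^sup>2 \<partial>M) * sqrt (\<integral>x. (G x)\<^sup>2 \<partial>M)"
        using Cauchy_Schwarz_L2_sqrt(1)[OF sq_integrable_diff[OF Y Z] G, of k] by simp
    qed
    show "(\<lambda>k. sqrt (\<integral>x. (Y k x - Z x)\<^sup>2 \<partial>M) * sqrt (\<integral>x. (G x)\<^sup>2 \<partial>M)) \<longlonglongrightarrow> 0"
      using tendsto_mult_left_zero[OF tendsto_real_sqrt[OF l, simplified]] by simp
  qed
  then show ?thesis by (simp add: LIM_zero_iff)
qed

lemma L2_dist_triangle:
  assumes f: "sq_integrable M f" and g: "sq_integrable M g" and h: "sq_integrable M h"
  shows "(\<integral>x. (f x - h x)\<^sup>2 \<partial>M) \<le> 2 * (\<integral>x. (f x - g x)\<^sup>2 \<partial>M) + 2 * (\<integral>x. (g x - h x)\<^sup>2 \<partial>M)"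
proof -
  have i: "integrable M (\<lambda>x. (f x - g x)\<^sup>2)" "integrable M (\<lambda>x. (g x - h x)\<^sup>2)" "integrable M (\<lambda>x. (f x - h x)\<^sup>2)"
    using sq_integrable_diff[OF f g] sq_integrable_diff[OF g h] sq_integrable_diff[OF f h] by (auto simp: sq_integrable_def)
  have "(f x - h x)\<^sup>2 \<le> 2 * (f x - g x)\<^sup>2 + 2 * (g x - h x)\<^sup>2" for x
  proof -
    have "0 \<le> ((f x - g x) - (g x - h x))\<^sup>2" by simp
    then show ?thesis by (simp add: power2_eq_square algebra_simps)
  qed
  then have "(\<integral>x. (f x - h x)\<^sup>2 \<partial>M) \<le> (\<integral>x. 2 * (f x - g x)\<^sup>2 + 2 * (g x - h x)\<^sup>2 \<partial>M)"
    using i by (intro integral_mono) auto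
  then show ?thesis using i by simp
qed

section \<open>The closed span of Hermite polynomials in the noise\<close>

context isonormal_process
begin

definition herm_comb :: "(real \<times> nat \<times> 'h) list \<Rightarrow> 'w \<Rightarrow> real" where
  "herm_comb L \<omega> = (\<Sum>(c, n, h)\<leftarrow>L. c * herm n h \<omega>)"

text \<open>Membership in the \<open>L^2\<close> closure of the Hermite combinations with directions
  in \<open>D\<close>, phrased for functions and not for classes. The set \<open>D\<close> is kept
  variable because the scheme only speaks about combinations of rectangles.\<close>

definition in_chaos :: "'h set \<Rightarrow> ('w \<Rightarrow> real) \<Rightarrow> bool" where
  "in_chaos D U \<longleftrightarrow> sq_integrable M U \<and>
     (\<forall>\<epsilon>>0. \<exists>L. (\<forall>(c, n, h)\<in>set L. h \<in> D) \<and> (\<integral>\<omega>. (U \<omega> - herm_comb L \<omega>)\<^sup>2 \<partial>M) < \<epsilon>)"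

lemma herm_sq_integrable: "sq_integrable M (herm n h)"
  using wick_herm_integrable(4)[of n h n h] by (simp add: sq_integrable_def power2_eq_square)

lemma wick_exp_sq_integrable: "sq_integrable M (wick_exp h)"
  using wick_herm_integrable(1)[of h h] by (simp add: sq_integrable_def power2_eq_square)

lemma herm_comb_simps [simp]:
  "herm_comb [] \<omega> = 0" "herm_comb ((c, n, h) # L) \<omega> = c * herm n h \<omega> + herm_comb L \<omega>"
  "herm_comb (L @ L') \<omega> = herm_comb L \<omega> + herm_comb L' \<omega>"
  by (simp_all add: herm_comb_def)

lemma herm_comb_scale: "herm_comb (map (\<lambda>(c, n, h). (a * c, n, h)) L) \<omega> = a * herm_comb L \<omega>"
  by (induction L) (auto simp: distrib_left)

lemma herm_comb_sq_integrable: "sq_integrable M (herm_comb L)"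
proof (induction L)
  case Nil
  then show ?case by (simp add: herm_comb_def)
next
  case (Cons p L)
  obtain c n h where "p = (c, n, h)" by (cases p)
  then show ?case using sq_integrable_add[OF sq_integrable_cmult[OF herm_sq_integrable] Cons] by simp
qed

lemma herm_comb_in_chaos: "(\<forall>(c, n, h)\<in>set L. h \<in> D) \<Longrightarrow> in_chaos D (herm_comb L)"
  unfolding in_chaos_def using herm_comb_sq_integrable by (auto intro!: exI[of _ L])

lemma in_chaos_sq_integrable: "in_chaos D U \<Longrightarrow> sq_integrable M U"
  by (simp add: in_chaos_def)

lemma in_chaos_limit:
  assumes "sq_integrable M Z" and "\<And>\<epsilon>. \<epsilon> > 0 \<Longrightarrow> \<exists>U. in_chaos D U \<and> (\<integral>\<omega>. (Z \<omega> - U \<omega>)\<^sup>2 \<partial>M) < \<epsilon>"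
  shows "in_chaos D Z"
  unfolding in_chaos_def
proof (intro conjI allI impI assms(1))
  fix \<epsilon> :: real assume "\<epsilon> > 0"
  then obtain U where U: "in_chaos D U" "(\<integral>\<omega>. (Z \<omega> - U \<omega>)\<^sup>2 \<partial>M) < \<epsilon> / 4"
    using assms(2)[of "\<epsilon> / 4"] by auto
  then obtain L where L: "\<forall>(c, n, h)\<in>set L. h \<in> D" "(\<integral>\<omega>. (U \<omega> - herm_comb L \<omega>)\<^sup>2 \<partial>M) < \<epsilon> / 4"
    using \<open>\<epsilon> > 0\<close> unfolding in_chaos_def by (meson divide_pos_pos zero_less_numeral)
  have "(\<integral>\<omega>. (Z \<omega> - herm_comb L \<omega>)\<^sup>2 \<partial>M) < \<epsilon>"
    using L2_dist_triangle[OF assms(1) in_chaos_sq_integrable[OF U(1)] herm_comb_sq_integrable[of L]] U L by linarith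
  with L show "\<exists>L. (\<forall>(c, n, h)\<in>set L. h \<in> D) \<and> (\<integral>\<omega>. (Z \<omega> - herm_comb L \<omega>)\<^sup>2 \<partial>M) < \<epsilon>" by blast
qed

lemma in_chaos_L2_tendsto:
  assumes "L2_tendsto M Y Z" "\<And>k. in_chaos D (Y k)"
  shows "in_chaos D Z"
proof (rule in_chaos_limit)
  show Z: "sq_integrable M Z" using assms(1) by (simp add: L2_tendsto_def)
  fix \<epsilon> :: real assume "\<epsilon> > 0"
  have "(\<lambda>k. \<integral>\<omega>. (Y k \<omega> - Z \<omega>)\<^sup>2 \<partial>M) \<longlonglongrightarrow> 0" using assms(1) by (simp add: L2_tendsto_def)
  from order_tendstoD(2)[OF this \<open>\<epsilon> > 0\<close>] obtain k where "(\<integral>\<omega>. (Y k \<omega> - Z \<omega>)\<^sup>2 \<partial>M) < \<epsilon>"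
    by (auto simp: eventually_sequentially)
  then have "(\<integral>\<omega>. (Z \<omega> - Y k \<omega>)\<^sup>2 \<partial>M) < \<epsilon>" by (simp add: power2_commute)
  then show "\<exists>U. in_chaos D U \<and> (\<integral>\<omega>. (Z \<omega> - U \<omega>)\<^sup>2 \<partial>M) < \<epsilon>" using assms(2) by blast
qed

lemma in_chaos_lincomb:
  assumes U: "in_chaos D U" and V: "in_chaos D V"
  shows "in_chaos D (\<lambda>\<omega>. a * U \<omega> + b * V \<omega>)"
  unfolding in_chaos_def
proof (intro conjI allI impI)
  show s: "sq_integrable M (\<lambda>\<omega>. a * U \<omega> + b * V \<omega>)"
    by (intro sq_integrable_lincomb in_chaos_sq_integrable[OF U] in_chaos_sq_integrable[OF V])
  fix \<epsilon> :: real assume e: "\<epsilon> > 0"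
  \<comment> \<open>The denominator exceeds \<open>2 a^2 + 2 b^2\<close>, the factor lost when the
    square of a sum is estimated, and it stays positive for \<open>a = b = 0\<close>.\<close>
  let ?e = "\<epsilon> / (4 * (a\<^sup>2 + 1) * (b\<^sup>2 + 1))"
  have p: "a\<^sup>2 + 1 > 0" "b\<^sup>2 + 1 > 0" by (auto intro: add_nonneg_pos)
  have e': "?e > 0" using e p by simp
  obtain L where L: "\<forall>(c, n, h)\<in>set L. h \<in> D" "(\<integral>\<omega>. (U \<omega> - herm_comb L \<omega>)\<^sup>2 \<partial>M) < ?e"
    using U e' unfolding in_chaos_def by meson
  obtain L' where L': "\<forall>(c, n, h)\<in>set L'. h \<in> D" "(\<integral>\<omega>. (V \<omega> - herm_comb L' \<omega>)\<^sup>2 \<partial>M) < ?e"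
    using V e' unfolding in_chaos_def by meson
  let ?L = "map (\<lambda>(c, n, h). (a * c, n, h)) L @ map (\<lambda>(c, n, h). (b * c, n, h)) L'"
  have i: "integrable M (\<lambda>\<omega>. (U \<omega> - herm_comb L \<omega>)\<^sup>2)" "integrable M (\<lambda>\<omega>. (V \<omega> - herm_comb L' \<omega>)\<^sup>2)"
    using sq_integrable_diff[OF in_chaos_sq_integrable[OF U] herm_comb_sq_integrable]
      sq_integrable_diff[OF in_chaos_sq_integrable[OF V] herm_comb_sq_integrable] by (auto simp: sq_integrable_def)
  have "(\<integral>\<omega>. (a * U \<omega> + b * V \<omega> - herm_comb ?L \<omega>)\<^sup>2 \<partial>M)
    \<le> (\<integral>\<omega>. 2 * a\<^sup>2 * (U \<omega> - herm_comb L \<omega>)\<^sup>2 + 2 * b\<^sup>2 * (V \<omega> - herm_comb L' \<omega>)\<^sup>2 \<partial>M)"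
  proof (rule integral_mono)
    show "integrable M (\<lambda>\<omega>. (a * U \<omega> + b * V \<omega> - herm_comb ?L \<omega>)\<^sup>2)"
      using sq_integrable_diff[OF s herm_comb_sq_integrable[of ?L]] by (simp only: sq_integrable_def)
    show "integrable M (\<lambda>\<omega>. 2 * a\<^sup>2 * (U \<omega> - herm_comb L \<omega>)\<^sup>2 + 2 * b\<^sup>2 * (V \<omega> - herm_comb L' \<omega>)\<^sup>2)"
      using i by (intro Bochner_Integration.integrable_add integrable_mult_right)
    fix \<omega>
    have sq: "(x + y)\<^sup>2 \<le> 2 * x\<^sup>2 + 2 * y\<^sup>2" for x y :: real
      using zero_le_power2[of "x - y"] by (simp add: power2_eq_square algebra_simps)
    have eq: "a * U \<omega> + b * V \<omega> - herm_comb ?L \<omega> = a * (U \<omega> - herm_comb L \<omega>) + b * (V \<omega> - herm_comb L' \<omega>)"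
      by (simp only: herm_comb_simps herm_comb_scale) (simp add: algebra_simps)
    show "(a * U \<omega> + b * V \<omega> - herm_comb ?L \<omega>)\<^sup>2 \<le> 2 * a\<^sup>2 * (U \<omega> - herm_comb L \<omega>)\<^sup>2 + 2 * b\<^sup>2 * (V \<omega> - herm_comb L' \<omega>)\<^sup>2"
      unfolding eq using sq[of "a * (U \<omega> - herm_comb L \<omega>)" "b * (V \<omega> - herm_comb L' \<omega>)"]
      by (simp only: power_mult_distrib mult.assoc)
  qed
  also have "\<dots> = 2 * a\<^sup>2 * (\<integral>\<omega>. (U \<omega> - herm_comb L \<omega>)\<^sup>2 \<partial>M) + 2 * b\<^sup>2 * (\<integral>\<omega>. (V \<omega> - herm_comb L' \<omega>)\<^sup>2 \<partial>M)"
    using i by simp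
  also have "\<dots> \<le> 2 * a\<^sup>2 * ?e + 2 * b\<^sup>2 * ?e"
    using L L' by (intro add_mono mult_left_mono) auto
  also have "\<dots> = (2 * a\<^sup>2 + 2 * b\<^sup>2) * ?e" by (simp only: distrib_right)
  also have "\<dots> < (4 * (a\<^sup>2 + 1) * (b\<^sup>2 + 1)) * ?e"
  proof (rule mult_strict_right_mono[OF _ e'])
    have "0 \<le> a\<^sup>2 * b\<^sup>2" by simp
    moreover have "4 * (a\<^sup>2 + 1) * (b\<^sup>2 + 1) = 4 * (a\<^sup>2 * b\<^sup>2) + 4 * a\<^sup>2 + 4 * b\<^sup>2 + 4" by (simp add: algebra_simps)
    ultimately show "2 * a\<^sup>2 + 2 * b\<^sup>2 < 4 * (a\<^sup>2 + 1) * (b\<^sup>2 + 1)"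
      using zero_le_power2[of a] zero_le_power2[of b] by linarith
  qed
  also have "\<dots> = \<epsilon>" using p by simp
  finally show "\<exists>L. (\<forall>(c, n, h)\<in>set L. h \<in> D) \<and> (\<integral>\<omega>. (a * U \<omega> + b * V \<omega> - herm_comb L \<omega>)\<^sup>2 \<partial>M) < \<epsilon>"
    using L L' by (intro exI[of _ ?L]) auto
qed

lemma in_chaos_add: "in_chaos D U \<Longrightarrow> in_chaos D V \<Longrightarrow> in_chaos D (\<lambda>\<omega>. U \<omega> + V \<omega>)"
  using in_chaos_lincomb[of D U V 1 1] by simp

lemma in_chaos_cmult: "in_chaos D U \<Longrightarrow> in_chaos D (\<lambda>\<omega>. a * U \<omega>)"
  using in_chaos_lincomb[of D U U a 0] by simp

lemma in_chaos_sum: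
  "finite A \<Longrightarrow> (\<And>i. i \<in> A \<Longrightarrow> in_chaos D (f i)) \<Longrightarrow> in_chaos D (\<lambda>\<omega>. \<Sum>i\<in>A. f i \<omega>)"
proof (induction A rule: finite_induct)
  case empty
  then show ?case using herm_comb_in_chaos[of "[]" D] by (simp add: herm_comb_def[abs_def])
qed (auto intro: in_chaos_add)

text \<open>By orthogonality the squared distance of two Hermite variables of order \<open>n\<close>
  is a polynomial in inner products, so \<open>herm n\<close> is continuous from the Hilbert space
  into \<open>L^2\<close>.\<close>

lemma herm_in_chaos:
  assumes "h \<in> closure D"
  shows "in_chaos D (herm n h)"
proof -
  obtain \<phi> where \<phi>: "\<And>k. \<phi> k \<in> D" "\<phi> \<longlonglongrightarrow> h" using assms by (auto simp: closure_sequential)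
  have "L2_tendsto M (\<lambda>k. herm n (\<phi> k)) (herm n h)"
    unfolding L2_tendsto_def
  proof (intro conjI allI herm_sq_integrable)
    have "(\<integral>\<omega>. (herm n (\<phi> k) \<omega> - herm n h \<omega>)\<^sup>2 \<partial>M)
      = fact n * (inner (\<phi> k) (\<phi> k) ^ n - 2 * inner (\<phi> k) h ^ n + inner h h ^ n)" for k
    proof -
      have "(\<lambda>\<omega>. (herm n (\<phi> k) \<omega> - herm n h \<omega>)\<^sup>2) = (\<lambda>\<omega>. herm n (\<phi> k) \<omega> * herm n (\<phi> k) \<omega>
         - 2 * (herm n (\<phi> k) \<omega> * herm n h \<omega>) + herm n h \<omega> * herm n h \<omega>)"
        by (auto simp: fun_eq_iff power2_eq_square algebra_simps)
      then show ?thesis by (simp add: herm_orthogonal algebra_simps inner_commute[of h "\<phi> k"])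
    qed
    moreover have "(\<lambda>k. fact n * (inner (\<phi> k) (\<phi> k) ^ n - 2 * inner (\<phi> k) h ^ n + inner h h ^ n))
      \<longlonglongrightarrow> fact n * (inner h h ^ n - 2 * inner h h ^ n + inner h h ^ n)"
      by (intro tendsto_intros \<phi>)
    ultimately show "(\<lambda>k. \<integral>\<omega>. (herm n (\<phi> k) \<omega> - herm n h \<omega>)\<^sup>2 \<partial>M) \<longlonglongrightarrow> 0" by simp
  qed
  then show ?thesis
  proof (rule in_chaos_L2_tendsto)
    fix k
    have "herm n (\<phi> k) = herm_comb [(1, n, \<phi> k)]" by (simp add: fun_eq_iff)
    then show "in_chaos D (herm n (\<phi> k))" using \<phi> by (simp add: herm_comb_in_chaos)
  qed
qed

text \<open>By orthogonality the squared error of the partial sums is the tail of the exponential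
  series at \<open>inner h h\<close>.\<close>

lemma wick_exp_in_chaos:
  assumes "h \<in> closure D"
  shows "in_chaos D (wick_exp h)"
proof -
  let ?S = "\<lambda>N \<omega>. \<Sum>m<N. (1 / fact m) * herm m h \<omega>" and ?v = "inner h h"
  have "L2_tendsto M ?S (wick_exp h)"
    unfolding L2_tendsto_def
  proof (intro conjI allI wick_exp_sq_integrable sq_integrable_sum sq_integrable_cmult herm_sq_integrable finite_lessThan)
    have eq: "(\<integral>\<omega>. (?S N \<omega> - wick_exp h \<omega>)\<^sup>2 \<partial>M) = exp ?v - (\<Sum>m<N. ?v ^ m /\<^sub>R fact m)" for N
    proof -
      have S: "sq_integrable M (?S N)"
        by (intro sq_integrable_sum sq_integrable_cmult herm_sq_integrable finite_lessThan)
      have 1: "(\<integral>\<omega>. ?S N \<omega> * wick_exp h \<omega> \<partial>M) = (\<Sum>m<N. ?v ^ m /\<^sub>R fact m)"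
      proof -
        have "?S N \<omega> * wick_exp h \<omega> = (\<Sum>m<N. (1 / fact m) * (herm m h \<omega> * wick_exp h \<omega>))" for \<omega>
          by (simp add: sum_distrib_right mult.assoc)
        then have "(\<integral>\<omega>. ?S N \<omega> * wick_exp h \<omega> \<partial>M) = (\<Sum>m<N. (1 / fact m) * (\<integral>\<omega>. herm m h \<omega> * wick_exp h \<omega> \<partial>M))"
          by (simp only:) (subst Bochner_Integration.integral_sum; intro integrable_mult_right wick_herm_integrable sum.cong refl integral_mult_right_zero)
        then show ?thesis by (simp add: herm_wick_exp divide_inverse)
      qed
      have "(\<integral>\<omega>. ?S N \<omega> * ?S N \<omega> \<partial>M) = (\<Sum>m<N. \<Sum>k<N. (1 / fact m) * (1 / fact k) * (\<integral>\<omega>. herm m h \<omega> * herm k h \<omega> \<partial>M))"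
        unfolding sum_product
        by (subst Bochner_Integration.integral_sum, auto simp: mult_ac intro!: integrable_mult_right)
      also have "\<dots> = (\<Sum>m<N. ?v ^ m /\<^sub>R fact m)"
      proof (intro sum.cong refl)
        fix m assume "m \<in> {..<N}"
        have "(\<Sum>k<N. (1 / fact m) * (1 / fact k) * (\<integral>\<omega>. herm m h \<omega> * herm k h \<omega> \<partial>M))
          = (\<Sum>k<N. if k = m then (1 / fact m) * (1 / fact m) * (fact m * ?v ^ m) else 0)"
          by (intro sum.cong) (auto simp: herm_orthogonal)
        also have "\<dots> = ?v ^ m /\<^sub>R fact m" using \<open>m \<in> {..<N}\<close> by (simp add: divide_inverse)
        finally show "(\<Sum>k<N. (1 / fact m) * (1 / fact k) * (\<integral>\<omega>. herm m h \<omega> * herm k h \<omega> \<partial>M)) = ?v ^ m /\<^sub>R fact m" .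
      qed
      finally have 2: "(\<integral>\<omega>. ?S N \<omega> * ?S N \<omega> \<partial>M) = (\<Sum>m<N. ?v ^ m /\<^sub>R fact m)" .
      have "(\<lambda>\<omega>. (?S N \<omega> - wick_exp h \<omega>)\<^sup>2) = (\<lambda>\<omega>. ?S N \<omega> * ?S N \<omega> - 2 * (?S N \<omega> * wick_exp h \<omega>) + wick_exp h \<omega> * wick_exp h \<omega>)"
        by (auto simp: fun_eq_iff power2_eq_square algebra_simps)
      then have "(\<integral>\<omega>. (?S N \<omega> - wick_exp h \<omega>)\<^sup>2 \<partial>M) = (\<integral>\<omega>. ?S N \<omega> * ?S N \<omega> \<partial>M) - 2 * (\<integral>\<omega>. ?S N \<omega> * wick_exp h \<omega> \<partial>M) + exp ?v"
        using sq_integrable_mult[OF S S] sq_integrable_mult[OF S wick_exp_sq_integrable] wick_exp_mult[of h h]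
        by simp
      then show ?thesis unfolding 1 2 by simp
    qed
    have "(\<lambda>N. exp ?v - (\<Sum>m<N. ?v ^ m /\<^sub>R fact m)) \<longlonglongrightarrow> exp ?v - exp ?v"
      using exp_converges[of ?v] unfolding sums_def by (intro tendsto_diff tendsto_const)
    then show "(\<lambda>N. \<integral>\<omega>. (?S N \<omega> - wick_exp h \<omega>)\<^sup>2 \<partial>M) \<longlonglongrightarrow> 0" unfolding eq by simp
  qed
  then show ?thesis
    by (rule in_chaos_L2_tendsto) (intro in_chaos_sum in_chaos_cmult herm_in_chaos assms finite_lessThan)
qed

text \<open>Pairings with \<open>herm m g\<close> see exactly one order and return the diagonal of
  the kernel there, which by polarization is the whole symmetric kernel. All later information on
  chaos expansions is extracted in this way.\<close>

lemma wiener_integral_herm: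
  fixes tens :: "'h list \<Rightarrow> 'f::{real_inner,complete_space}"
  assumes T: "hilbert_tensors tens" and Y: "wiener_integral M X tens n f Y"
  shows "sq_integrable M Y" "in_chaos UNIV Y"
    "(\<integral>\<omega>. Y \<omega> * herm m g \<omega> \<partial>M) = (if m = n then fact n * inner f (tens (replicate n g)) else 0)"
proof -
  obtain S where S: "(\<lambda>k. \<Sum>(c, h)\<leftarrow>S k. c *\<^sub>R tens (replicate n h)) \<longlonglongrightarrow> f"
    and L: "L2_tendsto M (\<lambda>k \<omega>. \<Sum>(c, h)\<leftarrow>S k. c * hermite n ((norm h)\<^sup>2) (X h \<omega>)) Y"
    using Y unfolding wiener_integral_def by blast
  have eq: "(\<Sum>(c, h)\<leftarrow>S k. c * hermite n ((norm h)\<^sup>2) (X h \<omega>)) = herm_comb (map (\<lambda>(c, h). (c, n, h)) (S k)) \<omega>" for k \<omega>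
    by (simp add: herm_comb_def herm_def o_def case_prod_unfold)
  have L': "L2_tendsto M (\<lambda>k. herm_comb (map (\<lambda>(c, h). (c, n, h)) (S k))) Y" using L unfolding eq .
  show "sq_integrable M Y" using L by (simp add: L2_tendsto_def)
  show "in_chaos UNIV Y" by (rule in_chaos_L2_tendsto[OF L']) (auto intro: herm_comb_in_chaos)
  have a: "(\<integral>\<omega>. herm_comb (map (\<lambda>(c, h). (c, n, h)) s) \<omega> * herm m g \<omega> \<partial>M)
    = (if m = n then fact n * inner (\<Sum>(c, h)\<leftarrow>s. c *\<^sub>R tens (replicate n h)) (tens (replicate n g)) else 0)" for s
  proof (induction s)
    case Nil
    show ?case by simp
  next
    case (Cons p s)
    obtain c h where p: "p = (c, h)" by (cases p)
    have "(\<integral>\<omega>. herm_comb (map (\<lambda>(c, h). (c, n, h)) (p # s)) \<omega> * herm m g \<omega> \<partial>M)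
      = c * (\<integral>\<omega>. herm n h \<omega> * herm m g \<omega> \<partial>M) + (\<integral>\<omega>. herm_comb (map (\<lambda>(c, h). (c, n, h)) s) \<omega> * herm m g \<omega> \<partial>M)"
      using sq_integrable_mult[OF herm_comb_sq_integrable herm_sq_integrable, of "map (\<lambda>(c, h). (c, n, h)) s" m g]
      by (simp add: p distrib_right mult.assoc)
    then show ?case using Cons
      by (auto simp: p herm_orthogonal tens_inner_replicate[OF T] inner_add_left algebra_simps inner_commute[of g h])
  qed
  have b: "(\<lambda>k. \<integral>\<omega>. herm_comb (map (\<lambda>(c, h). (c, n, h)) (S k)) \<omega> * herm m g \<omega> \<partial>M) \<longlonglongrightarrow> (\<integral>\<omega>. Y \<omega> * herm m g \<omega> \<partial>M)"
    by (rule L2_tendsto_mult[OF L' herm_sq_integrable])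
  have c: "(\<lambda>k. if m = n then fact n * inner (\<Sum>(c, h)\<leftarrow>S k. c *\<^sub>R tens (replicate n h)) (tens (replicate n g)) else 0)
    \<longlonglongrightarrow> (if m = n then fact n * inner f (tens (replicate n g)) else 0)"
    using S by (auto intro!: tendsto_intros)
  show "(\<integral>\<omega>. Y \<omega> * herm m g \<omega> \<partial>M) = (if m = n then fact n * inner f (tens (replicate n g)) else 0)"
    by (rule LIMSEQ_unique[OF b[unfolded a] c])
qed

text \<open>At most one term of the series meets \<open>G\<close>, so the pairings of the partial
  sums are eventually constant.\<close>

lemma expectation_series:
  assumes L: "L2_tendsto M (\<lambda>N \<omega>. A \<omega> + (\<Sum>n=1..N. Y n \<omega>)) Z" and G: "sq_integrable M G"
    and A: "sq_integrable M A" and Y: "\<And>n. n \<ge> 1 \<Longrightarrow> sq_integrable M (Y n)"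
    and y: "\<And>n. n \<ge> 1 \<Longrightarrow> (\<integral>\<omega>. Y n \<omega> * G \<omega> \<partial>M) = (if n = k then c else 0)"
  shows "(\<integral>\<omega>. Z \<omega> * G \<omega> \<partial>M) = (\<integral>\<omega>. A \<omega> * G \<omega> \<partial>M) + (if 1 \<le> k then c else 0)"
proof -
  have eq: "(\<integral>\<omega>. (A \<omega> + (\<Sum>n=1..N. Y n \<omega>)) * G \<omega> \<partial>M) = (\<integral>\<omega>. A \<omega> * G \<omega> \<partial>M) + (if 1 \<le> k \<and> k \<le> N then c else 0)" for N
  proof -
    have "(\<integral>\<omega>. (A \<omega> + (\<Sum>n=1..N. Y n \<omega>)) * G \<omega> \<partial>M) = (\<integral>\<omega>. A \<omega> * G \<omega> + (\<Sum>n=1..N. Y n \<omega> * G \<omega>) \<partial>M)"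
      by (simp add: distrib_right sum_distrib_right)
    also have "\<dots> = (\<integral>\<omega>. A \<omega> * G \<omega> \<partial>M) + (\<Sum>n=1..N. \<integral>\<omega>. Y n \<omega> * G \<omega> \<partial>M)"
      using sq_integrable_mult[OF A G] sq_integrable_mult[OF Y G]
      by (subst Bochner_Integration.integral_add) (auto intro!: Bochner_Integration.integral_sum)
    also have "(\<Sum>n=1..N. \<integral>\<omega>. Y n \<omega> * G \<omega> \<partial>M) = (\<Sum>n=1..N. if n = k then c else 0)"
      by (intro sum.cong refl y) auto
    also have "\<dots> = (if 1 \<le> k \<and> k \<le> N then c else 0)" by simp
    finally show ?thesis .
  qed
  have "(\<lambda>N. \<integral>\<omega>. (A \<omega> + (\<Sum>n=1..N. Y n \<omega>)) * G \<omega> \<partial>M) \<longlonglongrightarrow> (\<integral>\<omega>. Z \<omega> * G \<omega> \<partial>M)"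
    by (rule L2_tendsto_mult[OF L G])
  moreover have "(\<lambda>N. \<integral>\<omega>. (A \<omega> + (\<Sum>n=1..N. Y n \<omega>)) * G \<omega> \<partial>M) \<longlonglongrightarrow> (\<integral>\<omega>. A \<omega> * G \<omega> \<partial>M) + (if 1 \<le> k then c else 0)"
    unfolding eq by (rule tendsto_eventually) (auto simp: eventually_sequentially intro!: exI[of _ k])
  ultimately show ?thesis by (rule LIMSEQ_unique)
qed

lemma herm_0 [simp]: "herm 0 h \<omega> = 1"
  by (simp add: herm_def)

lemma herm_1: "herm (Suc 0) h = X h"
  by (simp add: herm_def fun_eq_iff)

lemma integral_herm: "(\<integral>\<omega>. herm n g \<omega> \<partial>M) = (if n = 0 then 1 else 0)"
  using herm_orthogonal[of 0 g n g] by auto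

end

lemma tensor_power_base: "length hs = n \<Longrightarrow> tens hs \<in> tensor_power tens n"
  unfolding tensor_power_def by (intro closure_subset[THEN subsetD] span_base) auto

lemma tens_Nil_sym: "c *\<^sub>R tens [] \<in> sym_tensor_power tens 0"
proof -
  have "c *\<^sub>R tens [] \<in> tensor_power tens 0"
    unfolding tensor_power_def by (intro closure_subset[THEN subsetD] span_mul span_base) auto
  then show ?thesis by (auto simp: sym_tensor_power_def)
qed

lemma tens_singleton_sym: "tens [k] \<in> sym_tensor_power tens (Suc 0)"
  by (auto simp: sym_tensor_power_def tensor_power_base length_Suc_conv)

section \<open>Kernels of the mild solution\<close>

context isonormal_process
begin

definition ind_list :: "(real \<Rightarrow> real ^ 'd \<Rightarrow> 'h) \<Rightarrow> (real \<times> (real ^ 'd)) list \<Rightarrow> 'h list" where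
  "ind_list ind ps = map (\<lambda>(r, x). ind r x) ps"

text \<open>Gathers what the mild equation says about kernels: \<open>F\<close> belongs to
  \<open>u t x\<close>, \<open>hh\<close> to the Duhamel field, and the Skorohod integral makes
  \<open>F (Suc n)\<close> the symmetrization of \<open>hh n\<close>. Both families are described by
  their pairings with Hermite polynomials, where the versions chosen in the expansions
  disappear.\<close>

lemma mild_kernels:
  fixes ind :: "real \<Rightarrow> real ^ 'd \<Rightarrow> 'h" and tens :: "'h list \<Rightarrow> 'f::{real_inner,complete_space}"
  assumes T: "hilbert_tensors tens" and mild: "mild_solution M H Q ind tens X u0 u" and t: "0 \<le> t"
  obtains F hh where
    "\<And>m. F m \<in> sym_tensor_power tens m"
    "\<And>m g. (\<integral>\<omega>. u t x \<omega> * herm m g \<omega> \<partial>M) = fact m * inner (F m) (tens (replicate m g))"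
    "F 0 = heat_semigroup t u0 x *\<^sub>R tens []"
    "\<And>n s y. 0 \<le> s \<Longrightarrow> hh n s y \<in> sym_tensor_power tens n"
    "\<And>n s y g. 0 \<le> s \<Longrightarrow> (\<integral>\<omega>. duhamel_field u t x s y \<omega> * herm n g \<omega> \<partial>M) = fact n * inner (hh n s y) (tens (replicate n g))"
    "\<And>n. symmetrization H Q ind tens n (hh n) (F (Suc n))"
    "in_chaos UNIV (u t x)"
proof -
  have um: "(\<lambda>((s, z), \<omega>). u s z \<omega>) \<in> borel_measurable ((restrict_space borel {0..} \<Otimes>\<^sub>M borel) \<Otimes>\<^sub>M M)"
    using mild by (simp add: mild_solution_def)
  have "(\<lambda>\<omega>. ((t, x), \<omega>)) \<in> M \<rightarrow>\<^sub>M (restrict_space borel {0..} \<Otimes>\<^sub>M borel) \<Otimes>\<^sub>M M"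
    using t by (intro measurable_Pair measurable_const measurable_ident) (auto simp: space_pair_measure space_restrict_space)
  from measurable_compose[OF this um] have utm [measurable]: "u t x \<in> borel_measurable M" by simp
  obtain Z where sk: "skorohod_integral M H Q ind tens X (duhamel_field u t x) Z"
    and uZ: "AE \<omega> in M. u t x \<omega> = heat_semigroup t u0 x + Z \<omega>"
    using mild t unfolding mild_solution_def by blast
  then obtain h k0 k Y where
    ce: "\<And>s y. s \<ge> 0 \<Longrightarrow> chaos_expansion M X tens (duhamel_field u t x s y) (\<lambda>n. h n s y)"
    and rp: "represents H Q ind (\<lambda>s y. \<integral>\<omega>. duhamel_field u t x s y \<omega> \<partial>M) k0"
    and sy: "\<And>n. n \<ge> 1 \<Longrightarrow> symmetrization H Q ind tens n (h n) (k n)"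
    and wi: "\<And>n. n \<ge> 1 \<Longrightarrow> wiener_integral M X tens (Suc n) (k n) (Y n)"
    and L: "L2_tendsto M (\<lambda>N \<omega>. X k0 \<omega> + (\<Sum>n=1..N. Y n \<omega>)) Z"
    unfolding skorohod_integral_def by blast
  define p where "p = heat_semigroup t u0 x"
  have Z: "sq_integrable M Z" using L by (simp add: L2_tendsto_def)
  have const: "sq_integrable M (\<lambda>\<omega>. c)" for c by (simp add: sq_integrable_def)
  have Xk: "sq_integrable M (X k0)" using herm_sq_integrable[of "Suc 0" k0] by (simp add: herm_1)
  have Ys: "sq_integrable M (Y n)" if "n \<ge> 1" for n using wiener_integral_herm(1)[OF T wi[OF that]] .
  have EZ: "(\<integral>\<omega>. Z \<omega> * herm m g \<omega> \<partial>M) = (if m = 0 then 0 else if m = 1 then inner k0 g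
     else fact m * inner (k (m - 1)) (tens (replicate m g)))" for m g
  proof -
    \<comment> \<open>For \<open>m = 0\<close> and for \<open>m = 1\<close> the index
      \<open>m - 1\<close> is \<open>0\<close>, which a series starting at \<open>1\<close> never
      meets.\<close>
    have y: "(\<integral>\<omega>. Y n \<omega> * herm m g \<omega> \<partial>M) = (if n = m - 1 then (if m = 0 then 0 else fact m * inner (k (m - 1)) (tens (replicate m g))) else 0)"
      if "n \<ge> 1" for n
      using wiener_integral_herm(3)[OF T wi[OF that], of m g] that by (cases m) auto
    have "(\<integral>\<omega>. Z \<omega> * herm m g \<omega> \<partial>M) = (\<integral>\<omega>. X k0 \<omega> * herm m g \<omega> \<partial>M)
       + (if 1 \<le> m - 1 then (if m = 0 then 0 else fact m * inner (k (m - 1)) (tens (replicate m g))) else 0)"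
      by (rule expectation_series[OF L herm_sq_integrable Xk Ys y])
    also have "(\<integral>\<omega>. X k0 \<omega> * herm m g \<omega> \<partial>M) = (if m = 1 then inner k0 g else 0)"
      using herm_orthogonal[of "Suc 0" k0 m g] by (simp add: herm_1)
    finally show ?thesis by auto
  qed
  \<comment> \<open>The integral raises the order by one, so the kernel of order \<open>m\<close> of
    \<open>u\<close> stems from order \<open>m - 1\<close> of the field: order \<open>1\<close> from
    the element that represents the mean, order \<open>0\<close> from the heat flow of the initial
    condition.\<close>
  define F where "F m = (if m = 0 then p *\<^sub>R tens [] else if m = 1 then tens [k0] else k (m - 1))" for m
  have Fsym: "F m \<in> sym_tensor_power tens m" for m
  proof -
    consider "m = 0" | "m = 1" | n where "m = Suc n" "n \<ge> 1" by (cases m) fastforce+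
    then show ?thesis
    proof cases
      case 3
      then show ?thesis using sy[of n] by (simp add: F_def symmetrization_def)
    qed (auto simp: F_def tens_Nil_sym tens_singleton_sym)
  qed
  have Fu: "(\<integral>\<omega>. u t x \<omega> * herm m g \<omega> \<partial>M) = fact m * inner (F m) (tens (replicate m g))" for m g
  proof -
    have "(\<integral>\<omega>. u t x \<omega> * herm m g \<omega> \<partial>M) = (\<integral>\<omega>. p * herm m g \<omega> + Z \<omega> * herm m g \<omega> \<partial>M)"
      using uZ Z by (intro integral_cong_AE) (auto simp: p_def distrib_right sq_integrable_def)
    also have "\<dots> = p * (\<integral>\<omega>. herm m g \<omega> \<partial>M) + (\<integral>\<omega>. Z \<omega> * herm m g \<omega> \<partial>M)"
      using sq_integrable_mult[OF Z herm_sq_integrable, of m g] sq_integrable_mult[OF const[of 1] herm_sq_integrable, of m g]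
      by simp
    also have "\<dots> = fact m * inner (F m) (tens (replicate m g))"
      by (auto simp: integral_herm EZ F_def tens_inner[OF T])
    finally show ?thesis .
  qed
  \<comment> \<open>A chaos expansion leaves its kernel of order \<open>0\<close> undetermined;
    filling in the mean makes order \<open>0\<close> obey the same statements as the others.\<close>
  define hh where "hh n s y = (if n = 0 then (\<integral>\<omega>. duhamel_field u t x s y \<omega> \<partial>M) *\<^sub>R tens [] else h n s y)" for n s y
  have "hh n s y \<in> sym_tensor_power tens n \<and>
    (\<forall>g. (\<integral>\<omega>. duhamel_field u t x s y \<omega> * herm n g \<omega> \<partial>M) = fact n * inner (hh n s y) (tens (replicate n g)))"
    if s: "0 \<le> s" for n s y
  proof -
    let ?v = "duhamel_field u t x s y"
    obtain V where V: "\<And>n. n \<ge> 1 \<Longrightarrow> wiener_integral M X tens n (h n s y) (V n)"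
      and LV: "L2_tendsto M (\<lambda>N \<omega>. (\<integral>\<omega>'. ?v \<omega>' \<partial>M) + (\<Sum>n=1..N. V n \<omega>)) ?v"
      using ce[OF s, of y] unfolding chaos_expansion_def by blast
    show ?thesis
    proof (cases "n = 0")
      case True
      then show ?thesis by (auto simp: hh_def tens_Nil_sym tens_inner[OF T])
    next
      case False
      have "(\<integral>\<omega>. ?v \<omega> * herm n g \<omega> \<partial>M) = fact n * inner (hh n s y) (tens (replicate n g))" for g
      proof -
        have "(\<integral>\<omega>. V m \<omega> * herm n g \<omega> \<partial>M) = (if m = n then fact n * inner (h n s y) (tens (replicate n g)) else 0)"
          if "m \<ge> 1" for m
          using wiener_integral_herm(3)[OF T V[OF that], of n g] by auto
        then have "(\<integral>\<omega>. ?v \<omega> * herm n g \<omega> \<partial>M) = (\<integral>\<omega>. (\<integral>\<omega>'. ?v \<omega>' \<partial>M) * herm n g \<omega> \<partial>M) +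
            (if 1 \<le> n then fact n * inner (h n s y) (tens (replicate n g)) else 0)"
          by (intro expectation_series[OF LV herm_sq_integrable const wiener_integral_herm(1)[OF T V]])
        then show ?thesis using False by (simp add: integral_herm hh_def)
      qed
      moreover have "h n s y \<in> sym_tensor_power tens n" using V[of n] False by (simp add: wiener_integral_def)
      ultimately show ?thesis using False by (simp add: hh_def)
    qed
  qed
  then have hh: "\<And>n s y. 0 \<le> s \<Longrightarrow> hh n s y \<in> sym_tensor_power tens n"
    "\<And>n s y g. 0 \<le> s \<Longrightarrow> (\<integral>\<omega>. duhamel_field u t x s y \<omega> * herm n g \<omega> \<partial>M) = fact n * inner (hh n s y) (tens (replicate n g))"
    by auto
  have symm: "symmetrization H Q ind tens n (hh n) (F (Suc n))" for n
  proof (cases "n = 0")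
    case True
    have "\<exists>c. (\<forall>i\<le>0. fun_inner H Q (\<lambda>s y. inner (hh 0 s y) (tens (map (\<lambda>(r, x). ind r x) (take i ps @ drop (Suc i) ps))))
        (fst (ps ! i)) (snd (ps ! i)) (c i)) \<and>
       inner (F (Suc 0)) (tens (map (\<lambda>(r, x). ind r x) ps)) = (\<Sum>i\<le>0. c i) / real (Suc 0)"
      if ps: "length ps = Suc 0" "\<forall>(r, x)\<in>set ps. 0 \<le> r" for ps :: "(real \<times> (real ^ 'd)) list"
    proof -
      obtain r y where q: "ps = [(r, y)]" "r \<ge> 0" using ps by (auto simp: length_Suc_conv)
      have "fun_inner H Q (\<lambda>s y. \<integral>\<omega>. duhamel_field u t x s y \<omega> \<partial>M) r y (inner k0 (ind r y))"
        using rp q by (auto simp: represents_def)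
      then show ?thesis
        by (intro exI[of _ "\<lambda>_. inner k0 (ind r y)"]) (simp add: q hh_def F_def tens_inner[OF T])
    qed
    then show ?thesis using True by (simp add: symmetrization_def Fsym)
  next
    case False
    then have "hh n = h n" "F (Suc n) = k n" by (auto simp: hh_def[abs_def] F_def fun_eq_iff)
    then show ?thesis using sy[of n] False by simp
  qed
  have "in_chaos UNIV (u t x)"
  proof -
    have "in_chaos UNIV Z"
    proof (rule in_chaos_L2_tendsto[OF L])
      fix N
      have "in_chaos UNIV (X k0)" using herm_in_chaos[of k0 UNIV "Suc 0"] by (simp add: herm_1)
      moreover have "in_chaos UNIV (\<lambda>\<omega>. \<Sum>n=1..N. Y n \<omega>)"
        by (intro in_chaos_sum wiener_integral_herm(2)[OF T wi]) auto
      ultimately show "in_chaos UNIV (\<lambda>\<omega>. X k0 \<omega> + (\<Sum>n=1..N. Y n \<omega>))" by (rule in_chaos_add)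
    qed
    moreover have "in_chaos UNIV (\<lambda>\<omega>. p * herm 0 0 \<omega>)" by (intro in_chaos_cmult herm_in_chaos) simp
    ultimately have pz: "in_chaos UNIV (\<lambda>\<omega>. p + Z \<omega>)" using in_chaos_add[of UNIV "\<lambda>\<omega>. p * herm 0 0 \<omega>" Z] by simp
    have ae: "AE \<omega> in M. u t x \<omega> = p + Z \<omega>" using uZ by (simp add: p_def)
    have [measurable]: "Z \<in> borel_measurable M" using Z by (simp add: sq_integrable_def)
    show ?thesis
    proof (rule in_chaos_limit)
      have "integrable M (\<lambda>\<omega>. (p + Z \<omega>)\<^sup>2)" using in_chaos_sq_integrable[OF pz] by (simp add: sq_integrable_def)
      moreover have "integrable M (\<lambda>\<omega>. (u t x \<omega>)\<^sup>2) = integrable M (\<lambda>\<omega>. (p + Z \<omega>)\<^sup>2)"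
        using ae by (intro integrable_cong_AE) auto
      ultimately show "sq_integrable M (u t x)" by (simp add: sq_integrable_def)
      have "(\<integral>\<omega>. (u t x \<omega> - (p + Z \<omega>))\<^sup>2 \<partial>M) = (\<integral>\<omega>. 0 \<partial>M)"
        using ae by (intro integral_cong_AE) auto
      then show "\<exists>U. in_chaos UNIV U \<and> (\<integral>\<omega>. (u t x \<omega> - U \<omega>)\<^sup>2 \<partial>M) < \<epsilon>" if "\<epsilon> > 0" for \<epsilon>
        using pz that by (intro exI[of _ "\<lambda>\<omega>. p + Z \<omega>"]) simp
    qed
  qed
  with Fsym Fu hh symm show ?thesis
    by (intro that[of F hh]) (simp_all add: F_def p_def)
qed

text \<open>The value is \<open>n!\<close> times the kernel of order \<open>n = length hs\<close> of the solution at \<open>(s, z)\<close>, tested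
  against \<open>hs\<close>.  Reading it off from projections onto Hermite polynomials, by polarization, makes its
  measurability in \<open>(s, z)\<close> evident.\<close>

definition kernel_test :: "(real \<Rightarrow> real ^ 'd \<Rightarrow> 'w \<Rightarrow> real) \<Rightarrow> 'h list \<Rightarrow> real \<Rightarrow> real ^ 'd \<Rightarrow> real" where
  "kernel_test u hs s z = fdiff hs (\<lambda>g. \<integral>\<omega>. u s z \<omega> * herm (length hs) g \<omega> \<partial>M) 0 / fact (length hs)"

section \<open>Recursion for the tested kernels of a mild solution\<close>

context
  fixes ind :: "real \<Rightarrow> real ^ 'd \<Rightarrow> 'h" and tens :: "'h list \<Rightarrow> 'f::{real_inner,complete_space}"
    and H Q u0 and u :: "real \<Rightarrow> real ^ 'd \<Rightarrow> 'w \<Rightarrow> real"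
  assumes T: "hilbert_tensors tens" and mild: "mild_solution M H Q ind tens X u0 u"
begin

lemma solution_measurable:
  "(\<lambda>((s, z), \<omega>). u s z \<omega>) \<in> borel_measurable ((restrict_space borel {0..} \<Otimes>\<^sub>M borel) \<Otimes>\<^sub>M M)"
  using mild by (simp add: mild_solution_def)

lemma solution_sq_integrable: "0 \<le> t \<Longrightarrow> sq_integrable M (u t x)"
  using mild_kernels[OF T mild] in_chaos_sq_integrable by blast

lemma solution_in_chaos: "0 \<le> t \<Longrightarrow> in_chaos UNIV (u t x)"
  using mild_kernels[OF T mild] by blast

lemma kernel_test_eq:
  assumes "f \<in> sym_tensor_power tens n" "\<And>g. (\<integral>\<omega>. u s z \<omega> * herm n g \<omega> \<partial>M) = fact n * inner f (tens (replicate n g))"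
    and "length hs = n"
  shows "kernel_test u hs s z = fact n * inner f (tens hs)"
  using assms polarization[OF T assms(1,3)] by (simp add: kernel_test_def fdiff_cmult)

lemma kernel_test_Nil:
  assumes "0 \<le> t"
  shows "kernel_test u [] t x = heat_semigroup t u0 x"
proof -
  obtain F hh where F: "\<And>m. F m \<in> sym_tensor_power tens m"
    "\<And>m g. (\<integral>\<omega>. u t x \<omega> * herm m g \<omega> \<partial>M) = fact m * inner (F m) (tens (replicate m g))"
    "F 0 = heat_semigroup t u0 x *\<^sub>R tens []"
    and hh: "\<And>n s y. 0 \<le> s \<Longrightarrow> hh n s y \<in> sym_tensor_power tens n"
    "\<And>n s y g. 0 \<le> s \<Longrightarrow> (\<integral>\<omega>. duhamel_field u t x s y \<omega> * herm n g \<omega> \<partial>M) = fact n * inner (hh n s y) (tens (replicate n g))"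
    and sy: "\<And>n. symmetrization H Q ind tens n (hh n) (F (Suc n))"
    and "in_chaos UNIV (u t x)"
    by (rule mild_kernels[OF T mild assms, of x]) (rule that; assumption)
  show ?thesis using kernel_test_eq[OF F(1,2), of "[]" 0] F by (simp add: tens_inner[OF T])
qed

lemma kernel_test_replicate:
  assumes "0 \<le> t"
  obtains f where "f \<in> sym_tensor_power tens n" "\<And>hs. length hs = n \<Longrightarrow> kernel_test u hs t x = fact n * inner f (tens hs)"
    "\<And>g. (\<integral>\<omega>. u t x \<omega> * herm n g \<omega> \<partial>M) = fact n * inner f (tens (replicate n g))"
proof -
  obtain F hh where F: "\<And>m. F m \<in> sym_tensor_power tens m"
    "\<And>m g. (\<integral>\<omega>. u t x \<omega> * herm m g \<omega> \<partial>M) = fact m * inner (F m) (tens (replicate m g))"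
    "F 0 = heat_semigroup t u0 x *\<^sub>R tens []"
    and hh: "\<And>n s y. 0 \<le> s \<Longrightarrow> hh n s y \<in> sym_tensor_power tens n"
    "\<And>n s y g. 0 \<le> s \<Longrightarrow> (\<integral>\<omega>. duhamel_field u t x s y \<omega> * herm n g \<omega> \<partial>M) = fact n * inner (hh n s y) (tens (replicate n g))"
    and sy: "\<And>n. symmetrization H Q ind tens n (hh n) (F (Suc n))"
    and "in_chaos UNIV (u t x)"
    by (rule mild_kernels[OF T mild assms, of x]) (rule that; assumption)
  show ?thesis using that[of "F n"] kernel_test_eq[OF F(1,2)] F(1,2) by blast
qed

lemma kernel_test_measurable:
  "(\<lambda>(s, z). kernel_test u hs s z) \<in> borel_measurable (restrict_space borel {0..} \<Otimes>\<^sub>M borel)"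
proof -
  let ?S = "restrict_space borel {0..} \<Otimes>\<^sub>M (borel :: (real ^ 'd) measure)"
  have "(\<lambda>p. \<integral>\<omega>. u (fst p) (snd p) \<omega> * herm (length hs) g \<omega> \<partial>M) \<in> borel_measurable ?S" for g
  proof (rule borel_measurable_lebesgue_integral)
    have "(\<lambda>q. u (fst (fst q)) (snd (fst q)) (snd q)) \<in> borel_measurable (?S \<Otimes>\<^sub>M M)"
      using solution_measurable by (simp add: case_prod_unfold)
    then show "(\<lambda>(p, \<omega>). u (fst p) (snd p) \<omega> * herm (length hs) g \<omega>) \<in> borel_measurable (?S \<Otimes>\<^sub>M M)"
      unfolding case_prod_unfold by measurable
  qed
  then have "(\<lambda>p. fdiff hs (\<lambda>g. \<integral>\<omega>. u (fst p) (snd p) \<omega> * herm (length hs) g \<omega> \<partial>M) 0) \<in> borel_measurable ?S"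
    by (rule fdiff_measurable)
  then show ?thesis unfolding kernel_test_def case_prod_unfold by measurable
qed

text \<open>Fubini for the spatial integral and the expectation. The absolute bound comes from
  Cauchy-Schwarz in \<open>M\<close> and from the weighted \<open>L^2\<close> condition in
  \<open>mild_solution\<close>.\<close>

lemma duhamel_projection:
  assumes s: "0 \<le> s" "s < t"
  shows "integrable lborel (\<lambda>z. heat_kernel (t - s) (x - z) * rect_ind z y * (\<integral>\<omega>. u s z \<omega> * herm n g \<omega> \<partial>M))"
    "(\<integral>\<omega>. duhamel_field u t x s y \<omega> * herm n g \<omega> \<partial>M)
       = (\<integral>z. heat_kernel (t - s) (x - z) * rect_ind z y * (\<integral>\<omega>. u s z \<omega> * herm n g \<omega> \<partial>M) \<partial>lborel)"
proof -
  interpret P: pair_sigma_finite lborel M ..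
  have um: "(\<lambda>p. u s (fst p) (snd p)) \<in> borel_measurable (lborel \<Otimes>\<^sub>M M)"
  proof -
    have "(\<lambda>p. ((s, fst p), snd p)) \<in> lborel \<Otimes>\<^sub>M M \<rightarrow>\<^sub>M (restrict_space borel {0..} \<Otimes>\<^sub>M borel) \<Otimes>\<^sub>M M"
      using s by (intro measurable_Pair measurable_const) (auto simp: space_restrict_space)
    from measurable_compose[OF this solution_measurable] show ?thesis by simp
  qed
  let ?f = "\<lambda>p. heat_kernel (t - s) (x - fst p) * rect_ind (fst p) y * (u s (fst p) (snd p) * herm n g (snd p))"
  have fm: "?f \<in> borel_measurable (lborel \<Otimes>\<^sub>M M)" using um by measurable
  have uh: "integrable M (\<lambda>\<omega>. u s z \<omega> * herm n g \<omega>)" for z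
    by (rule sq_integrable_mult[OF solution_sq_integrable[OF s(1)] herm_sq_integrable])
  have int: "integrable lborel (\<lambda>z. heat_kernel (t - s) (x - z) * sqrt (\<integral>\<omega>. (u s z \<omega>)\<^sup>2 \<partial>M))"
    using mild s unfolding mild_solution_def by auto
  have "integrable (lborel \<Otimes>\<^sub>M M) ?f"
  proof (rule P.Fubini_integrable[OF fm])
    show "AE z in lborel. integrable M (\<lambda>\<omega>. ?f (z, \<omega>))"
      unfolding fst_conv snd_conv by (intro AE_I2 integrable_mult_right uh)
    have "(\<lambda>z. \<integral>\<omega>. norm (?f (z, \<omega>)) \<partial>M) \<in> borel_measurable lborel"
      using fm by measurable
    then show "integrable lborel (\<lambda>z. \<integral>\<omega>. norm (?f (z, \<omega>)) \<partial>M)"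
    proof (rule Bochner_Integration.integrable_bound[OF integrable_mult_left[OF int, of "sqrt (\<integral>\<omega>. (herm n g \<omega>)\<^sup>2 \<partial>M)"]])
      show "AE z in lborel. norm (\<integral>\<omega>. norm (?f (z, \<omega>)) \<partial>M) \<le> norm (heat_kernel (t - s) (x - z) * sqrt (\<integral>\<omega>. (u s z \<omega>)\<^sup>2 \<partial>M) * sqrt (\<integral>\<omega>. (herm n g \<omega>)\<^sup>2 \<partial>M))"
      proof (rule AE_I2)
        fix z
        have "(\<integral>\<omega>. norm (?f (z, \<omega>)) \<partial>M) = heat_kernel (t - s) (x - z) * \<bar>rect_ind z y\<bar> * (\<integral>\<omega>. \<bar>u s z \<omega> * herm n g \<omega>\<bar> \<partial>M)"
          by (simp add: abs_mult)
        also have "\<dots> \<le> heat_kernel (t - s) (x - z) * 1 * (sqrt (\<integral>\<omega>. (u s z \<omega>)\<^sup>2 \<partial>M) * sqrt (\<integral>\<omega>. (herm n g \<omega>)\<^sup>2 \<partial>M))"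
          by (intro mult_mono Cauchy_Schwarz_L2_sqrt(2) solution_sq_integrable s herm_sq_integrable rect_ind_bound) auto
        finally show "norm (\<integral>\<omega>. norm (?f (z, \<omega>)) \<partial>M) \<le> norm (heat_kernel (t - s) (x - z) * sqrt (\<integral>\<omega>. (u s z \<omega>)\<^sup>2 \<partial>M) * sqrt (\<integral>\<omega>. (herm n g \<omega>)\<^sup>2 \<partial>M))"
          by (simp add: mult.assoc abs_mult)
      qed
    qed
  qed
  then have fi: "integrable (lborel \<Otimes>\<^sub>M M) (\<lambda>(z, \<omega>). ?f (z, \<omega>))" by (simp add: case_prod_unfold)
  have eq: "(\<integral>\<omega>. ?f (z, \<omega>) \<partial>M) = heat_kernel (t - s) (x - z) * rect_ind z y * (\<integral>\<omega>. u s z \<omega> * herm n g \<omega> \<partial>M)" for z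
    by simp
  show "integrable lborel (\<lambda>z. heat_kernel (t - s) (x - z) * rect_ind z y * (\<integral>\<omega>. u s z \<omega> * herm n g \<omega> \<partial>M))"
    using P.integrable_fst[OF fi] unfolding eq .
  have "(\<integral>\<omega>. duhamel_field u t x s y \<omega> * herm n g \<omega> \<partial>M) = (\<integral>\<omega>. (\<integral>z. ?f (z, \<omega>) \<partial>lborel) \<partial>M)"
  proof (intro Bochner_Integration.integral_cong refl)
    fix \<omega>
    have "duhamel_field u t x s y \<omega> * herm n g \<omega> = (\<integral>z. heat_kernel (t - s) (x - z) * u s z \<omega> * rect_ind z y * herm n g \<omega> \<partial>lborel)"
      unfolding duhamel_field_def using s by simp
    also have "\<dots> = (\<integral>z. ?f (z, \<omega>) \<partial>lborel)"
      by (intro Bochner_Integration.integral_cong) (auto simp: mult_ac)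
    finally show "duhamel_field u t x s y \<omega> * herm n g \<omega> = (\<integral>z. ?f (z, \<omega>) \<partial>lborel)" .
  qed
  also have "\<dots> = (\<integral>z. (\<integral>\<omega>. ?f (z, \<omega>) \<partial>M) \<partial>lborel)"
    by (rule P.Fubini_integral[OF fi])
  finally show "(\<integral>\<omega>. duhamel_field u t x s y \<omega> * herm n g \<omega> \<partial>M)
       = (\<integral>z. heat_kernel (t - s) (x - z) * rect_ind z y * (\<integral>\<omega>. u s z \<omega> * herm n g \<omega> \<partial>M) \<partial>lborel)"
    unfolding eq .
qed

text \<open>Polarization is carried out under the spatial integral: it moves the kernel of the
  field, known on the diagonal by \<open>duhamel_projection\<close>, to arbitrary test
  tensors.\<close>

lemma duhamel_kernel:
  assumes h: "h \<in> sym_tensor_power tens n"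
    "\<And>g. (\<integral>\<omega>. duhamel_field u t x s y \<omega> * herm n g \<omega> \<partial>M) = fact n * inner h (tens (replicate n g))"
    and hs: "length hs = n" and s: "0 \<le> s" "s < t"
  shows "fact n * inner h (tens hs) = (\<integral>z. heat_kernel (t - s) (x - z) * kernel_test u hs s z * rect_ind z y \<partial>lborel)"
proof -
  let ?E = "\<lambda>g z. \<integral>\<omega>. u s z \<omega> * herm n g \<omega> \<partial>M"
  let ?f = "\<lambda>g z. heat_kernel (t - s) (x - z) * rect_ind z y * ?E g z"
  have "fact n * (fact n * inner h (tens hs)) = fact n * fdiff hs (\<lambda>g. inner h (tens (replicate n g))) 0"
    by (simp add: polarization[OF T h(1) hs])
  also have "\<dots> = fdiff hs (\<lambda>g. \<integral>z. ?f g z \<partial>lborel) 0"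
    by (simp add: fdiff_cmult[symmetric] h(2)[symmetric] duhamel_projection(2)[OF s])
  also have "\<dots> = (\<integral>z. fdiff hs (\<lambda>g. ?f g z) 0 \<partial>lborel)"
    by (rule fdiff_integral(1)[OF duhamel_projection(1)[OF s]])
  also have "\<dots> = (\<integral>z. fact n * (heat_kernel (t - s) (x - z) * kernel_test u hs s z * rect_ind z y) \<partial>lborel)"
    using hs by (intro Bochner_Integration.integral_cong refl) (simp add: fdiff_cmult kernel_test_def)
  finally show ?thesis by simp
qed

lemma kernel_test_integrable:
  assumes s: "0 \<le> s" "s < t"
  shows "integrable lborel (\<lambda>z. heat_kernel (t - s) (x - z) * kernel_test u hs s z)"
proof -
  let ?E = "\<lambda>g z. \<integral>\<omega>. u s z \<omega> * herm (length hs) g \<omega> \<partial>M"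
  have "integrable lborel (\<lambda>z. heat_kernel (t - s) (x - z) * ?E g z)" for g
  proof (rule Bochner_Integration.integrable_bound)
    show "integrable lborel (\<lambda>z. heat_kernel (t - s) (x - z) * sqrt (\<integral>\<omega>. (u s z \<omega>)\<^sup>2 \<partial>M) * sqrt (\<integral>\<omega>. (herm (length hs) g \<omega>)\<^sup>2 \<partial>M))"
      using mild s unfolding mild_solution_def by auto
    have um: "(\<lambda>p. u s (fst p) (snd p)) \<in> borel_measurable (lborel \<Otimes>\<^sub>M M)"
    proof -
      have "(\<lambda>p. ((s, fst p), snd p)) \<in> lborel \<Otimes>\<^sub>M M \<rightarrow>\<^sub>M (restrict_space borel {0..} \<Otimes>\<^sub>M borel) \<Otimes>\<^sub>M M"
        using s by (intro measurable_Pair measurable_const) (auto simp: space_restrict_space)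
      from measurable_compose[OF this solution_measurable] show ?thesis by simp
    qed
    then have "(\<lambda>z. ?E g z) \<in> borel_measurable lborel"
      by (intro borel_measurable_lebesgue_integral) (simp add: case_prod_unfold)
    then show "(\<lambda>z. heat_kernel (t - s) (x - z) * ?E g z) \<in> borel_measurable lborel" by measurable
    show "AE z in lborel. norm (heat_kernel (t - s) (x - z) * ?E g z)
       \<le> norm (heat_kernel (t - s) (x - z) * sqrt (\<integral>\<omega>. (u s z \<omega>)\<^sup>2 \<partial>M) * sqrt (\<integral>\<omega>. (herm (length hs) g \<omega>)\<^sup>2 \<partial>M))"
    proof (rule AE_I2)
      fix z
      show "norm (heat_kernel (t - s) (x - z) * ?E g z)
       \<le> norm (heat_kernel (t - s) (x - z) * sqrt (\<integral>\<omega>. (u s z \<omega>)\<^sup>2 \<partial>M) * sqrt (\<integral>\<omega>. (herm (length hs) g \<omega>)\<^sup>2 \<partial>M))"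
        using Cauchy_Schwarz_L2_sqrt(1)[OF solution_sq_integrable[OF s(1)] herm_sq_integrable, of z "length hs" g]
        by (simp add: abs_mult mult.assoc mult_left_mono)
    qed
  qed
  from fdiff_integral(2)[of lborel "\<lambda>g z. heat_kernel (t - s) (x - z) * ?E g z", OF this, of hs 0]
  show ?thesis by (simp add: kernel_test_def fdiff_cmult)
qed

text \<open>The factorial in \<open>kernel_test\<close> is chosen so that it cancels the average
  \<open>1 / (n + 1)\<close> in the symmetrization: a plain sum over the rectangles remains. Each
  summand is the time integral in \<open>fun_inner\<close>, with the unspecified signed measures
  there identified through their rectangle transforms.\<close>

lemma kernel_recursion:
  fixes ps :: "(real \<times> (real ^ 'd)) list"
  defines "B \<equiv> \<lambda>ps. kernel_test u (ind_list ind ps)"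
  assumes Qm: "\<And>y. (\<lambda>z. Q z y) \<in> borel_measurable borel"
    and ps: "length ps = Suc n" "\<forall>(r, x)\<in>set ps. 0 \<le> r" and t: "0 \<le> t"
    and int: "\<And>i s. i \<le> n \<Longrightarrow> 0 \<le> s \<Longrightarrow> s < t \<Longrightarrow>
      integrable lborel (\<lambda>z. heat_kernel (t - s) (x - z) * (Q z (snd (ps ! i)) * B (take i ps @ drop (Suc i) ps) s z))"
  shows "B ps t x = (\<Sum>i\<le>n. LINT s:{0..t}|lborel. fbm_cov_deriv H s (fst (ps ! i)) *
      (\<integral>z. heat_kernel (t - s) (x - z) * (Q z (snd (ps ! i)) * B (take i ps @ drop (Suc i) ps) s z) \<partial>lborel))"
proof -
  obtain F hh where F: "\<And>m. F m \<in> sym_tensor_power tens m"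
    "\<And>m g. (\<integral>\<omega>. u t x \<omega> * herm m g \<omega> \<partial>M) = fact m * inner (F m) (tens (replicate m g))"
    "F 0 = heat_semigroup t u0 x *\<^sub>R tens []"
    and hh: "\<And>n s y. 0 \<le> s \<Longrightarrow> hh n s y \<in> sym_tensor_power tens n"
    "\<And>n s y g. 0 \<le> s \<Longrightarrow> (\<integral>\<omega>. duhamel_field u t x s y \<omega> * herm n g \<omega> \<partial>M) = fact n * inner (hh n s y) (tens (replicate n g))"
    and sy: "\<And>n. symmetrization H Q ind tens n (hh n) (F (Suc n))"
    and "in_chaos UNIV (u t x)"
    by (rule mild_kernels[OF T mild t, of x]) (rule that; assumption)
  let ?q = "\<lambda>i. take i ps @ drop (Suc i) ps"
  let ?J = "\<lambda>i s. \<integral>z. heat_kernel (t - s) (x - z) * (Q z (snd (ps ! i)) * B (?q i) s z) \<partial>lborel"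
  obtain c where c: "\<And>i. i \<le> n \<Longrightarrow> fun_inner H Q (\<lambda>s y. inner (hh n s y) (tens (ind_list ind (?q i)))) (fst (ps ! i)) (snd (ps ! i)) (c i)"
    and Fc: "inner (F (Suc n)) (tens (ind_list ind ps)) = (\<Sum>i\<le>n. c i) / real (Suc n)"
    using sy[of n] ps unfolding symmetrization_def ind_list_def by blast
  have ci: "fact n * c i = (LINT s:{0..t}|lborel. fbm_cov_deriv H s (fst (ps ! i)) * ?J i s)" if i: "i \<le> n" for i
  proof -
    let ?r = "fst (ps ! i)" and ?y = "snd (ps ! i)"
    obtain \<mu>1 \<mu>2 where k: "finite_kernel \<mu>1" "finite_kernel \<mu>2"
      and rep: "\<And>s y. s \<ge> 0 \<Longrightarrow> inner (hh n s y) (tens (ind_list ind (?q i))) = (\<integral>z. rect_ind z y \<partial>\<mu>1 s) - (\<integral>z. rect_ind z y \<partial>\<mu>2 s)"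
      and Qi: "\<And>s. s \<ge> 0 \<Longrightarrow> integrable (\<mu>1 s) (\<lambda>z. Q z ?y) \<and> integrable (\<mu>2 s) (\<lambda>z. Q z ?y)"
      and ceq: "c i = (LINT s:{0..}|lborel. fbm_cov_deriv H s ?r * ((\<integral>z. Q z ?y \<partial>\<mu>1 s) - (\<integral>z. Q z ?y \<partial>\<mu>2 s)))"
      using c[OF i] unfolding fun_inner_def by blast
    have fin: "finite_measure (\<mu>1 s)" "finite_measure (\<mu>2 s)" "sets (\<mu>1 s) = sets borel" "sets (\<mu>2 s) = sets borel" for s
      using k by (auto simp: finite_kernel_def)
    have len: "length (ind_list ind (?q i)) = n" using ps i by (simp add: ind_list_def)
    have inner_eq: "fact n * ((\<integral>z. Q z ?y \<partial>\<mu>1 s) - (\<integral>z. Q z ?y \<partial>\<mu>2 s)) = (if s < t then ?J i s else 0)" if s: "0 \<le> s" for s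
    proof (cases "s < t")
      case True
      \<comment> \<open>By \<open>duhamel_kernel\<close> the signed measure with this density has
        the rectangle transform of \<open>\<mu>1 s - \<mu>2 s\<close>, so the two integrate
        \<open>Q\<close> alike.\<close>
      let ?\<beta> = "\<lambda>z. heat_kernel (t - s) (x - z) * B (?q i) s z / fact n"
      have "(\<integral>z. Q z ?y \<partial>\<mu>1 s) - (\<integral>z. Q z ?y \<partial>\<mu>2 s) = (\<integral>z. ?\<beta> z * Q z ?y \<partial>lborel)"
      proof (rule rect_transform_signed_unique)
        show "integrable lborel ?\<beta>"
          unfolding B_def by (intro integrable_divide kernel_test_integrable s True)
        show "integrable lborel (\<lambda>z. ?\<beta> z * Q z ?y)"
          using integrable_divide[OF int[OF i s True], of "fact n"] by (simp add: mult_ac)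
        show "(\<integral>z. rect_ind z y \<partial>\<mu>1 s) - (\<integral>z. rect_ind z y \<partial>\<mu>2 s) = (\<integral>z. ?\<beta> z * rect_ind z y \<partial>lborel)" for y
        proof -
          have "fact n * inner (hh n s y) (tens (ind_list ind (?q i))) = (\<integral>z. heat_kernel (t - s) (x - z) * B (?q i) s z * rect_ind z y \<partial>lborel)"
            unfolding B_def by (rule duhamel_kernel[OF hh(1)[OF s] hh(2)[OF s] len s True])
          also have "\<dots> = (\<integral>z. fact n * (?\<beta> z * rect_ind z y) \<partial>lborel)"
            by (intro Bochner_Integration.integral_cong) auto
          finally show ?thesis unfolding rep[OF s, symmetric] by (simp add: field_simps)
        qed
      qed (use fin Qi[OF s] in auto)
      also have "\<dots> = (\<integral>z. (heat_kernel (t - s) (x - z) * (Q z ?y * B (?q i) s z)) / fact n \<partial>lborel)"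
        by (intro Bochner_Integration.integral_cong) (auto simp: mult_ac)
      finally show ?thesis using True by simp
    next
      case False
      \<comment> \<open>After time \<open>t\<close> the indicator vanishes, at \<open>s = t\<close>
        the heat kernel does by its value at time \<open>0\<close>. The measures representing the
        zero function may still be nonzero, but they cancel.\<close>
      have "duhamel_field u t x s y \<omega> = 0" for y \<omega>
      proof (cases "s = t")
        case True
        then show ?thesis by (simp add: duhamel_field_def heat_kernel_def)
      next
        case False
        then show ?thesis using \<open>\<not> s < t\<close> by (simp add: duhamel_field_def)
      qed
      then have z: "inner (hh n s y) (tens (replicate n g)) = 0" for y g using hh(2)[OF s, of y n g] by simp
      have z0: "inner (hh n s y) (tens (ind_list ind (?q i))) = 0" for y
        using polarization[OF T hh(1)[OF s, of n y] len] by (simp add: z)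
      have r0: "(\<integral>z. rect_ind z y \<partial>\<mu>1 s) - (\<integral>z. rect_ind z y \<partial>\<mu>2 s) = 0" for y
        using rep[OF s, of y] z0[of y] by linarith
      have "(\<integral>z. Q z ?y \<partial>\<mu>1 s) - (\<integral>z. Q z ?y \<partial>\<mu>2 s) = (\<integral>z. 0 * Q z ?y \<partial>lborel)"
        by (rule rect_transform_signed_unique[where \<beta>="\<lambda>z. 0", OF fin]) (simp_all only: r0 Qi[OF s] mult_zero_left integral_zero integrable_zero simp_thms Bochner_Integration.integral_zero)
      then show ?thesis using False by simp
    qed
    have "fact n * c i = (LINT s:{0..}|lborel. fbm_cov_deriv H s ?r * (fact n * ((\<integral>z. Q z ?y \<partial>\<mu>1 s) - (\<integral>z. Q z ?y \<partial>\<mu>2 s))))"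
      unfolding ceq by (subst set_integral_mult_right[symmetric]) (simp add: mult_ac)
    also have "\<dots> = (LINT s:{0..t}|lborel. fbm_cov_deriv H s ?r * ?J i s)"
      unfolding set_lebesgue_integral_def
    proof (intro Bochner_Integration.integral_cong refl)
      fix s :: real
      have "?J i t = 0" by (simp add: heat_kernel_def)
      then show "indicat_real {0..} s *\<^sub>R (fbm_cov_deriv H s ?r * (fact n * ((\<integral>z. Q z ?y \<partial>\<mu>1 s) - (\<integral>z. Q z ?y \<partial>\<mu>2 s)))) =
         indicat_real {0..t} s *\<^sub>R (fbm_cov_deriv H s ?r * ?J i s)"
        using inner_eq[of s] by (cases "s = t") (auto simp: indicator_def)
    qed
    finally show ?thesis .
  qed
  have "B ps t x = fact (Suc n) * inner (F (Suc n)) (tens (ind_list ind ps))"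
    unfolding B_def using ps by (intro kernel_test_eq[OF F(1,2)]) (simp add: ind_list_def)
  also have "\<dots> = fact n * (\<Sum>i\<le>n. c i)" unfolding Fc by (simp add: field_simps del: of_nat_Suc)
  also have "\<dots> = (\<Sum>i\<le>n. fact n * c i)" by (rule sum_distrib_left)
  also have "\<dots> = (\<Sum>i\<le>n. LINT s:{0..t}|lborel. fbm_cov_deriv H s (fst (ps ! i)) * ?J i s)"
    by (intro sum.cong refl ci) auto
  finally show ?thesis .
qed

end

end

section \<open>The heat flow on functions of exponential growth\<close>

text \<open>The family is multiplicative in \<open>a\<close>, so a product of \<open>m\<close>
  factors \<open>Q\<close>, each within the weight of rate \<open>1\<close>, stays within the weight
  of rate \<open>m\<close>.\<close>

definition exp_weight :: "real \<Rightarrow> real ^ 'd \<Rightarrow> real" where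
  "exp_weight a z = exp (a * norm z)"

lemma exp_weight_pos [simp]: "0 < exp_weight a z" "0 \<le> exp_weight a z" "exp_weight a z \<noteq> 0"
  by (auto simp: exp_weight_def)

lemma exp_weight_measurable [measurable]: "exp_weight a \<in> borel_measurable borel"
  unfolding exp_weight_def by measurable

lemma exp_weight_add: "exp_weight (a + b) z = exp_weight a z * exp_weight b z"
  by (simp add: exp_weight_def distrib_right exp_add)

lemma exp_weight_mono: "a \<le> b \<Longrightarrow> exp_weight a z \<le> exp_weight b z"
  by (simp add: exp_weight_def mult_right_mono)

lemma exp_weight_ge_1: "0 \<le> a \<Longrightarrow> 1 \<le> exp_weight a z"
  by (simp add: exp_weight_def)

text \<open>One constant for all times up to \<open>T\<close>: it dominates the factors in both
  weighted kernel estimates, with and without the modulus. The first argument only carries the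
  dimension.\<close>

definition heat_const :: "'d itself \<Rightarrow> real \<Rightarrow> real \<Rightarrow> real" where
  "heat_const _ a T = 2 powr (real CARD('d) / 2) * exp ((a * sqrt T + 1)\<^sup>2)"

lemma heat_const_ge:
  assumes "0 \<le> a" "0 \<le> \<tau>" "\<tau> \<le> T"
  shows "2 powr (real CARD('d::finite) / 2) * exp ((a * sqrt \<tau> + 1)\<^sup>2) \<le> heat_const TYPE('d) a T"
    "2 powr (real CARD('d) / 2) * exp (a\<^sup>2 * \<tau>) \<le> heat_const TYPE('d) a T" "1 \<le> heat_const TYPE('d) a T"
proof -
  have "a * sqrt \<tau> + 1 \<le> a * sqrt T + 1" using assms by (simp add: mult_left_mono)
  moreover have nn: "0 \<le> a * sqrt \<tau>" using assms by simp
  ultimately have "(a * sqrt \<tau> + 1)\<^sup>2 \<le> (a * sqrt T + 1)\<^sup>2" by (intro power_mono) auto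
  then show 1: "2 powr (real CARD('d::finite) / 2) * exp ((a * sqrt \<tau> + 1)\<^sup>2) \<le> heat_const TYPE('d) a T"
    unfolding heat_const_def by simp
  have "a\<^sup>2 * \<tau> = (a * sqrt \<tau>)\<^sup>2" using assms by (simp add: power_mult_distrib)
  also have "\<dots> \<le> (a * sqrt \<tau> + 1)\<^sup>2" using nn by (intro power_mono) auto
  finally show "2 powr (real CARD('d) / 2) * exp (a\<^sup>2 * \<tau>) \<le> heat_const TYPE('d) a T"
    by (intro order_trans[OF _ 1]) simp
  have "1 * 1 \<le> 2 powr (real CARD('d) / 2) * exp ((a * sqrt T + 1)\<^sup>2)"
    by (intro mult_mono ge_one_powr_ge_zero) auto
  then show "1 \<le> heat_const TYPE('d) a T" by (simp add: heat_const_def)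
qed

lemma heat_weight_integrable:
  fixes f :: "real ^ 'd \<Rightarrow> real"
  assumes "0 < \<tau>" "0 \<le> a" and [measurable]: "f \<in> borel_measurable borel" and f: "\<And>z. \<bar>f z\<bar> \<le> C * exp_weight a z"
  shows "integrable lborel (\<lambda>z. heat_kernel \<tau> (x - z) * f z)"
proof (rule Bochner_Integration.integrable_bound)
  show "integrable lborel (\<lambda>z. C * (heat_kernel \<tau> (x - z) * exp (a * norm z)))"
    by (intro integrable_mult_right heat_kernel_weight assms)
  show "AE z in lborel. norm (heat_kernel \<tau> (x - z) * f z) \<le> norm (C * (heat_kernel \<tau> (x - z) * exp (a * norm z)))"
  proof (rule AE_I2)
    fix z
    have "heat_kernel \<tau> (x - z) * \<bar>f z\<bar> \<le> heat_kernel \<tau> (x - z) * (C * exp (a * norm z))"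
      using f[of z] by (intro mult_left_mono) (auto simp: exp_weight_def)
    then show "norm (heat_kernel \<tau> (x - z) * f z) \<le> norm (C * (heat_kernel \<tau> (x - z) * exp (a * norm z)))"
      by (auto simp: abs_mult mult_ac intro: order_trans[OF _ abs_ge_self])
         (smt (verit) abs_ge_self heat_kernel_nonneg mult_right_mono exp_ge_zero mult_nonneg_nonneg)
  qed
qed measurable

lemma heat_weight_bound:
  fixes f :: "real ^ 'd \<Rightarrow> real"
  assumes "0 < \<tau>" "\<tau> \<le> T" "0 \<le> a" "0 \<le> C" and [measurable]: "f \<in> borel_measurable borel" and f: "\<And>z. \<bar>f z\<bar> \<le> C * exp_weight a z"
  shows "\<bar>\<integral>z. heat_kernel \<tau> (x - z) * f z \<partial>lborel\<bar> \<le> C * heat_const TYPE('d) a T * exp_weight a x"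
proof -
  have "\<bar>\<integral>z. heat_kernel \<tau> (x - z) * f z \<partial>lborel\<bar> \<le> (\<integral>z. \<bar>heat_kernel \<tau> (x - z) * f z\<bar> \<partial>lborel)"
    by (rule integral_abs_bound)
  also have "\<dots> \<le> (\<integral>z. C * (heat_kernel \<tau> (x - z) * exp (a * norm z)) \<partial>lborel)"
  proof (rule integral_mono)
    show "integrable lborel (\<lambda>z. \<bar>heat_kernel \<tau> (x - z) * f z\<bar>)"
      by (intro integrable_abs heat_weight_integrable[OF assms(1,3,5) f])
    show "integrable lborel (\<lambda>z. C * (heat_kernel \<tau> (x - z) * exp (a * norm z)))"
      by (intro integrable_mult_right heat_kernel_weight assms)
    fix z
    have "heat_kernel \<tau> (x - z) * \<bar>f z\<bar> \<le> heat_kernel \<tau> (x - z) * (C * exp (a * norm z))"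
      using f[of z] by (intro mult_left_mono) (auto simp: exp_weight_def)
    then show "\<bar>heat_kernel \<tau> (x - z) * f z\<bar> \<le> C * (heat_kernel \<tau> (x - z) * exp (a * norm z))"
      by (simp add: abs_mult mult_ac)
  qed
  also have "\<dots> = C * (\<integral>z. heat_kernel \<tau> (x - z) * exp (a * norm z) \<partial>lborel)" by simp
  also have "\<dots> \<le> C * (2 powr (real CARD('d) / 2) * exp (a\<^sup>2 * \<tau>) * exp (a * norm x))"
    by (intro mult_left_mono heat_kernel_weight assms)
  also have "\<dots> \<le> C * (heat_const TYPE('d) a T * exp (a * norm x))"
    using assms by (intro mult_left_mono mult_right_mono heat_const_ge) auto
  finally show ?thesis by (simp add: exp_weight_def mult.assoc)
qed

lemma heat_semigroup_bound:
  fixes f :: "real ^ 'd \<Rightarrow> real"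
  assumes "0 \<le> \<tau>" "\<tau> \<le> T" "0 \<le> a" "0 \<le> C" and [measurable]: "f \<in> borel_measurable borel" and f: "\<And>z. \<bar>f z\<bar> \<le> C * exp_weight a z"
  shows "\<bar>heat_semigroup \<tau> f x\<bar> \<le> C * heat_const TYPE('d) a T * exp_weight a x"
proof (cases "\<tau> = 0")
  case True
  have "C * 1 * exp_weight a x \<le> C * heat_const TYPE('d) a T * exp_weight a x"
    using assms heat_const_ge(3)[of a 0 T, where 'd='d] by (intro mult_right_mono mult_left_mono) auto
  then show ?thesis using f[of x] True by (simp add: heat_semigroup_def)
next
  case False
  then show ?thesis using heat_weight_bound[OF _ assms(2-5) f] assms(1) by (simp add: heat_semigroup_def)
qed

lemma heat_semigroup_measurable [measurable]:
  fixes f :: "real ^ 'd \<Rightarrow> real"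
  assumes [measurable]: "f \<in> borel_measurable borel"
  shows "heat_semigroup \<tau> f \<in> borel_measurable borel"
proof -
  have "(\<lambda>x. \<integral>y. heat_kernel \<tau> (x - y) * f y \<partial>lborel) \<in> borel_measurable borel"
    by (intro lborel.borel_measurable_lebesgue_integral) (simp add: case_prod_unfold)
  then show ?thesis unfolding heat_semigroup_def[abs_def] by (cases "\<tau> = 0") simp_all
qed

lemma heat_semigroup_lincomb:
  fixes f g :: "real ^ 'd \<Rightarrow> real"
  assumes "0 \<le> \<tau>" "0 \<le> a" and [measurable]: "f \<in> borel_measurable borel" "g \<in> borel_measurable borel"
    and f: "\<And>z. \<bar>f z\<bar> \<le> C * exp_weight a z" and g: "\<And>z. \<bar>g z\<bar> \<le> C' * exp_weight a z"
  shows "heat_semigroup \<tau> (\<lambda>z. b * f z + c * g z) x = b * heat_semigroup \<tau> f x + c * heat_semigroup \<tau> g x"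
proof (cases "\<tau> = 0")
  case False
  then have t: "0 < \<tau>" using assms by simp
  have "(\<lambda>z. heat_kernel \<tau> (x - z) * (b * f z + c * g z)) = (\<lambda>z. b * (heat_kernel \<tau> (x - z) * f z) + c * (heat_kernel \<tau> (x - z) * g z))"
    by (auto simp: fun_eq_iff algebra_simps)
  then show ?thesis using False heat_weight_integrable[OF t assms(2,3) f, of x] heat_weight_integrable[OF t assms(2,4) g, of x]
    by (simp add: heat_semigroup_def)
qed (simp add: heat_semigroup_def)

lemma heat_semigroup_compose:
  fixes f :: "real ^ 'd \<Rightarrow> real"
  assumes st: "0 \<le> s" "0 \<le> t" and a: "0 \<le> a" and [measurable]: "f \<in> borel_measurable borel"
    and f: "\<And>z. \<bar>f z\<bar> \<le> C * exp_weight a z"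
  shows "heat_semigroup s (heat_semigroup t f) x = heat_semigroup (s + t) f x"
proof (cases "s = 0 \<or> t = 0")
  case True
  have "heat_semigroup 0 g = g" for g :: "real ^ 'd \<Rightarrow> real" by (simp add: heat_semigroup_def fun_eq_iff)
  then show ?thesis using True by (auto simp: heat_semigroup_def)
next
  case False
  then have s: "0 < s" and t: "0 < t" using st by auto
  let ?g = "\<lambda>(y, z). heat_kernel s (x - y) * heat_kernel t (y - z) * f z"
  have C: "0 \<le> C" using f[of 0] exp_weight_pos(1)[of a "0::real^'d"] by (smt (verit) zero_le_mult_iff)
  have gi: "integrable (lborel \<Otimes>\<^sub>M lborel) ?g"
  proof (rule lborel_pair.Fubini_integrable)
    show "?g \<in> borel_measurable (lborel \<Otimes>\<^sub>M lborel)" by (simp add: case_prod_unfold)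
    show "AE y in lborel. integrable lborel (\<lambda>z. ?g (y, z))"
      unfolding prod.case mult.assoc by (intro AE_I2 integrable_mult_right heat_weight_integrable[OF t a _ f]) simp
    show "integrable lborel (\<lambda>y. \<integral>z. norm (?g (y, z)) \<partial>lborel)"
    proof (rule Bochner_Integration.integrable_bound)
      show "integrable lborel (\<lambda>y. (C * heat_const TYPE('d) a t) * (heat_kernel s (x - y) * exp (a * norm y)))"
        by (intro integrable_mult_right heat_kernel_weight s a)
      show "AE y in lborel. norm (\<integral>z. norm (?g (y, z)) \<partial>lborel) \<le> norm ((C * heat_const TYPE('d) a t) * (heat_kernel s (x - y) * exp (a * norm y)))"
      proof (rule AE_I2)
        fix y
        have "(\<integral>z. norm (?g (y, z)) \<partial>lborel) = heat_kernel s (x - y) * (\<integral>z. heat_kernel t (y - z) * \<bar>f z\<bar> \<partial>lborel)"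
          by (simp add: abs_mult mult.assoc)
        also have "\<dots> \<le> heat_kernel s (x - y) * \<bar>\<integral>z. heat_kernel t (y - z) * \<bar>f z\<bar> \<partial>lborel\<bar>"
          by (intro mult_left_mono) auto
        also have "\<dots> \<le> heat_kernel s (x - y) * (C * heat_const TYPE('d) a t * exp_weight a y)"
          using f by (intro mult_left_mono heat_weight_bound t a C) auto
        finally have "(\<integral>z. norm (?g (y, z)) \<partial>lborel) \<le> (C * heat_const TYPE('d) a t) * (heat_kernel s (x - y) * exp (a * norm y))"
          by (simp add: exp_weight_def mult_ac)
        moreover have "0 \<le> (\<integral>z. norm (?g (y, z)) \<partial>lborel)" by simp
        ultimately show "norm (\<integral>z. norm (?g (y, z)) \<partial>lborel) \<le> norm ((C * heat_const TYPE('d) a t) * (heat_kernel s (x - y) * exp (a * norm y)))"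
          unfolding real_norm_def by linarith
      qed
      show "(\<lambda>y. \<integral>z. norm (?g (y, z)) \<partial>lborel) \<in> borel_measurable lborel"
        by (intro lborel.borel_measurable_lebesgue_integral) (simp add: case_prod_unfold)
    qed
  qed
  have "heat_semigroup s (heat_semigroup t f) x = (\<integral>y. (\<integral>z. ?g (y, z) \<partial>lborel) \<partial>lborel)"
    using s t by (simp add: heat_semigroup_def mult.assoc)
  also have "\<dots> = (\<integral>z. (\<integral>y. ?g (y, z) \<partial>lborel) \<partial>lborel)"
    using lborel_pair.Fubini_integral[of "\<lambda>y z. ?g (y, z)"] gi by simp
  also have "\<dots> = (\<integral>z. heat_kernel (s + t) (x - z) * f z \<partial>lborel)"
    by (simp add: heat_kernel_convolution(2)[OF s t] mult.commute[of _ "f _"])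
  finally show ?thesis using s t by (simp add: heat_semigroup_def)
qed

lemma heat_semigroup_mono:
  fixes f g :: "real ^ 'd \<Rightarrow> real"
  assumes "0 \<le> \<tau>" "0 \<le> a" and [measurable]: "f \<in> borel_measurable borel" "g \<in> borel_measurable borel"
    and fg: "\<And>z. \<bar>f z\<bar> \<le> g z" and g: "\<And>z. \<bar>g z\<bar> \<le> C * exp_weight a z"
  shows "\<bar>heat_semigroup \<tau> f x\<bar> \<le> heat_semigroup \<tau> g x"
proof (cases "\<tau> = 0")
  case True
  then show ?thesis using fg by (simp add: heat_semigroup_def)
next
  case False
  then have t: "0 < \<tau>" using assms by simp
  have f: "\<bar>f z\<bar> \<le> C * exp_weight a z" for z using fg[of z] g[of z] by simp
  have "\<bar>\<integral>z. heat_kernel \<tau> (x - z) * f z \<partial>lborel\<bar> \<le> (\<integral>z. \<bar>heat_kernel \<tau> (x - z) * f z\<bar> \<partial>lborel)"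
    by (rule integral_abs_bound)
  also have "\<dots> \<le> (\<integral>z. heat_kernel \<tau> (x - z) * g z \<partial>lborel)"
    by (intro integral_mono integrable_abs heat_weight_integrable[OF t assms(2,3) f] heat_weight_integrable[OF t assms(2,4) g])
       (simp add: abs_mult fg mult_left_mono)
  finally show ?thesis using False by (simp add: heat_semigroup_def)
qed

text \<open>The function \<open>exp_weight a\<close> is convex and even about every point, so the heat flow
  does not decrease it.\<close>

lemma heat_semigroup_weight_ge:
  assumes "0 \<le> \<tau>" "0 \<le> a"
  shows "exp_weight a (x :: real ^ 'd) \<le> heat_semigroup \<tau> (exp_weight a) x"
proof (cases "\<tau> = 0")
  case True
  then show ?thesis by (simp add: heat_semigroup_def)
next
  case False
  then have t: "0 < \<tau>" using assms by simp
  let ?f = "\<lambda>z. heat_kernel \<tau> (x - z) * exp_weight a z"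
  have int: "integrable lborel ?f"
    using heat_weight_integrable[OF t assms(2), of "exp_weight a" 1 x] by simp
  have fm [measurable]: "?f \<in> borel_measurable borel" by measurable
  have p: "(\<integral>y. ?f (x + 1 *\<^sub>R y) \<partial>lborel) = (\<integral>z. ?f z \<partial>lborel)" "integrable lborel (\<lambda>y. ?f (x + 1 *\<^sub>R y))"
    using lborel_integral_shift_reflect[of 1, OF _ fm, of x] int by simp_all
  have m: "(\<integral>y. ?f (x + (-1) *\<^sub>R y) \<partial>lborel) = (\<integral>z. ?f z \<partial>lborel)" "integrable lborel (\<lambda>y. ?f (x + (-1) *\<^sub>R y))"
    using lborel_integral_shift_reflect[of "-1", OF _ fm, of x] int by simp_all
  have "2 * exp_weight a x = (\<integral>y. 2 * exp_weight a x * heat_kernel \<tau> (y :: real ^ 'd) \<partial>lborel)"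
    using heat_kernel_integral0(2)[OF t, where 'd='d] by simp
  also have "\<dots> \<le> (\<integral>y. ?f (x + 1 *\<^sub>R y) + ?f (x + (-1) *\<^sub>R y) \<partial>lborel)"
  proof (rule integral_mono)
    show "integrable lborel (\<lambda>y. 2 * exp_weight a x * heat_kernel \<tau> (y :: real ^ 'd))"
      using heat_kernel_integral0(1)[OF t, where 'd='d] by simp
    show "integrable lborel (\<lambda>y. ?f (x + 1 *\<^sub>R y) + ?f (x + (-1) *\<^sub>R y))"
      using p m by (intro Bochner_Integration.integrable_add)
    fix y
    have "2 * norm x \<le> norm (x + y) + norm (x - y)"
    proof -
      have "2 *\<^sub>R x = (x + y) + (x - y)" by (simp add: scaleR_2)
      then have "norm (2 *\<^sub>R x) \<le> norm (x + y) + norm (x - y)" by (metis norm_triangle_ineq)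
      then show ?thesis by simp
    qed
    then have "2 * (a * norm x) \<le> a * norm (x + y) + a * norm (x - y)"
      using mult_left_mono[OF _ assms(2)] by (simp add: distrib_left[symmetric] mult.left_commute)
    \<comment> \<open>Convexity of the exponential in the form of the inequality between the
      geometric and the arithmetic mean of \<open>?u\<^sup>2\<close> and
      \<open>?v\<^sup>2\<close>.\<close>
    then have "2 * exp (a * norm x) \<le> exp (a * norm (x + y)) + exp (a * norm (x - y))"
    proof -
      assume h: "2 * (a * norm x) \<le> a * norm (x + y) + a * norm (x - y)"
      let ?u = "exp (a * norm (x + y) / 2)" and ?v = "exp (a * norm (x - y) / 2)"
      have "exp (a * norm x) \<le> exp (a * norm (x + y) / 2 + a * norm (x - y) / 2)" using h by simp
      also have "\<dots> = ?u * ?v" by (rule exp_add)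
      finally have "2 * exp (a * norm x) \<le> 2 * ?u * ?v" by simp
      also have "\<dots> \<le> ?u\<^sup>2 + ?v\<^sup>2" by (rule sum_squares_bound)
      also have "\<dots> = exp (a * norm (x + y)) + exp (a * norm (x - y))" by (simp add: exp_double[symmetric])
      finally show ?thesis .
    qed
    from mult_left_mono[OF this heat_kernel_nonneg[of \<tau> y]]
    show "2 * exp_weight a x * heat_kernel \<tau> y \<le> ?f (x + 1 *\<^sub>R y) + ?f (x + (-1) *\<^sub>R y)"
      by (simp add: exp_weight_def distrib_left mult_ac)
  qed
  also have "\<dots> = 2 * (\<integral>z. ?f z \<partial>lborel)" using p m by (subst Bochner_Integration.integral_add) auto
  finally show ?thesis using False by (simp add: heat_semigroup_def)
qed

section \<open>The kernel recursion and its time discretization\<close>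

text \<open>In a time step, \<open>vs\<close> are the rectangles paired with the noise of the
  current slab, \<open>ss\<close> those left to the earlier slabs.\<close>

fun splits :: "'a list \<Rightarrow> ('a list \<times> 'a list) list" where
  "splits [] = [([], [])]"
| "splits (p # ps) = map (\<lambda>(vs, ss). (p # vs, ss)) (splits ps) @ map (\<lambda>(vs, ss). (vs, p # ss)) (splits ps)"

lemma splits_prod_list_add:
  fixes v S :: "'a \<Rightarrow> real"
  shows "(\<Prod>p\<leftarrow>ps. v p + S p) = (\<Sum>(vs, ss)\<leftarrow>splits ps. (\<Prod>p\<leftarrow>vs. v p) * (\<Prod>p\<leftarrow>ss. S p))"
  by (induction ps) (simp_all add: distrib_right o_def case_prod_unfold sum_list_addf sum_list_const_mult[symmetric] mult_ac)

lemma splits_length: "(vs, ss) \<in> set (splits ps) \<Longrightarrow> length vs + length ss = length ps"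
  by (induction ps arbitrary: vs ss) auto

lemma splits_set: "(vs, ss) \<in> set (splits ps) \<Longrightarrow> set vs \<subseteq> set ps \<and> set ss \<subseteq> set ps"
  by (induction ps arbitrary: vs ss) fastforce+

lemma splits_0:
  fixes G :: "'a list \<Rightarrow> 'a list \<Rightarrow> real"
  shows "(\<Sum>(vs, ss)\<leftarrow>filter (\<lambda>(vs, ss). length vs = 0) (splits ps). G vs ss) = G [] ps"
  by (induction ps arbitrary: G) (simp_all add: filter_map o_def case_prod_unfold)

lemma splits_1:
  fixes G :: "'a list \<Rightarrow> 'a list \<Rightarrow> real"
  shows "(\<Sum>(vs, ss)\<leftarrow>filter (\<lambda>(vs, ss). length vs = 1) (splits ps). G vs ss)
    = (\<Sum>i<length ps. G [ps ! i] (take i ps @ drop (Suc i) ps))"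
proof (induction ps arbitrary: G)
  case (Cons p ps)
  have "(\<Sum>(vs, ss)\<leftarrow>filter (\<lambda>(vs, ss). length vs = 1) (splits (p # ps)). G vs ss)
    = (\<Sum>(vs, ss)\<leftarrow>filter (\<lambda>(vs, ss). length vs = 0) (splits ps). G (p # vs) ss)
    + (\<Sum>(vs, ss)\<leftarrow>filter (\<lambda>(vs, ss). length vs = 1) (splits ps). G vs (p # ss))"
    by (simp add: filter_map o_def case_prod_unfold)
  also have "\<dots> = G [p] ps + (\<Sum>i<length ps. G [ps ! i] (p # take i ps @ drop (Suc i) ps))"
    unfolding splits_0[of "\<lambda>vs. G (p # vs)"] Cons.IH[of "\<lambda>vs ss. G vs (p # ss)"] ..
  also have "\<dots> = (\<Sum>i<length (p # ps). G [(p # ps) ! i] (take i (p # ps) @ drop (Suc i) (p # ps)))"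
    by (simp add: sum.lessThan_Suc_shift del: sum.lessThan_Suc)
  finally show ?case .
qed simp

text \<open>The term without an entry in \<open>vs\<close> is the heat flow, those with one entry
  mirror the kernel recursion; from two entries on the terms are of higher order in the step and
  belong to the error.\<close>

lemma splits_decompose:
  fixes G :: "'a list \<Rightarrow> 'a list \<Rightarrow> real"
  shows "(\<Sum>(vs, ss)\<leftarrow>splits ps. G vs ss) = G [] ps + (\<Sum>i<length ps. G [ps ! i] (take i ps @ drop (Suc i) ps))
    + (\<Sum>(vs, ss)\<leftarrow>filter (\<lambda>(vs, ss). 2 \<le> length vs) (splits ps). G vs ss)"
proof -
  have "(\<Sum>(vs, ss)\<leftarrow>xs. G vs ss) = (\<Sum>(vs, ss)\<leftarrow>filter (\<lambda>(vs, ss). length vs = 0) xs. G vs ss)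
     + (\<Sum>(vs, ss)\<leftarrow>filter (\<lambda>(vs, ss). length vs = 1) xs. G vs ss)
     + (\<Sum>(vs, ss)\<leftarrow>filter (\<lambda>(vs, ss). 2 \<le> length vs) xs. G vs ss)" for xs
  proof (induction xs)
    case (Cons x xs)
    obtain vs ss where x: "x = (vs, ss)" by (cases x)
    consider "length vs = 0" | "length vs = 1" | "2 \<le> length vs" by linarith
    then show ?case by cases (use Cons in \<open>auto simp: x\<close>)
  qed simp
  from this[of "splits ps"] show ?thesis unfolding splits_0 splits_1 .
qed

lemma abs_sum_list_le: "\<bar>\<Sum>x\<leftarrow>xs. f x\<bar> \<le> real (length xs) * c" if "\<And>x. x \<in> set xs \<Longrightarrow> \<bar>f x\<bar> \<le> (c::real)" for f :: "'a \<Rightarrow> real"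
  using that
proof (induction xs)
  case (Cons x xs)
  then have "\<bar>f x\<bar> \<le> c" "\<bar>\<Sum>x\<leftarrow>xs. f x\<bar> \<le> real (length xs) * c" by auto
  then show ?case by (auto simp: algebra_simps)
qed simp

lemma length_splits: "length (splits ps) = 2 ^ length ps"
  by (induction ps) auto

text \<open>\<open>B ps\<close> is a symmetric kernel tested against the rectangles \<open>ps\<close>; the factors \<open>a p\<close> and \<open>q p\<close>
  are the contributions of the rectangle \<open>p\<close> to the covariance in time and in space.\<close>

locale feynman_kac_scheme =
  fixes T H \<alpha> L R K :: real and \<rho> :: "real \<Rightarrow> real" and a :: "'p \<Rightarrow> real \<Rightarrow> real"
    and q :: "'p \<Rightarrow> real ^ 'd \<Rightarrow> real" and P :: "'p set" and u0 :: "real ^ 'd \<Rightarrow> real"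
    and B :: "'p list \<Rightarrow> real \<Rightarrow> real ^ 'd \<Rightarrow> real"
  assumes T: "0 < T" and H: "0 < H" and \<alpha>: "0 < \<alpha>" "\<alpha> \<le> 1" and L: "0 \<le> L" and R: "0 \<le> R"
    and a_meas [measurable]: "\<And>p. p \<in> P \<Longrightarrow> a p \<in> borel_measurable borel"
    and a_le: "\<And>p s. p \<in> P \<Longrightarrow> \<bar>a p s\<bar> \<le> \<rho> s"
    and \<rho>_int: "\<And>b c. 0 \<le> b \<Longrightarrow> b \<le> c \<Longrightarrow> set_integrable lborel {b..c} \<rho>"
    and \<rho>_le: "\<And>b c. 0 \<le> b \<Longrightarrow> b \<le> c \<Longrightarrow> (LINT s:{b..c}|lborel. \<rho> s) \<le> R * (c - b) powr (2 * H)"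
    and \<rho>_nonneg: "\<And>s. 0 \<le> \<rho> s"
    and q_le: "\<And>p z. p \<in> P \<Longrightarrow> \<bar>q p z\<bar> \<le> L * exp_weight 1 z"
    and q_holder: "\<And>p z z'. p \<in> P \<Longrightarrow> \<bar>q p z - q p z'\<bar> \<le> L * norm (z - z') powr \<alpha>"
    and q_meas [measurable]: "\<And>p. p \<in> P \<Longrightarrow> q p \<in> borel_measurable borel"
    and u0_meas [measurable]: "u0 \<in> borel_measurable borel" and u0_le: "\<And>z. \<bar>u0 z\<bar> \<le> K"
    and B_meas: "\<And>ps. (\<lambda>(s, z). B ps s z) \<in> borel_measurable (borel \<Otimes>\<^sub>M borel)"
    and B_Nil: "\<And>s z. 0 \<le> s \<Longrightarrow> B [] s z = heat_semigroup s u0 z"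
    and B_Suc: "\<And>ps n t x. set ps \<subseteq> P \<Longrightarrow> length ps = Suc n \<Longrightarrow> 0 \<le> t \<Longrightarrow>
      (\<And>i s. i \<le> n \<Longrightarrow> 0 \<le> s \<Longrightarrow> s < t \<Longrightarrow>
        integrable lborel (\<lambda>z. heat_kernel (t - s) (x - z) * (q (ps ! i) z * B (take i ps @ drop (Suc i) ps) s z))) \<Longrightarrow>
      B ps t x = (\<Sum>i\<le>n. LINT s:{0..t}|lborel. a (ps ! i) s *
        (\<integral>z. heat_kernel (t - s) (x - z) * (q (ps ! i) z * B (take i ps @ drop (Suc i) ps) s z) \<partial>lborel))"
begin

section \<open>Growth and time regularity of the kernels\<close>

lemma B_measurable [measurable (raw)]:
  assumes [measurable]: "f \<in> borel_measurable N" "g \<in> borel_measurable N"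
  shows "(\<lambda>w. B ps (f w) (g w)) \<in> borel_measurable N"
  using measurable_compose[OF measurable_Pair[OF assms] B_meas] by simp

text \<open>The spatial integral of the recursion, with \<open>s\<close> the final time and
  \<open>r\<close> the time of integration. At \<open>r = s\<close> it is \<open>0\<close> by the
  value of the heat kernel at time \<open>0\<close>, and has nothing to do with the limit from
  below.\<close>

definition J :: "real \<Rightarrow> 'p \<Rightarrow> 'p list \<Rightarrow> real \<Rightarrow> real ^ 'd \<Rightarrow> real" where
  "J s p ps r x = (\<integral>z. heat_kernel (s - r) (x - z) * (q p z * B ps r z) \<partial>lborel)"

lemma J_measurable [measurable (raw)]:
  assumes [measurable]: "p \<in> P" "f \<in> borel_measurable N" "g \<in> borel_measurable N"
  shows "(\<lambda>w. J s p ps (f w) (g w)) \<in> borel_measurable N"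
proof -
  have [measurable]: "q p \<in> borel_measurable borel" by (rule q_meas) fact
  show ?thesis unfolding J_def
    by (intro lborel.borel_measurable_lebesgue_integral) (simp add: case_prod_unfold)
qed

lemma u0_weight: "\<bar>u0 z\<bar> \<le> K * exp_weight 0 z"
  using u0_le[of z] by (simp add: exp_weight_def)

lemma K_nonneg: "0 \<le> K"
  using u0_le[of 0] by linarith

text \<open>Holds without measurability or integrability of \<open>f\<close>, the integral being
  \<open>0\<close> by convention when \<open>f\<close> is not integrable. The right end point is
  exempt, since \<open>J\<close> degenerates there.\<close>

lemma LINT_bound:
  assumes bc: "0 \<le> b" "b \<le> c" and D: "0 \<le> D" and f: "\<And>s. s \<in> {b..<c} \<Longrightarrow> \<bar>f s\<bar> \<le> D * \<rho> s"
  shows "\<bar>LINT s:{b..c}|lborel. f s\<bar> \<le> D * (LINT s:{b..c}|lborel. \<rho> s)"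
proof (cases "set_integrable lborel {b..c} f")
  case True
  have "\<bar>LINT s:{b..c}|lborel. f s\<bar> \<le> (LINT s:{b..c}|lborel. \<bar>f s\<bar>)"
    using set_integral_norm_bound[OF True] by simp
  also have "\<dots> \<le> (LINT s:{b..c}|lborel. D * \<rho> s)"
    unfolding set_lebesgue_integral_def
  proof (rule integral_mono_AE)
    show "integrable lborel (\<lambda>s. indicator {b..c} s *\<^sub>R \<bar>f s\<bar>)"
      using set_integrable_abs[OF True] by (simp add: set_integrable_def)
    show "integrable lborel (\<lambda>s. indicator {b..c} s *\<^sub>R (D * \<rho> s))"
      using set_integrable_mult_right[OF \<rho>_int[OF bc], of D] by (simp add: set_integrable_def)
    show "AE s in lborel. indicat_real {b..c} s *\<^sub>R \<bar>f s\<bar> \<le> indicat_real {b..c} s *\<^sub>R (D * \<rho> s)"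
      using AE_lborel_singleton[of c] by eventually_elim (use f in \<open>auto simp: indicator_def\<close>)
  qed
  finally show ?thesis by simp
next
  case False
  then have "(LINT s:{b..c}|lborel. f s) = 0"
    unfolding set_lebesgue_integral_def set_integrable_def by (rule not_integrable_integral_eq)
  moreover have "0 \<le> (LINT s:{b..c}|lborel. \<rho> s)"
    unfolding set_lebesgue_integral_def using \<rho>_nonneg by (intro Bochner_Integration.integral_nonneg) auto
  ultimately show ?thesis using D by simp
qed

lemma LINT_\<rho>_nonneg: "0 \<le> (LINT s:{b..c}|lborel. \<rho> s)"
  unfolding set_lebesgue_integral_def using \<rho>_nonneg by (intro Bochner_Integration.integral_nonneg) auto

lemma qB_bound:
  assumes p: "p \<in> P" and C: "0 \<le> C" and B: "\<bar>B ps r z\<bar> \<le> C * exp_weight (real n) z"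
  shows "\<bar>q p z * B ps r z\<bar> \<le> (L * C) * exp_weight (real (Suc n)) z"
proof -
  have "\<bar>q p z\<bar> * \<bar>B ps r z\<bar> \<le> (L * exp_weight 1 z) * (C * exp_weight (real n) z)"
    using L C by (intro mult_mono q_le[OF p] B) auto
  also have "\<dots> = (L * C) * exp_weight (1 + real n) z" by (simp add: exp_weight_add mult_ac)
  finally show ?thesis by (simp add: abs_mult add.commute)
qed

lemma hc_ge_1: "1 \<le> heat_const TYPE('d) (real n) T"
  using T by (intro heat_const_ge(3)[where \<tau>=0]) auto

lemma J_bound:
  assumes p: "p \<in> P" and C: "0 \<le> C" and B: "\<And>z. \<bar>B ps r z\<bar> \<le> C * exp_weight (real n) z"
    and r: "0 \<le> r" "r \<le> s" "s \<le> T"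
  shows "\<bar>J s p ps r x\<bar> \<le> L * C * heat_const TYPE('d) (real (Suc n)) T * exp_weight (real (Suc n)) x"
proof (cases "r = s")
  case True
  then show ?thesis using L C hc_ge_1[of "Suc n"] by (simp add: J_def heat_kernel_def)
next
  case False
  have [measurable]: "q p \<in> borel_measurable borel" by (rule q_meas) fact
  show ?thesis unfolding J_def
    by (rule heat_weight_bound) (use False r L C qB_bound[OF p C B] in auto)
qed

text \<open>A growth bound at length \<open>n\<close> discharges the integrability premise of the
  recursion, so bounds and recursion can be built up together along the length.\<close>

lemma B_Suc_J:
  assumes ps: "set ps \<subseteq> P" "length ps = Suc n" and t: "0 \<le> t" and C: "0 \<le> C"
    and B: "\<And>ps' s z. length ps' = n \<Longrightarrow> set ps' \<subseteq> P \<Longrightarrow> 0 \<le> s \<Longrightarrow> s \<le> t \<Longrightarrow> \<bar>B ps' s z\<bar> \<le> C * exp_weight (real n) z"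
  shows "B ps t x = (\<Sum>i\<le>n. LINT s:{0..t}|lborel. a (ps ! i) s * J t (ps ! i) (take i ps @ drop (Suc i) ps) s x)"
  unfolding J_def
proof (rule B_Suc[OF ps t])
  fix i s assume i: "i \<le> n" and s: "0 \<le> s" "s < t"
  have p: "ps ! i \<in> P" using ps i by auto
  have [measurable]: "q (ps ! i) \<in> borel_measurable borel" by (rule q_meas[OF p])
  have ps': "length (take i ps @ drop (Suc i) ps) = n" "set (take i ps @ drop (Suc i) ps) \<subseteq> P"
    using ps i by (auto dest: in_set_takeD in_set_dropD)
  show "integrable lborel (\<lambda>z. heat_kernel (t - s) (x - z) * (q (ps ! i) z * B (take i ps @ drop (Suc i) ps) s z))"
    by (rule heat_weight_integrable[OF _ _ _ qB_bound[OF p C B[OF ps']]]) (use s in auto)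
qed

lemma remove_nth_props:
  assumes "set ps \<subseteq> P" "length ps = Suc n" "i \<le> n"
  shows "ps ! i \<in> P" "length (take i ps @ drop (Suc i) ps) = n" "set (take i ps @ drop (Suc i) ps) \<subseteq> P"
  using assms by (auto dest: in_set_takeD in_set_dropD)

text \<open>One application of the recursion brings one factor \<open>q\<close>, which raises the
  rate of the weight by one, and one integral of \<open>\<rho>\<close> over at most
  \<open>[0, T]\<close>.\<close>

lemma B_growth:
  "\<exists>C\<ge>0. \<forall>ps. length ps \<le> n \<longrightarrow> set ps \<subseteq> P \<longrightarrow> (\<forall>s z. 0 \<le> s \<longrightarrow> s \<le> T \<longrightarrow> \<bar>B ps s z\<bar> \<le> C * exp_weight (real n) z)"
proof (induction n)
  case 0
  show ?case
    using heat_semigroup_bound[OF _ _ _ K_nonneg u0_meas u0_weight, where T=T] K_nonneg hc_ge_1[of 0]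
    by (intro exI[of _ "K * heat_const TYPE('d) (real 0) T"]) (auto simp: B_Nil)
next
  case (Suc n)
  then obtain C where C: "C \<ge> 0" and CB: "\<And>ps s z. length ps \<le> n \<Longrightarrow> set ps \<subseteq> P \<Longrightarrow> 0 \<le> s \<Longrightarrow> s \<le> T \<Longrightarrow> \<bar>B ps s z\<bar> \<le> C * exp_weight (real n) z"
    by blast
  let ?D = "L * C * heat_const TYPE('d) (real (Suc n)) T"
  let ?C = "C + real (Suc n) * (?D * (R * T powr (2 * H)))"
  have D: "0 \<le> ?D" using L C hc_ge_1[of "Suc n"] by simp
  have "\<bar>B ps s z\<bar> \<le> ?C * exp_weight (real (Suc n)) z"
    if ps: "length ps \<le> Suc n" "set ps \<subseteq> P" and s: "0 \<le> s" "s \<le> T" for ps s z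
  proof (cases "length ps \<le> n")
    case True
    then have "\<bar>B ps s z\<bar> \<le> C * exp_weight (real n) z" using CB ps s by blast
    also have "\<dots> \<le> ?C * exp_weight (real (Suc n)) z"
      using C D R by (intro mult_mono exp_weight_mono) auto
    finally show ?thesis .
  next
    case False
    then have len: "length ps = Suc n" using ps by simp
    let ?q = "\<lambda>i. take i ps @ drop (Suc i) ps"
    have eq: "B ps s z = (\<Sum>i\<le>n. LINT r:{0..s}|lborel. a (ps ! i) r * J s (ps ! i) (?q i) r z)"
      using CB s by (intro B_Suc_J[OF ps(2) len s(1) C]) auto
    have "\<bar>LINT r:{0..s}|lborel. a (ps ! i) r * J s (ps ! i) (?q i) r z\<bar> \<le> ?D * exp_weight (real (Suc n)) z * (R * T powr (2 * H))"
      if i: "i \<le> n" for i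
    proof -
      note rn = remove_nth_props[OF ps(2) len i]
      have "\<bar>LINT r:{0..s}|lborel. a (ps ! i) r * J s (ps ! i) (?q i) r z\<bar> \<le> (?D * exp_weight (real (Suc n)) z) * (LINT r:{0..s}|lborel. \<rho> r)"
      proof (rule LINT_bound)
        fix r assume r: "r \<in> {0..<s}"
        have "\<bar>a (ps ! i) r\<bar> * \<bar>J s (ps ! i) (?q i) r z\<bar> \<le> \<rho> r * (?D * exp_weight (real (Suc n)) z)"
          using r s rn \<rho>_nonneg by (intro mult_mono a_le J_bound C CB) auto
        then show "\<bar>a (ps ! i) r * J s (ps ! i) (?q i) r z\<bar> \<le> ?D * exp_weight (real (Suc n)) z * \<rho> r"
          by (simp add: abs_mult mult_ac)
      qed (use s D in auto)
      also have "\<dots> \<le> (?D * exp_weight (real (Suc n)) z) * (R * T powr (2 * H))"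
      proof (rule mult_left_mono)
        have "(LINT r:{0..s}|lborel. \<rho> r) \<le> R * (s - 0) powr (2 * H)" using s by (intro \<rho>_le) auto
        also have "\<dots> \<le> R * T powr (2 * H)" using s R H by (intro mult_left_mono powr_mono2) auto
        finally show "(LINT r:{0..s}|lborel. \<rho> r) \<le> R * T powr (2 * H)" .
      qed (use D in auto)
      finally show ?thesis .
    qed
    then have "\<bar>B ps s z\<bar> \<le> (\<Sum>i\<le>n. ?D * exp_weight (real (Suc n)) z * (R * T powr (2 * H)))"
      unfolding eq by (intro order_trans[OF sum_abs] sum_mono) auto
    also have "\<dots> = (real (Suc n) * (?D * (R * T powr (2 * H)))) * exp_weight (real (Suc n)) z"
      by (simp add: mult_ac)
    also have "\<dots> \<le> ?C * exp_weight (real (Suc n)) z" using C by (intro mult_right_mono) auto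
    finally show ?thesis .
  qed
  moreover have "0 \<le> ?C" using C D R by simp
  ultimately show ?case by blast
qed

text \<open>The Duhamel formula restarted at \<open>s0\<close>. Pulled through the recursion at
  \<open>s0\<close> by Fubini, the heat flow over \<open>s - s0\<close> replaces the final time
  \<open>s0\<close> by \<open>s\<close>, by the semigroup law; what it produces is the part
  \<open>r \<le> s0\<close> of the recursion at \<open>s\<close>.\<close>

lemma flow_identity:
  assumes ps: "set ps \<subseteq> P" "length ps = Suc n" and s: "0 \<le> s0" "s0 \<le> s" "s \<le> T" and C: "0 \<le> C"
    and CB: "\<And>ps' s z. length ps' = n \<Longrightarrow> set ps' \<subseteq> P \<Longrightarrow> 0 \<le> s \<Longrightarrow> s \<le> T \<Longrightarrow> \<bar>B ps' s z\<bar> \<le> C * exp_weight (real n) z"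
  shows "B ps s x = heat_semigroup (s - s0) (B ps s0) x +
     (\<Sum>i\<le>n. LINT r:{s0..s}|lborel. a (ps ! i) r * J s (ps ! i) (take i ps @ drop (Suc i) ps) r x)"
proof (cases "s0 = s")
  case True
  have "(LINT r:{s..s}|lborel. f r) = 0" for f :: "real \<Rightarrow> real"
    unfolding set_lebesgue_integral_def
  proof (rule integral_eq_zero_AE)
    show "AE r in lborel. indicat_real {s..s} r *\<^sub>R f r = 0"
      using AE_lborel_singleton[of s] by eventually_elim auto
  qed
  then show ?thesis using True by (simp add: heat_semigroup_def)
next
  case False
  then have lt: "s0 < s" using s by simp
  let ?q = "\<lambda>i. take i ps @ drop (Suc i) ps" and ?w = "exp_weight (real (Suc n)) :: real ^ 'd \<Rightarrow> real"
  let ?D = "L * C * heat_const TYPE('d) (real (Suc n)) T" and ?p = "\<lambda>y. heat_kernel (s - s0) (x - y)"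
  have D: "0 \<le> ?D" using L C hc_ge_1[of "Suc n"] by simp
  have aJ: "\<bar>a (ps ! i) r * J t (ps ! i) (?q i) r y\<bar> \<le> (?D * ?w y) * \<rho> r" if "i \<le> n" "0 \<le> r" "r \<le> t" "t \<le> T" for i r t y
  proof -
    note rn = remove_nth_props[OF ps that(1)]
    have "\<bar>a (ps ! i) r\<bar> * \<bar>J t (ps ! i) (?q i) r y\<bar> \<le> \<rho> r * (?D * ?w y)"
      using that rn \<rho>_nonneg by (intro mult_mono a_le J_bound C CB) auto
    then show ?thesis by (simp add: abs_mult mult_ac)
  qed
  have am: "a (ps ! i) \<in> borel_measurable borel" if "i \<le> n" for i
    using remove_nth_props(1)[OF ps that] by (rule a_meas)
  have aJ_int: "set_integrable lborel {b..c} (\<lambda>r. a (ps ! i) r * J t (ps ! i) (?q i) r y)"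
    if i: "i \<le> n" and "0 \<le> b" "b \<le> c" "c \<le> t" "t \<le> T" for i b c t y
    unfolding set_integrable_def
  proof (rule Bochner_Integration.integrable_bound)
    note [measurable] = am[OF i] J_measurable[OF remove_nth_props(1)[OF ps i]]
    show "integrable lborel (\<lambda>r. indicator {b..c} r *\<^sub>R ((?D * ?w y) * \<rho> r))"
      using set_integrable_mult_right[OF \<rho>_int[OF that(2,3)], of "?D * ?w y"] by (simp add: set_integrable_def)
    show "(\<lambda>r. indicator {b..c} r *\<^sub>R (a (ps ! i) r * J t (ps ! i) (?q i) r y)) \<in> borel_measurable lborel"
      by measurable
    show "AE r in lborel. norm (indicator {b..c} r *\<^sub>R (a (ps ! i) r * J t (ps ! i) (?q i) r y)) \<le> norm (indicator {b..c} r *\<^sub>R ((?D * ?w y) * \<rho> r))"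
      using aJ[OF i _ _ that(5), of _ y] that by (intro AE_I2) (auto simp: indicator_def intro: order_trans[OF _ abs_ge_self])
  qed
  have B0: "B ps s0 y = (\<Sum>i\<le>n. LINT r:{0..s0}|lborel. a (ps ! i) r * J s0 (ps ! i) (?q i) r y)" for y
    using CB s by (intro B_Suc_J[OF ps s(1) C]) auto
  have swap: "integrable lborel (\<lambda>y. ?p y * (LINT r:{0..s0}|lborel. a (ps ! i) r * J s0 (ps ! i) (?q i) r y)) \<and>
      (\<integral>y. ?p y * (LINT r:{0..s0}|lborel. a (ps ! i) r * J s0 (ps ! i) (?q i) r y) \<partial>lborel)
      = (LINT r:{0..s0}|lborel. a (ps ! i) r * J s (ps ! i) (?q i) r x)" if i: "i \<le> n" for i
  proof -
    note rn = remove_nth_props[OF ps i]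
    note [measurable] = am[OF i] J_measurable[OF rn(1)] q_meas[OF rn(1)]
    let ?f = "\<lambda>(y, r). ?p y * (indicator {0..s0} r * (a (ps ! i) r * J s0 (ps ! i) (?q i) r y))"
    have fi: "integrable (lborel \<Otimes>\<^sub>M lborel) ?f"
    proof (rule lborel_pair.Fubini_integrable)
      show fm: "?f \<in> borel_measurable (lborel \<Otimes>\<^sub>M lborel)" unfolding case_prod_unfold by measurable
      show "AE y in lborel. integrable lborel (\<lambda>r. ?f (y, r))"
        using aJ_int[OF i, of 0 s0 s0] s by (intro AE_I2) (simp add: set_integrable_def)
      show "integrable lborel (\<lambda>y. \<integral>r. norm (?f (y, r)) \<partial>lborel)"
      proof (rule Bochner_Integration.integrable_bound)
        show "integrable lborel (\<lambda>y. (?D * (LINT r:{0..s0}|lborel. \<rho> r)) * (?p y * ?w y))"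
          using heat_kernel_weight(1)[of "s - s0" "real (Suc n)" x] lt by (simp add: exp_weight_def)
        show "(\<lambda>y. \<integral>r. norm (?f (y, r)) \<partial>lborel) \<in> borel_measurable lborel"
          using fm by measurable
        show "AE y in lborel. norm (\<integral>r. norm (?f (y, r)) \<partial>lborel) \<le> norm ((?D * (LINT r:{0..s0}|lborel. \<rho> r)) * (?p y * ?w y))"
        proof (rule AE_I2)
          fix y
          have "(\<integral>r. norm (?f (y, r)) \<partial>lborel) \<le> (\<integral>r. (?p y * (?D * ?w y)) * (indicator {0..s0} r * \<rho> r) \<partial>lborel)"
          proof (rule integral_mono)
            show "integrable lborel (\<lambda>r. norm (?f (y, r)))"
              using aJ_int[OF i, of 0 s0 s0 y] s by (intro integrable_norm) (simp add: set_integrable_def)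
            show "integrable lborel (\<lambda>r. (?p y * (?D * ?w y)) * (indicator {0..s0} r * \<rho> r))"
              using \<rho>_int[of 0 s0] s by (simp add: set_integrable_def)
            fix r
            show "norm (?f (y, r)) \<le> (?p y * (?D * ?w y)) * (indicator {0..s0} r * \<rho> r)"
              using mult_left_mono[OF aJ[OF i, of r s0 y], of "?p y"] s by (auto simp: indicator_def abs_mult mult_ac)
          qed
          also have "\<dots> = (?D * (LINT r:{0..s0}|lborel. \<rho> r)) * (?p y * ?w y)"
            by (simp add: set_lebesgue_integral_def)
          finally have "(\<integral>r. norm (?f (y, r)) \<partial>lborel) \<le> (?D * (LINT r:{0..s0}|lborel. \<rho> r)) * (?p y * ?w y)" .
          moreover have "0 \<le> (\<integral>r. norm (?f (y, r)) \<partial>lborel)" by simp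
          ultimately show "norm (\<integral>r. norm (?f (y, r)) \<partial>lborel) \<le> norm ((?D * (LINT r:{0..s0}|lborel. \<rho> r)) * (?p y * ?w y))"
            unfolding real_norm_def by linarith
        qed
      qed
    qed
    have eq: "?p y * (LINT r:{0..s0}|lborel. a (ps ! i) r * J s0 (ps ! i) (?q i) r y) = (\<integral>r. ?f (y, r) \<partial>lborel)" for y
      by (simp add: set_lebesgue_integral_def)
    have "(\<integral>y. ?p y * (LINT r:{0..s0}|lborel. a (ps ! i) r * J s0 (ps ! i) (?q i) r y) \<partial>lborel) = (\<integral>r. (\<integral>y. ?f (y, r) \<partial>lborel) \<partial>lborel)"
      unfolding eq using lborel_pair.Fubini_integral[of "\<lambda>y r. ?f (y, r)"] fi by simp
    also have "\<dots> = (LINT r:{0..s0}|lborel. a (ps ! i) r * J s (ps ! i) (?q i) r x)"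
      unfolding set_lebesgue_integral_def
    proof (rule integral_cong_AE)
      show "(\<lambda>r. \<integral>y. ?f (y, r) \<partial>lborel) \<in> borel_measurable lborel"
        by (intro lborel.borel_measurable_lebesgue_integral) (simp add: case_prod_unfold)
      show "(\<lambda>r. indicator {0..s0} r *\<^sub>R (a (ps ! i) r * J s (ps ! i) (?q i) r x)) \<in> borel_measurable lborel" by measurable
      \<comment> \<open>At \<open>r = s0\<close> the left side is \<open>0\<close> by the convention
        for the heat kernel at time \<open>0\<close>, whereas the right side need not be; the
        identity is therefore claimed almost everywhere.\<close>
      show "AE r in lborel. (\<integral>y. ?f (y, r) \<partial>lborel) = indicator {0..s0} r *\<^sub>R (a (ps ! i) r * J s (ps ! i) (?q i) r x)"
        using AE_lborel_singleton[of s0]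
      proof eventually_elim
        case (elim r)
        show ?case
        proof (cases "r \<in> {0..s0}")
          case True
          then have r: "0 \<le> r" "r < s0" using elim by auto
          let ?F = "\<lambda>z. q (ps ! i) z * B (?q i) r z"
          have Fb: "\<bar>?F z\<bar> \<le> (L * C) * ?w z" for z
            using r s by (intro qB_bound rn C CB) auto
          have "(\<integral>y. ?f (y, r) \<partial>lborel) = a (ps ! i) r * (\<integral>y. ?p y * J s0 (ps ! i) (?q i) r y \<partial>lborel)"
            using True by (simp add: mult.left_commute)
          also have "(\<integral>y. ?p y * J s0 (ps ! i) (?q i) r y \<partial>lborel) = heat_semigroup (s - s0) (heat_semigroup (s0 - r) ?F) x"
            using r lt by (simp add: heat_semigroup_def J_def)
          also have "\<dots> = heat_semigroup ((s - s0) + (s0 - r)) ?F x"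
            using r lt by (intro heat_semigroup_compose[OF _ _ _ _ Fb]) auto
          also have "\<dots> = J s (ps ! i) (?q i) r x" using r lt by (simp add: heat_semigroup_def J_def)
          finally show ?thesis using True by simp
        qed simp
      qed
    qed
    finally show ?thesis using lborel_pair.integrable_fst[of "\<lambda>y r. ?f (y, r)"] fi unfolding eq by simp
  qed
  have "heat_semigroup (s - s0) (B ps s0) x = (\<integral>y. (\<Sum>i\<le>n. ?p y * (LINT r:{0..s0}|lborel. a (ps ! i) r * J s0 (ps ! i) (?q i) r y)) \<partial>lborel)"
    using lt by (simp add: heat_semigroup_def B0 sum_distrib_left)
  also have "\<dots> = (\<Sum>i\<le>n. LINT r:{0..s0}|lborel. a (ps ! i) r * J s (ps ! i) (?q i) r x)"
    using swap by (subst Bochner_Integration.integral_sum) auto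
  finally have heat: "heat_semigroup (s - s0) (B ps s0) x = (\<Sum>i\<le>n. LINT r:{0..s0}|lborel. a (ps ! i) r * J s (ps ! i) (?q i) r x)" .
  have split: "(LINT r:{0..s}|lborel. a (ps ! i) r * J s (ps ! i) (?q i) r x) = (LINT r:{0..s0}|lborel. a (ps ! i) r * J s (ps ! i) (?q i) r x)
     + (LINT r:{s0..s}|lborel. a (ps ! i) r * J s (ps ! i) (?q i) r x)" if i: "i \<le> n" for i
  proof -
    have U: "{0..s} = {0..s0} \<union> {s0..s}" using s by auto
    show ?thesis unfolding U
    proof (rule set_integral_Un_AE)
      show "AE r in lborel. \<not> (r \<in> {0..s0} \<and> r \<in> {s0..s})"
        using AE_lborel_singleton[of s0] by eventually_elim auto
    qed (use s i in \<open>auto intro!: aJ_int\<close>)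
  qed
  have "B ps s x = (\<Sum>i\<le>n. LINT r:{0..s}|lborel. a (ps ! i) r * J s (ps ! i) (?q i) r x)"
    using CB s by (intro B_Suc_J[OF ps _ C]) auto
  then show ?thesis unfolding heat by (simp add: split sum.distrib)
qed

end

lemma heat_const_mono: "0 \<le> a \<Longrightarrow> a \<le> b \<Longrightarrow> 0 \<le> T \<Longrightarrow> heat_const TYPE('d::finite) a T \<le> heat_const TYPE('d) b T"
  unfolding heat_const_def by (intro mult_left_mono, subst exp_le_cancel_iff) (auto intro!: power_mono mult_right_mono)

context feynman_kac_scheme
begin

text \<open>With the exact length in the weight, the weights belonging to \<open>vs\<close> and to
  \<open>ss\<close> multiply to that of \<open>ps\<close> in \<open>scheme_error\<close>.\<close>

lemma B_growth_length:
  "\<exists>C\<ge>0. \<forall>ps. length ps \<le> n \<longrightarrow> set ps \<subseteq> P \<longrightarrow> (\<forall>s z. 0 \<le> s \<longrightarrow> s \<le> T \<longrightarrow> \<bar>B ps s z\<bar> \<le> C * exp_weight (real (length ps)) z)"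
proof -
  obtain c where c: "\<And>m. c m \<ge> 0" "\<And>m ps s z. length ps \<le> m \<Longrightarrow> set ps \<subseteq> P \<Longrightarrow> 0 \<le> s \<Longrightarrow> s \<le> T \<Longrightarrow> \<bar>B ps s z\<bar> \<le> c m * exp_weight (real m) z"
    using B_growth by metis
  have "\<bar>B ps s z\<bar> \<le> (\<Sum>m\<le>n. c m) * exp_weight (real (length ps)) z"
    if "length ps \<le> n" "set ps \<subseteq> P" "0 \<le> s" "s \<le> T" for ps s z
  proof -
    have "\<bar>B ps s z\<bar> \<le> c (length ps) * exp_weight (real (length ps)) z" using that by (intro c) auto
    also have "\<dots> \<le> (\<Sum>m\<le>n. c m) * exp_weight (real (length ps)) z"
      using that c(1) by (intro mult_right_mono member_le_sum) auto
    finally show ?thesis .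
  qed
  then show ?thesis using c(1) by (intro exI[of _ "\<Sum>m\<le>n. c m"]) (auto intro!: sum_nonneg)
qed

lemma B_slice_measurable [measurable]: "B ps s \<in> borel_measurable borel"
  using B_measurable[of "\<lambda>z. s" borel "\<lambda>z. z" ps] by simp

text \<open>Compared with its own heat flow, the kernel changes only through the noise collected
  between \<open>t\<close> and \<open>r\<close>, which has mass of order
  \<open>(r - t) powr (2 * H)\<close>. This comparison makes sense for an initial condition that is
  merely bounded, where the kernel itself may be irregular at time \<open>0\<close>.\<close>

lemma B_time:
  "\<exists>C\<ge>0. \<forall>ps. length ps = n \<longrightarrow> set ps \<subseteq> P \<longrightarrow> (\<forall>t r z. 0 \<le> t \<longrightarrow> t \<le> r \<longrightarrow> r \<le> T \<longrightarrow>
     \<bar>B ps r z - heat_semigroup (r - t) (B ps t) z\<bar> \<le> C * (r - t) powr (2 * H) * exp_weight (real n) z)"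
proof (cases n)
  case 0
  have "B [] r z - heat_semigroup (r - t) (B [] t) z = 0" if "0 \<le> t" "t \<le> r" for t r z
  proof -
    have "B [] t = heat_semigroup t u0" using that B_Nil by auto
    then show ?thesis
      using that heat_semigroup_compose[OF _ _ _ u0_meas u0_weight, of "r - t" t z] by (simp add: B_Nil)
  qed
  then show ?thesis using 0 by (intro exI[of _ 0]) auto
next
  case (Suc m)
  obtain C where C: "C \<ge> 0" and CB: "\<And>ps s z. length ps \<le> m \<Longrightarrow> set ps \<subseteq> P \<Longrightarrow> 0 \<le> s \<Longrightarrow> s \<le> T \<Longrightarrow> \<bar>B ps s z\<bar> \<le> C * exp_weight (real m) z"
    using B_growth[of m] by blast
  let ?D = "L * C * heat_const TYPE('d) (real (Suc m)) T"
  have D: "0 \<le> ?D" using L C hc_ge_1[of "Suc m"] by simp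
  have "\<bar>B ps r z - heat_semigroup (r - t) (B ps t) z\<bar> \<le> (real n * ?D * R) * (r - t) powr (2 * H) * exp_weight (real n) z"
    if len: "length ps = n" and ps: "set ps \<subseteq> P" and t: "0 \<le> t" "t \<le> r" "r \<le> T" for ps t r z
  proof -
    let ?q = "\<lambda>i. take i ps @ drop (Suc i) ps"
    have len': "length ps = Suc m" using len Suc by simp
    have eq: "B ps r z - heat_semigroup (r - t) (B ps t) z = (\<Sum>i\<le>m. LINT v:{t..r}|lborel. a (ps ! i) v * J r (ps ! i) (?q i) v z)"
    proof -
      have "B ps r z = heat_semigroup (r - t) (B ps t) z + (\<Sum>i\<le>m. LINT v:{t..r}|lborel. a (ps ! i) v * J r (ps ! i) (?q i) v z)"
        by (rule flow_identity[OF ps len' t C]) (rule CB, simp_all)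
      then show ?thesis by linarith
    qed
    have "\<bar>B ps r z - heat_semigroup (r - t) (B ps t) z\<bar> \<le> (\<Sum>i\<le>m. (?D * exp_weight (real n) z) * (R * (r - t) powr (2 * H)))"
      unfolding eq
    proof (intro order_trans[OF sum_abs] sum_mono)
      fix i assume "i \<in> {..m}"
      then have i: "i \<le> m" by simp
      note rn = remove_nth_props[OF ps len' i]
      have "\<bar>LINT v:{t..r}|lborel. a (ps ! i) v * J r (ps ! i) (?q i) v z\<bar> \<le> (?D * exp_weight (real n) z) * (LINT v:{t..r}|lborel. \<rho> v)"
      proof (rule LINT_bound)
        fix v assume v: "v \<in> {t..<r}"
        have "\<bar>a (ps ! i) v\<bar> * \<bar>J r (ps ! i) (?q i) v z\<bar> \<le> \<rho> v * (?D * exp_weight (real (Suc m)) z)"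
          using v t rn \<rho>_nonneg by (intro mult_mono a_le J_bound C CB) auto
        then show "\<bar>a (ps ! i) v * J r (ps ! i) (?q i) v z\<bar> \<le> ?D * exp_weight (real n) z * \<rho> v"
          by (simp add: abs_mult mult_ac Suc)
      qed (use t D in auto)
      also have "\<dots> \<le> (?D * exp_weight (real n) z) * (R * (r - t) powr (2 * H))"
        using t D by (intro mult_left_mono \<rho>_le) auto
      finally show "\<bar>LINT v:{t..r}|lborel. a (ps ! i) v * J r (ps ! i) (?q i) v z\<bar> \<le> (?D * exp_weight (real n) z) * (R * (r - t) powr (2 * H))" .
    qed
    also have "\<dots> = (real n * ?D * R) * (r - t) powr (2 * H) * exp_weight (real n) z"
      by (simp add: Suc mult_ac)
    finally show ?thesis .
  qed
  then show ?thesis using D R by (intro exI[of _ "real n * ?D * R"]) auto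
qed

definition slab :: "real \<Rightarrow> nat \<Rightarrow> 'p \<Rightarrow> real" where
  "slab h k p = (LINT s:{real k * h..real (Suc k) * h}|lborel. a p s)"

text \<open>The mass is carried through the estimates in place of its bound
  \<open>R * h powr (2 * H)\<close>: for \<open>2 * H < 1\<close> these bounds would add up to
  something that diverges with the number of steps, while the masses add up to the integral of
  \<open>\<rho>\<close>.\<close>

definition slab_mass :: "real \<Rightarrow> nat \<Rightarrow> real" where
  "slab_mass h k = (LINT s:{real k * h..real (Suc k) * h}|lborel. \<rho> s)"

text \<open>For convergence an Euler step, with at most one element in \<open>vs\<close>, would do.  Summing over all
  splittings is what makes the scheme exactly an expectation over a Gaussian random walk, of a product
  over \<open>ps\<close>.\<close>

primrec scheme :: "real \<Rightarrow> nat \<Rightarrow> 'p list \<Rightarrow> real ^ 'd \<Rightarrow> real" where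
  "scheme h 0 ps x = (if ps = [] then u0 x else 0)"
| "scheme h (Suc k) ps x = (\<Sum>(vs, ss)\<leftarrow>splits ps. (\<Prod>p\<leftarrow>vs. slab h k p * q p x) * heat_semigroup h (scheme h k ss) x)"

text \<open>The first power comes from \<open>B_time\<close>, the second from freezing
  \<open>q\<close>, Hoelder of exponent \<open>\<alpha>\<close>, over the diffusive distance
  \<open>sqrt h\<close>.\<close>

definition rate :: "real \<Rightarrow> real" where
  "rate h = h powr (2 * H) + h powr (\<alpha> / 2)"

lemma rate_nonneg: "0 \<le> rate h"
  by (simp add: rate_def)

lemma slab_mass_nonneg: "0 \<le> slab_mass h k"
  unfolding slab_mass_def by (rule LINT_\<rho>_nonneg)

lemma slab_mass_le: "0 \<le> h \<Longrightarrow> slab_mass h k \<le> R * h powr (2 * H)"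
  using \<rho>_le[of "real k * h" "real (Suc k) * h"] unfolding slab_mass_def
  by (simp add: algebra_simps)

lemma slab_le: "p \<in> P \<Longrightarrow> 0 \<le> h \<Longrightarrow> \<bar>slab h k p\<bar> \<le> slab_mass h k"
  using LINT_bound[of "real k * h" "real (Suc k) * h" 1 "a p"] a_le[of p]
  unfolding slab_def slab_mass_def by (simp add: mult_right_mono)

lemma slab_mass_sum:
  assumes "0 \<le> h"
  shows "(\<Sum>j<k. slab_mass h j) = (LINT s:{0..real k * h}|lborel. \<rho> s)"
proof (induction k)
  case 0
  show ?case unfolding set_lebesgue_integral_def
  proof (simp, rule integral_eq_zero_AE[symmetric, THEN sym])
    show "AE s in lborel. indicat_real {0} s * \<rho> s = 0"
      using AE_lborel_singleton[of 0] by eventually_elim auto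
  qed
next
  case (Suc k)
  have U: "{0..real (Suc k) * h} = {0..real k * h} \<union> {real k * h..real (Suc k) * h}"
    using assms by (auto simp: algebra_simps) (smt (verit) mult_nonneg_nonneg of_nat_0_le_iff)
  have "(LINT s:{0..real (Suc k) * h}|lborel. \<rho> s) = (LINT s:{0..real k * h}|lborel. \<rho> s) + slab_mass h k"
    unfolding slab_mass_def U
  proof (rule set_integral_Un_AE)
    show "AE r in lborel. \<not> (r \<in> {0..real k * h} \<and> r \<in> {real k * h..real (Suc k) * h})"
      using AE_lborel_singleton[of "real k * h"] by eventually_elim auto
  qed (use assms in \<open>auto intro!: \<rho>_int mult_right_mono\<close>)
  then show ?case using Suc by simp
qed

lemma sum_list_measurable [measurable (raw)]:
  fixes f :: "'z \<Rightarrow> 'w \<Rightarrow> real"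
  assumes "\<And>z. z \<in> set zs \<Longrightarrow> f z \<in> borel_measurable N"
  shows "(\<lambda>w. \<Sum>z\<leftarrow>zs. f z w) \<in> borel_measurable N"
  using assms by (induction zs) auto

lemma prod_list_measurable:
  fixes f :: "'z \<Rightarrow> 'w \<Rightarrow> real"
  assumes "\<And>z. z \<in> set zs \<Longrightarrow> f z \<in> borel_measurable N"
  shows "(\<lambda>w. \<Prod>z\<leftarrow>zs. f z w) \<in> borel_measurable N"
  using assms by (induction zs) auto

lemma scheme_measurable: "set ps \<subseteq> P \<Longrightarrow> scheme h k ps \<in> borel_measurable borel"
proof (induction k arbitrary: ps)
  case 0
  then show ?case by (cases "ps = []") (simp_all add: fun_eq_iff[symmetric] scheme.simps(1)[abs_def])
next
  case (Suc k)
  have "(\<lambda>x. (\<Prod>p\<leftarrow>fst z. slab h k p * q p x) * heat_semigroup h (scheme h k (snd z)) x) \<in> borel_measurable borel"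
    if "z \<in> set (splits ps)" for z
  proof -
    have "set (fst z) \<subseteq> P" "set (snd z) \<subseteq> P" using splits_set[of "fst z" "snd z" ps] that Suc.prems by auto
    then show ?thesis
      by (intro borel_measurable_times prod_list_measurable heat_semigroup_measurable Suc.IH borel_measurable_const q_meas) auto
  qed
  then have "(\<lambda>x. \<Sum>z\<leftarrow>splits ps. (\<Prod>p\<leftarrow>fst z. slab h k p * q p x) * heat_semigroup h (scheme h k (snd z)) x) \<in> borel_measurable borel"
    by (rule sum_list_measurable)
  moreover have "scheme h (Suc k) ps = (\<lambda>x. \<Sum>z\<leftarrow>splits ps. (\<Prod>p\<leftarrow>fst z. slab h k p * q p x) * heat_semigroup h (scheme h k (snd z)) x)"
    by (simp add: fun_eq_iff case_prod_unfold)
  ultimately show ?case by simp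
qed

lemma abs_prod_list_le:
  fixes f :: "'z \<Rightarrow> real"
  assumes "\<And>z. z \<in> set zs \<Longrightarrow> \<bar>f z\<bar> \<le> c"
  shows "\<bar>\<Prod>z\<leftarrow>zs. f z\<bar> \<le> c ^ length zs"
  using assms
proof (induction zs)
  case (Cons z zs)
  have "\<bar>f z\<bar> \<le> c" "\<bar>\<Prod>z\<leftarrow>zs. f z\<bar> \<le> c ^ length zs" using Cons by auto
  moreover from this have "0 \<le> c" by linarith
  ultimately show ?case by (simp add: abs_mult mult_mono)
qed simp

text \<open>One step of the scheme freezes the noise on a slab of length \<open>h\<close> at the current position.\<close>

lemma local_error:
  "\<exists>C\<ge>0. \<forall>p ps t h x. p \<in> P \<longrightarrow> length ps = n \<longrightarrow> set ps \<subseteq> P \<longrightarrow> 0 < h \<longrightarrow> 0 \<le> t \<longrightarrow> t + h \<le> T \<longrightarrow>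
    (\<forall>r. t \<le> r \<longrightarrow> r < t + h \<longrightarrow> \<bar>q p x * heat_semigroup h (B ps t) x - J (t + h) p ps r x\<bar> \<le> C * rate h * exp_weight (real (Suc n)) x)"
proof -
  let ?Hn = "heat_const TYPE('d) (real n) T" and ?HS = "heat_const TYPE('d) (real (Suc n)) T"
  obtain C where C: "C \<ge> 0" and CB: "\<And>ps s z. length ps \<le> n \<Longrightarrow> set ps \<subseteq> P \<Longrightarrow> 0 \<le> s \<Longrightarrow> s \<le> T \<Longrightarrow> \<bar>B ps s z\<bar> \<le> C * exp_weight (real n) z"
    using B_growth[of n] by blast
  obtain C' where C': "C' \<ge> 0" and CT: "\<And>ps t r z. length ps = n \<Longrightarrow> set ps \<subseteq> P \<Longrightarrow> 0 \<le> t \<Longrightarrow> t \<le> r \<Longrightarrow> r \<le> T \<Longrightarrow>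
     \<bar>B ps r z - heat_semigroup (r - t) (B ps t) z\<bar> \<le> C' * (r - t) powr (2 * H) * exp_weight (real n) z"
    using B_time[of n] by blast
  have Hn: "1 \<le> ?Hn" "1 \<le> ?HS" by (rule hc_ge_1)+
  let ?E = "L * C' * ?HS + L * C * ?Hn * ?Hn"
  have "\<bar>q p x * heat_semigroup h (B ps t) x - J (t + h) p ps r x\<bar> \<le> ?E * rate h * exp_weight (real (Suc n)) x"
    if p: "p \<in> P" and ps: "length ps = n" "set ps \<subseteq> P" and h: "0 < h" and t: "0 \<le> t" "t + h \<le> T" and r: "t \<le> r" "r < t + h"
    for p ps t h x r
  proof -
    let ?b = "B ps" and ?\<tau> = "t + h - r" and ?g = "heat_semigroup (r - t) (B ps t)"
    have [measurable]: "q p \<in> borel_measurable borel" by (rule q_meas[OF p])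
    have \<tau>: "0 < ?\<tau>" "?\<tau> \<le> h" "?\<tau> \<le> T" using r t h by auto
    have bt: "\<bar>?b t z\<bar> \<le> C * exp_weight (real n) z" for z using ps t h by (intro CB) auto
    have g: "\<bar>?g z\<bar> \<le> (C * ?Hn) * exp_weight (real n) z" for z
      using r t h C by (intro heat_semigroup_bound bt) auto
    have hn: "h powr (2 * H) \<le> rate h" "h powr (\<alpha> / 2) \<le> rate h" by (auto simp: rate_def)
    \<comment> \<open>\<open>f1\<close> is the error in time, \<open>f2\<close> the error of
      freezing \<open>q\<close> at \<open>x\<close>. What remains of the integrand,
      \<open>q p x * ?g\<close>, integrates exactly to the term of the scheme, by the semigroup
      law.\<close>
    define f1 where "f1 z = q p z * (?b r z - ?g z)" for z
    define f2 where "f2 z = (q p z - q p x) * ?g z" for z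
    have [measurable]: "f1 \<in> borel_measurable borel" "f2 \<in> borel_measurable borel"
      unfolding f1_def[abs_def] f2_def[abs_def] by measurable
    have f1: "\<bar>f1 z\<bar> \<le> (L * (C' * h powr (2 * H))) * exp_weight (real (Suc n)) z" for z
    proof -
      have "\<bar>?b r z - ?g z\<bar> \<le> C' * (r - t) powr (2 * H) * exp_weight (real n) z"
        using r t h ps by (intro CT) auto
      also have "\<dots> \<le> C' * h powr (2 * H) * exp_weight (real n) z"
        using r h C' H by (intro mult_right_mono mult_left_mono powr_mono2) auto
      finally have "\<bar>q p z\<bar> * \<bar>?b r z - ?g z\<bar> \<le> (L * exp_weight 1 z) * (C' * h powr (2 * H) * exp_weight (real n) z)"
        using L by (intro mult_mono q_le[OF p]) auto
      also have "\<dots> = (L * (C' * h powr (2 * H))) * exp_weight (1 + real n) z" by (simp add: exp_weight_add mult_ac)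
      finally show ?thesis by (simp add: f1_def abs_mult add.commute)
    qed
    have f2: "\<bar>f2 z\<bar> \<le> (L * C * ?Hn) * (norm (x - z) powr \<alpha> * exp (real n * norm z))" for z
    proof -
      have "\<bar>q p z - q p x\<bar> * \<bar>?g z\<bar> \<le> (L * norm (z - x) powr \<alpha>) * ((C * ?Hn) * exp_weight (real n) z)"
        using L by (intro mult_mono q_holder[OF p] g) auto
      then show ?thesis by (simp add: f2_def abs_mult exp_weight_def mult_ac norm_minus_commute)
    qed
    note f1i = heat_weight_integrable[OF \<tau>(1) _ _ f1, of x, simplified]
    note mod = heat_kernel_weight_modulus[OF \<tau>(1) of_nat_0_le_iff[of n] \<alpha>, of x]
    have f2i: "integrable lborel (\<lambda>z. heat_kernel ?\<tau> (x - z) * f2 z)"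
    proof (rule Bochner_Integration.integrable_bound)
      show "integrable lborel (\<lambda>z. (L * C * ?Hn) * (heat_kernel ?\<tau> (x - z) * (norm (x - z) powr \<alpha> * exp (real n * norm z))))"
        by (intro integrable_mult_right mod(1))
      show "AE z in lborel. norm (heat_kernel ?\<tau> (x - z) * f2 z) \<le> norm ((L * C * ?Hn) * (heat_kernel ?\<tau> (x - z) * (norm (x - z) powr \<alpha> * exp (real n * norm z))))"
      proof (rule AE_I2)
        fix z
        have "heat_kernel ?\<tau> (x - z) * \<bar>f2 z\<bar> \<le> heat_kernel ?\<tau> (x - z) * ((L * C * ?Hn) * (norm (x - z) powr \<alpha> * exp (real n * norm z)))"
          by (intro mult_left_mono f2) auto
        also have "\<dots> \<le> \<bar>(L * C * ?Hn) * (heat_kernel ?\<tau> (x - z) * (norm (x - z) powr \<alpha> * exp (real n * norm z)))\<bar>"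
          by (simp only: mult_ac abs_ge_self)
        finally show "norm (heat_kernel ?\<tau> (x - z) * f2 z) \<le> norm ((L * C * ?Hn) * (heat_kernel ?\<tau> (x - z) * (norm (x - z) powr \<alpha> * exp (real n * norm z))))"
          by (simp add: abs_mult)
      qed
    qed measurable
    have i1: "\<bar>\<integral>z. heat_kernel ?\<tau> (x - z) * f1 z \<partial>lborel\<bar> \<le> (L * (C' * h powr (2 * H))) * ?HS * exp_weight (real (Suc n)) x"
      using f1 L C' \<tau> by (intro heat_weight_bound) auto
    have i2: "\<bar>\<integral>z. heat_kernel ?\<tau> (x - z) * f2 z \<partial>lborel\<bar> \<le> (L * C * ?Hn) * (h powr (\<alpha> / 2) * ?Hn * exp_weight (real n) x)"
    proof -
      have "\<bar>\<integral>z. heat_kernel ?\<tau> (x - z) * f2 z \<partial>lborel\<bar> \<le> (\<integral>z. \<bar>heat_kernel ?\<tau> (x - z) * f2 z\<bar> \<partial>lborel)"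
        by (rule integral_abs_bound)
      also have "\<dots> \<le> (\<integral>z. (L * C * ?Hn) * (heat_kernel ?\<tau> (x - z) * (norm (x - z) powr \<alpha> * exp (real n * norm z))) \<partial>lborel)"
      proof (rule integral_mono)
        fix z
        have "heat_kernel ?\<tau> (x - z) * \<bar>f2 z\<bar> \<le> heat_kernel ?\<tau> (x - z) * ((L * C * ?Hn) * (norm (x - z) powr \<alpha> * exp (real n * norm z)))"
          by (intro mult_left_mono f2) auto
        then show "\<bar>heat_kernel ?\<tau> (x - z) * f2 z\<bar> \<le> (L * C * ?Hn) * (heat_kernel ?\<tau> (x - z) * (norm (x - z) powr \<alpha> * exp (real n * norm z)))"
          by (simp add: abs_mult mult_ac)
      qed (intro integrable_abs f2i integrable_mult_right mod(1))+
      also have "\<dots> = (L * C * ?Hn) * (\<integral>z. heat_kernel ?\<tau> (x - z) * (norm (x - z) powr \<alpha> * exp (real n * norm z)) \<partial>lborel)"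
        by simp
      also have "\<dots> \<le> (L * C * ?Hn) * (?\<tau> powr (\<alpha> / 2) * (2 powr (real CARD('d) / 2) * exp ((real n * sqrt ?\<tau> + 1)\<^sup>2)) * exp (real n * norm x))"
        using L C Hn by (intro mult_left_mono mod(2)) auto
      also have "\<dots> \<le> (L * C * ?Hn) * (h powr (\<alpha> / 2) * ?Hn * exp (real n * norm x))"
        using L C Hn \<tau> \<alpha> by (intro mult_left_mono mult_mono mult_right_mono powr_mono2 heat_const_ge(1)) auto
      finally show ?thesis by (simp add: exp_weight_def)
    qed
    have gi: "integrable lborel (\<lambda>z. heat_kernel ?\<tau> (x - z) * ?g z)"
      by (rule heat_weight_integrable[OF \<tau>(1) _ _ g]) auto
    have "heat_semigroup h (B ps t) x = heat_semigroup ?\<tau> ?g x"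
      using heat_semigroup_compose[OF _ _ _ _ bt, of ?\<tau> "r - t" x] \<tau> r by simp
    also have "\<dots> = (\<integral>z. heat_kernel ?\<tau> (x - z) * ?g z \<partial>lborel)" using \<tau> by (simp add: heat_semigroup_def)
    finally have hs: "heat_semigroup h (B ps t) x = (\<integral>z. heat_kernel ?\<tau> (x - z) * ?g z \<partial>lborel)" .
    have "J (t + h) p ps r x = (\<integral>z. heat_kernel ?\<tau> (x - z) * f1 z + heat_kernel ?\<tau> (x - z) * f2 z + q p x * (heat_kernel ?\<tau> (x - z) * ?g z) \<partial>lborel)"
      unfolding J_def by (intro Bochner_Integration.integral_cong refl) (simp add: f1_def f2_def algebra_simps)
    also have "\<dots> = (\<integral>z. heat_kernel ?\<tau> (x - z) * f1 z \<partial>lborel) + (\<integral>z. heat_kernel ?\<tau> (x - z) * f2 z \<partial>lborel) + q p x * heat_semigroup h (B ps t) x"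
      unfolding hs using f1i f2i gi by simp
    finally have "\<bar>q p x * heat_semigroup h (B ps t) x - J (t + h) p ps r x\<bar>
      \<le> (L * (C' * h powr (2 * H))) * ?HS * exp_weight (real (Suc n)) x + (L * C * ?Hn) * (h powr (\<alpha> / 2) * ?Hn * exp_weight (real n) x)"
      using i1 i2 by linarith
    also have "\<dots> \<le> (L * (C' * rate h)) * ?HS * exp_weight (real (Suc n)) x + (L * C * ?Hn) * (rate h * ?Hn * exp_weight (real (Suc n)) x)"
      using L C C' Hn hn rate_nonneg[of h] by (intro add_mono mult_mono mult_left_mono mult_right_mono exp_weight_mono) auto
    also have "\<dots> = ?E * rate h * exp_weight (real (Suc n)) x" by (simp add: algebra_simps)
    finally show ?thesis .
  qed
  moreover have "0 \<le> ?E" using L C C' Hn by simp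
  ultimately show ?thesis by blast
qed

lemma scheme_Nil: "0 \<le> h \<Longrightarrow> scheme h k [] = heat_semigroup (real k * h) u0"
proof (induction k)
  case 0
  then show ?case by (simp add: fun_eq_iff heat_semigroup_def)
next
  case (Suc k)
  have "scheme h (Suc k) [] x = heat_semigroup (real (Suc k) * h) u0 x" for x
    using heat_semigroup_compose[OF _ _ _ u0_meas u0_weight, of h "real k * h" x] Suc
    by (simp add: distrib_right)
  then show ?case by (simp add: fun_eq_iff)
qed

lemma B_zero:
  assumes ps: "set ps \<subseteq> P" "ps \<noteq> []"
  shows "B ps 0 x = 0"
proof -
  obtain n where n: "length ps = Suc n" using ps(2) by (cases ps) auto
  have z: "(LINT s:{0..0}|lborel. f s) = 0" for f :: "real \<Rightarrow> real"
    unfolding set_lebesgue_integral_def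
  proof (rule integral_eq_zero_AE)
    show "AE s in lborel. indicat_real {0..0} s *\<^sub>R f s = 0"
      using AE_lborel_singleton[of 0] by eventually_elim auto
  qed
  show ?thesis by (subst B_Suc[OF ps(1) n]) (auto simp only: z sum.neutral_const)
qed

lemma exp_weight_power: "exp_weight 1 z ^ m = exp_weight (real m) z"
  by (simp add: exp_weight_def exp_of_nat_mult[symmetric])

text \<open>Consistency and stability, by induction on the length. At length \<open>n + 1\<close>
  the error made at length \<open>n\<close> acts as a source weighted by the slab mass. Scheme and
  kernel agree at time \<open>0\<close>, so the error is made of such sources, transported by the
  heat flow, and the masses sum to the integral of \<open>\<rho>\<close>.\<close>

lemma scheme_error:
  "\<exists>C\<ge>0. \<forall>ps. length ps \<le> n \<longrightarrow> set ps \<subseteq> P \<longrightarrow> (\<forall>h k x. 0 < h \<longrightarrow> real k * h \<le> T \<longrightarrow>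
     \<bar>scheme h k ps x - B ps (real k * h) x\<bar> \<le> C * rate h * exp_weight (real (length ps)) x)"
proof (induction n)
  case 0
  have "scheme h k [] x - B [] (real k * h) x = 0" if "0 < h" for h k x
    using that by (simp add: scheme_Nil B_Nil)
  then show ?case by (intro exI[of _ 0]) auto
next
  case (Suc n)
  then obtain CA where CA: "0 \<le> CA" and err: "\<And>ps h k x. length ps \<le> n \<Longrightarrow> set ps \<subseteq> P \<Longrightarrow> 0 < h \<Longrightarrow> real k * h \<le> T \<Longrightarrow>
     \<bar>scheme h k ps x - B ps (real k * h) x\<bar> \<le> CA * rate h * exp_weight (real (length ps)) x"
    by blast
  obtain CB where CB: "0 \<le> CB" and grow: "\<And>ps s z. length ps \<le> Suc n \<Longrightarrow> set ps \<subseteq> P \<Longrightarrow> 0 \<le> s \<Longrightarrow> s \<le> T \<Longrightarrow>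
      \<bar>B ps s z\<bar> \<le> CB * exp_weight (real (length ps)) z"
    using B_growth_length[of "Suc n"] by blast
  obtain CL where CL: "0 \<le> CL" and loc: "\<And>p ps t h x r. p \<in> P \<Longrightarrow> length ps = n \<Longrightarrow> set ps \<subseteq> P \<Longrightarrow> 0 < h \<Longrightarrow> 0 \<le> t \<Longrightarrow> t + h \<le> T \<Longrightarrow>
     t \<le> r \<Longrightarrow> r < t + h \<Longrightarrow> \<bar>q p x * heat_semigroup h (B ps t) x - J (t + h) p ps r x\<bar> \<le> CL * rate h * exp_weight (real (Suc n)) x"
    using local_error[of n] by blast
  define Hc where "Hc = heat_const TYPE('d) (real (Suc n)) T"
  define W :: "real ^ 'd \<Rightarrow> real" where "W = exp_weight (real (Suc n))"
  define E where "E = rate T"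
  define CS where "CS = CB + CA * E"
  \<comment> \<open>\<open>\<Theta>\<close> and \<open>L1\<close> are at least \<open>1\<close>, so
    powers with varying exponents up to \<open>Suc n\<close> are all bounded by the highest
    one.\<close>
  define \<Theta> where "\<Theta> = max 1 (R * T powr (2 * H))"
  define L1 where "L1 = max 1 L"
  \<comment> \<open>The three summands bound, per step, the error of the scheme at the shorter
    length (\<open>e1\<close>), the local freezing error (\<open>e2\<close>) and the terms with at
    least two rectangles in one slab (\<open>e3\<close>).\<close>
  define G where "G = real (Suc n) * (L * CA * Hc) + real (Suc n) * CL + 2 ^ Suc n * (R * \<Theta> ^ Suc n * L1 ^ Suc n * (CS * Hc))"
  have Hc: "1 \<le> Hc" unfolding Hc_def by (rule hc_ge_1)
  have E: "0 \<le> E" unfolding E_def by (rule rate_nonneg)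
  have CS: "0 \<le> CS" unfolding CS_def using CB CA E by simp
  have \<Theta>: "1 \<le> \<Theta>" "R * T powr (2 * H) \<le> \<Theta>" by (auto simp: \<Theta>_def)
  have L1: "1 \<le> L1" "L \<le> L1" by (auto simp: L1_def)
  have rate_mono: "rate h \<le> E" if "0 < h" "h \<le> T" for h
    unfolding rate_def E_def using that H \<alpha> by (intro add_mono powr_mono2) auto
  have G: "0 \<le> G" unfolding G_def using L CA Hc CL R \<Theta> L1 CS by (intro add_nonneg_nonneg mult_nonneg_nonneg zero_le_power) auto
  have W: "0 < W z" for z by (simp add: W_def)
  have heat_le: "\<bar>heat_semigroup h f x\<bar> \<le> C * Hc * exp_weight (real m) x"
    if "0 < h" "h \<le> T" "m \<le> Suc n" "0 \<le> C" "f \<in> borel_measurable borel" "\<And>z. \<bar>f z\<bar> \<le> C * exp_weight (real m) z" for h C m and f :: "real ^ 'd \<Rightarrow> real" and x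
  proof -
    have "\<bar>heat_semigroup h f x\<bar> \<le> C * heat_const TYPE('d) (real m) T * exp_weight (real m) x"
      using that by (intro heat_semigroup_bound) auto
    also have "\<dots> \<le> C * Hc * exp_weight (real m) x"
      unfolding Hc_def using that T by (intro mult_right_mono mult_left_mono heat_const_mono) auto
    finally show ?thesis .
  qed
  have scheme_growth: "\<bar>scheme h k ps z\<bar> \<le> CS * exp_weight (real (length ps)) z"
    if "length ps \<le> n" "set ps \<subseteq> P" "0 < h" "h \<le> T" "real k * h \<le> T" for ps h k z
  proof -
    have "\<bar>scheme h k ps z\<bar> \<le> \<bar>B ps (real k * h) z\<bar> + \<bar>scheme h k ps z - B ps (real k * h) z\<bar>" by linarith
    also have "\<dots> \<le> CB * exp_weight (real (length ps)) z + CA * rate h * exp_weight (real (length ps)) z"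
      using that by (intro add_mono grow err) auto
    also have "\<dots> \<le> CB * exp_weight (real (length ps)) z + CA * E * exp_weight (real (length ps)) z"
      using CA that by (intro add_mono mult_right_mono mult_left_mono rate_mono) auto
    finally show ?thesis by (simp add: CS_def algebra_simps)
  qed
  have step: "\<bar>scheme h (Suc k) ps x - B ps (real (Suc k) * h) x
      - (heat_semigroup h (scheme h k ps) x - heat_semigroup h (B ps (real k * h)) x)\<bar> \<le> G * slab_mass h k * rate h * W x"
    if ps: "length ps = Suc n" "set ps \<subseteq> P" and h: "0 < h" and k: "real (Suc k) * h \<le> T" for ps h k x
  proof -
    let ?q = "\<lambda>i. take i ps @ drop (Suc i) ps" and ?t = "real k * h" and ?\<theta> = "slab_mass h k"
    have t: "0 \<le> ?t" "?t + h \<le> T" "real (Suc k) * h = ?t + h" "?t \<le> T" "h \<le> T"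
      using h k by (auto simp: algebra_simps) (smt (verit) mult_nonneg_nonneg of_nat_0_le_iff)+
    have \<theta>: "0 \<le> ?\<theta>" "?\<theta> \<le> R * h powr (2 * H)" using slab_mass_nonneg slab_mass_le h by auto
    have \<theta>\<Theta>: "?\<theta> \<le> \<Theta>"
    proof -
      have "R * h powr (2 * H) \<le> R * T powr (2 * H)" using R h t H by (intro mult_left_mono powr_mono2) auto
      then show ?thesis using \<theta> \<Theta> by linarith
    qed
    let ?G = "\<lambda>vs ss. (\<Prod>p\<leftarrow>vs. slab h k p * q p x) * heat_semigroup h (scheme h k ss) x"
    define Rm where "Rm = (\<Sum>(vs, ss)\<leftarrow>filter (\<lambda>(vs, ss). 2 \<le> length vs) (splits ps). ?G vs ss)"
    have S: "scheme h (Suc k) ps x = heat_semigroup h (scheme h k ps) x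
      + (\<Sum>i\<le>n. slab h k (ps ! i) * q (ps ! i) x * heat_semigroup h (scheme h k (?q i)) x) + Rm"
      unfolding scheme.simps Rm_def splits_decompose[of ?G] using ps(1) by (simp add: lessThan_Suc_atMost)
    have Bs: "B ps (real (Suc k) * h) x = heat_semigroup h (B ps ?t) x + (\<Sum>i\<le>n. LINT r:{?t..?t + h}|lborel. a (ps ! i) r * J (?t + h) (ps ! i) (?q i) r x)"
    proof -
      have "B ps (?t + h) x = heat_semigroup (?t + h - ?t) (B ps ?t) x + (\<Sum>i\<le>n. LINT r:{?t..?t + h}|lborel. a (ps ! i) r * J (?t + h) (ps ! i) (?q i) r x)"
      proof (rule flow_identity[OF ps(2,1) t(1) _ t(2) CB])
        fix ps' s z assume "length ps' = n" "set ps' \<subseteq> P" "0 \<le> s" "s \<le> T"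
        then show "\<bar>B ps' s z\<bar> \<le> CB * exp_weight (real n) z" using grow[of ps' s z] by simp
      qed (use h in simp)
      then show ?thesis unfolding t(3) by simp
    qed
    have e1: "\<bar>slab h k (ps ! i) * q (ps ! i) x * (heat_semigroup h (scheme h k (?q i)) x - heat_semigroup h (B (?q i) ?t) x)\<bar>
        \<le> ?\<theta> * rate h * (L * CA * Hc) * W x" if i: "i \<le> n" for i
    proof -
      note rn = remove_nth_props[OF ps(2,1) i]
      have s1: "\<bar>scheme h k (?q i) z\<bar> \<le> CS * exp_weight (real n) z" for z
        using scheme_growth[OF _ rn(3) h t(5,4), of z, unfolded rn(2)] by simp
      have b1: "\<bar>B (?q i) ?t z\<bar> \<le> CB * exp_weight (real n) z" for z
        using grow[OF _ rn(3) t(1,4), of z, unfolded rn(2)] by simp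
      have "heat_semigroup h (scheme h k (?q i)) x - heat_semigroup h (B (?q i) ?t) x
         = heat_semigroup h (\<lambda>z. 1 * scheme h k (?q i) z + (-1) * B (?q i) ?t z) x"
        using h by (subst heat_semigroup_lincomb[OF _ _ scheme_measurable[OF rn(3)] B_slice_measurable s1 b1]) auto
      also have "\<bar>\<dots>\<bar> \<le> (CA * rate h) * Hc * exp_weight (real n) x"
      proof (rule heat_le[OF h t(5)])
        show "(\<lambda>z. 1 * scheme h k (?q i) z + (-1) * B (?q i) ?t z) \<in> borel_measurable borel"
          using scheme_measurable[OF rn(3)] by measurable
        show "\<bar>1 * scheme h k (?q i) z + (-1) * B (?q i) ?t z\<bar> \<le> (CA * rate h) * exp_weight (real n) z" for z
          using err[OF _ rn(3) h t(4), of z, unfolded rn(2)] by simp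
      qed (use CA rate_nonneg in auto)
      finally have "\<bar>slab h k (ps ! i)\<bar> * \<bar>q (ps ! i) x\<bar> * \<bar>heat_semigroup h (scheme h k (?q i)) x - heat_semigroup h (B (?q i) ?t) x\<bar>
        \<le> ?\<theta> * (L * exp_weight 1 x) * ((CA * rate h) * Hc * exp_weight (real n) x)"
        using h \<theta> L by (intro mult_mono slab_le q_le rn) auto
      also have "\<dots> = ?\<theta> * rate h * (L * CA * Hc) * exp_weight (1 + real n) x" by (simp add: exp_weight_add mult_ac)
      finally show ?thesis by (simp add: abs_mult W_def add.commute)
    qed
    have e2: "\<bar>slab h k (ps ! i) * q (ps ! i) x * heat_semigroup h (B (?q i) ?t) x
       - (LINT r:{?t..?t + h}|lborel. a (ps ! i) r * J (?t + h) (ps ! i) (?q i) r x)\<bar> \<le> ?\<theta> * rate h * CL * W x" if i: "i \<le> n" for i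
    proof -
      note rn = remove_nth_props[OF ps(2,1) i]
      let ?c = "q (ps ! i) x * heat_semigroup h (B (?q i) ?t) x"
      have sm: "?\<theta> = (LINT r:{?t..?t + h}|lborel. \<rho> r)" unfolding slab_mass_def t(3) ..
      have ai: "set_integrable lborel {?t..?t + h} (a (ps ! i))"
        unfolding set_integrable_def
      proof (rule Bochner_Integration.integrable_bound)
        show "integrable lborel (\<lambda>r. indicator {?t..?t + h} r *\<^sub>R \<rho> r)" using \<rho>_int[of ?t "?t + h"] t h by (simp add: set_integrable_def)
        show "(\<lambda>r. indicator {?t..?t + h} r *\<^sub>R a (ps ! i) r) \<in> borel_measurable lborel" using a_meas[OF rn(1)] by measurable
        show "AE r in lborel. norm (indicat_real {?t..?t + h} r *\<^sub>R a (ps ! i) r) \<le> norm (indicat_real {?t..?t + h} r *\<^sub>R \<rho> r)"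
          using a_le[OF rn(1)] \<rho>_nonneg by (auto simp: indicator_def)
      qed
      have aJi: "set_integrable lborel {?t..?t + h} (\<lambda>r. a (ps ! i) r * J (?t + h) (ps ! i) (?q i) r x)"
        unfolding set_integrable_def
      proof (rule Bochner_Integration.integrable_bound)
        let ?D = "L * CB * Hc * W x"
        show "integrable lborel (\<lambda>r. indicator {?t..?t + h} r *\<^sub>R (?D * \<rho> r))"
          using set_integrable_mult_right[OF \<rho>_int[of ?t "?t + h"], of ?D] t h by (simp add: set_integrable_def)
        show "(\<lambda>r. indicator {?t..?t + h} r *\<^sub>R (a (ps ! i) r * J (?t + h) (ps ! i) (?q i) r x)) \<in> borel_measurable lborel"
          using a_meas[OF rn(1)] J_measurable[OF rn(1)] by measurable
        show "AE r in lborel. norm (indicat_real {?t..?t + h} r *\<^sub>R (a (ps ! i) r * J (?t + h) (ps ! i) (?q i) r x)) \<le> norm (indicat_real {?t..?t + h} r *\<^sub>R (?D * \<rho> r))"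
        proof (rule AE_I2)
          fix r :: real
          have le: "\<bar>a (ps ! i) r\<bar> * \<bar>J (?t + h) (ps ! i) (?q i) r x\<bar> \<le> \<rho> r * ?D" if r: "r \<in> {?t..?t + h}"
          proof (intro mult_mono a_le rn)
            show "\<bar>J (?t + h) (ps ! i) (?q i) r x\<bar> \<le> ?D"
            proof -
              have r': "0 \<le> r" "r \<le> ?t + h" "r \<le> T" using order_trans[OF t(1), of r] r t(2) by auto
              have "\<bar>B (?q i) r z\<bar> \<le> CB * exp_weight (real n) z" for z
                using grow[OF _ rn(3) r'(1,3), of z, unfolded rn(2)] by simp
              then show ?thesis unfolding Hc_def W_def by (rule J_bound[OF rn(1) CB _ r'(1,2) t(2)])
            qed
          qed (use \<rho>_nonneg in auto)
          show "norm (indicat_real {?t..?t + h} r *\<^sub>R (a (ps ! i) r * J (?t + h) (ps ! i) (?q i) r x)) \<le> norm (indicat_real {?t..?t + h} r *\<^sub>R (?D * \<rho> r))"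
          proof (cases "r \<in> {?t..?t + h}")
            case True
            have "\<bar>a (ps ! i) r * J (?t + h) (ps ! i) (?q i) r x\<bar> \<le> \<bar>?D * \<rho> r\<bar>"
              unfolding abs_mult[of "a (ps ! i) r"] mult.commute[of ?D] by (rule order_trans[OF le[OF True] abs_ge_self])
            then show ?thesis using True by simp
          qed simp
        qed
      qed
      have "slab h k (ps ! i) * ?c = (LINT r:{?t..?t + h}|lborel. a (ps ! i) r * ?c)"
        unfolding slab_def t(3) by simp
      then have "slab h k (ps ! i) * ?c - (LINT r:{?t..?t + h}|lborel. a (ps ! i) r * J (?t + h) (ps ! i) (?q i) r x)
        = (LINT r:{?t..?t + h}|lborel. a (ps ! i) r * ?c - a (ps ! i) r * J (?t + h) (ps ! i) (?q i) r x)"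
        using ai aJi by (subst set_integral_diff) auto
      also have "\<bar>\<dots>\<bar> \<le> (CL * rate h * W x) * ?\<theta>"
        unfolding sm
      proof (rule LINT_bound)
        fix r assume r: "r \<in> {?t..<?t + h}"
        have "\<bar>a (ps ! i) r\<bar> * \<bar>?c - J (?t + h) (ps ! i) (?q i) r x\<bar> \<le> \<rho> r * (CL * rate h * W x)"
          unfolding W_def using r h t \<rho>_nonneg by (intro mult_mono a_le loc rn) auto
        then show "\<bar>a (ps ! i) r * ?c - a (ps ! i) r * J (?t + h) (ps ! i) (?q i) r x\<bar> \<le> CL * rate h * W x * \<rho> r"
          by (simp add: abs_mult[symmetric] right_diff_distrib mult_ac)
      qed (use t(1) h CL rate_nonneg[of h] less_imp_le[OF W[of x]] in simp_all)
      finally show ?thesis by (simp add: mult_ac)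
    qed
    have e3: "\<bar>Rm\<bar> \<le> 2 ^ Suc n * (?\<theta> * rate h * (R * \<Theta> ^ Suc n * L1 ^ Suc n * (CS * Hc)) * W x)"
    proof -
      let ?c = "?\<theta> * rate h * (R * \<Theta> ^ Suc n * L1 ^ Suc n * (CS * Hc)) * W x"
      have c: "0 \<le> ?c" using \<theta> rate_nonneg R \<Theta> L1 CS Hc W by (intro mult_nonneg_nonneg zero_le_power) (auto intro: less_imp_le)
      have "\<bar>?G vs ss\<bar> \<le> ?c" if vs: "(vs, ss) \<in> set (splits ps)" "2 \<le> length vs" for vs ss
      proof -
        define m where "m = length vs"
        have m: "m + length ss = Suc n" "2 \<le> m" using splits_length[OF vs(1)] ps vs by (auto simp: m_def)
        have sub: "set vs \<subseteq> P" "set ss \<subseteq> P" using splits_set[OF vs(1)] ps by auto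
        have "\<bar>\<Prod>p\<leftarrow>vs. slab h k p * q p x\<bar> \<le> (?\<theta> * (L * exp_weight 1 x)) ^ m"
          unfolding m_def
        proof (rule abs_prod_list_le)
          fix p assume "p \<in> set vs"
          then show "\<bar>slab h k p * q p x\<bar> \<le> ?\<theta> * (L * exp_weight 1 x)"
            unfolding abs_mult using sub h \<theta> by (intro mult_mono slab_le q_le) auto
        qed
        moreover have "\<bar>heat_semigroup h (scheme h k ss) x\<bar> \<le> CS * Hc * exp_weight (real (length ss)) x"
          using m sub h t by (intro heat_le scheme_measurable scheme_growth CS) auto
        ultimately have "\<bar>?G vs ss\<bar> \<le> (?\<theta> * (L * exp_weight 1 x)) ^ m * (CS * Hc * exp_weight (real (length ss)) x)"
          unfolding abs_mult using \<theta> L by (intro mult_mono) auto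
        also have "\<dots> = ?\<theta> ^ m * L ^ m * (CS * Hc) * (exp_weight (real m) x * exp_weight (real (length ss)) x)"
          by (simp add: power_mult_distrib exp_weight_power mult_ac)
        also have "exp_weight (real m) x * exp_weight (real (length ss)) x = W x"
          unfolding W_def exp_weight_add[symmetric] using m by (simp flip: of_nat_add)
        also have "?\<theta> ^ m * L ^ m * (CS * Hc) * W x \<le> (?\<theta> * rate h * (R * \<Theta> ^ Suc n)) * L1 ^ Suc n * (CS * Hc) * W x"
        proof (intro mult_right_mono mult_mono)
          \<comment> \<open>One factor \<open>?\<theta>\<close> is kept so that the steps can be
            summed, a second one is at most \<open>R * rate h\<close>, and the other
            \<open>m - 2\<close> are bounded by powers of \<open>\<Theta>\<close>.\<close>
          have "?\<theta> ^ m = ?\<theta> ^ (2 + (m - 2))" by (simp only: le_add_diff_inverse[OF m(2)])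
          also have "\<dots> = ?\<theta> * ?\<theta> * ?\<theta> ^ (m - 2)" by (simp only: power_add power2_eq_square)
          also have "\<dots> \<le> ?\<theta> * (R * rate h) * \<Theta> ^ Suc n"
          proof (intro mult_mono)
            have "R * h powr (2 * H) \<le> R * rate h" unfolding rate_def using R by (intro mult_left_mono) auto
            then show "?\<theta> \<le> R * rate h" using \<theta> by linarith
            have "?\<theta> ^ (m - 2) \<le> \<Theta> ^ (m - 2)" using \<theta> \<theta>\<Theta> by (intro power_mono) auto
            also have "\<dots> \<le> \<Theta> ^ Suc n" using \<Theta> m by (intro power_increasing) auto
            finally show "?\<theta> ^ (m - 2) \<le> \<Theta> ^ Suc n" .
          qed (use \<theta> R rate_nonneg in auto)
          finally show "?\<theta> ^ m \<le> ?\<theta> * rate h * (R * \<Theta> ^ Suc n)" by (simp add: mult_ac)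
          have "L ^ m \<le> L1 ^ m" using L L1 by (intro power_mono) auto
          also have "\<dots> \<le> L1 ^ Suc n" using L1 m by (intro power_increasing) auto
          finally show "L ^ m \<le> L1 ^ Suc n" .
        qed (use \<theta> rate_nonneg R \<Theta> L L1 CS Hc W in \<open>auto intro: less_imp_le\<close>)
        also have "\<dots> = ?c" by (simp add: mult_ac)
        finally show ?thesis .
      qed
      then have "\<bar>Rm\<bar> \<le> real (length (filter (\<lambda>(vs, ss). 2 \<le> length vs) (splits ps))) * ?c"
        unfolding Rm_def by (intro abs_sum_list_le) auto
      also have "\<dots> \<le> real (length (splits ps)) * ?c"
        using c by (intro mult_right_mono) auto
      finally show ?thesis using ps by (simp add: length_splits)
    qed
    have "scheme h (Suc k) ps x - B ps (real (Suc k) * h) x - (heat_semigroup h (scheme h k ps) x - heat_semigroup h (B ps ?t) x)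
      = (\<Sum>i\<le>n. slab h k (ps ! i) * q (ps ! i) x * (heat_semigroup h (scheme h k (?q i)) x - heat_semigroup h (B (?q i) ?t) x))
      + (\<Sum>i\<le>n. slab h k (ps ! i) * q (ps ! i) x * heat_semigroup h (B (?q i) ?t) x
       - (LINT r:{?t..?t + h}|lborel. a (ps ! i) r * J (?t + h) (ps ! i) (?q i) r x)) + Rm"
      unfolding S Bs by (simp add: right_diff_distrib sum_subtractf)
    moreover have "\<bar>\<Sum>i\<le>n. slab h k (ps ! i) * q (ps ! i) x * (heat_semigroup h (scheme h k (?q i)) x - heat_semigroup h (B (?q i) ?t) x)\<bar>
      \<le> (\<Sum>i\<le>n. ?\<theta> * rate h * (L * CA * Hc) * W x)"
      by (rule order_trans[OF sum_abs]) (intro sum_mono e1, simp)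
    moreover have "\<bar>\<Sum>i\<le>n. slab h k (ps ! i) * q (ps ! i) x * heat_semigroup h (B (?q i) ?t) x
       - (LINT r:{?t..?t + h}|lborel. a (ps ! i) r * J (?t + h) (ps ! i) (?q i) r x)\<bar> \<le> (\<Sum>i\<le>n. ?\<theta> * rate h * CL * W x)"
      by (rule order_trans[OF sum_abs]) (intro sum_mono e2, simp)
    ultimately have "\<bar>scheme h (Suc k) ps x - B ps (real (Suc k) * h) x - (heat_semigroup h (scheme h k ps) x - heat_semigroup h (B ps ?t) x)\<bar>
      \<le> (\<Sum>i\<le>n. ?\<theta> * rate h * (L * CA * Hc) * W x) + (\<Sum>i\<le>n. ?\<theta> * rate h * CL * W x)
        + 2 ^ Suc n * (?\<theta> * rate h * (R * \<Theta> ^ Suc n * L1 ^ Suc n * (CS * Hc)) * W x)"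
      using e3 by linarith
    also have "\<dots> = G * ?\<theta> * rate h * W x" unfolding G_def by (simp add: algebra_simps)
    finally show ?thesis .
  qed
  \<comment> \<open>Estimating the transported error anew by \<open>Hc\<close> in every step would
    produce \<open>Hc ^ k\<close>. The error is measured instead by the heat evolution of the
    weight: one step maps \<open>\<Psi> h k\<close> exactly to \<open>\<Psi> h (Suc k)\<close>, and
    \<open>W \<le> \<Psi> h k\<close> absorbs each new local error. The constant \<open>Hc\<close>
    is spent once, at the end.\<close>
  define \<Psi> where "\<Psi> h k = heat_semigroup (real k * h) W" for h :: real and k :: nat
  have Wm [measurable]: "W \<in> borel_measurable borel" unfolding W_def by measurable
  have Wb: "\<bar>W z\<bar> \<le> 1 * exp_weight (real (Suc n)) z" for z by (simp add: W_def)
  have \<Psi>m [measurable]: "\<Psi> h k \<in> borel_measurable borel" for h k unfolding \<Psi>_def by measurable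
  have \<Psi>b: "\<bar>\<Psi> h k z\<bar> \<le> Hc * exp_weight (real (Suc n)) z" if "0 < h" "real k * h \<le> T" for h k z
    using heat_semigroup_bound[OF _ that(2) _ _ Wm Wb, of z] that by (simp add: \<Psi>_def Hc_def)
  have \<Psi>W: "W z \<le> \<Psi> h k z" if "0 < h" for h k z
    using heat_semigroup_weight_ge[of "real k * h" "real (Suc n)" z] that by (simp add: \<Psi>_def W_def)
  have \<Psi>S: "heat_semigroup h (\<Psi> h k) z = \<Psi> h (Suc k) z" if "0 < h" for h k z
    using heat_semigroup_compose[OF _ _ _ Wm Wb, of h "real k * h" z] that by (simp add: \<Psi>_def algebra_simps)
  have main: "\<bar>scheme h k ps x - B ps (real k * h) x\<bar> \<le> G * rate h * (\<Sum>j<k. slab_mass h j) * \<Psi> h k x"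
    if ps: "length ps = Suc n" "set ps \<subseteq> P" and h: "0 < h" and k: "real k * h \<le> T" for ps h k x
    using k
  proof (induction k arbitrary: x)
    case 0
    then show ?case using ps B_zero[OF ps(2), of x] by (cases ps) auto
  next
    case (Suc k)
    let ?M = "G * rate h * (\<Sum>j<k. slab_mass h j)"
    have kT: "real k * h \<le> T" using Suc.prems h by (simp add: algebra_simps)
    have M: "0 \<le> ?M" using G rate_nonneg slab_mass_nonneg by (intro mult_nonneg_nonneg sum_nonneg) auto
    note IH = Suc.IH[OF kT]
    have Bb: "\<bar>B ps (real k * h) z\<bar> \<le> CB * exp_weight (real (Suc n)) z" for z
      using grow[of ps "real k * h" z] ps h kT by simp
    have Db: "\<bar>?M * \<Psi> h k z\<bar> \<le> (?M * Hc) * exp_weight (real (Suc n)) z" for z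
      unfolding abs_mult[of ?M] abs_of_nonneg[OF M] using mult_left_mono[OF \<Psi>b[OF h kT, of z] M] by (simp only: mult.assoc)
    have Ab: "\<bar>scheme h k ps z\<bar> \<le> (CB + ?M * Hc) * exp_weight (real (Suc n)) z" for z
      using Bb[of z] IH[of z] Db[of z] by (simp add: distrib_right)
    have diff: "heat_semigroup h (scheme h k ps) x - heat_semigroup h (B ps (real k * h)) x
      = heat_semigroup h (\<lambda>z. 1 * scheme h k ps z + (-1) * B ps (real k * h) z) x"
      using h by (subst heat_semigroup_lincomb[OF _ _ scheme_measurable[OF ps(2)] B_slice_measurable Ab Bb]) auto
    have "\<bar>heat_semigroup h (\<lambda>z. 1 * scheme h k ps z + (-1) * B ps (real k * h) z) x\<bar> \<le> heat_semigroup h (\<lambda>z. ?M * \<Psi> h k z) x"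
    proof (rule heat_semigroup_mono[OF _ _ _ _ _ Db])
      show "\<bar>1 * scheme h k ps z + (-1) * B ps (real k * h) z\<bar> \<le> ?M * \<Psi> h k z" for z
        using IH[of z] by simp
      show "(\<lambda>z. 1 * scheme h k ps z + (-1) * B ps (real k * h) z) \<in> borel_measurable borel"
        using scheme_measurable[OF ps(2)] by measurable
    qed (use h in auto)
    also have "\<dots> = ?M * \<Psi> h (Suc k) x"
      using heat_semigroup_lincomb[OF _ _ \<Psi>m \<Psi>m \<Psi>b[OF h kT] \<Psi>b[OF h kT], of h ?M 0 x] h \<Psi>S[OF h] by simp
    finally have 1: "\<bar>heat_semigroup h (scheme h k ps) x - heat_semigroup h (B ps (real k * h)) x\<bar> \<le> ?M * \<Psi> h (Suc k) x"
      unfolding diff .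
    have "G * slab_mass h k * rate h * W x \<le> G * slab_mass h k * rate h * \<Psi> h (Suc k) x"
      using G rate_nonneg slab_mass_nonneg by (intro mult_left_mono \<Psi>W h mult_nonneg_nonneg) auto
    with 1 step[OF ps h Suc.prems, of x]
    have "\<bar>scheme h (Suc k) ps x - B ps (real (Suc k) * h) x\<bar> \<le> ?M * \<Psi> h (Suc k) x + G * slab_mass h k * rate h * \<Psi> h (Suc k) x"
      by linarith
    then show ?case by (simp add: algebra_simps)
  qed
  define C where "C = CA + G * (R * T powr (2 * H)) * Hc"
  have C: "0 \<le> C" unfolding C_def using CA G R Hc by simp
  have "\<bar>scheme h k ps x - B ps (real k * h) x\<bar> \<le> C * rate h * exp_weight (real (length ps)) x"
    if ps: "length ps \<le> Suc n" "set ps \<subseteq> P" and h: "0 < h" and k: "real k * h \<le> T" for ps h k x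
  proof (cases "length ps \<le> n")
    case True
    have "\<bar>scheme h k ps x - B ps (real k * h) x\<bar> \<le> CA * rate h * exp_weight (real (length ps)) x"
      by (rule err[OF True ps(2) h k])
    also have "\<dots> \<le> C * rate h * exp_weight (real (length ps)) x"
      unfolding C_def using G R Hc rate_nonneg by (intro mult_right_mono) auto
    finally show ?thesis .
  next
    case False
    then have len: "length ps = Suc n" using ps by simp
    have "(\<Sum>j<k. slab_mass h j) \<le> R * T powr (2 * H)"
    proof -
      have "(\<Sum>j<k. slab_mass h j) \<le> R * (real k * h - 0) powr (2 * H)"
        unfolding slab_mass_sum[OF less_imp_le[OF h]] using h by (intro \<rho>_le) auto
      also have "\<dots> \<le> R * T powr (2 * H)" using R H h k by (intro mult_left_mono powr_mono2) auto
      finally show ?thesis .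
    qed
    moreover have "\<Psi> h k x \<le> Hc * exp_weight (real (Suc n)) x" using \<Psi>b[OF h k, of x] by simp
    moreover have "0 \<le> \<Psi> h k x" using \<Psi>W[OF h, of x k] W[of x] by linarith
    ultimately have "G * rate h * (\<Sum>j<k. slab_mass h j) * \<Psi> h k x \<le> G * rate h * (R * T powr (2 * H)) * (Hc * exp_weight (real (Suc n)) x)"
      using G rate_nonneg slab_mass_nonneg R by (intro mult_mono mult_left_mono mult_nonneg_nonneg sum_nonneg) auto
    also have "\<dots> = (G * (R * T powr (2 * H)) * Hc) * rate h * exp_weight (real (length ps)) x" by (simp add: len mult_ac)
    also have "\<dots> \<le> C * rate h * exp_weight (real (length ps)) x"
      unfolding C_def using CA rate_nonneg by (intro mult_right_mono) auto
    finally show ?thesis using main[OF len ps(2) h k, of x] by linarith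
  qed
  then show ?case using C by blast
qed

end

section \<open>Random walk representation of the scheme\<close>

definition gauss :: "real \<Rightarrow> (real ^ 'd) measure" where
  "gauss h = density lborel (\<lambda>z. ennreal (heat_kernel h z))"

lemma sets_gauss [simp, measurable_cong]: "sets (gauss h) = sets borel"
  by (simp add: gauss_def)

lemma space_gauss [simp]: "space (gauss h) = UNIV"
  by (simp add: gauss_def)

lemma prob_space_gauss: "0 < h \<Longrightarrow> prob_space (gauss h :: (real ^ 'd) measure)"
proof
  assume h: "0 < h"
  have "emeasure (gauss h :: (real ^ 'd) measure) (space (gauss h)) = (\<integral>\<^sup>+z. ennreal (heat_kernel h (z :: real ^ 'd)) \<partial>lborel)"
    by (simp add: gauss_def emeasure_density)
  also have "\<dots> = 1" using heat_kernel_integral0[OF h, where 'd='d] by (simp add: nn_integral_eq_integral)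
  finally show "emeasure (gauss h :: (real ^ 'd) measure) (space (gauss h)) = 1" .
qed

lemma integral_gauss:
  fixes f :: "real ^ 'd \<Rightarrow> real"
  assumes [measurable]: "f \<in> borel_measurable borel"
  shows "(\<integral>z. f z \<partial>gauss h) = (\<integral>z. heat_kernel h z * f z \<partial>lborel)"
    "integrable (gauss h) f \<longleftrightarrow> integrable lborel (\<lambda>z. heat_kernel h z * f z)"
  unfolding gauss_def by (subst integral_density integrable_density; simp)+

lemma integral_gauss_shift:
  fixes f :: "real ^ 'd \<Rightarrow> real"
  assumes "0 < h" and fm [measurable]: "f \<in> borel_measurable borel"
  shows "(\<integral>z. f (x + z) \<partial>gauss h) = heat_semigroup h f x"
proof -
  have "(\<integral>z. f (x + z) \<partial>gauss h) = (\<integral>z. heat_kernel h (x - (x + 1 *\<^sub>R z)) * f (x + 1 *\<^sub>R z) \<partial>lborel)"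
    by (subst integral_gauss(1)) simp_all
  also have "\<dots> = (\<integral>z. heat_kernel h (x - z) * f z \<partial>lborel)"
    by (rule lborel_integral_shift_reflect(1)[of 1 "\<lambda>z. heat_kernel h (x - z) * f z"]) simp_all
  finally show ?thesis using assms by (simp add: heat_semigroup_def)
qed

lemma exp_weight_gauss_integrable:
  assumes "0 < h" "0 \<le> a"
  shows "integrable (gauss h) (exp_weight a :: real ^ 'd \<Rightarrow> real)"
  using heat_weight_integrable[OF assms, of "exp_weight a" 1 0] by (simp add: integral_gauss)

text \<open>The law of the independent increments; positions are partial sums of them.\<close>

abbreviation walk :: "real \<Rightarrow> nat \<Rightarrow> (nat \<Rightarrow> real ^ 'd) measure" where
  "walk h k \<equiv> Pi\<^sub>M {..<k} (\<lambda>_. gauss h)"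

lemma product_sigma_finite_gauss: "0 < h \<Longrightarrow> product_sigma_finite (\<lambda>_ :: nat. gauss h :: (real ^ 'd) measure)"
  by (simp add: product_sigma_finite_def prob_space_imp_sigma_finite prob_space_gauss)

lemma prob_space_walk: "0 < h \<Longrightarrow> prob_space (walk h k :: (nat \<Rightarrow> real ^ 'd) measure)"
  by (intro prob_space_PiM prob_space_gauss)

lemma walk_sum_measurable [measurable]:
  assumes "A \<subseteq> {..<k}"
  shows "(\<lambda>\<xi>. \<Sum>i\<in>A. \<xi> i) \<in> borel_measurable (walk h k :: (nat \<Rightarrow> real ^ 'd) measure)"
proof (rule borel_measurable_sum)
  fix i assume "i \<in> A"
  then have "(\<lambda>\<xi>. \<xi> i) \<in> walk h k \<rightarrow>\<^sub>M (gauss h :: (real ^ 'd) measure)" using assms by (intro measurable_component_singleton) auto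
  then show "(\<lambda>\<xi>. \<xi> i) \<in> borel_measurable (walk h k :: (nat \<Rightarrow> real ^ 'd) measure)"
    by (simp cong: measurable_cong_sets)
qed

text \<open>The increment with the largest index is integrated last because it is the first step
  that the walk takes from \<open>x\<close>; this matches the order of operations in
  \<open>scheme h (Suc k)\<close>.\<close>

lemma product_integral_insert_first:
  fixes f :: "(nat \<Rightarrow> real ^ 'd) \<Rightarrow> real"
  assumes h: "0 < h" and f: "integrable (walk h (Suc k)) f"
  shows "(\<integral>\<xi>. f \<xi> \<partial>walk h (Suc k)) = (\<integral>\<eta>. (\<integral>\<xi>. f (\<xi>(k := \<eta>)) \<partial>walk h k) \<partial>gauss h)"
proof -
  interpret product_sigma_finite "\<lambda>_ :: nat. gauss h :: (real ^ 'd) measure" by (rule product_sigma_finite_gauss[OF h])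
  interpret W: prob_space "walk h k :: (nat \<Rightarrow> real ^ 'd) measure" by (rule prob_space_walk[OF h])
  have I: "{..<Suc k} = {k} \<union> {..<k}" by auto
  have "(\<integral>\<xi>. f \<xi> \<partial>walk h (Suc k)) = (\<integral>\<zeta>. (\<integral>\<xi>. f (merge {k} {..<k} (\<zeta>, \<xi>)) \<partial>walk h k) \<partial>Pi\<^sub>M {k} (\<lambda>_. gauss h))"
    using f unfolding I by (intro product_integral_fold) auto
  also have "\<dots> = (\<integral>\<zeta>. (\<integral>\<xi>. f (\<xi>(k := \<zeta> k)) \<partial>walk h k) \<partial>Pi\<^sub>M {k} (\<lambda>_. gauss h))"
  proof (intro Bochner_Integration.integral_cong refl)
    fix \<zeta> \<xi> :: "nat \<Rightarrow> real ^ 'd"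
    assume "\<xi> \<in> space (walk h k :: (nat \<Rightarrow> real ^ 'd) measure)"
    then have "merge {k} {..<k} (\<zeta>, \<xi>) = \<xi>(k := \<zeta> k)"
      by (auto simp: merge_def fun_eq_iff space_PiM PiE_def extensional_def)
    then show "f (merge {k} {..<k} (\<zeta>, \<xi>)) = f (\<xi>(k := \<zeta> k))" by simp
  qed
  also have "\<dots> = (\<integral>\<eta>. (\<integral>\<xi>. f (\<xi>(k := \<eta>)) \<partial>walk h k) \<partial>gauss h)"
  proof (rule product_integral_singleton)
    have "(\<lambda>(\<eta>, \<xi>). \<xi>(k := \<eta>)) \<in> gauss h \<Otimes>\<^sub>M walk h k \<rightarrow>\<^sub>M walk h (Suc k)"
      unfolding case_prod_unfold lessThan_Suc by (rule measurable_fun_upd[where J="{..<k}"]) auto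
    then have "(\<lambda>(\<eta>, \<xi>). f (\<xi>(k := \<eta>))) \<in> borel_measurable (gauss h \<Otimes>\<^sub>M walk h k)"
      using measurable_compose[OF _ borel_measurable_integrable[OF f]] by (simp add: case_prod_unfold)
    then show "(\<lambda>\<eta>. \<integral>\<xi>. f (\<xi>(k := \<eta>)) \<partial>walk h k) \<in> borel_measurable (gauss h)"
      by (rule W.borel_measurable_lebesgue_integral)
  qed
  finally show ?thesis .
qed

lemma product_nn_integral_insert_first:
  fixes f :: "(nat \<Rightarrow> real ^ 'd) \<Rightarrow> ennreal"
  assumes h: "0 < h" and f: "f \<in> borel_measurable (walk h (Suc k))"
  shows "(\<integral>\<^sup>+\<xi>. f \<xi> \<partial>walk h (Suc k)) = (\<integral>\<^sup>+\<eta>. (\<integral>\<^sup>+\<xi>. f (\<xi>(k := \<eta>)) \<partial>walk h k) \<partial>gauss h)"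
proof -
  interpret product_sigma_finite "\<lambda>_ :: nat. gauss h :: (real ^ 'd) measure" by (rule product_sigma_finite_gauss[OF h])
  show ?thesis using f unfolding lessThan_Suc by (intro product_nn_integral_insert_rev) auto
qed

lemma nn_integral_heat_shift:
  fixes f :: "real ^ 'd \<Rightarrow> ennreal"
  assumes [measurable]: "f \<in> borel_measurable borel"
  shows "(\<integral>\<^sup>+z. f (x + z) \<partial>gauss h) = (\<integral>\<^sup>+z. ennreal (heat_kernel h (x - z)) * f z \<partial>lborel)"
proof -
  have eq: "lborel = distr lborel borel (\<lambda>z. x + 1 *\<^sub>R z :: real ^ 'd)"
    using lborel_affine[of 1 x] by (simp add: density_1)
  have "(\<integral>\<^sup>+z. f (x + z) \<partial>gauss h) = (\<integral>\<^sup>+z. ennreal (heat_kernel h (x - (x + 1 *\<^sub>R z))) * f (x + 1 *\<^sub>R z) \<partial>lborel)"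
    unfolding gauss_def by (subst nn_integral_density) auto
  also have "\<dots> = (\<integral>\<^sup>+z. ennreal (heat_kernel h (x - z)) * f z \<partial>lborel)"
    by (subst (2) eq, subst nn_integral_distr) auto
  finally show ?thesis .
qed

text \<open>Chapman-Kolmogorov, one index at a time, with the shift \<open>y\<close> taking up the
  increments already conditioned on. Nonnegative integrals let it be applied to exponentials of
  squares before their finiteness is known.\<close>

lemma walk_increment_law:
  fixes f :: "real ^ 'd \<Rightarrow> ennreal"
  assumes h: "0 < h" and [measurable]: "f \<in> borel_measurable borel"
  shows "A \<subseteq> {..<k} \<Longrightarrow> A \<noteq> {} \<Longrightarrow> (\<integral>\<^sup>+\<xi>. f (y + (\<Sum>i\<in>A. \<xi> i)) \<partial>walk h k) = (\<integral>\<^sup>+z. f (y + z) \<partial>gauss (real (card A) * h))"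
proof (induction k arbitrary: A y)
  case (Suc k)
  interpret W: prob_space "walk h k :: (nat \<Rightarrow> real ^ 'd) measure" by (rule prob_space_walk[OF h])
  interpret G: prob_space "gauss h :: (real ^ 'd) measure" by (rule prob_space_gauss[OF h])
  have fm: "(\<lambda>\<xi>. f (y + (\<Sum>i\<in>A. \<xi> i))) \<in> borel_measurable (walk h (Suc k))"
    using walk_sum_measurable[OF Suc.prems(1)] by measurable
  have fA: "finite A" using Suc.prems(1) finite_subset by blast
  show ?case
  proof (cases "k \<in> A")
    case False
    then have A: "A \<subseteq> {..<k}" using Suc.prems(1) by (auto simp: lessThan_Suc)
    have "(\<Sum>i\<in>A. (\<xi>(k := \<eta>)) i) = (\<Sum>i\<in>A. \<xi> i)" for \<xi> :: "nat \<Rightarrow> real ^ 'd" and \<eta>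
      using False by (intro sum.cong) auto
    then show ?thesis
      unfolding product_nn_integral_insert_first[OF h fm] by (simp add: Suc.IH[OF A Suc.prems(2)] G.emeasure_space_1[simplified] del: fun_upd_apply)
  next
    case True
    let ?A = "A - {k}"
    have A: "?A \<subseteq> {..<k}" using Suc.prems(1) by (auto simp: lessThan_Suc)
    have s: "y + (\<Sum>i\<in>A. (\<xi>(k := \<eta>)) i) = (y + \<eta>) + (\<Sum>i\<in>?A. \<xi> i)" for \<xi> :: "nat \<Rightarrow> real ^ 'd" and \<eta>
    proof -
      have "(\<Sum>i\<in>A. (\<xi>(k := \<eta>)) i) = \<eta> + (\<Sum>i\<in>?A. (\<xi>(k := \<eta>)) i)" using True fA by (simp add: sum.remove)
      also have "(\<Sum>i\<in>?A. (\<xi>(k := \<eta>)) i) = (\<Sum>i\<in>?A. \<xi> i)" by (intro sum.cong) auto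
      finally show ?thesis by (simp add: add.assoc)
    qed
    have lhs: "(\<integral>\<^sup>+\<xi>. f (y + (\<Sum>i\<in>A. \<xi> i)) \<partial>walk h (Suc k)) = (\<integral>\<^sup>+\<eta>. (\<integral>\<^sup>+\<xi>. f ((y + \<eta>) + (\<Sum>i\<in>?A. \<xi> i)) \<partial>walk h k) \<partial>gauss h)"
      unfolding product_nn_integral_insert_first[OF h fm] s ..
    show ?thesis
    proof (cases "?A = {}")
      case True
      have "card A = 1" using True \<open>k \<in> A\<close> by (metis card_1_singleton_iff insert_Diff One_nat_def)
      then show ?thesis unfolding lhs unfolding True by (simp add: W.emeasure_space_1)
    next
      case False
      let ?m = "real (card ?A) * h"
      have m: "0 < ?m" using False A h finite_subset[OF A] by (simp add: card_gt_0_iff)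
      have cA: "real (card A) * h = h + ?m"
        unfolding card_Suc_Diff1[OF fA True, symmetric] of_nat_Suc by (simp only: distrib_right mult_1)
      have "(\<integral>\<^sup>+\<eta>. (\<integral>\<^sup>+\<xi>. f ((y + \<eta>) + (\<Sum>i\<in>?A. \<xi> i)) \<partial>walk h k) \<partial>gauss h)
        = (\<integral>\<^sup>+\<eta>. (\<integral>\<^sup>+z. ennreal (heat_kernel ?m ((y + \<eta>) - z)) * f z \<partial>lborel) \<partial>gauss h)"
        unfolding Suc.IH[OF A False] by (subst nn_integral_heat_shift) auto
      also have "\<dots> = (\<integral>\<^sup>+w. ennreal (heat_kernel h (y - w)) * (\<integral>\<^sup>+z. ennreal (heat_kernel ?m (w - z)) * f z \<partial>lborel) \<partial>lborel)"
        by (rule nn_integral_heat_shift[of "\<lambda>w. \<integral>\<^sup>+z. ennreal (heat_kernel ?m (w - z)) * f z \<partial>lborel"]) measurable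
      also have "\<dots> = (\<integral>\<^sup>+w. (\<integral>\<^sup>+z. ennreal (heat_kernel h (y - w)) * (ennreal (heat_kernel ?m (w - z)) * f z) \<partial>lborel) \<partial>lborel)"
        by (intro nn_integral_cong nn_integral_cmult[symmetric]) measurable
      also have "\<dots> = (\<integral>\<^sup>+z. (\<integral>\<^sup>+w. ennreal (heat_kernel h (y - w)) * (ennreal (heat_kernel ?m (w - z)) * f z) \<partial>lborel) \<partial>lborel)"
        by (rule lborel_pair.Fubini') (simp add: case_prod_unfold)
      also have "\<dots> = (\<integral>\<^sup>+z. ennreal (heat_kernel (h + ?m) (y - z)) * f z \<partial>lborel)"
      proof (rule nn_integral_cong)
        fix z
        have "(\<integral>\<^sup>+w. ennreal (heat_kernel h (y - w)) * (ennreal (heat_kernel ?m (w - z)) * f z) \<partial>lborel)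
          = (\<integral>\<^sup>+w. ennreal (heat_kernel h (y - w) * heat_kernel ?m (w - z)) * f z \<partial>lborel)"
          by (simp add: ennreal_mult mult.assoc)
        also have "\<dots> = (\<integral>\<^sup>+w. ennreal (heat_kernel h (y - w) * heat_kernel ?m (w - z)) \<partial>lborel) * f z"
          by (rule nn_integral_multc) measurable
        also have "(\<integral>\<^sup>+w. ennreal (heat_kernel h (y - w) * heat_kernel ?m (w - z)) \<partial>lborel) = ennreal (heat_kernel (h + ?m) (y - z))"
          using heat_kernel_convolution[OF h m, of y z] by (subst nn_integral_eq_integral) auto
        finally show "(\<integral>\<^sup>+w. ennreal (heat_kernel h (y - w)) * (ennreal (heat_kernel ?m (w - z)) * f z) \<partial>lborel) = ennreal (heat_kernel (h + ?m) (y - z)) * f z" .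
      qed
      also have "\<dots> = (\<integral>\<^sup>+z. f (y + z) \<partial>gauss (h + ?m))" by (rule nn_integral_heat_shift[symmetric]) measurable
      finally show ?thesis unfolding lhs cA .
    qed
  qed
qed simp

text \<open>When the variance is exactly \<open>V\<close>, the exponential uses up half of the
  Gaussian exponent and the integral depends on the dimension alone; a smaller variance only
  decreases it.\<close>

lemma walk_increment_exp_square:
  assumes h: "0 < h" and A: "A \<subseteq> {..<k}" and V: "real (card A) * h \<le> V" "0 < V"
  shows "(\<integral>\<^sup>+\<xi>. ennreal (exp ((norm (\<Sum>i\<in>A. \<xi> i :: real ^ 'd))\<^sup>2 / (4 * V))) \<partial>walk h k) \<le> ennreal (2 powr (real CARD('d) / 2))"
proof (cases "A = {}")
  case True
  interpret W: prob_space "walk h k :: (nat \<Rightarrow> real ^ 'd) measure" by (rule prob_space_walk[OF h])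
  have "ennreal 1 \<le> ennreal (2 powr (real CARD('d) / 2))"
    by (intro ennreal_leI ge_one_powr_ge_zero) auto
  then show ?thesis using True by (simp add: W.emeasure_space_1)
next
  case False
  let ?v = "real (card A) * h"
  have v: "0 < ?v" using False h finite_subset[OF A] by (simp add: card_gt_0_iff)
  have "(\<integral>\<^sup>+\<xi>. ennreal (exp ((norm (\<Sum>i\<in>A. \<xi> i :: real ^ 'd))\<^sup>2 / (4 * V))) \<partial>walk h k)
    = (\<integral>\<^sup>+z. ennreal (exp ((norm (z :: real ^ 'd))\<^sup>2 / (4 * V))) \<partial>gauss ?v)"
    using walk_increment_law[OF h _ A False, of "\<lambda>z. ennreal (exp ((norm z)\<^sup>2 / (4 * V)))" 0] by simp
  also have "\<dots> \<le> (\<integral>\<^sup>+z. ennreal (exp ((norm (z :: real ^ 'd))\<^sup>2 / (4 * ?v))) \<partial>gauss ?v)"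
    using v V by (intro nn_integral_mono ennreal_leI) (simp add: divide_left_mono)
  also have "\<dots> = (\<integral>\<^sup>+z. ennreal (heat_kernel ?v (z :: real ^ 'd) * exp ((norm z)\<^sup>2 / (4 * ?v))) \<partial>lborel)"
    unfolding gauss_def by (subst nn_integral_density) (auto simp: ennreal_mult)
  also have "\<dots> = ennreal (2 powr (real CARD('d) / 2))"
    using heat_kernel_exp_square[OF v, where 'd='d] by (subst nn_integral_eq_integral) auto
  finally show ?thesis .
qed

lemma integral_sum_list:
  fixes f :: "'z \<Rightarrow> 'w \<Rightarrow> real"
  assumes "\<And>z. z \<in> set zs \<Longrightarrow> integrable N (f z)"
  shows "integrable N (\<lambda>w. \<Sum>z\<leftarrow>zs. f z w)" "(\<integral>w. (\<Sum>z\<leftarrow>zs. f z w) \<partial>N) = (\<Sum>z\<leftarrow>zs. \<integral>w. f z w \<partial>N)"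
proof -
  have "integrable N (\<lambda>w. \<Sum>z\<leftarrow>zs. f z w) \<and> (\<integral>w. (\<Sum>z\<leftarrow>zs. f z w) \<partial>N) = (\<Sum>z\<leftarrow>zs. \<integral>w. f z w \<partial>N)"
    using assms by (induction zs) auto
  then show "integrable N (\<lambda>w. \<Sum>z\<leftarrow>zs. f z w)" "(\<integral>w. (\<Sum>z\<leftarrow>zs. f z w) \<partial>N) = (\<Sum>z\<leftarrow>zs. \<integral>w. f z w \<partial>N)" by auto
qed

context feynman_kac_scheme
begin

text \<open>In the application this is the inner product of the discretized path with the rectangle
  \<open>p\<close>.\<close>

definition path_sum :: "real \<Rightarrow> nat \<Rightarrow> real ^ 'd \<Rightarrow> (nat \<Rightarrow> real ^ 'd) \<Rightarrow> 'p \<Rightarrow> real" where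
  "path_sum h k x \<xi> p = (\<Sum>j<k. slab h j p * q p (x + (\<Sum>i\<in>{j<..<k}. \<xi> i)))"

lemma path_sum_Suc:
  "path_sum h (Suc k) x (\<xi>(k := \<eta>)) p = slab h k p * q p x + path_sum h k (x + \<eta>) \<xi> p"
proof -
  have "(\<Sum>i\<in>{j<..<Suc k}. (\<xi>(k := \<eta>)) i) = \<eta> + (\<Sum>i\<in>{j<..<k}. \<xi> i)" if "j < k" for j
  proof -
    have "{j<..<Suc k} = insert k {j<..<k}" using that by auto
    then have "(\<Sum>i\<in>{j<..<Suc k}. (\<xi>(k := \<eta>)) i) = \<eta> + (\<Sum>i\<in>{j<..<k}. (\<xi>(k := \<eta>)) i)" by simp
    also have "(\<Sum>i\<in>{j<..<k}. (\<xi>(k := \<eta>)) i) = (\<Sum>i\<in>{j<..<k}. \<xi> i)" by (intro sum.cong) auto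
    finally show ?thesis .
  qed
  then have "(\<Sum>j<k. slab h j p * q p (x + (\<Sum>i\<in>{j<..<Suc k}. (\<xi>(k := \<eta>)) i))) = path_sum h k (x + \<eta>) \<xi> p"
    unfolding path_sum_def by (intro sum.cong) (auto simp: add.assoc)
  moreover have "{k<..<Suc k} = {}" by auto
  ultimately show ?thesis unfolding path_sum_def by simp
qed

lemma path_sum_measurable: "p \<in> P \<Longrightarrow> (\<lambda>\<xi>. path_sum h k x \<xi> p) \<in> borel_measurable (walk h' k)"
proof -
  assume p: "p \<in> P"
  have "(\<lambda>\<xi>. q p (x + (\<Sum>i\<in>{j<..<k}. \<xi> i))) \<in> borel_measurable (walk h' k)" for j
  proof -
    have "(\<lambda>\<xi>. x + (\<Sum>i\<in>{j<..<k}. \<xi> i)) \<in> borel_measurable (walk h' k)"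
      using walk_sum_measurable[of "{j<..<k}" k h'] by (intro borel_measurable_add) auto
    then show ?thesis by (rule measurable_compose[OF _ q_meas[OF p]])
  qed
  then show ?thesis unfolding path_sum_def by (intro borel_measurable_sum borel_measurable_times) auto
qed

text \<open>Each position is at most \<open>|x|\<close> plus the sum of all step lengths, so the
  functional is dominated by a constant times a product of exponential weights of independent
  increments.\<close>

lemma path_functional_integrable:
  assumes h: "0 < h" and ps: "set ps \<subseteq> P"
  shows "integrable (walk h k) (\<lambda>\<xi>. u0 (x + (\<Sum>i<k. \<xi> i)) * (\<Prod>p\<leftarrow>ps. path_sum h k x \<xi> p))"
proof (rule Bochner_Integration.integrable_bound)
  interpret product_sigma_finite "\<lambda>_ :: nat. gauss h :: (real ^ 'd) measure" by (rule product_sigma_finite_gauss[OF h])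
  let ?n = "length ps" and ?C = "(\<Sum>j<k. slab_mass h j) * L * exp_weight 1 x"
  show "integrable (walk h k) (\<lambda>\<xi>. (K * ?C ^ ?n) * (\<Prod>i<k. exp_weight (real ?n) (\<xi> i :: real ^ 'd)))"
    using product_integrable_prod[of "{..<k}" "\<lambda>_. exp_weight (real ?n)"] exp_weight_gauss_integrable[OF h, of "real ?n", where 'd='d]
    by (intro integrable_mult_right) simp
  have "(\<lambda>\<xi>. x + (\<Sum>i<k. \<xi> i)) \<in> borel_measurable (walk h k)"
    using walk_sum_measurable[of "{..<k}" k h] by (intro borel_measurable_add) auto
  from measurable_compose[OF this u0_meas]
  show "(\<lambda>\<xi>. u0 (x + (\<Sum>i<k. \<xi> i)) * (\<Prod>p\<leftarrow>ps. path_sum h k x \<xi> p)) \<in> borel_measurable (walk h k)"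
    using ps by (intro borel_measurable_times prod_list_measurable path_sum_measurable) auto
  show "AE \<xi> in walk h k. norm (u0 (x + (\<Sum>i<k. \<xi> i)) * (\<Prod>p\<leftarrow>ps. path_sum h k x \<xi> p)) \<le> norm ((K * ?C ^ ?n) * (\<Prod>i<k. exp_weight (real ?n) (\<xi> i)))"
  proof (rule AE_I2)
    fix \<xi> :: "nat \<Rightarrow> real ^ 'd"
    let ?w = "\<Prod>i<k. exp_weight 1 (\<xi> i)"
    have path: "exp_weight 1 (x + (\<Sum>i\<in>{j<..<k}. \<xi> i)) \<le> exp_weight 1 x * ?w" for j
    proof -
      have "norm (x + (\<Sum>i\<in>{j<..<k}. \<xi> i)) \<le> norm x + (\<Sum>i\<in>{j<..<k}. norm (\<xi> i))"
        by (rule norm_triangle_le) (simp add: norm_sum)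
      also have "(\<Sum>i\<in>{j<..<k}. norm (\<xi> i)) \<le> (\<Sum>i<k. norm (\<xi> i))" by (intro sum_mono2) auto
      finally show ?thesis by (simp add: exp_weight_def exp_sum[symmetric] exp_add[symmetric])
    qed
    have "\<bar>path_sum h k x \<xi> p\<bar> \<le> ?C * ?w" if p: "p \<in> set ps" for p
    proof -
      have "\<bar>path_sum h k x \<xi> p\<bar> \<le> (\<Sum>j<k. slab_mass h j * (L * (exp_weight 1 x * ?w)))"
        unfolding path_sum_def
      proof (intro order_trans[OF sum_abs] sum_mono)
        fix j
        have "\<bar>q p (x + (\<Sum>i\<in>{j<..<k}. \<xi> i))\<bar> \<le> L * exp_weight 1 (x + (\<Sum>i\<in>{j<..<k}. \<xi> i))"
          using p ps by (intro q_le) auto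
        also have "\<dots> \<le> L * (exp_weight 1 x * ?w)" using L path by (intro mult_left_mono) auto
        finally show "\<bar>slab h j p * q p (x + (\<Sum>i\<in>{j<..<k}. \<xi> i))\<bar> \<le> slab_mass h j * (L * (exp_weight 1 x * ?w))"
          unfolding abs_mult using p ps h slab_mass_nonneg by (intro mult_mono slab_le) auto
      qed
      then show ?thesis by (simp add: sum_distrib_right sum_distrib_left mult_ac)
    qed
    then have "\<bar>\<Prod>p\<leftarrow>ps. path_sum h k x \<xi> p\<bar> \<le> (?C * ?w) ^ ?n" by (rule abs_prod_list_le)
    also have "\<dots> = ?C ^ ?n * (\<Prod>i<k. exp_weight (real ?n) (\<xi> i))"
      by (simp add: power_mult_distrib prod_power_distrib exp_weight_power)
    finally have "\<bar>u0 (x + (\<Sum>i<k. \<xi> i))\<bar> * \<bar>\<Prod>p\<leftarrow>ps. path_sum h k x \<xi> p\<bar> \<le> K * (?C ^ ?n * (\<Prod>i<k. exp_weight (real ?n) (\<xi> i)))"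
      using K_nonneg by (intro mult_mono u0_le) auto
    then show "norm (u0 (x + (\<Sum>i<k. \<xi> i)) * (\<Prod>p\<leftarrow>ps. path_sum h k x \<xi> p)) \<le> norm ((K * ?C ^ ?n) * (\<Prod>i<k. exp_weight (real ?n) (\<xi> i)))"
      unfolding real_norm_def abs_mult[symmetric] mult.assoc by (rule order_trans[OF _ abs_ge_self])
  qed
qed

lemma scheme_weight:
  assumes "set ps \<subseteq> P" "0 < h" "real k * h \<le> T"
  obtains C where "\<And>z. \<bar>scheme h k ps z\<bar> \<le> C * exp_weight (real (length ps)) z"
proof -
  obtain CA where "\<And>x. \<bar>scheme h k ps x - B ps (real k * h) x\<bar> \<le> CA * rate h * exp_weight (real (length ps)) x"
    using scheme_error[of "length ps"] assms by blast
  moreover obtain CB where "\<And>z. \<bar>B ps (real k * h) z\<bar> \<le> CB * exp_weight (real (length ps)) z"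
    using B_growth_length[of "length ps"] assms by (metis less_imp_le mult_nonneg_nonneg of_nat_0_le_iff order_refl)
  ultimately have "\<bar>scheme h k ps z\<bar> \<le> (CA * rate h + CB) * exp_weight (real (length ps)) z" for z
    by (smt (verit) distrib_right)
  then show ?thesis by (rule that)
qed

text \<open>By \<open>path_sum_Suc\<close>, conditioning on the first step splits each factor into a
  contribution of slab \<open>k\<close>, fixed at \<open>x\<close>, and the path sum of the walk
  restarted at \<open>x + \<eta>\<close>. Expanding the product over \<open>ps\<close> gives
  precisely the sum over \<open>splits ps\<close> in the scheme.\<close>

lemma scheme_eq_walk_integral:
  assumes h: "0 < h"
  shows "set ps \<subseteq> P \<Longrightarrow> real k * h \<le> T \<Longrightarrow> scheme h k ps x =
    (\<integral>\<xi>. u0 (x + (\<Sum>i<k. \<xi> i)) * (\<Prod>p\<leftarrow>ps. path_sum h k x \<xi> p) \<partial>walk h k)"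
proof (induction k arbitrary: ps x)
  case 0
  have "(\<Prod>p\<leftarrow>ps. path_sum h 0 x \<xi> p) = (if ps = [] then 1 else 0)" for \<xi>
    by (cases ps) (simp_all add: path_sum_def)
  then show ?case by (simp add: PiM_empty lebesgue_integral_count_space_finite)
next
  case (Suc k)
  have kT: "real k * h \<le> T" using Suc.prems h by (simp add: algebra_simps)
  let ?F = "\<lambda>ps x \<xi>. u0 (x + (\<Sum>i<k. \<xi> i)) * (\<Prod>p\<leftarrow>ps. path_sum h k x \<xi> p)"
  let ?c = "\<lambda>vs. \<Prod>p\<leftarrow>vs. slab h k p * q p x"
  have sub: "set (snd z) \<subseteq> P" if "z \<in> set (splits ps)" for z
    using splits_set[of "fst z" "snd z" ps] that Suc.prems by auto
  have f_eq: "u0 (x + (\<Sum>i<Suc k. (\<xi>(k := \<eta>)) i)) * (\<Prod>p\<leftarrow>ps. path_sum h (Suc k) x (\<xi>(k := \<eta>)) p)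
    = (\<Sum>z\<leftarrow>splits ps. ?c (fst z) * ?F (snd z) (x + \<eta>) \<xi>)" for \<xi> \<eta>
  proof -
    have "(\<Sum>i<k. (\<xi>(k := \<eta>)) i) = (\<Sum>i<k. \<xi> i)" by (intro sum.cong) auto
    then have "x + (\<Sum>i<Suc k. (\<xi>(k := \<eta>)) i) = (x + \<eta>) + (\<Sum>i<k. \<xi> i)" by (simp add: add_ac)
    then show ?thesis
      unfolding path_sum_Suc splits_prod_list_add by (simp only: sum_list_const_mult[symmetric] case_prod_unfold mult_ac)
  qed
  have "(\<integral>\<xi>. u0 (x + (\<Sum>i<Suc k. \<xi> i)) * (\<Prod>p\<leftarrow>ps. path_sum h (Suc k) x \<xi> p) \<partial>walk h (Suc k))
    = (\<integral>\<eta>. (\<integral>\<xi>. (\<Sum>z\<leftarrow>splits ps. ?c (fst z) * ?F (snd z) (x + \<eta>) \<xi>) \<partial>walk h k) \<partial>gauss h)"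
    unfolding product_integral_insert_first[OF h path_functional_integrable[OF h Suc.prems(1)]] f_eq ..
  also have "\<dots> = (\<integral>\<eta>. (\<Sum>z\<leftarrow>splits ps. ?c (fst z) * scheme h k (snd z) (x + \<eta>)) \<partial>gauss h)"
  proof (rule Bochner_Integration.integral_cong[OF refl])
    fix \<eta>
    have "(\<integral>\<xi>. (\<Sum>z\<leftarrow>splits ps. ?c (fst z) * ?F (snd z) (x + \<eta>) \<xi>) \<partial>walk h k)
      = (\<Sum>z\<leftarrow>splits ps. \<integral>\<xi>. ?c (fst z) * ?F (snd z) (x + \<eta>) \<xi> \<partial>walk h k)"
      by (intro integral_sum_list integrable_mult_right path_functional_integrable h sub)
    also have "\<dots> = (\<Sum>z\<leftarrow>splits ps. ?c (fst z) * scheme h k (snd z) (x + \<eta>))"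
      by (intro arg_cong[where f=sum_list] map_cong refl) (simp add: Suc.IH[OF sub kT])
    finally show "(\<integral>\<xi>. (\<Sum>z\<leftarrow>splits ps. ?c (fst z) * ?F (snd z) (x + \<eta>) \<xi>) \<partial>walk h k) = (\<Sum>z\<leftarrow>splits ps. ?c (fst z) * scheme h k (snd z) (x + \<eta>))" .
  qed
  also have "\<dots> = (\<Sum>z\<leftarrow>splits ps. \<integral>\<eta>. ?c (fst z) * scheme h k (snd z) (x + \<eta>) \<partial>gauss h)"
  proof (intro integral_sum_list integrable_mult_right)
    fix z assume z: "z \<in> set (splits ps)"
    note [measurable] = scheme_measurable[OF sub[OF z]]
    obtain C where C: "\<And>y. \<bar>scheme h k (snd z) y\<bar> \<le> C * exp_weight (real (length (snd z))) y"
      using scheme_weight[OF sub[OF z] h kT] by blast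
    have "integrable lborel (\<lambda>y. heat_kernel h (x - y) * scheme h k (snd z) y)"
      by (rule heat_weight_integrable[OF h _ _ C]) auto
    then show "integrable (gauss h) (\<lambda>\<eta>. scheme h k (snd z) (x + \<eta>))"
      using lborel_integral_shift_reflect(2)[of 1 "\<lambda>y. heat_kernel h (x - y) * scheme h k (snd z) y" x]
      by (simp add: integral_gauss)
  qed
  also have "\<dots> = scheme h (Suc k) ps x"
    unfolding scheme.simps case_prod_unfold
    by (intro arg_cong[where f=sum_list] map_cong refl)
       (simp add: integral_gauss_shift[OF h scheme_measurable[OF sub]])
  finally show ?case by simp
qed

end

section \<open>The discretized path as an element of the Hilbert space\<close>

lemma powr_bernoulli:
  fixes x p :: real
  assumes "0 \<le> x" "0 \<le> p" "p \<le> 1"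
  shows "x powr p \<le> 1 + p * (x - 1)"
proof (cases "x = 0")
  case False
  have "x powr p * 1 powr (1 - p) \<le> p * x + (1 - p) * 1"
    using assms False by (intro Youngs_inequality_0) auto
  then show ?thesis by (simp add: algebra_simps)
qed (use assms in simp)

text \<open>Increment of the power function between consecutive integers; at \<open>m = 0\<close> it
  is \<open>0\<close> by truncated subtraction.\<close>

definition powr_step :: "real \<Rightarrow> nat \<Rightarrow> real" where
  "powr_step p m = real m powr p - real (m - 1) powr p"

lemma powr_step_nonneg: "0 \<le> p \<Longrightarrow> 0 \<le> powr_step p m"
  unfolding powr_step_def by (cases "p = 0") (auto intro!: powr_mono2)

lemma powr_step_le:
  assumes "0 < p" "p \<le> 1" "1 \<le> m"
  shows "powr_step p m \<le> real m powr (p - 1)"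
proof -
  let ?u = "real (m - 1) / real m"
  have m: "0 < real m" using assms by simp
  have "?u powr 1 \<le> ?u powr p"
  proof (cases "m = 1")
    case False
    then have "0 < ?u" "?u \<le> 1" using assms by auto
    then show ?thesis using assms by (intro powr_mono') auto
  qed (use assms in simp)
  then have "1 - ?u powr p \<le> 1 / real m" using assms m by (simp add: of_nat_diff field_simps)
  from mult_left_mono[OF this, of "real m powr p"]
  have "real m powr p - real m powr p * ?u powr p \<le> real m powr p / real m" by (simp add: algebra_simps)
  moreover have "real m powr p * ?u powr p = real (m - 1) powr p"
    using m by (simp add: powr_divide)
  moreover have "real m powr p / real m = real m powr (p - 1)" using m by (simp add: powr_diff)
  ultimately show ?thesis by (simp add: powr_step_def)
qed

text \<open>The tangent at \<open>1\<close> lies above the concave power; it is evaluated at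
  \<open>(m - 1) / m\<close>. Read from right to left, the bound converts a sum of the powers
  \<open>m powr (p - 1)\<close> into a telescoping one.\<close>

lemma powr_step_ge:
  assumes "0 < p" "p \<le> 1" "1 \<le> m"
  shows "p * real m powr (p - 1) \<le> powr_step p m"
proof -
  let ?u = "real (m - 1) / real m"
  have m: "0 < real m" using assms by simp
  have "?u powr p \<le> 1 + p * (?u - 1)" using assms by (intro powr_bernoulli) auto
  also have "?u - 1 = - (1 / real m)" using assms m by (simp add: of_nat_diff field_simps)
  finally have "p / real m \<le> 1 - ?u powr p" by simp
  from mult_left_mono[OF this, of "real m powr p"]
  have "real m powr p * (p / real m) \<le> real m powr p - real m powr p * ?u powr p" by (simp add: algebra_simps)
  moreover have "real m powr p * ?u powr p = real (m - 1) powr p"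
    using m by (simp add: powr_divide)
  moreover have "real m powr p * (p / real m) = p * real m powr (p - 1)" using m by (simp add: powr_diff)
  ultimately show ?thesis by (simp add: powr_step_def)
qed

text \<open>Concavity once more; for \<open>p = 2 * H\<close> it is the negative correlation of the
  increments of fractional Brownian motion.\<close>

lemma powr_step_antimono:
  assumes "0 < p" "p \<le> 1" "1 \<le> m"
  shows "powr_step p (Suc m) \<le> powr_step p m"
proof -
  have m: "0 < real m" using assms by simp
  have b: "(real (m + 1) / real m) powr p \<le> 1 + p * (real (m + 1) / real m - 1)"
    "(real (m - 1) / real m) powr p \<le> 1 + p * (real (m - 1) / real m - 1)"
    using assms by (intro powr_bernoulli; auto)+
  have "real (m + 1) / real m - 1 = 1 / real m" "real (m - 1) / real m - 1 = - (1 / real m)"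
    using assms m by (simp_all add: of_nat_diff field_simps)
  with b have "(real (m + 1) / real m) powr p + (real (m - 1) / real m) powr p \<le> 2" by simp
  from mult_left_mono[OF this, of "real m powr p"]
  have "real m powr p * (real (m + 1) / real m) powr p + real m powr p * (real (m - 1) / real m) powr p \<le> 2 * real m powr p"
    by (simp add: algebra_simps)
  moreover have "real m powr p * (real (m + 1) / real m) powr p = real (m + 1) powr p"
    "real m powr p * (real (m - 1) / real m) powr p = real (m - 1) powr p"
    using m by (simp_all add: powr_divide)
  ultimately show ?thesis by (simp add: powr_step_def add.commute)
qed

lemma powr_step_sum: "0 < p \<Longrightarrow> (\<Sum>m=1..M. powr_step p m) = real M powr p"
  by (induction M) (auto simp: powr_step_def)

text \<open>Summation by parts; this is where the assumption \<open>\<alpha> > 1 - 2H\<close> enters.\<close>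

lemma second_difference_sum:
  assumes \<beta>: "0 < \<beta>" "\<beta> < 1" and \<alpha>: "0 < \<alpha>" "\<alpha> < 1" "1 < \<alpha> + \<beta>"
  shows "(\<Sum>m=1..M. (powr_step \<beta> m - powr_step \<beta> (Suc m)) * real m powr \<alpha>) \<le> real M powr (\<alpha> + \<beta> - 1) / (\<alpha> + \<beta> - 1)"
proof -
  let ?\<gamma> = "\<alpha> + \<beta> - 1"
  have "(\<Sum>m=1..M. (powr_step \<beta> m - powr_step \<beta> (Suc m)) * real m powr \<alpha>)
    = (\<Sum>m=1..M. powr_step \<beta> m * powr_step \<alpha> m) - powr_step \<beta> (Suc M) * real M powr \<alpha>"
  proof (induction M)
    case (Suc M)
    let ?S = "\<Sum>m=1..M. powr_step \<beta> m * powr_step \<alpha> m" and ?X = "real (Suc M) powr \<alpha>"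
    have rM: "real M powr \<alpha> = ?X - powr_step \<alpha> (Suc M)" by (simp add: powr_step_def)
    have "(\<Sum>m=1..Suc M. (powr_step \<beta> m - powr_step \<beta> (Suc m)) * real m powr \<alpha>)
      = (?S - powr_step \<beta> (Suc M) * (?X - powr_step \<alpha> (Suc M))) + (powr_step \<beta> (Suc M) - powr_step \<beta> (Suc (Suc M))) * ?X"
      using Suc unfolding rM by simp
    also have "\<dots> = (?S + powr_step \<beta> (Suc M) * powr_step \<alpha> (Suc M)) - powr_step \<beta> (Suc (Suc M)) * ?X"
      by (simp only: left_diff_distrib right_diff_distrib)
    finally show ?case by simp
  qed (use \<alpha> in simp)
  also have "\<dots> \<le> (\<Sum>m=1..M. powr_step \<beta> m * powr_step \<alpha> m)"
    using powr_step_nonneg[of \<beta> "Suc M"] \<beta> by simp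
  \<comment> \<open>The product of the two increments is at most
    \<open>m powr (?\<gamma> - 1)\<close>, which \<open>powr_step_ge\<close> turns back into
    increments of the power \<open>?\<gamma> > 0\<close>, so that the sum telescopes.\<close>
  also have "\<dots> \<le> (\<Sum>m=1..M. powr_step ?\<gamma> m / ?\<gamma>)"
  proof (rule sum_mono)
    fix m assume m: "m \<in> {1..M}"
    have "powr_step \<beta> m * powr_step \<alpha> m \<le> real m powr (\<beta> - 1) * real m powr (\<alpha> - 1)"
      using m \<alpha> \<beta> by (intro mult_mono powr_step_le powr_step_nonneg) auto
    also have "\<dots> = real m powr (?\<gamma> - 1)" by (simp add: powr_add[symmetric] algebra_simps)
    also have "\<dots> \<le> powr_step ?\<gamma> m / ?\<gamma>"
      using powr_step_ge[of ?\<gamma> m] m \<alpha> \<beta> by (simp add: field_simps)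
    finally show "powr_step \<beta> m * powr_step \<alpha> m \<le> powr_step ?\<gamma> m / ?\<gamma>" .
  qed
  also have "\<dots> = real M powr ?\<gamma> / ?\<gamma>"
    using powr_step_sum[of ?\<gamma> M] \<alpha> by (simp add: sum_divide_distrib[symmetric])
  finally show ?thesis .
qed

text \<open>A dichotomy at the threshold \<open>r\<close> with
  \<open>r powr (1 - \<alpha>) = 4 * \<Lambda>\<close>: above it the left side is at most
  \<open>y / 4\<close>, below it at most \<open>r\<close>. The fraction \<open>1/4\<close> is the
  one that \<open>walk_increment_exp_square\<close> can integrate.\<close>

lemma young_powr:
  fixes \<Lambda> y \<alpha> :: real
  assumes "0 \<le> \<Lambda>" "0 \<le> y" "0 < \<alpha>" "\<alpha> < 1"
  shows "\<Lambda> * y powr \<alpha> \<le> y / 4 + (4 * \<Lambda>) powr (1 / (1 - \<alpha>))"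
proof (cases "\<Lambda> = 0 \<or> y = 0")
  case True
  then show ?thesis using assms by auto
next
  case False
  then have L: "0 < \<Lambda>" and y: "0 < y" using assms by auto
  let ?r = "(4 * \<Lambda>) powr (1 / (1 - \<alpha>))"
  have r: "0 < ?r" using L by simp
  have rp: "?r powr (1 - \<alpha>) = 4 * \<Lambda>" using L assms by (simp add: powr_powr)
  show ?thesis
  proof (cases "?r \<le> y")
    case True
    then have "?r powr (1 - \<alpha>) \<le> y powr (1 - \<alpha>)" using assms r by (intro powr_mono2) auto
    then have "4 * \<Lambda> \<le> y powr (1 - \<alpha>)" by (simp only: rp)
    then have "4 * \<Lambda> * y powr \<alpha> \<le> y powr (1 - \<alpha>) * y powr \<alpha>" by (intro mult_right_mono) auto
    also have "\<dots> = y" using y by (simp add: powr_add[symmetric])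
    finally show ?thesis using r by linarith
  next
    case False
    then have "\<Lambda> * y powr \<alpha> \<le> \<Lambda> * ?r powr \<alpha>" using assms y by (intro mult_left_mono powr_mono2) auto
    also have "\<dots> \<le> (4 * \<Lambda>) * ?r powr \<alpha>" using L by (intro mult_right_mono) auto
    also have "\<dots> = ?r powr (1 - \<alpha>) * ?r powr \<alpha>" by (simp only: rp)
    also have "\<dots> = ?r" using r by (simp add: powr_add[symmetric])
    finally show ?thesis using y by linarith
  qed
qed

text \<open>Jensen's inequality, the missing mass \<open>1 - (\<Sum>i\<in>I. w i) / W\<close> being placed at \<open>0\<close>.\<close>

lemma exp_sum_le:
  fixes w y :: "'i \<Rightarrow> real"
  assumes I: "finite I" and w: "\<And>i. i \<in> I \<Longrightarrow> 0 \<le> w i" and W: "(\<Sum>i\<in>I. w i) \<le> W" "0 < W"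
  shows "exp (\<Sum>i\<in>I. w i * y i) \<le> (\<Sum>i\<in>I. (w i / W) * exp (W * y i)) + (1 - (\<Sum>i\<in>I. w i) / W)"
proof -
  let ?A = "\<Sum>i\<in>I. w i * y i" and ?s = "(\<Sum>i\<in>I. w i) / W"
  \<comment> \<open>The tangent of the exponential at the barycentre \<open>?A\<close>. It is
    averaged over the points \<open>W * y i\<close> with masses \<open>w i / W\<close> and the point
    \<open>0\<close> with the missing mass; the linear terms then cancel.\<close>
  have tan: "exp ?A * (1 + a - ?A) \<le> exp a" for a
  proof -
    have "exp ?A * (1 + (a - ?A)) \<le> exp ?A * exp (a - ?A)" by (intro mult_left_mono exp_ge_add_one_self) auto
    then show ?thesis by (simp add: exp_add[symmetric] algebra_simps)
  qed
  have "(\<Sum>i\<in>I. (w i / W) * (exp ?A * (1 + W * y i - ?A))) + (1 - ?s) * (exp ?A * (1 + 0 - ?A))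
      \<le> (\<Sum>i\<in>I. (w i / W) * exp (W * y i)) + (1 - ?s) * exp 0"
  proof (intro add_mono sum_mono mult_left_mono tan)
    show "0 \<le> w i / W" if "i \<in> I" for i using w[OF that] W by simp
    show "0 \<le> 1 - ?s" using W by simp
  qed
  also have "(\<Sum>i\<in>I. (w i / W) * (exp ?A * (1 + W * y i - ?A))) = exp ?A * (?s * (1 - ?A) + ?A)"
  proof -
    have "(w i / W) * (exp ?A * (1 + W * y i - ?A)) = exp ?A * (1 - ?A) / W * w i + exp ?A * (w i * y i)" for i
      using W by (simp add: field_simps)
    then have "(\<Sum>i\<in>I. (w i / W) * (exp ?A * (1 + W * y i - ?A)))
      = (\<Sum>i\<in>I. exp ?A * (1 - ?A) / W * w i) + (\<Sum>i\<in>I. exp ?A * (w i * y i))"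
      by (simp add: sum.distrib)
    also have "\<dots> = exp ?A * (1 - ?A) / W * (\<Sum>i\<in>I. w i) + exp ?A * ?A"
      by (simp only: sum_distrib_left)
    also have "\<dots> = exp ?A * (?s * (1 - ?A) + ?A)" by (simp add: distrib_left mult_ac)
    finally show ?thesis .
  qed
  also have "exp ?A * (?s * (1 - ?A) + ?A) + (1 - ?s) * (exp ?A * (1 + 0 - ?A)) = exp ?A" by (simp add: algebra_simps)
  finally show ?thesis by simp
qed

section \<open>The covariance \<open>Q\<close> and the norm of the discretized path\<close>

locale noise_space =
  fixes H \<alpha> C1 :: real and Q :: "real ^ 'd \<Rightarrow> real ^ 'd \<Rightarrow> real"
    and ind :: "real \<Rightarrow> real ^ 'd \<Rightarrow> 'h :: {real_inner, complete_space}"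
  assumes H: "0 < H" "H < 1/2" and \<alpha>: "1 - 2 * H < \<alpha>" "\<alpha> < 1" and C1: "0 < C1"
    and completion: "rectangle_completion H Q ind"
    and Q_inc: "\<And>x y. Q x x + Q y y - 2 * Q x y \<le> C1 * norm (x - y) powr (2 * \<alpha>)"
begin

lemma \<alpha>_pos: "0 < \<alpha>"
  using H \<alpha> by linarith

lemma ind_inner: "0 \<le> t \<Longrightarrow> 0 \<le> s \<Longrightarrow> inner (ind t x) (ind s y) = fbm_cov H t s * Q x y"
  using completion unfolding rectangle_completion_def by blast

text \<open>At time \<open>1\<close> the temporal covariance is \<open>1\<close>, so the vectors
  \<open>ind 1 x\<close> realize \<open>Q\<close> as a Gram kernel. The hypothesis on increments
  becomes Hoelder continuity of these vectors, and Cauchy-Schwarz passes it on to \<open>Q\<close>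
  in each variable.\<close>

lemma Q_inner: "Q x y = inner (ind 1 x) (ind 1 y)"
  using ind_inner[of 1 1 x y] by (simp add: fbm_cov_def)

lemma Q_dist: "Q x x + Q y y - 2 * Q x y = (norm (ind 1 x - ind 1 y))\<^sup>2"
proof -
  have "inner (ind 1 y) (ind 1 x) = inner (ind 1 x) (ind 1 y)" by (rule inner_commute)
  then show ?thesis unfolding Q_inner power2_norm_eq_inner inner_diff_left inner_diff_right by linarith
qed

lemma ind_dist: "norm (ind 1 x - ind 1 y) \<le> sqrt C1 * norm (x - y) powr \<alpha>"
proof -
  have "(norm (ind 1 x - ind 1 y))\<^sup>2 \<le> C1 * norm (x - y) powr (2 * \<alpha>)" using Q_inc[of x y] Q_dist[of x y] by simp
  also have "\<dots> = (sqrt C1 * norm (x - y) powr \<alpha>)\<^sup>2"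
  proof -
    have "(norm (x - y) powr \<alpha>)\<^sup>2 = norm (x - y) powr (2 * \<alpha>)"
      by (simp only: power2_eq_square powr_add[symmetric] mult_2)
    then show ?thesis using C1 by (simp add: power_mult_distrib)
  qed
  finally show ?thesis by (rule power2_le_imp_le) (use C1 in simp)
qed

lemma Q_holder: "\<bar>Q z y - Q z' y\<bar> \<le> (sqrt C1 * norm (ind 1 y)) * norm (z - z') powr \<alpha>"
proof -
  have "\<bar>Q z y - Q z' y\<bar> = \<bar>inner (ind 1 z - ind 1 z') (ind 1 y)\<bar>" by (simp add: Q_inner inner_diff_left)
  also have "\<dots> \<le> norm (ind 1 z - ind 1 z') * norm (ind 1 y)" by (rule Cauchy_Schwarz_ineq2)
  also have "\<dots> \<le> (sqrt C1 * norm (z - z') powr \<alpha>) * norm (ind 1 y)" by (intro mult_right_mono ind_dist) auto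
  finally show ?thesis by (simp add: mult_ac)
qed

lemma Q_growth: "\<bar>Q z y\<bar> \<le> (norm (ind 1 0) + sqrt C1) * norm (ind 1 y) * exp_weight 1 z"
proof -
  have "norm (ind 1 z) \<le> norm (ind 1 0) + norm (ind 1 z - ind 1 0)" by (rule norm_triangle_sub)
  also have "\<dots> \<le> norm (ind 1 0) + sqrt C1 * norm z powr \<alpha>" using ind_dist[of z 0] by simp
  also have "\<dots> \<le> norm (ind 1 0) * exp_weight 1 z + sqrt C1 * exp_weight 1 z"
  proof (intro add_mono mult_left_mono)
    show "norm (ind 1 0) \<le> norm (ind 1 0) * exp_weight 1 z"
      using exp_weight_ge_1[of 1 z] by (simp add: mult_left_le_one_le mult_le_cancel_left1)
    have "norm z powr \<alpha> \<le> 1 + \<alpha> * (norm z - 1)" using \<alpha>_pos \<alpha> by (intro powr_bernoulli) auto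
    also have "\<dots> \<le> 1 + norm z" using \<alpha>_pos \<alpha> mult_right_mono[of \<alpha> 1 "norm z"] by (simp add: algebra_simps)
    also have "\<dots> \<le> exp (norm z)" by (rule exp_ge_add_one_self)
    finally show "norm z powr \<alpha> \<le> exp_weight 1 z" by (simp add: exp_weight_def)
  qed (use C1 in auto)
  finally have "norm (ind 1 z) * norm (ind 1 y) \<le> ((norm (ind 1 0) + sqrt C1) * exp_weight 1 z) * norm (ind 1 y)"
    by (intro mult_right_mono) (auto simp: distrib_right)
  then show ?thesis using Cauchy_Schwarz_ineq2[of "ind 1 z" "ind 1 y"] by (simp add: Q_inner mult_ac)
qed

lemma Q_measurable: "(\<lambda>z. Q z y) \<in> borel_measurable borel"
proof (rule borel_measurable_continuous_onI)
  have "((\<lambda>z. Q z y) \<longlongrightarrow> Q z0 y) (at z0)" for z0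
  proof (rule LIM_zero_cancel, rule Lim_null_comparison)
    show "\<forall>\<^sub>F z in at z0. norm (Q z y - Q z0 y) \<le> (sqrt C1 * norm (ind 1 y)) * norm (z - z0) powr \<alpha>"
      using Q_holder[of _ y z0] by simp
    have "((\<lambda>z. norm (z - z0) powr \<alpha>) \<longlongrightarrow> norm (z0 - z0) powr \<alpha>) (at z0)"
      using \<alpha>_pos by (intro tendsto_powr' tendsto_intros) auto
    then show "((\<lambda>z. (sqrt C1 * norm (ind 1 y)) * norm (z - z0) powr \<alpha>) \<longlongrightarrow> 0) (at z0)"
      using tendsto_mult_right_zero[of "\<lambda>z. norm (z - z0) powr \<alpha>" "at z0"] by simp
  qed
  then show "continuous_on UNIV (\<lambda>z. Q z y)" by (simp add: continuous_on_def)
qed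

text \<open>Separates the starting point from the displacement, so that \<open>x\<close> enters the
  final estimate through \<open>Q x x\<close> alone.\<close>

lemma Q_diag: "Q y y \<le> 2 * Q x x + 2 * (C1 * norm (y - x) powr (2 * \<alpha>))"
proof -
  have "(norm (ind 1 y))\<^sup>2 \<le> 2 * (norm (ind 1 x))\<^sup>2 + 2 * (norm (ind 1 y - ind 1 x))\<^sup>2"
  proof -
    have "norm (ind 1 y) \<le> norm (ind 1 x) + norm (ind 1 y - ind 1 x)" by (rule norm_triangle_sub)
    then have "(norm (ind 1 y))\<^sup>2 \<le> (norm (ind 1 x) + norm (ind 1 y - ind 1 x))\<^sup>2" by (intro power_mono) auto
    also have "\<dots> \<le> 2 * (norm (ind 1 x))\<^sup>2 + 2 * (norm (ind 1 y - ind 1 x))\<^sup>2"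
      using zero_le_power2[of "norm (ind 1 x) - norm (ind 1 y - ind 1 x)"] by (simp add: power2_eq_square algebra_simps)
    finally show ?thesis .
  qed
  then show ?thesis using Q_inc[of y x] Q_dist[of y x] by (simp add: Q_inner power2_norm_eq_inner)
qed

text \<open>This is the indicator \<open>(s,y) \<mapsto> 1\<^bsub>[0,b\<^sub>j]\<^esub>(y)\<close>, \<open>s\<close> in the cell \<open>[jh,(j+1)h]\<close>, a discretization of
  \<open>g\<^sup>B\<close>.\<close>

definition path_element :: "real \<Rightarrow> nat \<Rightarrow> (nat \<Rightarrow> real ^ 'd) \<Rightarrow> 'h" where
  "path_element h N b = (\<Sum>j<N. ind (real (Suc j) * h) (b j) - ind (real j * h) (b j))"

text \<open>Covariance of the fractional increment over cell \<open>j\<close> with the value at the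
  final time, that is, the sum of row \<open>j\<close> of the covariance matrix of the
  increments.\<close>

definition time_weight :: "real \<Rightarrow> nat \<Rightarrow> nat \<Rightarrow> real" where
  "time_weight h N j = fbm_cov H (real (Suc j) * h) (real N * h) - fbm_cov H (real j * h) (real N * h)"

text \<open>For \<open>m \<ge> 1\<close>, minus the covariance of the increments over two cells at
  distance \<open>m\<close>.\<close>

definition pair_weight :: "real \<Rightarrow> nat \<Rightarrow> real" where
  "pair_weight h m = h powr (2 * H) * (powr_step (2 * H) m - powr_step (2 * H) (Suc m)) / 2"

lemma time_weight_nonneg: "0 \<le> h \<Longrightarrow> j < N \<Longrightarrow> 0 \<le> time_weight h N j"
proof -
  assume h: "0 \<le> h" and j: "j < N"
  have "(real j * h) powr (2 * H) \<le> (real (Suc j) * h) powr (2 * H)"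
    using h H by (intro powr_mono2 mult_right_mono) auto
  moreover have "\<bar>real (Suc j) * h - real N * h\<bar> powr (2 * H) \<le> \<bar>real j * h - real N * h\<bar> powr (2 * H)"
  proof (intro powr_mono2)
    have "real (Suc j) * h \<le> real N * h" "real j * h \<le> real (Suc j) * h" using h j by (intro mult_right_mono; simp)+
    then show "\<bar>real (Suc j) * h - real N * h\<bar> \<le> \<bar>real j * h - real N * h\<bar>" by linarith
  qed (use H in auto)
  ultimately show ?thesis by (simp add: time_weight_def fbm_cov_def)
qed

lemma time_weight_sum: "0 \<le> h \<Longrightarrow> (\<Sum>j<N. time_weight h N j) = (real N * h) powr (2 * H)"
  unfolding time_weight_def using sum_lessThan_telescope[of "\<lambda>j. fbm_cov H (real j * h) (real N * h)" N]
  by (simp add: fbm_cov_def)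

lemma pair_weight_nonneg: "1 \<le> m \<Longrightarrow> 0 \<le> pair_weight h m"
  unfolding pair_weight_def using powr_step_antimono[of "2 * H" m] H by simp

definition incr_cov :: "real \<Rightarrow> nat \<Rightarrow> nat \<Rightarrow> real" where
  "incr_cov h j l = fbm_cov H (real (Suc j) * h) (real (Suc l) * h) - fbm_cov H (real (Suc j) * h) (real l * h)
     - fbm_cov H (real j * h) (real (Suc l) * h) + fbm_cov H (real j * h) (real l * h)"

lemma incr_cov_commute: "incr_cov h j l = incr_cov h l j"
  by (simp add: incr_cov_def fbm_cov_def abs_minus_commute add.commute)

lemma incr_cov_less: "0 \<le> h \<Longrightarrow> l < j \<Longrightarrow> incr_cov h j l = - pair_weight h (j - l)"
proof -
  assume h: "0 \<le> h" and l: "l < j"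
  define m where "m = j - l"
  have j: "j = l + m" and m: "1 \<le> m" using l by (auto simp: m_def)
  have e: "\<bar>real (Suc j) * h - real (Suc l) * h\<bar> = real m * h" "\<bar>real (Suc j) * h - real l * h\<bar> = real (Suc m) * h"
    "\<bar>real j * h - real (Suc l) * h\<bar> = real (m - 1) * h" "\<bar>real j * h - real l * h\<bar> = real m * h"
  proof -
    have "real (Suc j) * h - real (Suc l) * h = real m * h" "real (Suc j) * h - real l * h = real (Suc m) * h"
      "real j * h - real (Suc l) * h = real (m - 1) * h" "real j * h - real l * h = real m * h"
      using m by (simp_all add: j of_nat_diff algebra_simps)
    then show "\<bar>real (Suc j) * h - real (Suc l) * h\<bar> = real m * h" "\<bar>real (Suc j) * h - real l * h\<bar> = real (Suc m) * h"
      "\<bar>real j * h - real (Suc l) * h\<bar> = real (m - 1) * h" "\<bar>real j * h - real l * h\<bar> = real m * h"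
      using h by (simp_all only: abs_mult abs_of_nat abs_of_nonneg)
  qed
  have "incr_cov h j l = ((real (Suc m) * h) powr (2 * H) + (real (m - 1) * h) powr (2 * H) - 2 * (real m * h) powr (2 * H)) / 2"
    unfolding incr_cov_def fbm_cov_def e by (simp add: field_simps)
  also have "\<dots> = - pair_weight h m"
  proof -
    have "(real k * h) powr (2 * H) = real k powr (2 * H) * h powr (2 * H)" for k
      using h by (simp add: powr_mult)
    then show ?thesis unfolding pair_weight_def powr_step_def by (simp add: field_simps del: of_nat_Suc)
  qed
  finally show ?thesis by (simp add: m_def)
qed

lemma incr_cov_row: "0 \<le> h \<Longrightarrow> (\<Sum>l<N. incr_cov h j l) = time_weight h N j"
proof -
  assume "0 \<le> h"
  have "(\<Sum>l<N. incr_cov h j l) = (\<Sum>l<N. (\<lambda>l. fbm_cov H (real (Suc j) * h) (real l * h) - fbm_cov H (real j * h) (real l * h)) (Suc l)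
     - (\<lambda>l. fbm_cov H (real (Suc j) * h) (real l * h) - fbm_cov H (real j * h) (real l * h)) l)"
    by (intro sum.cong) (auto simp: incr_cov_def)
  also have "\<dots> = time_weight h N j"
  proof -
    have "fbm_cov H t 0 = 0" if "0 \<le> t" for t using that by (simp add: fbm_cov_def)
    then show ?thesis using \<open>0 \<le> h\<close> by (subst sum_lessThan_telescope) (simp add: time_weight_def)
  qed
  finally show ?thesis .
qed

text \<open>For \<open>H < 1/2\<close> increments of fractional Brownian motion over distinct cells are negatively
  correlated, so the norm is controlled by the increments of \<open>Q\<close> and by its diagonal.\<close>

lemma path_element_norm:
  assumes h: "0 \<le> h"
  shows "(norm (path_element h N b))\<^sup>2 \<le> 2 * (real N * h) powr (2 * H) * Q x x
     + (\<Sum>j<N. 2 * C1 * time_weight h N j * norm (b j - x) powr (2 * \<alpha>))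
     + (\<Sum>j<N. \<Sum>l\<in>{..<N} - {j}. C1 / 2 * pair_weight h (max j l - min j l) * norm (b j - b l) powr (2 * \<alpha>))"
proof -
  let ?D = "\<lambda>y z. Q y y + Q z z - 2 * Q y z"
  have "(norm (path_element h N b))\<^sup>2 = (\<Sum>j<N. \<Sum>l<N. incr_cov h j l * Q (b j) (b l))"
  proof -
    have "inner (ind (real (Suc j) * h) (b j) - ind (real j * h) (b j)) (ind (real (Suc l) * h) (b l) - ind (real l * h) (b l))
      = incr_cov h j l * Q (b j) (b l)" for j l
      using h by (simp add: inner_diff_left inner_diff_right ind_inner incr_cov_def algebra_simps)
    then show ?thesis unfolding path_element_def power2_norm_eq_inner inner_sum_left inner_sum_right
      by (subst sum.swap) simp
  qed
  \<comment> \<open>\<open>Q y z\<close> is half of \<open>Q y y + Q z z - ?D y z\<close>. The two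
    diagonal parts sum along rows to \<open>time_weight\<close>. In the last part the terms
    \<open>l = j\<close> vanish because \<open>?D y y = 0\<close>, and all others have the
    nonnegative coefficient \<open>- incr_cov h j l\<close>.\<close>
  also have "\<dots> = (\<Sum>j<N. \<Sum>l<N. incr_cov h j l * Q (b j) (b j) / 2 + incr_cov h j l * Q (b l) (b l) / 2 - incr_cov h j l * ?D (b j) (b l) / 2)"
    by (intro sum.cong refl) (simp add: field_simps)
  also have "\<dots> = (\<Sum>j<N. \<Sum>l<N. incr_cov h j l * Q (b j) (b j) / 2) + (\<Sum>j<N. \<Sum>l<N. incr_cov h j l * Q (b l) (b l) / 2)
     + (\<Sum>j<N. \<Sum>l<N. - (incr_cov h j l * ?D (b j) (b l) / 2))"
    by (simp add: sum.distrib sum_subtractf sum_negf)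
  also have "(\<Sum>j<N. \<Sum>l<N. incr_cov h j l * Q (b l) (b l) / 2) = (\<Sum>j<N. \<Sum>l<N. incr_cov h j l * Q (b j) (b j) / 2)"
    by (subst sum.swap) (simp add: incr_cov_commute)
  also have "(\<Sum>j<N. \<Sum>l<N. incr_cov h j l * Q (b j) (b j) / 2) = (\<Sum>j<N. time_weight h N j * Q (b j) (b j)) / 2"
    using h by (simp add: incr_cov_row[symmetric] sum_distrib_right sum_divide_distrib)
  also have "(\<Sum>j<N. \<Sum>l<N. - (incr_cov h j l * ?D (b j) (b l) / 2)) = (\<Sum>j<N. \<Sum>l\<in>{..<N} - {j}. pair_weight h (max j l - min j l) * ?D (b j) (b l) / 2)"
  proof (rule sum.cong[OF refl])
    fix j assume j: "j \<in> {..<N}"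
    have "(\<Sum>l<N. - (incr_cov h j l * ?D (b j) (b l) / 2)) = (\<Sum>l\<in>{..<N} - {j}. - (incr_cov h j l * ?D (b j) (b l) / 2))"
      using j by (subst sum.remove[of _ j]) auto
    also have "\<dots> = (\<Sum>l\<in>{..<N} - {j}. pair_weight h (max j l - min j l) * ?D (b j) (b l) / 2)"
    proof (intro sum.cong refl)
      fix l assume "l \<in> {..<N} - {j}"
      then have "l < j \<or> j < l" by auto
      then have "incr_cov h j l = - pair_weight h (max j l - min j l)"
        using incr_cov_less[OF h, of l j] incr_cov_less[OF h, of j l] incr_cov_commute[of h j l] by (auto simp: max_def min_def)
      then show "- (incr_cov h j l * ?D (b j) (b l) / 2) = pair_weight h (max j l - min j l) * ?D (b j) (b l) / 2" by simp
    qed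
    finally show "(\<Sum>l<N. - (incr_cov h j l * ?D (b j) (b l) / 2)) = (\<Sum>l\<in>{..<N} - {j}. pair_weight h (max j l - min j l) * ?D (b j) (b l) / 2)" .
  qed
  also have "(\<Sum>j<N. time_weight h N j * Q (b j) (b j)) / 2 + (\<Sum>j<N. time_weight h N j * Q (b j) (b j)) / 2
    \<le> (\<Sum>j<N. time_weight h N j * (2 * Q x x + 2 * (C1 * norm (b j - x) powr (2 * \<alpha>))))"
    unfolding field_sum_of_halves using h by (intro sum_mono mult_left_mono Q_diag time_weight_nonneg) auto
  also have "\<dots> = 2 * (real N * h) powr (2 * H) * Q x x + (\<Sum>j<N. 2 * C1 * time_weight h N j * norm (b j - x) powr (2 * \<alpha>))"
  proof -
    have "(\<Sum>j<N. time_weight h N j * (2 * Q x x + 2 * (C1 * norm (b j - x) powr (2 * \<alpha>))))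
      = (\<Sum>j<N. time_weight h N j) * (2 * Q x x) + (\<Sum>j<N. 2 * C1 * time_weight h N j * norm (b j - x) powr (2 * \<alpha>))"
      unfolding sum_distrib_right sum.distrib[symmetric] by (intro sum.cong refl) (simp add: algebra_simps)
    then show ?thesis unfolding time_weight_sum[OF h] by simp
  qed
  also have "(\<Sum>j<N. \<Sum>l\<in>{..<N} - {j}. pair_weight h (max j l - min j l) * ?D (b j) (b l) / 2)
     \<le> (\<Sum>j<N. \<Sum>l\<in>{..<N} - {j}. C1 / 2 * pair_weight h (max j l - min j l) * norm (b j - b l) powr (2 * \<alpha>))"
  proof (intro sum_mono)
    fix j l assume "l \<in> {..<N} - {j}"
    then have "1 \<le> max j l - min j l" by (auto simp: max_def min_def)
    from mult_left_mono[OF Q_inc[of "b j" "b l"] pair_weight_nonneg[OF this, of h]]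
    show "pair_weight h (max j l - min j l) * ?D (b j) (b l) / 2 \<le> C1 / 2 * pair_weight h (max j l - min j l) * norm (b j - b l) powr (2 * \<alpha>)"
      by (simp add: mult_ac)
  qed
  finally show ?thesis by simp
qed

text \<open>Within a row each distance occurs at most twice, which the denominator \<open>2\<close>
  of \<open>pair_weight\<close> makes up for; the rest is \<open>second_difference_sum\<close> with
  the powers of \<open>h\<close> factored out.\<close>

lemma pair_weight_row_sum:
  assumes h: "0 < h" and j: "j < N"
  shows "(\<Sum>l\<in>{..<N} - {j}. pair_weight h (max j l - min j l) * (real (max j l - min j l) * h) powr \<alpha>)
    \<le> h powr (2 * H + \<alpha>) * real N powr (\<alpha> + 2 * H - 1) / (\<alpha> + 2 * H - 1)"
proof -
  let ?f = "\<lambda>m. pair_weight h m * (real m * h) powr \<alpha>"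
  have f0: "0 \<le> ?f m" if "1 \<le> m" for m using pair_weight_nonneg[OF that] by simp
  have split: "{..<N} - {j} = {..<j} \<union> {Suc j..<N}" using j by auto
  have "(\<Sum>l\<in>{..<N} - {j}. ?f (max j l - min j l)) = (\<Sum>l<j. ?f (j - l)) + (\<Sum>l\<in>{Suc j..<N}. ?f (l - j))"
    unfolding split by (subst sum.union_disjoint) (auto intro!: arg_cong2[where f="(+)"] sum.cong simp: max_def min_def)
  also have "(\<Sum>l<j. ?f (j - l)) = (\<Sum>m=1..j. ?f m)"
    by (rule sum.reindex_bij_witness[of _ "\<lambda>m. j - m" "\<lambda>l. j - l"]) auto
  also have "(\<Sum>l\<in>{Suc j..<N}. ?f (l - j)) = (\<Sum>m=1..N - 1 - j. ?f m)"
    by (rule sum.reindex_bij_witness[of _ "\<lambda>m. m + j" "\<lambda>l. l - j"]) (use j in auto)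
  also have "(\<Sum>m=1..j. ?f m) + (\<Sum>m=1..N - 1 - j. ?f m) \<le> (\<Sum>m=1..N. ?f m) + (\<Sum>m=1..N. ?f m)"
    using j f0 by (intro add_mono sum_mono2) auto
  also have "\<dots> = h powr (2 * H + \<alpha>) * (\<Sum>m=1..N. (powr_step (2 * H) m - powr_step (2 * H) (Suc m)) * real m powr \<alpha>)"
  proof -
    have "?f m = h powr (2 * H + \<alpha>) * ((powr_step (2 * H) m - powr_step (2 * H) (Suc m)) * real m powr \<alpha>) / 2" for m
      using h by (simp add: pair_weight_def powr_mult powr_add)
    then show ?thesis by (simp only: sum_divide_distrib[symmetric] sum_distrib_left[symmetric] field_sum_of_halves)
  qed
  also have "\<dots> \<le> h powr (2 * H + \<alpha>) * (real N powr (\<alpha> + 2 * H - 1) / (\<alpha> + 2 * H - 1))"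
    using H \<alpha> \<alpha>_pos by (intro mult_left_mono second_difference_sum) auto
  finally show ?thesis by simp
qed

text \<open>Time runs backwards: the walk starts at \<open>x\<close> in the last cell, and cell \<open>j\<close> is reached after the
  steps with indices above \<open>j\<close>.\<close>

definition walk_pos :: "nat \<Rightarrow> real ^ 'd \<Rightarrow> (nat \<Rightarrow> real ^ 'd) \<Rightarrow> nat \<Rightarrow> real ^ 'd" where
  "walk_pos N x \<xi> j = x + (\<Sum>i\<in>{j<..<N}. \<xi> i)"

text \<open>The index \<open>l = N\<close> is included and stands for the starting point
  \<open>x\<close>; intersecting with \<open>{..<N}\<close> drops the step that does not exist
  there.\<close>

lemma walk_pos_diff:
  assumes "j \<le> l"
  shows "walk_pos N x \<xi> j - walk_pos N x \<xi> l = (\<Sum>i\<in>{j<..l} \<inter> {..<N}. \<xi> i)"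
proof -
  have "{j<..<N} = ({j<..l} \<inter> {..<N}) \<union> {l<..<N}" using assms by auto
  then have "(\<Sum>i\<in>{j<..<N}. \<xi> i) = (\<Sum>i\<in>{j<..l} \<inter> {..<N}. \<xi> i) + (\<Sum>i\<in>{l<..<N}. \<xi> i)"
    by (simp only:) (rule sum.union_disjoint, auto)
  then show ?thesis by (simp add: walk_pos_def)
qed

text \<open>The summand \<open>2\<close> collects the distances from the starting point, the other
  one the mutual distances: a coefficient \<open>1 / 2\<close> times the denominator left by
  \<open>second_difference_sum\<close>.\<close>

definition norm_const :: real where
  "norm_const = C1 * (2 + 1 / (2 * (\<alpha> + 2 * H - 1)))"

text \<open>Stands in for the squared norm of the path element: as a finite sum of powers of
  distances it is visibly measurable, and its terms are increments of the walk.\<close>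

definition walk_norm_bound :: "real \<Rightarrow> nat \<Rightarrow> real ^ 'd \<Rightarrow> (nat \<Rightarrow> real ^ 'd) \<Rightarrow> real" where
  "walk_norm_bound h N x \<xi> = 2 * (real N * h) powr (2 * H) * Q x x
     + (\<Sum>j<N. 2 * C1 * time_weight h N j * norm (walk_pos N x \<xi> j - x) powr (2 * \<alpha>))
     + (\<Sum>j<N. \<Sum>l\<in>{..<N} - {j}. C1 / 2 * pair_weight h (max j l - min j l) * norm (walk_pos N x \<xi> j - walk_pos N x \<xi> l) powr (2 * \<alpha>))"

lemma path_element_norm_walk: "0 \<le> h \<Longrightarrow> (norm (path_element h N (walk_pos N x \<xi>)))\<^sup>2 \<le> walk_norm_bound h N x \<xi>"
  unfolding walk_norm_bound_def by (rule path_element_norm)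

lemma walk_pos_diff_measurable:
  "j \<le> N \<Longrightarrow> l \<le> N \<Longrightarrow> (\<lambda>\<xi>. walk_pos N x \<xi> j - walk_pos N x \<xi> l) \<in> borel_measurable (walk h N)"
  unfolding walk_pos_def
  using walk_sum_measurable[of "{j<..<N}" N h] walk_sum_measurable[of "{l<..<N}" N h]
  by (intro borel_measurable_diff borel_measurable_add) auto

lemma walk_pos_end: "walk_pos N x \<xi> N = x"
  by (simp add: walk_pos_def)

lemma walk_norm_bound_measurable: "(\<lambda>\<xi>. walk_norm_bound h N x \<xi>) \<in> borel_measurable (walk h N)"
proof -
  have m: "(\<lambda>\<xi>. norm (walk_pos N x \<xi> j - walk_pos N x \<xi> l) powr (2 * \<alpha>)) \<in> borel_measurable (walk h N)" if "j \<le> N" "l \<le> N" for j l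
    using walk_pos_diff_measurable[OF that] by measurable
  have m': "(\<lambda>\<xi>. norm (walk_pos N x \<xi> j - x) powr (2 * \<alpha>)) \<in> borel_measurable (walk h N)" if "j \<le> N" for j
    using m[OF that order_refl] by (simp add: walk_pos_end)
  show ?thesis unfolding walk_norm_bound_def
    by (intro borel_measurable_add borel_measurable_sum borel_measurable_times m m' borel_measurable_const) auto
qed

text \<open>Each squared distance is divided by its own diffusive scale \<open>V i\<close>, so the
  weights \<open>w i\<close> carry all powers of \<open>h\<close> and \<open>t\<close>. Their total
  is at most \<open>W\<close>, the same for every \<open>N\<close>, and Jensen with mass
  \<open>W\<close> leaves exponentials of one normalized increment each. Young then moves
  \<open>W\<close> into the factor \<open>?K\<close>.\<close>

lemma walk_norm_exp_moment:
  assumes h: "0 < h" and N: "1 \<le> N" and \<kappa>: "0 < \<kappa>"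
  defines "t \<equiv> real N * h"
  shows "(\<integral>\<^sup>+\<xi>. ennreal (exp (\<kappa> * walk_norm_bound h N x \<xi>)) \<partial>walk h N)
    \<le> ennreal (exp (2 * \<kappa> * t powr (2 * H) * Q x x) * (2 powr (real CARD('d) / 2)
        * exp ((4 * (\<kappa> * norm_const * t powr (2 * H + \<alpha>))) powr (1 / (1 - \<alpha>)))))"
proof -
  \<comment> \<open>A second index \<open>l = N\<close> encodes the distance from the starting
    point, so both sums in \<open>walk_norm_bound\<close> become one sum over
    \<open>I\<close>.\<close>
  define I where "I = Sigma {..<N} (\<lambda>j. {..N} - {j})"
  define c where "c i = (case i of (j, l) \<Rightarrow> if l = N then 2 * C1 * time_weight h N j else C1 / 2 * pair_weight h (max j l - min j l))" for i
  \<comment> \<open>Only an upper bound for the variance is required. For \<open>l = N\<close> the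
    crude choice \<open>t\<close>, which is the same for all \<open>j\<close>, lets the time weights
    be summed by \<open>time_weight_sum\<close>.\<close>
  define V where "V i = (case i of (j, l) \<Rightarrow> if l = N then t else real (max j l - min j l) * h)" for i
  define d where "d \<xi> i = (case i of (j, l) \<Rightarrow> norm (walk_pos N x \<xi> j - walk_pos N x \<xi> l))" for \<xi> i
  define W where "W = \<kappa> * norm_const * t powr (2 * H + \<alpha>)"
  define w where "w i = \<kappa> * c i * V i powr \<alpha>" for i
  define Y where "Y \<xi> i = ((d \<xi> i)\<^sup>2 / V i) powr \<alpha>" for \<xi> i
  have t: "0 < t" unfolding t_def using h N by simp
  have \<gamma>: "0 < \<alpha> + 2 * H - 1" using \<alpha> by simp
  have finI: "finite I" unfolding I_def by auto
  have V: "0 < V i" if iI: "i \<in> I" for i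
  proof -
    obtain j l where i: "i = (j, l)" "j < N" "l \<le> N" "l \<noteq> j" using iI by (auto simp: I_def)
    then have "0 < max j l - min j l" by (auto simp: max_def min_def)
    then show ?thesis using i t h by (simp add: V_def)
  qed
  have c: "0 \<le> c i" if iI: "i \<in> I" for i
  proof -
    obtain j l where i: "i = (j, l)" "j < N" "l \<le> N" "l \<noteq> j" using iI by (auto simp: I_def)
    then have "1 \<le> max j l - min j l" by (auto simp: max_def min_def)
    then show ?thesis using i C1 h pair_weight_nonneg time_weight_nonneg by (auto simp: c_def)
  qed
  have nc: "0 < norm_const" unfolding norm_const_def using C1 \<gamma> by (intro mult_pos_pos add_pos_pos) auto
  have W: "0 < W" unfolding W_def using \<kappa> t nc by simp
  have w: "0 \<le> w i" if "i \<in> I" for i using c[OF that] \<kappa> by (simp add: w_def)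
  have row: "(\<Sum>l\<in>{..N} - {j}. f l) = f N + (\<Sum>l\<in>{..<N} - {j}. f l)" if "j < N" for f :: "nat \<Rightarrow> real" and j
  proof -
    have "{..N} - {j} = insert N ({..<N} - {j})" using that by auto
    then show ?thesis by simp
  qed
  have "(\<Sum>i\<in>I. c i * V i powr \<alpha>) = (\<Sum>j<N. \<Sum>l\<in>{..N} - {j}. c (j, l) * V (j, l) powr \<alpha>)"
    unfolding I_def by (subst sum.Sigma) auto
  also have "\<dots> = (\<Sum>j<N. 2 * C1 * time_weight h N j * t powr \<alpha>
      + (\<Sum>l\<in>{..<N} - {j}. C1 / 2 * pair_weight h (max j l - min j l) * (real (max j l - min j l) * h) powr \<alpha>))"
    by (intro sum.cong refl, subst row) (auto simp: c_def V_def intro!: sum.cong)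
  also have "\<dots> = 2 * C1 * t powr \<alpha> * (\<Sum>j<N. time_weight h N j)
     + C1 / 2 * (\<Sum>j<N. \<Sum>l\<in>{..<N} - {j}. pair_weight h (max j l - min j l) * (real (max j l - min j l) * h) powr \<alpha>)"
    by (simp add: sum.distrib sum_distrib_left mult_ac)
  also have "\<dots> \<le> 2 * C1 * t powr \<alpha> * t powr (2 * H) + C1 / 2 * (\<Sum>j<N. h powr (2 * H + \<alpha>) * real N powr (\<alpha> + 2 * H - 1) / (\<alpha> + 2 * H - 1))"
    using C1 h time_weight_sum[of h N] by (intro add_mono mult_left_mono sum_mono pair_weight_row_sum) (auto simp: t_def)
  also have "\<dots> = norm_const * t powr (2 * H + \<alpha>)"
  proof -
    have "real N * real N powr (\<alpha> + 2 * H - 1) = real N powr (2 * H + \<alpha>)"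
      using N by (simp add: powr_diff add.commute)
    then have "real N * (h powr (2 * H + \<alpha>) * real N powr (\<alpha> + 2 * H - 1)) = t powr (2 * H + \<alpha>)"
      unfolding t_def using h by (simp add: powr_mult mult_ac)
    then have "(\<Sum>j<N. h powr (2 * H + \<alpha>) * real N powr (\<alpha> + 2 * H - 1) / (\<alpha> + 2 * H - 1)) = t powr (2 * H + \<alpha>) / (\<alpha> + 2 * H - 1)"
      by simp
    moreover have "t powr \<alpha> * t powr (2 * H) = t powr (2 * H + \<alpha>)" by (simp add: powr_add)
    moreover have "2 * C1 * A * B + C1 / 2 * S = norm_const * P" if "S = P / (\<alpha> + 2 * H - 1)" "A * B = P" for A B S P :: real
      using that(1) by (simp add: that(2) norm_const_def mult.assoc distrib_left distrib_right)
    ultimately show ?thesis by blast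
  qed
  finally have sumw: "(\<Sum>i\<in>I. w i) \<le> W"
    unfolding w_def W_def mult.assoc sum_distrib_left[symmetric] using \<kappa> by (intro mult_left_mono) auto
  let ?r = "1 - (\<Sum>i\<in>I. w i) / W" and ?E = "2 powr (real CARD('d) / 2)"
  let ?K = "exp ((4 * W) powr (1 / (1 - \<alpha>)))" and ?A = "exp (2 * \<kappa> * t powr (2 * H) * Q x x)"
  let ?g = "\<lambda>\<xi> i. exp ((d \<xi> i)\<^sup>2 / (4 * V i))"
  have r: "0 \<le> ?r" using sumw W by simp
  have E: "1 \<le> ?E" by (intro ge_one_powr_ge_zero) auto
  have K: "1 \<le> ?K" by simp
  have bound: "\<kappa> * walk_norm_bound h N x \<xi> = 2 * \<kappa> * t powr (2 * H) * Q x x + (\<Sum>i\<in>I. w i * Y \<xi> i)" for \<xi>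
  proof -
    have "w i * Y \<xi> i = \<kappa> * (c i * d \<xi> i powr (2 * \<alpha>))" if "i \<in> I" for i
    proof -
      have "V i powr \<alpha> * Y \<xi> i = (V i * ((d \<xi> i)\<^sup>2 / V i)) powr \<alpha>"
        unfolding Y_def using V[OF that] by (subst powr_mult) auto
      also have "\<dots> = ((d \<xi> i)\<^sup>2) powr \<alpha>" using V[OF that] by simp
      also have "\<dots> = d \<xi> i powr (2 * \<alpha>)"
      proof (cases "d \<xi> i = 0")
        case False
        then have "0 < d \<xi> i" by (simp add: d_def split: prod.splits)
        then show ?thesis by (simp add: powr_powr flip: powr_numeral)
      qed simp
      finally show ?thesis by (simp add: w_def mult.assoc)
    qed
    then have "(\<Sum>i\<in>I. w i * Y \<xi> i) = \<kappa> * (\<Sum>i\<in>I. c i * d \<xi> i powr (2 * \<alpha>))"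
      by (simp add: sum_distrib_left)
    also have "(\<Sum>i\<in>I. c i * d \<xi> i powr (2 * \<alpha>)) = (\<Sum>j<N. \<Sum>l\<in>{..N} - {j}. c (j, l) * d \<xi> (j, l) powr (2 * \<alpha>))"
      unfolding I_def by (subst sum.Sigma) auto
    also have "\<dots> = (\<Sum>j<N. 2 * C1 * time_weight h N j * norm (walk_pos N x \<xi> j - x) powr (2 * \<alpha>)
      + (\<Sum>l\<in>{..<N} - {j}. C1 / 2 * pair_weight h (max j l - min j l) * norm (walk_pos N x \<xi> j - walk_pos N x \<xi> l) powr (2 * \<alpha>)))"
      by (intro sum.cong refl, subst row) (auto simp: c_def d_def walk_pos_end intro!: sum.cong)
    finally show ?thesis unfolding walk_norm_bound_def t_def by (simp add: sum.distrib algebra_simps)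
  qed
  have pointwise: "exp (\<kappa> * walk_norm_bound h N x \<xi>) \<le> (?A * ?K) * ((\<Sum>i\<in>I. (w i / W) * ?g \<xi> i) + ?r)" for \<xi>
  proof -
    have "exp (\<Sum>i\<in>I. w i * Y \<xi> i) \<le> (\<Sum>i\<in>I. (w i / W) * exp (W * Y \<xi> i)) + ?r"
      by (rule exp_sum_le[OF finI w sumw W])
    also have "\<dots> \<le> (\<Sum>i\<in>I. (w i / W) * (?g \<xi> i * ?K)) + ?r * ?K"
    proof (intro add_mono sum_mono mult_left_mono)
      fix i assume i: "i \<in> I"
      have "W * Y \<xi> i \<le> ((d \<xi> i)\<^sup>2 / V i) / 4 + (4 * W) powr (1 / (1 - \<alpha>))"
        unfolding Y_def using V[OF i] W \<alpha>_pos \<alpha> by (intro young_powr) auto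
      then show "exp (W * Y \<xi> i) \<le> ?g \<xi> i * ?K" by (simp add: exp_add[symmetric] mult.commute)
      show "0 \<le> w i / W" using w[OF i] W by simp
    next
      show "?r \<le> ?r * ?K" using mult_left_mono[OF K r] by simp
    qed
    also have "\<dots> = ?K * ((\<Sum>i\<in>I. (w i / W) * ?g \<xi> i) + ?r)"
      by (simp add: sum_distrib_left distrib_left mult_ac)
    finally show ?thesis unfolding bound exp_add mult.assoc by (intro mult_left_mono) auto
  qed
  have gm: "(\<lambda>\<xi>. ennreal (?g \<xi> i)) \<in> borel_measurable (walk h N)" if iI: "i \<in> I" for i
  proof -
    obtain j l where i: "i = (j, l)" "j \<le> N" "l \<le> N" using iI by (auto simp: I_def)
    show ?thesis unfolding d_def i(1) prod.case using walk_pos_diff_measurable[OF i(2,3)] by measurable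
  qed
  have gint: "(\<integral>\<^sup>+\<xi>. ennreal (?g \<xi> i) \<partial>walk h N) \<le> ennreal ?E" if i: "i \<in> I" for i
  proof -
    obtain j l where jl: "i = (j, l)" "j < N" "l \<le> N" "l \<noteq> j" using i by (auto simp: I_def)
    define A where "A = {min j l<..max j l} \<inter> {..<N}"
    have dA: "d \<xi> i = norm (\<Sum>i\<in>A. \<xi> i)" for \<xi>
    proof (cases "j \<le> l")
      case True
      then show ?thesis unfolding d_def jl(1) prod.case walk_pos_diff[OF True] by (simp add: A_def max_def min_def)
    next
      case False
      then have "l \<le> j" by simp
      have "d \<xi> i = norm (walk_pos N x \<xi> l - walk_pos N x \<xi> j)" by (simp add: d_def jl norm_minus_commute)
      then show ?thesis unfolding walk_pos_diff[OF \<open>l \<le> j\<close>] using False by (simp add: A_def max_def min_def)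
    qed
    have "card A \<le> card {min j l<..max j l}" unfolding A_def by (intro card_mono) auto
    then have "card A \<le> max j l - min j l" by simp
    moreover have "max j l - min j l \<le> N" using jl by auto
    ultimately have "real (card A) * h \<le> V i"
      unfolding V_def jl(1) prod.case t_def using h by (auto intro!: mult_right_mono)
    then show ?thesis unfolding dA
      by (intro walk_increment_exp_square h V i) (auto simp: A_def)
  qed
  have gsm: "(\<lambda>\<xi>. \<Sum>i\<in>I. ennreal (w i / W) * ennreal (?g \<xi> i)) \<in> borel_measurable (walk h N)"
    using gm by (intro borel_measurable_sum borel_measurable_times_ennreal) auto
  interpret W: prob_space "walk h N :: (nat \<Rightarrow> real ^ 'd) measure" by (rule prob_space_walk[OF h])
  have wW: "0 \<le> w i / W" if "i \<in> I" for i using w[OF that] W by simp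
  have conv: "ennreal (?A * ?K) * ((\<Sum>i\<in>I. ennreal (w i / W) * ennreal (g i)) + ennreal s) = ennreal ((?A * ?K) * ((\<Sum>i\<in>I. (w i / W) * g i) + s))"
    if "\<And>i. 0 \<le> g i" "0 \<le> s" for g s
  proof -
    have "(\<Sum>i\<in>I. ennreal (w i / W) * ennreal (g i)) = (\<Sum>i\<in>I. ennreal ((w i / W) * g i))"
      by (intro sum.cong refl ennreal_mult[symmetric] wW that)
    also have "\<dots> = ennreal (\<Sum>i\<in>I. (w i / W) * g i)"
      using wW that by (intro sum_ennreal mult_nonneg_nonneg)
    finally have "(\<Sum>i\<in>I. ennreal (w i / W) * ennreal (g i)) + ennreal s = ennreal ((\<Sum>i\<in>I. (w i / W) * g i) + s)"
      using wW that by (simp only:) (intro ennreal_plus[symmetric] sum_nonneg mult_nonneg_nonneg)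
    moreover have "0 \<le> (\<Sum>i\<in>I. (w i / W) * g i) + s"
      using wW that by (intro add_nonneg_nonneg sum_nonneg mult_nonneg_nonneg)
    moreover have "0 \<le> ?A * ?K" by simp
    ultimately show ?thesis by (simp only: ennreal_mult)
  qed
  have "(\<integral>\<^sup>+\<xi>. ennreal (exp (\<kappa> * walk_norm_bound h N x \<xi>)) \<partial>walk h N)
    \<le> (\<integral>\<^sup>+\<xi>. ennreal (?A * ?K) * ((\<Sum>i\<in>I. ennreal (w i / W) * ennreal (?g \<xi> i)) + ennreal ?r) \<partial>walk h N)"
  proof (rule nn_integral_mono)
    fix \<xi>
    show "ennreal (exp (\<kappa> * walk_norm_bound h N x \<xi>)) \<le> ennreal (?A * ?K) * ((\<Sum>i\<in>I. ennreal (w i / W) * ennreal (?g \<xi> i)) + ennreal ?r)"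
      unfolding conv[of "?g \<xi>", OF exp_ge_zero r] by (rule ennreal_leI[OF pointwise])
  qed
  also have "\<dots> = ennreal (?A * ?K) * ((\<Sum>i\<in>I. ennreal (w i / W) * (\<integral>\<^sup>+\<xi>. ennreal (?g \<xi> i) \<partial>walk h N)) + ennreal ?r)"
  proof -
    have "(\<integral>\<^sup>+\<xi>. ennreal (?A * ?K) * ((\<Sum>i\<in>I. ennreal (w i / W) * ennreal (?g \<xi> i)) + ennreal ?r) \<partial>walk h N)
      = ennreal (?A * ?K) * (\<integral>\<^sup>+\<xi>. (\<Sum>i\<in>I. ennreal (w i / W) * ennreal (?g \<xi> i)) + ennreal ?r \<partial>walk h N)"
      using gsm by (intro nn_integral_cmult) auto
    also have "(\<integral>\<^sup>+\<xi>. (\<Sum>i\<in>I. ennreal (w i / W) * ennreal (?g \<xi> i)) + ennreal ?r \<partial>walk h N)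
      = (\<integral>\<^sup>+\<xi>. (\<Sum>i\<in>I. ennreal (w i / W) * ennreal (?g \<xi> i)) \<partial>walk h N) + ennreal ?r"
      using gsm by (subst nn_integral_add) (auto simp: W.emeasure_space_1)
    also have "(\<integral>\<^sup>+\<xi>. (\<Sum>i\<in>I. ennreal (w i / W) * ennreal (?g \<xi> i)) \<partial>walk h N) = (\<Sum>i\<in>I. ennreal (w i / W) * (\<integral>\<^sup>+\<xi>. ennreal (?g \<xi> i) \<partial>walk h N))"
      using gm by (subst nn_integral_sum) (auto intro!: sum.cong nn_integral_cmult)
    finally show ?thesis .
  qed
  also have "\<dots> \<le> ennreal (?A * ?K) * ((\<Sum>i\<in>I. ennreal (w i / W) * ennreal ?E) + ennreal (?r * ?E))"
  proof (intro mult_left_mono add_mono sum_mono gint)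
    show "ennreal ?r \<le> ennreal (?r * ?E)" using mult_left_mono[OF E r] by (intro ennreal_leI) simp
  qed auto
  also have "\<dots> = ennreal ((?A * ?K) * ((\<Sum>i\<in>I. (w i / W) * ?E) + ?r * ?E))"
    using mult_nonneg_nonneg[OF r, of ?E] by (intro conv) auto
  also have "(\<Sum>i\<in>I. (w i / W) * ?E) + ?r * ?E = ?E"
    unfolding sum_distrib_right[symmetric] sum_divide_distrib[symmetric] by (simp add: algebra_simps)
  finally show ?thesis unfolding W_def by (simp add: mult_ac)
qed

end

section \<open>Moments by duality\<close>

text \<open>Young's inequality for integer exponents. The induction step adds
  \<open>(a - b) * (a ^ Suc n - b ^ Suc n)\<close>, whose factors have the same sign.\<close>

lemma power_mult_le_young:
  fixes a b :: real
  assumes "0 \<le> a" "0 \<le> b"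
  shows "real (Suc n) * (a ^ n * b) \<le> real n * a ^ Suc n + b ^ Suc n"
proof (induction n)
  case (Suc n)
  have "0 \<le> (a - b) * (a ^ Suc n - b ^ Suc n)"
  proof (cases "a \<le> b")
    case True
    then show ?thesis using power_mono[OF True assms(1), of "Suc n"] by (intro mult_nonpos_nonpos) auto
  next
    case False
    then show ?thesis using power_mono[of b a "Suc n"] assms by (intro mult_nonneg_nonneg) auto
  qed
  moreover have "a * (real (Suc n) * (a ^ n * b)) \<le> a * (real n * a ^ Suc n + b ^ Suc n)"
    by (intro mult_left_mono Suc assms)
  ultimately show ?case by (simp add: algebra_simps)
qed simp

text \<open>A non-integrable \<open>f\<close> is covered too: its integral is \<open>0\<close> by
  convention.\<close>

lemma integral_abs_le_nn_integral:
  fixes f :: "'a \<Rightarrow> real"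
  assumes "(\<integral>\<^sup>+x. ennreal \<bar>f x\<bar> \<partial>M) \<le> ennreal c" "0 \<le> c"
  shows "\<bar>\<integral>x. f x \<partial>M\<bar> \<le> c"
proof (cases "integrable M f")
  case True
  have "ennreal \<bar>\<integral>x. f x \<partial>M\<bar> \<le> (\<integral>\<^sup>+x. ennreal \<bar>f x\<bar> \<partial>M)"
    using integral_norm_bound_ennreal[OF True] by simp
  then show ?thesis using assms by (metis ennreal_le_iff order_trans)
qed (use assms in \<open>simp add: not_integrable_integral_eq\<close>)

context isonormal_process
begin

lemma integral_herm_comb_wick_exp:
  "(\<integral>\<omega>. herm_comb L \<omega> * wick_exp g \<omega> \<partial>M) = (\<Sum>(c, n, h)\<leftarrow>L. c * inner h g ^ n)"
  "integrable M (\<lambda>\<omega>. herm_comb L \<omega> * wick_exp g \<omega>)"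
proof -
  show i: "integrable M (\<lambda>\<omega>. herm_comb L \<omega> * wick_exp g \<omega>)" for L
    by (rule sq_integrable_mult[OF herm_comb_sq_integrable wick_exp_sq_integrable])
  show "(\<integral>\<omega>. herm_comb L \<omega> * wick_exp g \<omega> \<partial>M) = (\<Sum>(c, n, h)\<leftarrow>L. c * inner h g ^ n)"
  proof (induction L)
    case (Cons p L)
    obtain c n h where p: "p = (c, n, h)" by (cases p)
    have "(\<integral>\<omega>. herm_comb (p # L) \<omega> * wick_exp g \<omega> \<partial>M) = (\<integral>\<omega>. c * (herm n h \<omega> * wick_exp g \<omega>) + herm_comb L \<omega> * wick_exp g \<omega> \<partial>M)"
      by (simp add: p distrib_right mult.assoc)
    also have "\<dots> = c * inner h g ^ n + (\<integral>\<omega>. herm_comb L \<omega> * wick_exp g \<omega> \<partial>M)"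
      using i by (simp add: herm_wick_exp)
    finally show ?case using Cons by (simp add: p)
  qed simp
qed

text \<open>An approximate orthogonal projection. A near-minimizer \<open>V\<close> of the distance
  from \<open>\<psi>\<close> to the chaos is compared with \<open>V + l U\<close>, which makes the
  residual almost orthogonal to every \<open>U\<close>, in proportion to the norm of
  \<open>U\<close>. Half of \<open>\<epsilon>\<close> pays for near-minimality, half for
  approximating \<open>V\<close> by a Hermite combination.\<close>

lemma chaos_projection:
  assumes \<psi>: "sq_integrable M \<psi>" and \<epsilon>: "0 < \<epsilon>"
  obtains L where "\<forall>(c, n, h)\<in>set L. h \<in> D"
    "\<And>U. in_chaos D U \<Longrightarrow> \<bar>\<integral>\<omega>. (\<psi> \<omega> - herm_comb L \<omega>) * U \<omega> \<partial>M\<bar> \<le> \<epsilon> * sqrt (\<integral>\<omega>. (U \<omega>)\<^sup>2 \<partial>M)"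
proof -
  define S where "S = (\<lambda>V. \<integral>\<omega>. (\<psi> \<omega> - V \<omega>)\<^sup>2 \<partial>M) ` Collect (in_chaos D)"
  have z: "in_chaos D (\<lambda>_. 0)" using herm_comb_in_chaos[of "[]" D] by (simp add: herm_comb_def[abs_def])
  then have ne: "S \<noteq> {}" by (auto simp: S_def)
  have bdd: "bdd_below S" by (rule bdd_belowI[of _ 0]) (auto simp: S_def)
  have "\<exists>s\<in>S. s < Inf S + (\<epsilon> / 2)\<^sup>2" using \<epsilon> by (intro cInf_lessD[OF ne]) simp
  then obtain V where V: "in_chaos D V" and Vm: "(\<integral>\<omega>. (\<psi> \<omega> - V \<omega>)\<^sup>2 \<partial>M) < Inf S + (\<epsilon> / 2)\<^sup>2"
    by (auto simp: S_def)
  obtain L where L: "\<forall>(c, n, h)\<in>set L. h \<in> D" and VL: "(\<integral>\<omega>. (V \<omega> - herm_comb L \<omega>)\<^sup>2 \<partial>M) < (\<epsilon> / 2)\<^sup>2"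
  proof -
    have "0 < (\<epsilon> / 2)\<^sup>2" using \<epsilon> by simp
    then show thesis using V that unfolding in_chaos_def by blast
  qed
  have Vs: "sq_integrable M V" using in_chaos_sq_integrable[OF V] .
  note sq = sq_integrable_diff[OF \<psi> Vs] sq_integrable_diff[OF Vs herm_comb_sq_integrable]
  show thesis
  proof (rule that[OF L])
    fix U assume U: "in_chaos D U"
    then have Us: "sq_integrable M U" by (rule in_chaos_sq_integrable)
    let ?a = "\<integral>\<omega>. (\<psi> \<omega> - V \<omega>)\<^sup>2 \<partial>M" and ?b = "\<integral>\<omega>. (\<psi> \<omega> - V \<omega>) * U \<omega> \<partial>M" and ?c = "\<integral>\<omega>. (U \<omega>)\<^sup>2 \<partial>M"
    have q: "0 \<le> l\<^sup>2 * ?c - 2 * l * ?b + (\<epsilon> / 2)\<^sup>2" for l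
    proof -
      have "in_chaos D (\<lambda>\<omega>. 1 * V \<omega> + l * U \<omega>)" by (rule in_chaos_lincomb[OF V U])
      then have "Inf S \<le> (\<integral>\<omega>. (\<psi> \<omega> - (1 * V \<omega> + l * U \<omega>))\<^sup>2 \<partial>M)"
        by (intro cInf_lower[OF _ bdd]) (auto simp: S_def)
      also have "\<dots> = (\<integral>\<omega>. (\<psi> \<omega> - V \<omega>)\<^sup>2 - 2 * l * ((\<psi> \<omega> - V \<omega>) * U \<omega>) + l\<^sup>2 * (U \<omega>)\<^sup>2 \<partial>M)"
        by (rule arg_cong[where f = "lebesgue_integral M"]) (auto simp: power2_eq_square algebra_simps)
      also have "\<dots> = ?a - 2 * l * ?b + l\<^sup>2 * ?c"
        using sq(1) Us sq_integrable_mult[OF sq(1) Us] by (simp add: sq_integrable_def)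
      finally show ?thesis using Vm by linarith
    qed
    have c0: "0 \<le> ?c" by simp
    have "\<bar>?b\<bar> \<le> (\<epsilon> / 2) * sqrt ?c"
    proof (cases "?c = 0")
      case True
      then show ?thesis using Cauchy_Schwarz_L2_sqrt(1)[OF sq(1) Us] by simp
    next
      case False
      then have c: "0 < ?c" using c0 by linarith
      have "(?b / ?c)\<^sup>2 * ?c = ?b\<^sup>2 / ?c" "2 * (?b / ?c) * ?b = 2 * (?b\<^sup>2 / ?c)"
        using c by (simp_all add: power2_eq_square)
      \<comment> \<open>The value of \<open>l\<close> that minimizes the quadratic polynomial in
        \<open>q\<close>.\<close>
      with q[of "?b / ?c"] have "?b\<^sup>2 / ?c \<le> (\<epsilon> / 2)\<^sup>2" by linarith
      then have "?b\<^sup>2 \<le> (\<epsilon> / 2)\<^sup>2 * ?c" using c by (simp only: pos_divide_le_eq)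
      then have "sqrt (?b\<^sup>2) \<le> sqrt ((\<epsilon> / 2)\<^sup>2 * ?c)" by (rule real_sqrt_le_mono)
      then show ?thesis using \<epsilon> by (simp add: real_sqrt_mult)
    qed
    moreover have "\<bar>\<integral>\<omega>. (V \<omega> - herm_comb L \<omega>) * U \<omega> \<partial>M\<bar> \<le> (\<epsilon> / 2) * sqrt ?c"
    proof -
      have "sqrt (\<integral>\<omega>. (V \<omega> - herm_comb L \<omega>)\<^sup>2 \<partial>M) \<le> sqrt ((\<epsilon> / 2)\<^sup>2)"
        using VL by (intro real_sqrt_le_mono) simp
      also have "\<dots> = \<epsilon> / 2" using \<epsilon> by simp
      finally show ?thesis
        using order_trans[OF Cauchy_Schwarz_L2_sqrt(1)[OF sq(2) Us]] c0 by (meson mult_right_mono real_sqrt_ge_zero)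
    qed
    moreover have "(\<integral>\<omega>. (\<psi> \<omega> - herm_comb L \<omega>) * U \<omega> \<partial>M) = ?b + (\<integral>\<omega>. (V \<omega> - herm_comb L \<omega>) * U \<omega> \<partial>M)"
      using sq_integrable_mult[OF sq(1) Us] sq_integrable_mult[OF sq(2) Us]
      by (subst Bochner_Integration.integral_add[symmetric]) (auto simp: algebra_simps)
    ultimately show "\<bar>\<integral>\<omega>. (\<psi> \<omega> - herm_comb L \<omega>) * U \<omega> \<partial>M\<bar> \<le> \<epsilon> * sqrt ?c"
      by (auto simp: field_simps)
  qed
qed

text \<open>Restricts the directions to linear combinations of rectangles, the only ones for which
  the Feynman-Kac limit is available.\<close>

lemma in_chaos_dense:
  assumes U: "in_chaos UNIV U" and D: "closure D = UNIV"
  shows "in_chaos D U"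
proof (rule in_chaos_limit)
  show "sq_integrable M U" using in_chaos_sq_integrable[OF U] .
  fix \<epsilon> :: real assume "0 < \<epsilon>"
  then obtain L where "(\<integral>\<omega>. (U \<omega> - herm_comb L \<omega>)\<^sup>2 \<partial>M) < \<epsilon>" using U unfolding in_chaos_def by blast
  moreover have "in_chaos D (herm_comb L)"
  proof (induction L)
    case Nil
    then show ?case by (rule herm_comb_in_chaos) simp
  next
    case (Cons p L)
    obtain c n h where p: "p = (c, n, h)" by (cases p)
    have "in_chaos D (\<lambda>\<omega>. c * herm n h \<omega> + 1 * herm_comb L \<omega>)"
      using Cons herm_in_chaos[of h D n] D by (intro in_chaos_lincomb) auto
    moreover have "herm_comb (p # L) = (\<lambda>\<omega>. c * herm n h \<omega> + 1 * herm_comb L \<omega>)" by (auto simp: p)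
    ultimately show ?case by simp
  qed
  ultimately show "\<exists>V. in_chaos D V \<and> (\<integral>\<omega>. (U \<omega> - V \<omega>)\<^sup>2 \<partial>M) < \<epsilon>" by blast
qed

text \<open>Young's inequality against \<open>wick_exp g\<close>, normalised by its \<open>L\<^sup>n\<close> norm \<open>exp (m |g|\<^sup>2 / 2)\<close>,
  \<open>n = m + 1\<close>, takes the place of Hoelder's inequality.\<close>

lemma wick_exp_hoelder:
  assumes v: "v \<in> borel_measurable M" "\<And>\<omega>. 0 \<le> v \<omega>" and vi: "integrable M (\<lambda>\<omega>. v \<omega> ^ Suc m)"
    and c: "0 < c" "(\<integral>\<omega>. v \<omega> ^ Suc m \<partial>M) \<le> c ^ Suc m"
    and \<psi>: "\<psi> \<in> borel_measurable M" "\<And>\<omega>. \<bar>\<psi> \<omega>\<bar> \<le> v \<omega> ^ m"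
  shows "\<bar>\<integral>\<omega>. \<psi> \<omega> * wick_exp g \<omega> \<partial>M\<bar> \<le> c ^ m * exp (real m / 2 * (norm g)\<^sup>2)"
proof -
  let ?E = "exp (real m / 2 * (norm g)\<^sup>2)"
  let ?b = "\<lambda>\<omega>. c ^ m * ?E * ((real m / c ^ Suc m * v \<omega> ^ Suc m + wick_exp g \<omega> ^ Suc m / ?E ^ Suc m) / real (Suc m))"
  have le: "\<bar>\<psi> \<omega> * wick_exp g \<omega>\<bar> \<le> ?b \<omega>" for \<omega>
  proof -
    have w: "0 \<le> wick_exp g \<omega>" by (simp add: wick_exp_def)
    have "\<bar>\<psi> \<omega> * wick_exp g \<omega>\<bar> \<le> v \<omega> ^ m * wick_exp g \<omega>"
      unfolding abs_mult using \<psi>(2) v(2) w by (intro mult_mono) auto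
    also have "\<dots> = c ^ m * ?E * ((v \<omega> / c) ^ m * (wick_exp g \<omega> / ?E))"
      using c by (simp add: power_divide)
    also have "\<dots> \<le> ?b \<omega>"
    proof (intro mult_left_mono)
      have "real (Suc m) * ((v \<omega> / c) ^ m * (wick_exp g \<omega> / ?E)) \<le> real m * (v \<omega> / c) ^ Suc m + (wick_exp g \<omega> / ?E) ^ Suc m"
        using v(2) c w by (intro power_mult_le_young) auto
      then show "(v \<omega> / c) ^ m * (wick_exp g \<omega> / ?E) \<le> (real m / c ^ Suc m * v \<omega> ^ Suc m + wick_exp g \<omega> ^ Suc m / ?E ^ Suc m) / real (Suc m)"
        unfolding power_divide by (subst pos_le_divide_eq) (auto simp: mult_ac)
    qed (use c in auto)
    finally show ?thesis .
  qed
  have bi: "integrable M ?b" using vi wick_exp_power(1)[of g "Suc m"] by simp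
  have i: "integrable M (\<lambda>\<omega>. \<psi> \<omega> * wick_exp g \<omega>)"
  proof (rule Bochner_Integration.integrable_bound[OF bi])
    have "wick_exp g \<in> borel_measurable M" using wick_exp_sq_integrable by (simp add: sq_integrable_def)
    then show "(\<lambda>\<omega>. \<psi> \<omega> * wick_exp g \<omega>) \<in> borel_measurable M" using \<psi>(1) by (rule borel_measurable_times[rotated])
    show "AE \<omega> in M. norm (\<psi> \<omega> * wick_exp g \<omega>) \<le> norm (?b \<omega>)"
      using order_trans[OF le abs_ge_self] unfolding real_norm_def by (rule AE_I2)
  qed
  have "\<bar>\<integral>\<omega>. \<psi> \<omega> * wick_exp g \<omega> \<partial>M\<bar> \<le> (\<integral>\<omega>. ?b \<omega> \<partial>M)"
    by (rule order_trans[OF integral_abs_bound integral_mono[OF integrable_abs[OF i] bi le]])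
  also have "\<dots> = c ^ m * ?E * ((real m / c ^ Suc m * (\<integral>\<omega>. v \<omega> ^ Suc m \<partial>M) + 1) / real (Suc m))"
  proof -
    have "(\<integral>\<omega>. wick_exp g \<omega> ^ Suc m \<partial>M) = ?E ^ Suc m"
      unfolding wick_exp_power(2) exp_of_nat_mult[symmetric] by (simp add: field_simps)
    then show ?thesis using vi wick_exp_power(1)[of g "Suc m"] by simp
  qed
  also have "\<dots> \<le> c ^ m * ?E * ((real m / c ^ Suc m * c ^ Suc m + 1) / real (Suc m))"
    using c by (intro mult_left_mono divide_right_mono add_right_mono) auto
  also have "\<dots> = c ^ m * ?E" using c by (simp add: field_simps)
  finally show ?thesis .
qed

text \<open>In the application \<open>Z N\<close> is the law of the walk, \<open>w N\<close> the
  initial datum at its end point, \<open>G N\<close> the path element and \<open>b N\<close> a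
  measurable bound of its squared norm. The polynomial replacing \<open>\<psi>\<close> inherits the
  pointwise bound with \<open>c + \<epsilon>\<close>, because each Wick exponential lies in the
  chaos with norm \<open>exp ((norm g)\<^sup>2 / 2)\<close>; comparing this with the exponent
  \<open>real m / 2\<close> is where \<open>1 \<le> m\<close> enters.\<close>

lemma chaos_duality:
  fixes Z :: "nat \<Rightarrow> 'a measure" and w :: "nat \<Rightarrow> 'a \<Rightarrow> real" and G :: "nat \<Rightarrow> 'a \<Rightarrow> 'h"
  assumes U: "in_chaos D U" and D: "closure D = UNIV" and m: "1 \<le> m" and J: "0 \<le> J" and K: "0 \<le> K"
    and b: "\<And>N. b N \<in> borel_measurable (Z N)" "\<And>N \<xi>. (norm (G N \<xi>))\<^sup>2 \<le> b N \<xi>"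
    and Jb: "\<And>N. (\<integral>\<^sup>+\<xi>. ennreal (exp (real m / 2 * b N \<xi>)) \<partial>Z N) \<le> ennreal J"
    and w: "\<And>N \<xi>. \<bar>w N \<xi>\<bar> \<le> K"
    and lim: "\<And>L. \<forall>(c, k, h)\<in>set L. h \<in> D \<Longrightarrow>
      (\<lambda>N. \<integral>\<xi>. w N \<xi> * (\<Sum>(c, k, h)\<leftarrow>L. c * inner h (G N \<xi>) ^ k) \<partial>Z N) \<longlonglongrightarrow> (\<integral>\<omega>. U \<omega> * herm_comb L \<omega> \<partial>M)"
    and \<psi>: "sq_integrable M \<psi>" and c: "0 \<le> c"
    and \<psi>_le: "\<And>g. \<bar>\<integral>\<omega>. \<psi> \<omega> * wick_exp g \<omega> \<partial>M\<bar> \<le> c * exp (real m / 2 * (norm g)\<^sup>2)"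
  shows "(\<integral>\<omega>. U \<omega> * \<psi> \<omega> \<partial>M) \<le> K * J * c"
proof (rule field_le_epsilon)
  fix e :: real assume e: "0 < e"
  let ?s = "sqrt (\<integral>\<omega>. (U \<omega>)\<^sup>2 \<partial>M) + K * J"
  have s: "0 \<le> ?s" using K J by simp
  \<comment> \<open>\<open>?s\<close> collects both losses: the projection costs
    \<open>\<epsilon>\<close> times the \<open>L^2\<close> norm of \<open>U\<close>, the weakened
    pointwise bound costs \<open>\<epsilon> * K * J\<close>.\<close>
  define \<epsilon> where "\<epsilon> = e / (?s + 1)"
  have \<epsilon>: "0 < \<epsilon>" using e s by (simp add: \<epsilon>_def)
  have \<epsilon>s: "\<epsilon> * ?s \<le> e"
  proof -
    have "\<epsilon> * ?s \<le> \<epsilon> * (?s + 1)" using \<epsilon> by (intro mult_left_mono) auto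
    also have "\<dots> = e" using s by (simp add: \<epsilon>_def)
    finally show ?thesis .
  qed
  obtain L where L: "\<forall>(c, k, h)\<in>set L. h \<in> D"
    and pr: "\<And>V. in_chaos D V \<Longrightarrow> \<bar>\<integral>\<omega>. (\<psi> \<omega> - herm_comb L \<omega>) * V \<omega> \<partial>M\<bar> \<le> \<epsilon> * sqrt (\<integral>\<omega>. (V \<omega>)\<^sup>2 \<partial>M)"
    using chaos_projection[OF \<psi> \<epsilon>] by blast
  note Us = in_chaos_sq_integrable[OF U]
  have point: "\<bar>\<Sum>(c, k, h)\<leftarrow>L. c * inner h g ^ k\<bar> \<le> (c + \<epsilon>) * exp (real m / 2 * (norm g)\<^sup>2)" for g
  proof -
    have "\<bar>\<integral>\<omega>. (\<psi> \<omega> - herm_comb L \<omega>) * wick_exp g \<omega> \<partial>M\<bar> \<le> \<epsilon> * sqrt (exp ((norm g)\<^sup>2))"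
      using pr[OF wick_exp_in_chaos[of g D]] D wick_exp_power(2)[of g 2] by simp
    also have "sqrt (exp ((norm g)\<^sup>2)) = exp ((norm g)\<^sup>2 / 2)"
      by (intro real_sqrt_unique) (auto simp: power2_eq_square exp_add[symmetric])
    also have "\<epsilon> * \<dots> \<le> \<epsilon> * exp (real m / 2 * (norm g)\<^sup>2)"
      using \<epsilon> m mult_right_mono[of 1 "real m" "(norm g)\<^sup>2"] by simp
    finally have 1: "\<bar>\<integral>\<omega>. (\<psi> \<omega> - herm_comb L \<omega>) * wick_exp g \<omega> \<partial>M\<bar> \<le> \<epsilon> * exp (real m / 2 * (norm g)\<^sup>2)" .
    have "(\<integral>\<omega>. (\<psi> \<omega> - herm_comb L \<omega>) * wick_exp g \<omega> \<partial>M)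
      = (\<integral>\<omega>. \<psi> \<omega> * wick_exp g \<omega> \<partial>M) - (\<Sum>(c, k, h)\<leftarrow>L. c * inner h g ^ k)"
      unfolding integral_herm_comb_wick_exp(1)[symmetric] left_diff_distrib
      using sq_integrable_mult[OF \<psi> wick_exp_sq_integrable] integral_herm_comb_wick_exp(2)
      by (rule Bochner_Integration.integral_diff)
    with 1 \<psi>_le[of g] show ?thesis unfolding distrib_right by linarith
  qed
  have "\<bar>\<integral>\<xi>. w N \<xi> * (\<Sum>(c, k, h)\<leftarrow>L. c * inner h (G N \<xi>) ^ k) \<partial>Z N\<bar> \<le> K * (c + \<epsilon>) * J" for N
  proof (rule integral_abs_le_nn_integral)
    show "0 \<le> K * (c + \<epsilon>) * J" using K J c \<epsilon> by simp
    have "(\<integral>\<^sup>+\<xi>. ennreal \<bar>w N \<xi> * (\<Sum>(c, k, h)\<leftarrow>L. c * inner h (G N \<xi>) ^ k)\<bar> \<partial>Z N)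
      \<le> (\<integral>\<^sup>+\<xi>. ennreal (K * (c + \<epsilon>)) * ennreal (exp (real m / 2 * b N \<xi>)) \<partial>Z N)"
    proof (rule nn_integral_mono)
      fix \<xi>
      have "\<bar>w N \<xi> * (\<Sum>(c, k, h)\<leftarrow>L. c * inner h (G N \<xi>) ^ k)\<bar> \<le> K * ((c + \<epsilon>) * exp (real m / 2 * (norm (G N \<xi>))\<^sup>2))"
        unfolding abs_mult using w point K by (intro mult_mono) auto
      also have "\<dots> \<le> K * ((c + \<epsilon>) * exp (real m / 2 * b N \<xi>))"
        using K c \<epsilon> b(2)[of N \<xi>] by (intro mult_left_mono) (auto intro!: mult_left_mono)
      finally show "ennreal \<bar>w N \<xi> * (\<Sum>(c, k, h)\<leftarrow>L. c * inner h (G N \<xi>) ^ k)\<bar> \<le> ennreal (K * (c + \<epsilon>)) * ennreal (exp (real m / 2 * b N \<xi>))"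
        using K c \<epsilon> by (subst ennreal_mult[symmetric]) (auto simp: mult.assoc intro!: ennreal_leI)
    qed
    also have "\<dots> = ennreal (K * (c + \<epsilon>)) * (\<integral>\<^sup>+\<xi>. ennreal (exp (real m / 2 * b N \<xi>)) \<partial>Z N)"
      using b(1)[of N] by (intro nn_integral_cmult) measurable
    also have "\<dots> \<le> ennreal (K * (c + \<epsilon>)) * ennreal J" by (intro mult_left_mono Jb) simp
    also have "\<dots> = ennreal (K * (c + \<epsilon>) * J)" using K J c \<epsilon> by (subst ennreal_mult[symmetric]) auto
    finally show "(\<integral>\<^sup>+\<xi>. ennreal \<bar>w N \<xi> * (\<Sum>(c, k, h)\<leftarrow>L. c * inner h (G N \<xi>) ^ k)\<bar> \<partial>Z N) \<le> ennreal (K * (c + \<epsilon>) * J)" .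
  qed
  then have "\<bar>\<integral>\<omega>. U \<omega> * herm_comb L \<omega> \<partial>M\<bar> \<le> K * (c + \<epsilon>) * J"
    by (intro LIMSEQ_le_const2[OF tendsto_rabs[OF lim[OF L]]]) auto
  moreover have "(\<integral>\<omega>. U \<omega> * \<psi> \<omega> \<partial>M) = (\<integral>\<omega>. (\<psi> \<omega> - herm_comb L \<omega>) * U \<omega> \<partial>M) + (\<integral>\<omega>. U \<omega> * herm_comb L \<omega> \<partial>M)"
    using sq_integrable_mult[OF sq_integrable_diff[OF \<psi> herm_comb_sq_integrable[of L]] Us] sq_integrable_mult[OF Us herm_comb_sq_integrable[of L]]
    by (subst Bochner_Integration.integral_add[symmetric]) (auto simp: algebra_simps)
  ultimately have "(\<integral>\<omega>. U \<omega> * \<psi> \<omega> \<partial>M) \<le> \<epsilon> * sqrt (\<integral>\<omega>. (U \<omega>)\<^sup>2 \<partial>M) + K * (c + \<epsilon>) * J"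
    using pr[OF U] by linarith
  also have "\<dots> = K * J * c + \<epsilon> * ?s" by (simp add: algebra_simps)
  finally show "(\<integral>\<omega>. U \<omega> * \<psi> \<omega> \<partial>M) \<le> K * J * c + e" using \<epsilon>s by linarith
qed

text \<open>The truncation at level \<open>A\<close> makes the test variable bounded and the norm
  \<open>c\<close> finite before any moment of \<open>U\<close> is known, so
  \<open>c ^ Suc m \<le> K * J * c ^ m\<close> may be divided by \<open>c ^ m\<close>. Monotone
  convergence removes the truncation and gives integrability at the same time.\<close>

lemma chaos_moment_bound:
  fixes Z :: "nat \<Rightarrow> 'a measure" and w :: "nat \<Rightarrow> 'a \<Rightarrow> real" and G :: "nat \<Rightarrow> 'a \<Rightarrow> 'h"
  assumes U: "in_chaos D U" and D: "closure D = UNIV" and m: "1 \<le> m" and J: "0 \<le> J" and K: "0 \<le> K"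
    and b: "\<And>N. b N \<in> borel_measurable (Z N)" "\<And>N \<xi>. (norm (G N \<xi>))\<^sup>2 \<le> b N \<xi>"
    and Jb: "\<And>N. (\<integral>\<^sup>+\<xi>. ennreal (exp (real m / 2 * b N \<xi>)) \<partial>Z N) \<le> ennreal J"
    and w: "\<And>N \<xi>. \<bar>w N \<xi>\<bar> \<le> K"
    and lim: "\<And>L. \<forall>(c, k, h)\<in>set L. h \<in> D \<Longrightarrow>
      (\<lambda>N. \<integral>\<xi>. w N \<xi> * (\<Sum>(c, k, h)\<leftarrow>L. c * inner h (G N \<xi>) ^ k) \<partial>Z N) \<longlonglongrightarrow> (\<integral>\<omega>. U \<omega> * herm_comb L \<omega> \<partial>M)"
  shows "integrable M (\<lambda>\<omega>. \<bar>U \<omega>\<bar> ^ Suc m)" "(\<integral>\<omega>. \<bar>U \<omega>\<bar> ^ Suc m \<partial>M) \<le> (K * J) ^ Suc m"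
proof -
  note Us = in_chaos_sq_integrable[OF U]
  have Um [measurable]: "U \<in> borel_measurable M" using Us by (simp add: sq_integrable_def)
  define v where "v A \<omega> = min \<bar>U \<omega>\<bar> (real A)" for A :: nat and \<omega>
  have vm [measurable]: "v A \<in> borel_measurable M" for A unfolding v_def by measurable
  have v0: "0 \<le> v A \<omega>" and vA: "v A \<omega> \<le> real A" for A \<omega> by (auto simp: v_def)
  have bdd: "integrable M f" if "f \<in> borel_measurable M" "\<And>\<omega>. \<bar>f \<omega>\<bar> \<le> r" for f :: "'w \<Rightarrow> real" and r
    by (rule integrable_const_bound[of f r]) (use that in auto)
  have vi: "integrable M (\<lambda>\<omega>. v A \<omega> ^ k)" for A k
    using v0 vA by (intro bdd[of _ "real A ^ k"]) (auto intro!: power_mono)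
  have trunc: "(\<integral>\<omega>. v A \<omega> ^ Suc m \<partial>M) \<le> (K * J) ^ Suc m" for A
  proof (cases "(\<integral>\<omega>. v A \<omega> ^ Suc m \<partial>M) = 0")
    case True
    then show ?thesis using K J by simp
  next
    case False
    moreover have "0 \<le> (\<integral>\<omega>. v A \<omega> ^ Suc m \<partial>M)" using v0 by (intro integral_nonneg_AE) auto
    ultimately have pos: "0 < (\<integral>\<omega>. v A \<omega> ^ Suc m \<partial>M)" by linarith
    define c where "c = root (Suc m) (\<integral>\<omega>. v A \<omega> ^ Suc m \<partial>M)"
    have c: "0 < c" and cp: "c ^ Suc m = (\<integral>\<omega>. v A \<omega> ^ Suc m \<partial>M)"
      unfolding c_def using pos by (simp_all only: real_root_gt_zero real_root_pow_pos zero_less_Suc)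
    define \<psi> where "\<psi> \<omega> = sgn (U \<omega>) * v A \<omega> ^ m" for \<omega>
    have \<psi>m [measurable]: "\<psi> \<in> borel_measurable M" unfolding \<psi>_def by measurable
    have \<psi>v: "\<bar>\<psi> \<omega>\<bar> \<le> v A \<omega> ^ m" for \<omega>
      using v0[of A \<omega>] by (simp add: \<psi>_def abs_mult abs_sgn_eq)
    have \<psi>A: "\<bar>\<psi> \<omega>\<bar> \<le> real A ^ m" for \<omega>
      using order_trans[OF \<psi>v power_mono[OF vA v0]] .
    have "(\<psi> \<omega>)\<^sup>2 \<le> (real A ^ m)\<^sup>2" for \<omega> using power_mono[OF \<psi>A[of \<omega>] abs_ge_zero, of 2] by simp
    then have \<psi>s: "sq_integrable M \<psi>"
      unfolding sq_integrable_def by (intro conjI \<psi>m bdd[of _ "(real A ^ m)\<^sup>2"]) auto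
    have "(\<integral>\<omega>. v A \<omega> ^ Suc m \<partial>M) \<le> (\<integral>\<omega>. U \<omega> * \<psi> \<omega> \<partial>M)"
    proof (rule integral_mono[OF vi sq_integrable_mult[OF Us \<psi>s]])
      fix \<omega>
      have "v A \<omega> * v A \<omega> ^ m \<le> \<bar>U \<omega>\<bar> * v A \<omega> ^ m" using v0[of A \<omega>] by (intro mult_right_mono) (auto simp: v_def)
      also have "\<dots> = U \<omega> * \<psi> \<omega>" by (simp add: \<psi>_def abs_sgn mult_ac)
      finally show "v A \<omega> ^ Suc m \<le> U \<omega> * \<psi> \<omega>" by simp
    qed
    also have "\<dots> \<le> K * J * c ^ m"
      using c by (intro chaos_duality[OF U D m J K b Jb w lim \<psi>s] wick_exp_hoelder[OF vm v0 vi c eq_refl[OF cp[symmetric]] \<psi>m \<psi>v]) auto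
    finally have "c ^ Suc m \<le> K * J * c ^ m" unfolding cp .
    then have "c \<le> K * J" using c by simp
    then have "c ^ Suc m \<le> (K * J) ^ Suc m" using c by (intro power_mono) auto
    then show ?thesis using cp by simp
  qed
  have "(\<integral>\<^sup>+\<omega>. ennreal (\<bar>U \<omega>\<bar> ^ Suc m) \<partial>M) = (\<integral>\<^sup>+\<omega>. (SUP A. ennreal (v A \<omega> ^ Suc m)) \<partial>M)"
  proof (rule nn_integral_cong, rule antisym)
    fix \<omega>
    obtain A :: nat where "\<bar>U \<omega>\<bar> \<le> real A" using real_arch_simple by blast
    then have "v A \<omega> = \<bar>U \<omega>\<bar>" by (simp add: v_def)
    then show "ennreal (\<bar>U \<omega>\<bar> ^ Suc m) \<le> (SUP A. ennreal (v A \<omega> ^ Suc m))" by (intro SUP_upper2[of A]) auto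
    show "(SUP A. ennreal (v A \<omega> ^ Suc m)) \<le> ennreal (\<bar>U \<omega>\<bar> ^ Suc m)"
      using v0 by (intro SUP_least ennreal_leI power_mono) (auto simp: v_def)
  qed
  also have "\<dots> = (SUP A. \<integral>\<^sup>+\<omega>. ennreal (v A \<omega> ^ Suc m) \<partial>M)"
  proof (rule nn_integral_monotone_convergence_SUP)
    show "incseq (\<lambda>A \<omega>. ennreal (v A \<omega> ^ Suc m))"
      using v0 by (intro incseq_SucI le_funI ennreal_leI power_mono) (auto simp: v_def)
  qed measurable
  also have "\<dots> \<le> ennreal ((K * J) ^ Suc m)"
  proof (rule SUP_least)
    fix A
    have "(\<integral>\<^sup>+\<omega>. ennreal (v A \<omega> ^ Suc m) \<partial>M) = ennreal (\<integral>\<omega>. v A \<omega> ^ Suc m \<partial>M)"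
      using v0 by (intro nn_integral_eq_integral vi) auto
    then show "(\<integral>\<^sup>+\<omega>. ennreal (v A \<omega> ^ Suc m) \<partial>M) \<le> ennreal ((K * J) ^ Suc m)"
      using trunc by (simp only: ennreal_leI)
  qed
  finally have le: "(\<integral>\<^sup>+\<omega>. ennreal (\<bar>U \<omega>\<bar> ^ Suc m) \<partial>M) \<le> ennreal ((K * J) ^ Suc m)" .
  show i: "integrable M (\<lambda>\<omega>. \<bar>U \<omega>\<bar> ^ Suc m)"
  proof (rule integrableI_bounded)
    show "(\<lambda>\<omega>. \<bar>U \<omega>\<bar> ^ Suc m) \<in> borel_measurable M" by measurable
    show "(\<integral>\<^sup>+\<omega>. ennreal (norm (\<bar>U \<omega>\<bar> ^ Suc m)) \<partial>M) < \<infinity>"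
      using order.strict_trans1[OF le ennreal_less_top] by (simp add: abs_mult power_abs)
  qed
  have "\<bar>\<integral>\<omega>. \<bar>U \<omega>\<bar> ^ Suc m \<partial>M\<bar> \<le> (K * J) ^ Suc m"
    using le K J by (intro integral_abs_le_nn_integral) (auto simp: abs_mult power_abs)
  then show "(\<integral>\<omega>. \<bar>U \<omega>\<bar> ^ Suc m \<partial>M) \<le> (K * J) ^ Suc m" by linarith
qed

end

section \<open>The Feynman-Kac limit\<close>

locale parabolic_anderson =
  isonormal_process M X + noise_space H \<alpha> C1 Q ind
  for M :: "'w measure" and X :: "'h :: {real_inner, complete_space} \<Rightarrow> 'w \<Rightarrow> real"
    and H \<alpha> C1 :: real and Q :: "real ^ 'd \<Rightarrow> real ^ 'd \<Rightarrow> real" and ind :: "real \<Rightarrow> real ^ 'd \<Rightarrow> 'h" +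
  fixes tens :: "'h list \<Rightarrow> 'f :: {real_inner, complete_space}"
    and u0 :: "real ^ 'd \<Rightarrow> real" and u :: "real \<Rightarrow> real ^ 'd \<Rightarrow> 'w \<Rightarrow> real" and K :: real
  assumes tensors: "hilbert_tensors tens" and solution: "mild_solution M H Q ind tens X u0 u"
    and u0_meas: "u0 \<in> borel_measurable borel" and u0_le: "\<And>z. \<bar>u0 z\<bar> \<le> K"
begin

text \<open>The scheme asks for measurability on the whole time axis, while the solution is
  measurable on nonnegative times only; the extension by \<open>0\<close> bridges the two.\<close>

definition kernel_ext :: "(real \<times> (real ^ 'd)) list \<Rightarrow> real \<Rightarrow> real ^ 'd \<Rightarrow> real" where
  "kernel_ext ps s z = (if 0 \<le> s then kernel_test u (ind_list ind ps) s z else 0)"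

lemma kernel_ext_measurable: "(\<lambda>(s, z). kernel_ext ps s z) \<in> borel_measurable (borel \<Otimes>\<^sub>M borel)"
proof -
  have "(\<lambda>p. (max (0 :: real) (fst p), snd p)) \<in> measurable (borel \<Otimes>\<^sub>M (borel :: (real ^ 'd) measure)) (restrict_space borel {0..} \<Otimes>\<^sub>M borel)"
    by (intro measurable_Pair measurable_restrict_space2) auto
  from measurable_compose[OF this kernel_test_measurable[OF tensors solution, of "ind_list ind ps"]]
  have [measurable]: "(\<lambda>p. kernel_test u (ind_list ind ps) (max 0 (fst p)) (snd p)) \<in> borel_measurable (borel \<Otimes>\<^sub>M borel)"
    by simp
  have "(\<lambda>p. if 0 \<le> fst p then kernel_test u (ind_list ind ps) (max 0 (fst p)) (snd p) else 0) \<in> borel_measurable (borel \<Otimes>\<^sub>M (borel :: (real ^ 'd) measure))"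
    by measurable
  also have "(\<lambda>p. if 0 \<le> fst p then kernel_test u (ind_list ind ps) (max 0 (fst p)) (snd p) else 0) = (\<lambda>(s, z). kernel_ext ps s z)"
    by (auto simp: kernel_ext_def)
  finally show ?thesis .
qed

text \<open>One test involves finitely many rectangles, so sums over \<open>P\<close> supply the
  common constants and the common rate \<open>\<rho>\<close>. The kernel recursion becomes the
  locale assumption on \<open>B\<close>.\<close>

lemma kernel_ext_scheme:
  assumes P: "finite P" "\<And>r y. (r, y) \<in> P \<Longrightarrow> 0 \<le> r" and t: "0 < t"
  obtains L R \<rho> where "feynman_kac_scheme t H \<alpha> L R K \<rho> (\<lambda>p s. fbm_cov_deriv H s (fst p)) (\<lambda>p z. Q z (snd p)) P u0 kernel_ext"
proof
  let ?\<rho> = "\<lambda>s. \<Sum>p\<in>P. fbm_rate H s (fst p)" and ?R = "\<Sum>p\<in>P. 2 :: real"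
  let ?c = "norm (ind 1 0) + sqrt C1" and ?N = "\<Sum>p\<in>P. norm (ind 1 (snd p))"
  have r: "0 \<le> fst p" if "p \<in> P" for p using P(2)[of "fst p" "snd p"] that by simp
  have N: "norm (ind 1 (snd p)) \<le> ?N" if "p \<in> P" for p
    using P that by (intro member_le_sum) auto
  have N0: "0 \<le> ?N" by (intro sum_nonneg) auto
  have c0: "0 \<le> ?c" "sqrt C1 \<le> ?c" using C1 by simp_all
  have int: "set_integrable lborel {b..c} (\<lambda>s. fbm_rate H s (fst p))" if "0 \<le> b" "b \<le> c" "p \<in> P" for b c p
    using H r that by (intro fbm_rate_integrable) auto
  show "feynman_kac_scheme t H \<alpha> (?c * ?N) ?R K ?\<rho> (\<lambda>p s. fbm_cov_deriv H s (fst p)) (\<lambda>p z. Q z (snd p)) P u0 kernel_ext"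
  proof
    show "0 < t" "0 < H" "0 < \<alpha>" "\<alpha> \<le> 1" using t H \<alpha> \<alpha>_pos by auto
    show "0 \<le> ?c * ?N" using c0 N0 by simp
    show "0 \<le> ?R" by simp
    show "\<bar>fbm_cov_deriv H s (fst p)\<bar> \<le> ?\<rho> s" if "p \<in> P" for p s
    proof -
      have "fbm_rate H s (fst p) \<le> ?\<rho> s" using P that fbm_rate_nonneg H by (intro member_le_sum) auto
      then show ?thesis using fbm_cov_deriv_le_rate[OF H(1), of s "fst p"] by linarith
    qed
    show "set_integrable lborel {b..c} ?\<rho>" if "0 \<le> b" "b \<le> c" for b c
      unfolding set_integrable_def sum_distrib_left scaleR_sum_right
      using int[OF that] by (intro Bochner_Integration.integrable_sum) (simp add: set_integrable_def)
    show "(LINT s:{b..c}|lborel. ?\<rho> s) \<le> ?R * (c - b) powr (2 * H)" if "0 \<le> b" "b \<le> c" for b c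
    proof -
      have "(LINT s:{b..c}|lborel. ?\<rho> s) = (\<Sum>p\<in>P. LINT s:{b..c}|lborel. fbm_rate H s (fst p))"
        unfolding set_lebesgue_integral_def scaleR_sum_right
        using int[OF that] by (intro Bochner_Integration.integral_sum) (simp add: set_integrable_def)
      also have "\<dots> \<le> (\<Sum>p\<in>P. 2 * (c - b) powr (2 * H))"
        using H r that by (intro sum_mono fbm_rate_integral_le) auto
      finally show ?thesis by (simp add: sum_distrib_right)
    qed
    show "0 \<le> ?\<rho> s" for s using fbm_rate_nonneg H by (intro sum_nonneg) auto
    show "\<bar>Q z (snd p)\<bar> \<le> ?c * ?N * exp_weight 1 z" if "p \<in> P" for p z
    proof -
      have "?c * norm (ind 1 (snd p)) * exp_weight 1 z \<le> ?c * ?N * exp_weight 1 z"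
        using N[OF that] c0 by (intro mult_right_mono mult_left_mono) (auto simp: exp_weight_def)
      then show ?thesis using Q_growth[of z "snd p"] by linarith
    qed
    show "\<bar>Q z (snd p) - Q z' (snd p)\<bar> \<le> ?c * ?N * norm (z - z') powr \<alpha>" if "p \<in> P" for p z z'
    proof -
      have "sqrt C1 * norm (ind 1 (snd p)) * norm (z - z') powr \<alpha> \<le> ?c * ?N * norm (z - z') powr \<alpha>"
        using N[OF that] c0 N0 by (intro mult_right_mono mult_mono) auto
      then show ?thesis using Q_holder[of z "snd p" z'] by linarith
    qed
    show "(\<lambda>s. fbm_cov_deriv H s (fst p)) \<in> borel_measurable borel" "(\<lambda>z. Q z (snd p)) \<in> borel_measurable borel" for p
      by (rule fbm_cov_deriv_measurable, rule Q_measurable)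
    show "(\<lambda>(s, z). kernel_ext ps s z) \<in> borel_measurable (borel \<Otimes>\<^sub>M borel)" for ps by (rule kernel_ext_measurable)
    show "kernel_ext [] s z = heat_semigroup s u0 z" if "0 \<le> s" for s z
      using that kernel_test_Nil[OF tensors solution that] by (simp add: kernel_ext_def ind_list_def)
    show "u0 \<in> borel_measurable borel" by (rule u0_meas)
    show "\<bar>u0 z\<bar> \<le> K" for z by (rule u0_le)
    fix ps n t x
    assume ps: "set ps \<subseteq> P" "length ps = Suc n" and t: "0 \<le> t"
      and int: "\<And>i s. i \<le> n \<Longrightarrow> 0 \<le> s \<Longrightarrow> s < t \<Longrightarrow>
        integrable lborel (\<lambda>z. heat_kernel (t - s) (x - z) * (Q z (snd (ps ! i)) * kernel_ext (take i ps @ drop (Suc i) ps) s z))"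
    have ext: "kernel_ext qs s = kernel_test u (ind_list ind qs) s" if "0 \<le> s" for qs s
      using that by (auto simp: kernel_ext_def)
    have "kernel_test u (ind_list ind ps) t x = (\<Sum>i\<le>n. LINT s:{0..t}|lborel. fbm_cov_deriv H s (fst (ps ! i)) *
      (\<integral>z. heat_kernel (t - s) (x - z) * (Q z (snd (ps ! i)) * kernel_test u (ind_list ind (take i ps @ drop (Suc i) ps)) s z) \<partial>lborel))"
    proof (rule kernel_recursion[OF tensors solution Q_measurable ps(2) _ t])
      show "\<forall>(r, x)\<in>set ps. 0 \<le> r" using ps(1) P(2) by auto
      show "integrable lborel (\<lambda>z. heat_kernel (t - s) (x - z) * (Q z (snd (ps ! i)) * kernel_test u (ind_list ind (take i ps @ drop (Suc i) ps)) s z))"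
        if "i \<le> n" "0 \<le> s" "s < t" for i s
        using int[OF that] by (simp add: ext[OF that(2)])
    qed
    also have "\<dots> = (\<Sum>i\<le>n. LINT s:{0..t}|lborel. fbm_cov_deriv H s (fst (ps ! i)) *
      (\<integral>z. heat_kernel (t - s) (x - z) * (Q z (snd (ps ! i)) * kernel_ext (take i ps @ drop (Suc i) ps) s z) \<partial>lborel))"
      by (intro sum.cong refl set_lebesgue_integral_cong) (auto simp: ext)
    finally show "kernel_ext ps t x = (\<Sum>i\<le>n. LINT s:{0..t}|lborel. fbm_cov_deriv H s (fst (ps ! i)) *
      (\<integral>z. heat_kernel (t - s) (x - z) * (Q z (snd (ps ! i)) * kernel_ext (take i ps @ drop (Suc i) ps) s z) \<partial>lborel))"
      by (simp add: ext[OF t])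
  qed
qed

definition walk_element :: "real \<Rightarrow> real ^ 'd \<Rightarrow> nat \<Rightarrow> (nat \<Rightarrow> real ^ 'd) \<Rightarrow> 'h" where
  "walk_element t x N \<xi> = path_element (t / real N) N (walk_pos N x \<xi>)"

definition walk_datum :: "real ^ 'd \<Rightarrow> nat \<Rightarrow> (nat \<Rightarrow> real ^ 'd) \<Rightarrow> real" where
  "walk_datum x N \<xi> = u0 (x + (\<Sum>i<N. \<xi> i))"

abbreviation fk_walk :: "real \<Rightarrow> nat \<Rightarrow> (nat \<Rightarrow> real ^ 'd) measure" where
  "fk_walk t N \<equiv> walk (t / real N) N"

lemma inner_walk_element:
  assumes "0 \<le> r" "0 \<le> t"
  shows "inner (walk_element t x N \<xi>) (ind r y) =
    (\<Sum>j<N. (fbm_cov H (real (Suc j) * (t / real N)) r - fbm_cov H (real j * (t / real N)) r) * Q (walk_pos N x \<xi> j) y)"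
  unfolding walk_element_def path_element_def inner_sum_left inner_diff_left
  using assms by (intro sum.cong refl, subst (1 2) ind_inner) (auto simp: left_diff_distrib)

text \<open>A slab integral of the covariance derivative is an increment of the covariance, so
  \<open>path_sum\<close> is the inner product of the path element with the rectangle. The walk
  integral is then the scheme, and the scheme converges to the kernel because the rate tends to
  \<open>0\<close> with the mesh. \<open>Suc N\<close> keeps the mesh
  \<open>t / real (Suc N)\<close> positive.\<close>

lemma feynman_kac_indicators:
  assumes t: "0 < t" and qs: "\<forall>(r, y)\<in>set qs. 0 \<le> r"
  shows "integrable (fk_walk t (Suc N)) (\<lambda>\<xi>. walk_datum x (Suc N) \<xi> * (\<Prod>(r, y)\<leftarrow>qs. inner (walk_element t x (Suc N) \<xi>) (ind r y)))"
    and "(\<lambda>N. \<integral>\<xi>. walk_datum x (Suc N) \<xi> * (\<Prod>(r, y)\<leftarrow>qs. inner (walk_element t x (Suc N) \<xi>) (ind r y)) \<partial>fk_walk t (Suc N))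
      \<longlonglongrightarrow> kernel_test u (ind_list ind qs) t x"
proof -
  have "0 \<le> r" if "(r, y) \<in> set qs" for r y using qs that by auto
  then obtain L R \<rho> where "feynman_kac_scheme t H \<alpha> L R K \<rho> (\<lambda>p s. fbm_cov_deriv H s (fst p)) (\<lambda>p z. Q z (snd p)) (set qs) u0 kernel_ext"
    by (rule kernel_ext_scheme[OF finite_set _ t])
  then interpret S: feynman_kac_scheme t H \<alpha> L R K \<rho> "\<lambda>p s. fbm_cov_deriv H s (fst p)" "\<lambda>p z. Q z (snd p)" "set qs" u0 kernel_ext .
  let ?h = "\<lambda>N. t / real N"
  have h: "0 < ?h (Suc N)" "real (Suc N) * ?h (Suc N) = t" for N using t by simp_all
  have slab: "S.slab (?h N) j p = fbm_cov H (real (Suc j) * ?h N) (fst p) - fbm_cov H (real j * ?h N) (fst p)"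
    if "p \<in> set qs" for N j p
    unfolding S.slab_def using qs that H t by (intro fbm_cov_deriv_integral mult_right_mono) auto
  have path: "S.path_sum (?h N) N x \<xi> p = (case p of (r, y) \<Rightarrow> inner (walk_element t x N \<xi>) (ind r y))" if "p \<in> set qs" for N \<xi> p
  proof -
    obtain r y where p: "p = (r, y)" by (cases p)
    then have "0 \<le> r" using qs that by auto
    then show ?thesis using slab[OF that] t
      unfolding S.path_sum_def p by (simp add: inner_walk_element walk_pos_def)
  qed
  have prod: "(\<Prod>p\<leftarrow>qs. S.path_sum (?h N) N x \<xi> p) = (\<Prod>(r, y)\<leftarrow>qs. inner (walk_element t x N \<xi>) (ind r y))" for N \<xi>
    using path by (intro arg_cong[where f = prod_list] map_cong) auto
  show "integrable (fk_walk t (Suc N)) (\<lambda>\<xi>. walk_datum x (Suc N) \<xi> * (\<Prod>(r, y)\<leftarrow>qs. inner (walk_element t x (Suc N) \<xi>) (ind r y)))" for N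
    using S.path_functional_integrable[OF h(1)[of N], of qs "Suc N" x] unfolding prod walk_datum_def by simp
  obtain C where "0 \<le> C" and err: "\<And>h k x. 0 < h \<Longrightarrow> real k * h \<le> t \<Longrightarrow>
     \<bar>S.scheme h k qs x - kernel_ext qs (real k * h) x\<bar> \<le> C * S.rate h * exp_weight (real (length qs)) x"
    using S.scheme_error[of "length qs"] by auto
  have "(\<lambda>N. S.scheme (?h (Suc N)) (Suc N) qs x - kernel_ext qs t x) \<longlonglongrightarrow> 0"
  proof (rule Lim_null_comparison)
    show "\<forall>\<^sub>F N in sequentially. norm (S.scheme (?h (Suc N)) (Suc N) qs x - kernel_ext qs t x) \<le> C * S.rate (?h (Suc N)) * exp_weight (real (length qs)) x"
      unfolding real_norm_def using err[OF h(1) eq_refl[OF h(2)], unfolded h(2)] by (rule always_eventually[OF allI])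
    have "(\<lambda>N. ?h (Suc N)) \<longlonglongrightarrow> 0" by (rule LIMSEQ_Suc[OF lim_const_over_n])
    then have "(\<lambda>N. S.rate (?h (Suc N))) \<longlonglongrightarrow> 0 powr (2 * H) + 0 powr (\<alpha> / 2)"
      unfolding S.rate_def using H \<alpha>_pos h(1) by (intro tendsto_add tendsto_powr2) (auto intro!: always_eventually less_imp_le)
    then show "(\<lambda>N. C * S.rate (?h (Suc N)) * exp_weight (real (length qs)) x) \<longlonglongrightarrow> 0"
      by (auto intro!: tendsto_mult_left_zero tendsto_mult_right_zero)
  qed
  then have "(\<lambda>N. S.scheme (?h (Suc N)) (Suc N) qs x) \<longlonglongrightarrow> kernel_ext qs t x" by (simp only: LIM_zero_iff)
  also have "(\<lambda>N. S.scheme (?h (Suc N)) (Suc N) qs x) = (\<lambda>N. \<integral>\<xi>. walk_datum x (Suc N) \<xi> * (\<Prod>(r, y)\<leftarrow>qs. inner (walk_element t x (Suc N) \<xi>) (ind r y)) \<partial>fk_walk t (Suc N))"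
    unfolding walk_datum_def prod[symmetric] by (intro ext S.scheme_eq_walk_integral[OF h(1) order_refl eq_refl[OF h(2)]])
  also have "kernel_ext qs t x = kernel_test u (ind_list ind qs) t x" using t by (simp add: kernel_ext_def)
  finally show "(\<lambda>N. \<integral>\<xi>. walk_datum x (Suc N) \<xi> * (\<Prod>(r, y)\<leftarrow>qs. inner (walk_element t x (Suc N) \<xi>) (ind r y)) \<partial>fk_walk t (Suc N))
      \<longlonglongrightarrow> kernel_test u (ind_list ind qs) t x" .
qed

text \<open>Both sides are linear in \<open>w\<close>, and on products of rectangles the limit is
  \<open>feynman_kac_indicators\<close>. Integrability for every \<open>N\<close> is carried through
  the induction because the integrals are additive only with it.\<close>

lemma feynman_kac_tensor:
  assumes t: "0 < t" and f: "\<And>hs. length hs = n \<Longrightarrow> kernel_test u hs t x = fact n * inner f (tens hs)"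
    and w: "w \<in> span (tens ` {hs. set hs \<subseteq> {ind r y |r y. 0 \<le> r} \<and> length hs = n})"
  defines "F \<equiv> \<lambda>N \<xi>. walk_datum x (Suc N) \<xi> * inner (tens (replicate n (walk_element t x (Suc N) \<xi>))) w"
  shows "(\<forall>N. integrable (fk_walk t (Suc N)) (F N)) \<and>
    (\<lambda>N. \<integral>\<xi>. F N \<xi> \<partial>fk_walk t (Suc N)) \<longlonglongrightarrow> fact n * inner f w"
  using w unfolding F_def
proof (induction rule: span_induct_alt)
  case base
  show ?case by simp
next
  case (step c v w)
  then obtain hs where v: "v = tens hs" and hs: "set hs \<subseteq> {ind r y |r y. 0 \<le> r}" "length hs = n" by blast
  have "\<exists>qs. (\<forall>(r, y)\<in>set qs. 0 \<le> r) \<and> hs = ind_list ind qs"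
    using hs(1)
  proof (induction hs)
    case Nil
    then show ?case by (intro exI[of _ "[]"]) (simp add: ind_list_def)
  next
    case (Cons h hs)
    then obtain qs where "\<forall>(r, y)\<in>set qs. 0 \<le> r" "hs = ind_list ind qs" by auto
    moreover obtain r y where "h = ind r y" "0 \<le> r" using Cons.prems by auto
    ultimately show ?case by (intro exI[of _ "(r, y) # qs"]) (simp add: ind_list_def)
  qed
  then obtain qs where qs: "\<forall>(r, y)\<in>set qs. 0 \<le> r" "hs = ind_list ind qs" by blast
  have len: "length qs = n" using hs(2) qs(2) by (simp add: ind_list_def)
  have "inner (tens (replicate n g)) v = (\<Prod>(r, y)\<leftarrow>qs. inner g (ind r y))" for g
  proof -
    have "inner (tens (replicate n g)) v = (\<Prod>i<n. inner g (hs ! i))"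
      using hs(2) by (simp add: v tens_inner[OF tensors])
    also have "\<dots> = prod_list (map (inner g) hs)"
      unfolding prod.list_conv_set_nth atLeast0LessThan using hs(2) by simp
    also have "map (inner g) hs = map (\<lambda>(r, y). inner g (ind r y)) qs"
      by (simp add: qs(2) ind_list_def case_prod_unfold)
    finally show ?thesis .
  qed
  then have lim: "integrable (fk_walk t (Suc N)) (\<lambda>\<xi>. walk_datum x (Suc N) \<xi> * inner (tens (replicate n (walk_element t x (Suc N) \<xi>))) v)"
    "(\<lambda>N. \<integral>\<xi>. walk_datum x (Suc N) \<xi> * inner (tens (replicate n (walk_element t x (Suc N) \<xi>))) v \<partial>fk_walk t (Suc N)) \<longlonglongrightarrow> fact n * inner f v" for N
    using feynman_kac_indicators[OF t qs(1), where x = x] f[of "ind_list ind qs"] hs(2) qs(2) v by simp_all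
  have eq: "a * inner g (c *\<^sub>R v + w) = c * (a * inner g v) + a * inner g w" for a g
    by (simp add: inner_add_right algebra_simps)
  have "(\<lambda>N. c * (\<integral>\<xi>. walk_datum x (Suc N) \<xi> * inner (tens (replicate n (walk_element t x (Suc N) \<xi>))) v \<partial>fk_walk t (Suc N))
      + (\<integral>\<xi>. walk_datum x (Suc N) \<xi> * inner (tens (replicate n (walk_element t x (Suc N) \<xi>))) w \<partial>fk_walk t (Suc N)))
    \<longlonglongrightarrow> c * (fact n * inner f v) + fact n * inner f w"
    using step lim by (intro tendsto_add tendsto_mult_left) auto
  then show ?case unfolding eq using lim(1) step by simp
qed

text \<open>By multilinearity the \<open>n\<close>-th tensor power of a combination of rectangles is
  a combination of tensors of rectangles, to which \<open>feynman_kac_tensor\<close>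
  applies.\<close>

lemma feynman_kac_hermite:
  assumes t: "0 < t" and h: "h \<in> span {ind r y |r y. 0 \<le> r}"
  shows "integrable (fk_walk t (Suc N)) (\<lambda>\<xi>. walk_datum x (Suc N) \<xi> * inner h (walk_element t x (Suc N) \<xi>) ^ n)"
    and "(\<lambda>N. \<integral>\<xi>. walk_datum x (Suc N) \<xi> * inner h (walk_element t x (Suc N) \<xi>) ^ n \<partial>fk_walk t (Suc N))
      \<longlonglongrightarrow> (\<integral>\<omega>. u t x \<omega> * herm n h \<omega> \<partial>M)"
proof -
  obtain f where f: "\<And>hs. length hs = n \<Longrightarrow> kernel_test u hs t x = fact n * inner f (tens hs)"
    and fh: "\<And>g. (\<integral>\<omega>. u t x \<omega> * herm n g \<omega> \<partial>M) = fact n * inner f (tens (replicate n g))"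
    using kernel_test_replicate[OF tensors solution, of t n x] t by (metis less_imp_le)
  have "tens ([] @ replicate n h) \<in> span (tens ` {hs. set hs \<subseteq> {ind r y |r y. 0 \<le> r} \<and> length hs = length ([] :: 'h list) + length (replicate n h)})"
    using h by (intro tens_span[OF tensors]) auto
  then have "tens (replicate n h) \<in> span (tens ` {hs. set hs \<subseteq> {ind r y |r y. 0 \<le> r} \<and> length hs = n})"
    by simp
  note * = feynman_kac_tensor[OF t f this]
  show "integrable (fk_walk t (Suc N)) (\<lambda>\<xi>. walk_datum x (Suc N) \<xi> * inner h (walk_element t x (Suc N) \<xi>) ^ n)"
    using * by (simp add: tens_inner_replicate[OF tensors] inner_commute)
  show "(\<lambda>N. \<integral>\<xi>. walk_datum x (Suc N) \<xi> * inner h (walk_element t x (Suc N) \<xi>) ^ n \<partial>fk_walk t (Suc N))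
      \<longlonglongrightarrow> (\<integral>\<omega>. u t x \<omega> * herm n h \<omega> \<partial>M)"
    using * by (simp add: tens_inner_replicate[OF tensors] inner_commute fh)
qed

lemma feynman_kac_limit:
  assumes t: "0 < t" and L: "\<forall>(c, n, h)\<in>set L. h \<in> span {ind r y |r y. 0 \<le> r}"
  shows "(\<lambda>N. \<integral>\<xi>. walk_datum x (Suc N) \<xi> * (\<Sum>(c, n, h)\<leftarrow>L. c * inner h (walk_element t x (Suc N) \<xi>) ^ n) \<partial>fk_walk t (Suc N))
      \<longlonglongrightarrow> (\<integral>\<omega>. u t x \<omega> * herm_comb L \<omega> \<partial>M)"
proof -
  let ?F = "\<lambda>L N \<xi>. walk_datum x (Suc N) \<xi> * (\<Sum>(c, n, h)\<leftarrow>L. c * inner h (walk_element t x (Suc N) \<xi>) ^ n)"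
  note us = solution_sq_integrable[OF tensors solution less_imp_le[OF t], of x]
  have "(\<forall>N. integrable (fk_walk t (Suc N)) (?F L N)) \<and> (\<lambda>N. \<integral>\<xi>. ?F L N \<xi> \<partial>fk_walk t (Suc N)) \<longlonglongrightarrow> (\<integral>\<omega>. u t x \<omega> * herm_comb L \<omega> \<partial>M)"
    using L
  proof (induction L)
    case (Cons p L)
    obtain c n h where p: "p = (c, n, h)" by (cases p)
    then have h: "h \<in> span {ind r y |r y. 0 \<le> r}" using Cons.prems by simp
    have IH: "\<forall>N. integrable (fk_walk t (Suc N)) (?F L N)" "(\<lambda>N. \<integral>\<xi>. ?F L N \<xi> \<partial>fk_walk t (Suc N)) \<longlonglongrightarrow> (\<integral>\<omega>. u t x \<omega> * herm_comb L \<omega> \<partial>M)"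
      using Cons by simp_all
    have F: "?F (p # L) N = (\<lambda>\<xi>. c * (walk_datum x (Suc N) \<xi> * inner h (walk_element t x (Suc N) \<xi>) ^ n) + ?F L N \<xi>)" for N
      by (simp add: p algebra_simps)
    have u: "(\<lambda>\<omega>. u t x \<omega> * herm_comb (p # L) \<omega>) = (\<lambda>\<omega>. c * (u t x \<omega> * herm n h \<omega>) + u t x \<omega> * herm_comb L \<omega>)"
      by (simp add: p algebra_simps)
    have "(\<lambda>N. c * (\<integral>\<xi>. walk_datum x (Suc N) \<xi> * inner h (walk_element t x (Suc N) \<xi>) ^ n \<partial>fk_walk t (Suc N)) + (\<integral>\<xi>. ?F L N \<xi> \<partial>fk_walk t (Suc N)))
      \<longlonglongrightarrow> c * (\<integral>\<omega>. u t x \<omega> * herm n h \<omega> \<partial>M) + (\<integral>\<omega>. u t x \<omega> * herm_comb L \<omega> \<partial>M)"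
      by (intro tendsto_add tendsto_mult_left feynman_kac_hermite t h IH)
    then show ?case
      unfolding F u using feynman_kac_hermite(1)[OF t h] IH(1) sq_integrable_mult[OF us herm_sq_integrable] sq_integrable_mult[OF us herm_comb_sq_integrable]
      by simp
  qed simp
  then show ?thesis ..
qed

lemma span_ind_dense: "closure (span {ind r y |r y. 0 \<le> r}) = UNIV"
  using completion by (simp add: rectangle_completion_def)

lemma K_nonneg: "0 \<le> K"
  using order_trans[OF abs_ge_zero u0_le[of 0]] .

text \<open>The bound of \<open>walk_norm_exp_moment\<close> at
  \<open>\<kappa> = real m / 2\<close>, the exponent that the duality leaves.\<close>

definition moment_const :: "nat \<Rightarrow> real \<Rightarrow> real ^ 'd \<Rightarrow> real" where
  "moment_const m t x = exp (real m * t powr (2 * H) * Q x x) * (2 powr (real CARD('d) / 2)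
      * exp ((2 * real m * norm_const * t powr (2 * H + \<alpha>)) powr (1 / (1 - \<alpha>))))"

lemma solution_moments:
  assumes t: "0 < t" and m: "1 \<le> m"
  shows "integrable M (\<lambda>\<omega>. \<bar>u t x \<omega>\<bar> ^ Suc m)" "(\<integral>\<omega>. \<bar>u t x \<omega>\<bar> ^ Suc m \<partial>M) \<le> (K * moment_const m t x) ^ Suc m"
proof -
  let ?h = "\<lambda>N. t / real (Suc N)"
  let ?b = "\<lambda>N \<xi>. walk_norm_bound (?h N) (Suc N) x \<xi>"
  have h: "0 < ?h N" for N using t by simp
  have J: "0 \<le> moment_const m t x" by (simp add: moment_const_def)
  have U: "in_chaos (span {ind r y |r y. 0 \<le> r}) (u t x)"
    using t by (intro in_chaos_dense[OF _ span_ind_dense] solution_in_chaos[OF tensors solution]) simp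
  have b: "?b N \<in> borel_measurable (fk_walk t (Suc N))" for N by (rule walk_norm_bound_measurable)
  have G: "(norm (walk_element t x (Suc N) \<xi>))\<^sup>2 \<le> ?b N \<xi>" for N \<xi>
    unfolding walk_element_def using h[of N] by (intro path_element_norm_walk) simp
  have Jb: "(\<integral>\<^sup>+\<xi>. ennreal (exp (real m / 2 * ?b N \<xi>)) \<partial>fk_walk t (Suc N)) \<le> ennreal (moment_const m t x)" for N
  proof -
    have "real (Suc N) * ?h N = t" by simp
    then show ?thesis using walk_norm_exp_moment[OF h[of N], of "Suc N" "real m / 2" x] m
      by (simp only: moment_const_def) (simp add: mult_ac)
  qed
  have w: "\<bar>walk_datum x (Suc N) \<xi>\<bar> \<le> K" for N \<xi> unfolding walk_datum_def by (rule u0_le)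
  note bound = chaos_moment_bound[where Z = "\<lambda>N. fk_walk t (Suc N)" and w = "\<lambda>N. walk_datum x (Suc N)"
      and G = "\<lambda>N. walk_element t x (Suc N)" and b = ?b, OF U span_ind_dense m J K_nonneg b G Jb w feynman_kac_limit[OF t]]
  show "integrable M (\<lambda>\<omega>. \<bar>u t x \<omega>\<bar> ^ Suc m)" "(\<integral>\<omega>. \<bar>u t x \<omega>\<bar> ^ Suc m \<partial>M) \<le> (K * moment_const m t x) ^ Suc m"
    by (rule bound, assumption)+
qed

text \<open>The first moment, which lies outside the duality argument with its
  \<open>1 \<le> m\<close>; here the limit at order \<open>0\<close> is read directly.\<close>

lemma solution_mean:
  assumes t: "0 < t"
  shows "integrable M (u t x)" "(\<integral>\<omega>. u t x \<omega> \<partial>M) \<le> K"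
proof -
  note us = solution_sq_integrable[OF tensors solution less_imp_le[OF t], of x]
  show "integrable M (u t x)"
    using sq_integrable_mult[OF us herm_sq_integrable[of 0 0]] by simp
  show "(\<integral>\<omega>. u t x \<omega> \<partial>M) \<le> K"
  proof (rule LIMSEQ_le_const2)
    show "(\<lambda>N. \<integral>\<xi>. walk_datum x (Suc N) \<xi> \<partial>fk_walk t (Suc N)) \<longlonglongrightarrow> (\<integral>\<omega>. u t x \<omega> \<partial>M)"
      using feynman_kac_hermite(2)[OF t span_zero, of x 0] by simp
    have "(\<integral>\<xi>. walk_datum x (Suc N) \<xi> \<partial>fk_walk t (Suc N)) \<le> K" for N
    proof -
      interpret W: prob_space "fk_walk t (Suc N) :: (nat \<Rightarrow> real ^ 'd) measure"
        using t by (intro prob_space_walk) simp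
      have "(\<integral>\<xi>. walk_datum x (Suc N) \<xi> \<partial>fk_walk t (Suc N)) \<le> (\<integral>\<xi>. K \<partial>(fk_walk t (Suc N) :: (nat \<Rightarrow> real ^ 'd) measure))"
        using feynman_kac_hermite(1)[OF t span_zero, of N x 0] u0_le
        by (intro integral_mono W.integrable_const) (simp_all add: walk_datum_def abs_le_iff del: sum.lessThan_Suc)
      then show ?thesis by (simp only: lebesgue_integral_const W.prob_space scaleR_one)
    qed
    then show "\<exists>N0. \<forall>N\<ge>N0. (\<integral>\<xi>. walk_datum x (Suc N) \<xi> \<partial>fk_walk t (Suc N)) \<le> K" by blast
  qed
qed

end

section \<open>The moment bound\<close>

text \<open>The factor \<open>q = Q x x\<close> may only enter the constant \<open>C\<^sub>x\<close>: either \<open>(n t)\<^sup>\<delta>\<close> exceeds it, or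
  \<open>n t\<close> is bounded in terms of \<open>q\<close>.\<close>

lemma powr_exponent_absorb:
  fixes n t q \<delta> a b c d :: real
  assumes "1 \<le> n" "1 \<le> t" "0 \<le> q" "a \<le> 2" "b \<le> 2" "0 < \<delta>" "a + \<delta> \<le> c" "b + \<delta> \<le> d"
  shows "q * (n powr a * t powr b) \<le> q * (q powr (1 / \<delta>))\<^sup>2 + n powr c * t powr d"
proof (cases "q \<le> (n * t) powr \<delta>")
  case True
  then have "q * (n powr a * t powr b) \<le> (n * t) powr \<delta> * (n powr a * t powr b)"
    by (intro mult_right_mono) auto
  also have "\<dots> = n powr (a + \<delta>) * t powr (b + \<delta>)"
    using assms by (simp add: powr_mult powr_add mult_ac)
  also have "\<dots> \<le> n powr c * t powr d"
    using assms by (intro mult_mono powr_mono) auto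
  finally show ?thesis using assms by (simp add: add_increasing)
next
  case False
  then have "((n * t) powr \<delta>) powr (1 / \<delta>) \<le> q powr (1 / \<delta>)" using assms by (intro powr_mono2) auto
  then have y: "n * t \<le> q powr (1 / \<delta>)" using assms by (simp add: powr_powr)
  have "n powr a * t powr b \<le> n powr 2 * t powr 2" using assms by (intro mult_mono powr_mono) auto
  also have "\<dots> = (n * t)\<^sup>2" using assms by (simp add: power_mult_distrib)
  also have "\<dots> \<le> (q powr (1 / \<delta>))\<^sup>2" using y assms by (intro power_mono) auto
  finally have "q * (n powr a * t powr b) \<le> q * (q powr (1 / \<delta>))\<^sup>2" using assms by (intro mult_left_mono) auto
  then show ?thesis by (simp add: add_increasing2)
qed

text \<open>The power \<open>(2 - \<alpha>) / (1 - \<alpha>)\<close> is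
  \<open>1 + 1 / (1 - \<alpha>)\<close>: the \<open>n\<close>-th power contributes the
  \<open>1\<close>, Young's inequality the rest. The term with \<open>q\<close> grows only like
  \<open>n^2 t^(2H)\<close>, which is smaller by the margin \<open>\<delta>\<close> in both
  exponents, since \<open>(2 - \<alpha>) / (1 - \<alpha>) = 2 + \<alpha> / (1 - \<alpha>)\<close>;
  this margin lets \<open>powr_exponent_absorb\<close> shift \<open>q\<close> into an additive
  constant.\<close>

lemma moment_exponent_bound:
  fixes H \<alpha> t q c :: real
  assumes H: "0 < H" "H < 1/2" and \<alpha>: "0 < \<alpha>" "\<alpha> < 1" and t: "1 \<le> t" and q: "0 \<le> q" and c: "0 \<le> c"
  defines "\<delta> \<equiv> min (\<alpha> / (1 - \<alpha>)) ((2 * H + \<alpha>) / (1 - \<alpha>) - 2 * H)"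
  shows "real (Suc m) * (real m * t powr (2 * H) * q + (2 * real m * c * t powr (2 * H + \<alpha>)) powr (1 / (1 - \<alpha>)))
    \<le> q * (q powr (1 / \<delta>))\<^sup>2
      + (1 + (2 * c) powr (1 / (1 - \<alpha>))) * (real (Suc m) powr ((2 - \<alpha>) / (1 - \<alpha>)) * t powr ((2 * H + \<alpha>) / (1 - \<alpha>)))"
proof -
  let ?n = "real (Suc m)" and ?p = "1 / (1 - \<alpha>)"
  have p: "(2 - \<alpha>) / (1 - \<alpha>) = 1 + ?p" "\<alpha> / (1 - \<alpha>) = ?p - 1" using \<alpha> by (simp_all add: field_simps)
  have p1: "0 < \<alpha> / (1 - \<alpha>)" using \<alpha> by simp
  have "2 * H + \<alpha> \<le> (2 * H + \<alpha>) / (1 - \<alpha>)"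
    using H \<alpha> by (simp add: pos_le_divide_eq mult_left_le)
  then have \<delta>: "0 < \<delta>" using \<alpha> p1 unfolding \<delta>_def by simp
  have 1: "?n * (real m * t powr (2 * H) * q) \<le> q * (?n powr 2 * t powr (2 * H))"
  proof -
    have "?n * real m \<le> ?n * ?n" by (intro mult_left_mono) auto
    also have "\<dots> = ?n powr 2" by (simp add: power2_eq_square)
    finally have "(?n * real m) * (t powr (2 * H) * q) \<le> ?n powr 2 * (t powr (2 * H) * q)"
      using q by (intro mult_right_mono) auto
    then show ?thesis by (simp only: mult_ac)
  qed
  have 2: "?n * (2 * real m * c * t powr (2 * H + \<alpha>)) powr ?p \<le> (2 * c) powr ?p * (?n powr (1 + ?p) * t powr ((2 * H + \<alpha>) * ?p))"
  proof -
    have "(2 * real m * c * t powr (2 * H + \<alpha>)) powr ?p = (2 * c) powr ?p * (real m powr ?p * t powr ((2 * H + \<alpha>) * ?p))"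
      using c by (simp add: powr_mult powr_powr mult_ac)
    moreover have "real m powr ?p \<le> ?n powr ?p" using \<alpha> by (intro powr_mono2) auto
    ultimately have "?n * (2 * real m * c * t powr (2 * H + \<alpha>)) powr ?p \<le> ?n * ((2 * c) powr ?p * (?n powr ?p * t powr ((2 * H + \<alpha>) * ?p)))"
      by (simp only:) (intro mult_left_mono mult_right_mono, auto)
    also have "\<dots> = (2 * c) powr ?p * (?n powr (1 + ?p) * t powr ((2 * H + \<alpha>) * ?p))"
      by (simp only: powr_add powr_one mult_ac of_nat_0_le_iff)
    finally show ?thesis .
  qed
  have "q * (?n powr 2 * t powr (2 * H)) \<le> q * (q powr (1 / \<delta>))\<^sup>2 + ?n powr (1 + ?p) * t powr ((2 * H + \<alpha>) / (1 - \<alpha>))"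
    using t q H \<delta> p by (intro powr_exponent_absorb) (auto simp: \<delta>_def)
  moreover have "(2 * H + \<alpha>) * ?p = (2 * H + \<alpha>) / (1 - \<alpha>)" by simp
  ultimately show ?thesis using 1 2 unfolding p(1) distrib_right[of 1] distrib_left by (simp only:)
qed

text \<open>\<open>C\<close> is chosen before \<open>Q\<close> and can only depend on the dimension,
  \<open>H\<close>, \<open>\<alpha>\<close>, \<open>C1\<close> and \<open>K\<close>. The sole trace
  of \<open>x\<close> in the moment estimate is \<open>Q x x\<close>, and it goes into
  \<open>Cx\<close>.\<close>

theorem theorem3p3:
  fixes H \<alpha> C1 K :: real
  assumes "0 < H" and "H < 1/2"
    and "1 - 2 * H < \<alpha>" and "\<alpha> < 1"
    and "C1 > 0"
  shows "\<exists>C>0. \<forall>Q :: real ^ 'd \<Rightarrow> real ^ 'd \<Rightarrow> real.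
    (\<forall>x y. Q x x + Q y y - 2 * Q x y \<le> C1 * norm (x - y) powr (2 * \<alpha>)) \<longrightarrow>
    (\<exists>Cx :: real ^ 'd \<Rightarrow> real. (\<forall>x. Cx x > 0) \<and>
      (\<forall>(M :: 'w measure) W
         (ind :: real \<Rightarrow> real ^ 'd \<Rightarrow> 'h :: {real_inner, complete_space})
         (tens :: 'h list \<Rightarrow> 'f :: {real_inner, complete_space}) X u0 u.
        prob_space M \<and>
        gaussian_noise M H Q W \<and>
        rectangle_completion H Q ind \<and>
        hilbert_tensors tens \<and>
        isonormal M X \<and>
        (\<forall>t\<ge>0. \<forall>x. AE \<omega> in M. X (ind t x) \<omega> = W t x \<omega>) \<and>
        u0 \<in> borel_measurable borel \<and> bounded (range u0) \<and> (SUP y. \<bar>u0 y\<bar>) = K \<and>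
        mild_solution M H Q ind tens X u0 u \<longrightarrow>
        (\<forall>n\<ge>1. \<forall>t\<ge>1. \<forall>x.
           integrable M (\<lambda>\<omega>. u t x \<omega> ^ n) \<and>
           (\<integral>\<omega>. u t x \<omega> ^ n \<partial>M)
             \<le> Cx x * exp (C * real n powr ((2 - \<alpha>) / (1 - \<alpha>))
                             * t powr ((2 * H + \<alpha>) / (1 - \<alpha>))))))"
proof -
  \<comment> \<open>\<open>exp A\<close> absorbs the prefactor of a single moment constant; the
    summand \<open>1\<close> keeps \<open>A\<close> nonnegative, so that \<open>A * real n\<close>
    is dominated by \<open>A\<close> times the main term of the exponent.\<close>
  define A where "A = ln (\<bar>K\<bar> * 2 powr (real CARD('d) / 2) + 1)"
  define nc where "nc = C1 * (2 + 1 / (2 * (\<alpha> + 2 * H - 1)))"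
  define C where "C = A + (1 + (2 * nc) powr (1 / (1 - \<alpha>)))"
  define \<delta> where "\<delta> = min (\<alpha> / (1 - \<alpha>)) ((2 * H + \<alpha>) / (1 - \<alpha>) - 2 * H)"
  define R where "R q = q * (q powr (1 / \<delta>))\<^sup>2" for q :: real
  have A: "0 \<le> A" "\<bar>K\<bar> * 2 powr (real CARD('d) / 2) \<le> exp A"
    unfolding A_def by (simp, subst exp_ln) (auto simp: add_nonneg_pos)
  have nc: "0 \<le> nc" unfolding nc_def using assms by simp
  have C: "0 < C" using A(1) powr_ge_zero[of "2 * nc" "1 / (1 - \<alpha>)"] unfolding C_def by linarith
  show ?thesis
  proof (intro exI[of _ C] conjI C allI impI)
    fix Q :: "real ^ 'd \<Rightarrow> real ^ 'd \<Rightarrow> real"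
    assume Q: "\<forall>x y. Q x x + Q y y - 2 * Q x y \<le> C1 * norm (x - y) powr (2 * \<alpha>)"
    \<comment> \<open>\<open>Cx\<close> is chosen before any Hilbert space is given from which
      \<open>0 \<le> Q x x\<close> would follow; the maximum with \<open>0\<close> makes the
      estimate with a nonnegative \<open>q\<close> applicable at this stage.\<close>
    let ?Cx = "\<lambda>x. exp (R (max 0 (Q x x)))"
    have main: "integrable M (\<lambda>\<omega>. u t x \<omega> ^ n) \<and> (\<integral>\<omega>. u t x \<omega> ^ n \<partial>M)
         \<le> ?Cx x * exp (C * real n powr ((2 - \<alpha>) / (1 - \<alpha>)) * t powr ((2 * H + \<alpha>) / (1 - \<alpha>)))"
      if M: "prob_space M" "rectangle_completion H Q ind" "hilbert_tensors tens" "isonormal M X"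
        "u0 \<in> borel_measurable borel" "bounded (range u0)" "(SUP y. \<bar>u0 y\<bar>) = K" "mild_solution M H Q ind tens X u0 u"
        and n: "1 \<le> n" and t: "1 \<le> t"
      for M :: "'w measure" and ind :: "real \<Rightarrow> real ^ 'd \<Rightarrow> 'h" and tens :: "'h list \<Rightarrow> 'f"
        and X u0 u and n :: nat and t :: real and x
    proof -
      have u0: "\<bar>u0 y\<bar> \<le> K" for y
      proof -
        obtain b where "\<And>y. \<bar>u0 y\<bar> \<le> b" using M(6) unfolding bounded_iff by auto
        then have "bdd_above (range (\<lambda>y. \<bar>u0 y\<bar>))" by (intro bdd_aboveI[of _ b]) auto
        then show ?thesis unfolding M(7)[symmetric] by (intro cSUP_upper) auto
      qed
      interpret prob_space M by (rule M(1))
      interpret parabolic_anderson M X H \<alpha> C1 Q ind tens u0 u K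
        using assms M Q u0 by unfold_locales auto
      have t0: "0 < t" using t by simp
      have [measurable]: "u t x \<in> borel_measurable M"
        using solution_sq_integrable[OF tensors solution, of t x] t by (simp add: sq_integrable_def)
      obtain m where m: "n = Suc m" using n by (cases n) auto
      let ?q = "max 0 (Q x x)"
      let ?E = "real n powr ((2 - \<alpha>) / (1 - \<alpha>)) * t powr ((2 * H + \<alpha>) / (1 - \<alpha>))"
      have E: "real n \<le> ?E"
      proof -
        have "real n powr 1 * 1 \<le> ?E"
          using n t assms \<alpha>_pos by (intro mult_mono powr_mono ge_one_powr_ge_zero) (auto simp: field_simps)
        then show ?thesis by simp
      qed
      have R: "0 \<le> R ?q" unfolding R_def by simp
      show ?thesis
      proof (cases "m = 0")
        case True
        have "(\<integral>\<omega>. u t x \<omega> \<partial>M) \<le> K * 1" using solution_mean(2)[OF t0] by simp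
        also have "\<dots> \<le> \<bar>K\<bar> * 2 powr (real CARD('d) / 2)"
          using K_nonneg by (intro mult_mono ge_one_powr_ge_zero) auto
        also have "\<dots> \<le> exp A" by (rule A)
        also have "\<dots> \<le> exp (R ?q + C * ?E)"
        proof -
          have "A * 1 \<le> C * ?E" using A E n C by (intro mult_mono) (auto simp: C_def)
          then show ?thesis using R by simp
        qed
        finally show ?thesis using solution_mean(1)[OF t0] True m by (simp add: exp_add mult.assoc)
      next
        case False
        then have m1: "1 \<le> m" by simp
        note mom = solution_moments[OF t0 m1, of x, folded m]
        have "integrable M (\<lambda>\<omega>. u t x \<omega> ^ n)"
          by (rule Bochner_Integration.integrable_bound[OF mom(1)]) (auto simp: power_abs)
        moreover have "(\<integral>\<omega>. u t x \<omega> ^ n \<partial>M) \<le> (\<integral>\<omega>. \<bar>u t x \<omega>\<bar> ^ n \<partial>M)"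
          using calculation mom(1) by (intro integral_mono) (auto simp: power_abs[symmetric])
        moreover have "(K * moment_const m t x) ^ n \<le> exp (R ?q + C * ?E)"
        proof -
          let ?b = "real m * t powr (2 * H) * ?q + (2 * real m * nc * t powr (2 * H + \<alpha>)) powr (1 / (1 - \<alpha>))"
          have "K * moment_const m t x = (K * 2 powr (real CARD('d) / 2)) *
              exp (real m * t powr (2 * H) * Q x x + (2 * real m * nc * t powr (2 * H + \<alpha>)) powr (1 / (1 - \<alpha>)))"
            by (simp only: moment_const_def norm_const_def nc_def exp_add mult_ac)
          also have "\<dots> \<le> exp A * exp ?b"
            using A(2) K_nonneg by (intro mult_mono) (auto intro!: mult_left_mono)
          finally have "K * moment_const m t x \<le> exp (A + ?b)" by (simp only: exp_add)
          moreover have "0 \<le> K * moment_const m t x" using K_nonneg by (simp add: moment_const_def)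
          ultimately have "(K * moment_const m t x) ^ n \<le> exp (A + ?b) ^ n" by (intro power_mono)
          also have "\<dots> = exp (A * real n + real (Suc m) * ?b)"
            unfolding exp_of_nat_mult[symmetric] m by (simp only: distrib_left mult_ac)
          also have "\<dots> \<le> exp (R ?q + C * ?E)"
          proof -
            have "real (Suc m) * ?b \<le> R ?q + (1 + (2 * nc) powr (1 / (1 - \<alpha>))) * ?E"
              unfolding R_def \<delta>_def m by (rule moment_exponent_bound) (use H \<alpha> \<alpha>_pos t nc in auto)
            moreover have "A * real n \<le> A * ?E" using A(1) E by (intro mult_left_mono)
            ultimately show ?thesis unfolding C_def distrib_right[of A] by simp
          qed
          finally show ?thesis .
        qed
        ultimately show ?thesis using mom(2) by (simp add: exp_add mult.assoc)
      qed
    qed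
    show "\<exists>Cx :: real ^ 'd \<Rightarrow> real. (\<forall>x. Cx x > 0) \<and>
      (\<forall>(M :: 'w measure) W (ind :: real \<Rightarrow> real ^ 'd \<Rightarrow> 'h) (tens :: 'h list \<Rightarrow> 'f) X u0 u.
        prob_space M \<and> gaussian_noise M H Q W \<and> rectangle_completion H Q ind \<and> hilbert_tensors tens \<and> isonormal M X \<and>
        (\<forall>t\<ge>0. \<forall>x. AE \<omega> in M. X (ind t x) \<omega> = W t x \<omega>) \<and>
        u0 \<in> borel_measurable borel \<and> bounded (range u0) \<and> (SUP y. \<bar>u0 y\<bar>) = K \<and>
        mild_solution M H Q ind tens X u0 u \<longrightarrow>
        (\<forall>n\<ge>1. \<forall>t\<ge>1. \<forall>x.
           integrable M (\<lambda>\<omega>. u t x \<omega> ^ n) \<and>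
           (\<integral>\<omega>. u t x \<omega> ^ n \<partial>M)
             \<le> Cx x * exp (C * real n powr ((2 - \<alpha>) / (1 - \<alpha>)) * t powr ((2 * H + \<alpha>) / (1 - \<alpha>)))))"
      by (rule exI[of _ ?Cx], rule conjI, rule allI, rule exp_gt_zero, intro allI impI main) blast+
  qed
qed

end
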